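(* Let $g\geq 2$. The $J$-adic filtration of $A_{K_{g,1}}$ stabilizes; that is, there is an integer $N\ge 0$ such that $J^kA_{K_{g,1}}=J^NA_{K_{g,1}}$ for all $k\geq N$.
   Context: Let $S_g$ be a closed orientable surface of genus $g$, $\pi=\pi_1(S_g)$, with lower central series $\pi^{(1)}=\pi$, $\pi^{(n+1)}=[\pi,\pi^{(n)}]$; $H=\pi^{ab}\cong\mathbb{Z}^{2g}$; $J$ is the augmentation ideal of $\mathbb{Q}H$. Let $\Gamma_{g,1}$ be the mapping class group of $S_g$ with one marked point, and $K_{g,1}=\ker(\Gamma_{g,1}\to\mathrm{Aut}(\pi/\pi^{(3)}))$. Let $A=H_1(\pi^{(2)},\mathbb{Q})$, a $\mathbb{Q}H$-module via conjugation by $\pi$. The group $K_{g,1}$ acts on $A$ through its action on $\pi$; $A_{K_{g,1}}=A/J_{K_{g,1}}A$ is the space of coinvariants, where $J_{K_{g,1}}$ is the augmentation ideal of $\mathbb{Q}K_{g,1}$. Since $J_{K_{g,1}}A$ is a $\mathbb{Q}H$-submodule of $A$, $A_{K_{g,1}}$ is a $\mathbb{Q}H$-module. *)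

theory Defs
  imports
    "HOL-Homology.Homology"
    "HOL-Algebra.Bij"
    "HOL-Algebra.Ideal_Product"
    "HOL-Algebra.Generated_Groups"
    "HOL-Algebra.Module"
begin

section \<open>Closed orientable surfaces\<close>

text \<open>
  The boundary of the unit disc is read as a \<open>4g\<close>-gon whose \<open>k\<close>-th edge is the arc
  \<open>polygon_point g ` {k..k+1}\<close>, and the edges are glued according to the word
  \<open>a\<^sub>1 b\<^sub>1 a\<^sub>1\<^sup>-\<^sup>1 b\<^sub>1\<^sup>-\<^sup>1 \<dots> a\<^sub>g b\<^sub>g a\<^sub>g\<^sup>-\<^sup>1 b\<^sub>g\<^sup>-\<^sup>1\<close>.
\<close>

definition polygon_point :: "nat \<Rightarrow> real \<Rightarrow> complex" where
  "polygon_point g t = cis (2 * pi * t / real (4 * g))"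

definition polygon_gluing :: "nat \<Rightarrow> (complex \<times> complex) set" where
  "polygon_gluing g =
     {(polygon_point g (real (4 * j) + s), polygon_point g (real (4 * j + 3) - s)) | j s.
        j < g \<and> s \<in> {0..1}} \<union>
     {(polygon_point g (real (4 * j + 1) + s), polygon_point g (real (4 * j + 4) - s)) | j s.
        j < g \<and> s \<in> {0..1}}"

text \<open>
  \<open>S\<close> is homeomorphic to the quotient of the disc by the equivalence relation generated by the
  gluing. The sphere is not presented by such a word, so only \<open>g \<ge> 1\<close> is covered.
\<close>

definition closed_orientable_surface :: "nat \<Rightarrow> 'a::topological_space set \<Rightarrow> bool" where
  "closed_orientable_surface g S \<longleftrightarrow>
     g \<ge> 1 \<and>
     (\<exists>f. quotient_map (top_of_set (cball (0::complex) 1)) (top_of_set S) f \<and>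
          (\<forall>z\<in>cball 0 1. \<forall>w\<in>cball 0 1.
             f z = f w \<longleftrightarrow> (z, w) \<in> (polygon_gluing g \<union> (polygon_gluing g)\<inverse>)\<^sup>*))"

section \<open>Fundamental group and mapping class group\<close>

definition path_class :: "'a::topological_space set \<Rightarrow> (real \<Rightarrow> 'a) \<Rightarrow> (real \<Rightarrow> 'a) set" where
  "path_class S \<gamma> = {\<delta>. homotopic_paths S \<gamma> \<delta>}"

definition fundamental_group ::
    "'a::topological_space set \<Rightarrow> 'a \<Rightarrow> (real \<Rightarrow> 'a) set monoid" where
  "fundamental_group S p =
     \<lparr>carrier = path_class S `
        {\<gamma>. path \<gamma> \<and> path_image \<gamma> \<subseteq> S \<and> pathstart \<gamma> = p \<and> pathfinish \<gamma> = p},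
      mult = (\<lambda>X Y. \<Union>\<gamma>\<in>X. \<Union>\<delta>\<in>Y. path_class S (\<gamma> +++ \<delta>)),
      one = path_class S (\<lambda>_. p)\<rparr>"

text \<open>
  Since the marked point is fixed, a homeomorphism of a connected oriented surface preserves
  the orientation iff it preserves the local orientation at the marked point, i.e.\ acts trivially
  on \<open>H\<^sub>2(S, S - {p}; \<int>)\<close>.
\<close>

definition orientation_preserving_at ::
    "'a::topological_space set \<Rightarrow> 'a \<Rightarrow> ('a \<Rightarrow> 'a) \<Rightarrow> bool" where
  "orientation_preserving_at S p f \<longleftrightarrow>
     (\<forall>c\<in>carrier (relative_homology_group 2 (top_of_set S) (S - {p})).
        hom_induced 2 (top_of_set S) (S - {p}) (top_of_set S) (S - {p}) f c = c)"

definition pointed_homeo :: "'a::topological_space set \<Rightarrow> 'a \<Rightarrow> ('a \<Rightarrow> 'a) \<Rightarrow> bool" where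
  "pointed_homeo S p f \<longleftrightarrow> homeomorphic_map (top_of_set S) (top_of_set S) f \<and> f p = p"

definition isotopy_class ::
    "'a::topological_space set \<Rightarrow> 'a \<Rightarrow> ('a \<Rightarrow> 'a) \<Rightarrow> ('a \<Rightarrow> 'a) set" where
  "isotopy_class S p f =
     {f'. homotopic_with (pointed_homeo S p) (top_of_set S) (top_of_set S) f f'}"

definition mapping_class_group ::
    "'a::topological_space set \<Rightarrow> 'a \<Rightarrow> ('a \<Rightarrow> 'a) set monoid" where
  "mapping_class_group S p =
     \<lparr>carrier = isotopy_class S p ` {f. pointed_homeo S p f \<and> orientation_preserving_at S p f},
      mult = (\<lambda>\<Phi> \<Psi>. \<Union>f\<in>\<Phi>. \<Union>f'\<in>\<Psi>. isotopy_class S p (f \<circ> f')),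
      one = isotopy_class S p id\<rparr>"

definition mapping_class_action ::
    "'a::topological_space set \<Rightarrow> ('a \<Rightarrow> 'a) set \<Rightarrow> (real \<Rightarrow> 'a) set \<Rightarrow> (real \<Rightarrow> 'a) set" where
  "mapping_class_action S \<Phi> X = (\<Union>f\<in>\<Phi>. \<Union>\<gamma>\<in>X. path_class S (f \<circ> \<gamma>))"

text \<open>
  The indexing is \<open>lower_central G 1 = G\<close>, \<open>lower_central G 2 = [G, G]\<close>; the value at \<open>0\<close> is
  a dummy.
\<close>

fun lower_central :: "('g, 'm) monoid_scheme \<Rightarrow> nat \<Rightarrow> 'g set" where
  "lower_central G 0 = carrier G"
| "lower_central G (Suc 0) = carrier G"
| "lower_central G (Suc (Suc n)) =
     generate G {x \<otimes>\<^bsub>G\<^esub> y \<otimes>\<^bsub>G\<^esub> inv\<^bsub>G\<^esub> x \<otimes>\<^bsub>G\<^esub> inv\<^bsub>G\<^esub> y | x y.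
       x \<in> carrier G \<and> y \<in> lower_central G (Suc n)}"

definition nilpotent_quotient_action ::
    "'a::topological_space set \<Rightarrow> 'a \<Rightarrow> nat \<Rightarrow> ('a \<Rightarrow> 'a) set
       \<Rightarrow> (real \<Rightarrow> 'a) set set \<Rightarrow> (real \<Rightarrow> 'a) set set" where
  "nilpotent_quotient_action S p n \<Phi> =
     (let \<pi> = fundamental_group S p in
      restrict ((`) (mapping_class_action S \<Phi>)) (carrier (\<pi> Mod lower_central \<pi> n)))"

definition johnson_kernel ::
    "'a::topological_space set \<Rightarrow> 'a \<Rightarrow> ('a \<Rightarrow> 'a) set monoid" where
  "johnson_kernel S p =
     (let \<pi> = fundamental_group S p; \<Gamma> = mapping_class_group S p in
      \<Gamma>\<lparr>carrier := kernel \<Gamma> (AutoGroup (\<pi> Mod lower_central \<pi> 3))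
                     (nilpotent_quotient_action S p 3)\<rparr>)"

section \<open>Rational group algebras and their modules\<close>

definition point_mass :: "'g \<Rightarrow> 'g \<Rightarrow> rat" where
  "point_mass g = (\<lambda>x. if x = g then 1 else 0)"

definition supp :: "('g \<Rightarrow> rat) \<Rightarrow> 'g set" where
  "supp u = {x. u x \<noteq> 0}"

text \<open>The group algebra \<open>\<rat>G\<close>, as a record carrying both its ring and its \<open>\<rat>\<close>-module structure.\<close>

definition group_algebra :: "('g, 'm) monoid_scheme \<Rightarrow> (rat, 'g \<Rightarrow> rat) module" where
  "group_algebra G =
     \<lparr>carrier = {u. finite (supp u) \<and> supp u \<subseteq> carrier G},
      mult = (\<lambda>u v x. \<Sum>(y, z) \<in> {(y, z) \<in> supp u \<times> supp v. y \<otimes>\<^bsub>G\<^esub> z = x}. u y * v z),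
      one = point_mass \<one>\<^bsub>G\<^esub>,
      zero = (\<lambda>_. 0),
      add = (\<lambda>u v x. u x + v x),
      smult = (\<lambda>q u x. q * u x)\<rparr>"

definition augmentation_ideal :: "('g, 'm) monoid_scheme \<Rightarrow> ('g \<Rightarrow> rat) set" where
  "augmentation_ideal G = {u \<in> carrier (group_algebra G). (\<Sum>x\<in>supp u. u x) = 0}"

primrec ideal_power :: "('r, 'm) ring_scheme \<Rightarrow> 'r set \<Rightarrow> nat \<Rightarrow> 'r set" where
  "ideal_power R I 0 = carrier R"
| "ideal_power R I (Suc k) = I \<cdot>\<^bsub>R\<^esub> ideal_power R I k"

text \<open>The additive subgroup generated by the products; this is \<open>I X\<close> for an ideal \<open>I\<close>.\<close>

definition module_span :: "('r, 'v, 'm) module_scheme \<Rightarrow> 'r set \<Rightarrow> 'v set \<Rightarrow> 'v set" where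
  "module_span M I X = generate (add_monoid M) {r \<odot>\<^bsub>M\<^esub> x | r x. r \<in> I \<and> x \<in> X}"

text \<open>
  The record type \<^typ>\<open>('r, 'v) module\<close> extends rings, so a module value has multiplicative
  fields, which have no meaning for a module.
\<close>

definition quotient_module ::
    "('r, 'v, 'm) module_scheme \<Rightarrow> 'v set \<Rightarrow> ('r, 'v set) module" where
  "quotient_module M N =
     \<lparr>carrier = a_rcosets\<^bsub>M\<^esub> N,
      mult = undefined,
      one = undefined,
      zero = N,
      add = set_add M,
      smult = (\<lambda>r X. \<Union>x\<in>X. N +>\<^bsub>M\<^esub> (r \<odot>\<^bsub>M\<^esub> x))\<rparr>"

text \<open>
  A rational vector space \<open>V\<close> with an action \<open>\<rho>\<close> of a group \<open>G\<close> by linear maps, as a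
  \<open>\<rat>G\<close>-module.
\<close>

definition group_algebra_module ::
    "(rat, 'v, 'm) module_scheme \<Rightarrow> ('g \<Rightarrow> 'v \<Rightarrow> 'v) \<Rightarrow> ('g \<Rightarrow> rat, 'v) module" where
  "group_algebra_module V \<rho> =
     \<lparr>carrier = carrier V,
      mult = undefined,
      one = undefined,
      zero = \<zero>\<^bsub>V\<^esub>,
      add = add V,
      smult = (\<lambda>u m. \<Oplus>\<^bsub>V\<^esub>g\<in>supp u. u g \<odot>\<^bsub>V\<^esub> \<rho> g m)\<rparr>"

text \<open>
  Rational group homology in degree one, by the inhomogeneous bar complex: with trivial
  coefficients every \<open>1\<close>-chain is a cycle and \<open>\<partial>[x|y] = [y] - [x y] + [x]\<close>.
\<close>

definition bar_boundaries :: "('g, 'm) monoid_scheme \<Rightarrow> ('g \<Rightarrow> rat) set" where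
  "bar_boundaries G =
     module_span (group_algebra G) UNIV
       {(\<lambda>z. point_mass y z - point_mass (x \<otimes>\<^bsub>G\<^esub> y) z + point_mass x z) | x y.
          x \<in> carrier G \<and> y \<in> carrier G}"

definition group_H1 :: "('g, 'm) monoid_scheme \<Rightarrow> (rat, ('g \<Rightarrow> rat) set) module" where
  "group_H1 G = quotient_module (group_algebra G) (bar_boundaries G)"

definition push_chain :: "('g \<Rightarrow> 'h) \<Rightarrow> ('g \<Rightarrow> rat) \<Rightarrow> 'h \<Rightarrow> rat" where
  "push_chain \<phi> u = (\<lambda>y. \<Sum>x\<in>{x \<in> supp u. \<phi> x = y}. u x)"

definition group_H1_map ::
    "('h, 'm) monoid_scheme \<Rightarrow> ('g \<Rightarrow> 'h) \<Rightarrow> ('g \<Rightarrow> rat) set \<Rightarrow> ('h \<Rightarrow> rat) set" where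
  "group_H1_map G' \<phi> X = (\<Union>u\<in>X. bar_boundaries G' +>\<^bsub>group_algebra G'\<^esub> push_chain \<phi> u)"

section \<open>The coinvariants of the Johnson kernel\<close>

definition commutator_group :: "('g, 'm) monoid_scheme \<Rightarrow> ('g, 'm) monoid_scheme" where
  "commutator_group G = G\<lparr>carrier := lower_central G 2\<rparr>"

definition abelianization :: "('g, 'm) monoid_scheme \<Rightarrow> 'g set monoid" where
  "abelianization G = G Mod lower_central G 2"

text \<open>An element of the abelianization is a coset; its members all act alike on \<open>H\<^sub>1([G, G]; \<rat>)\<close>.\<close>

definition conjugation_action ::
    "('g, 'm) monoid_scheme \<Rightarrow> 'g set \<Rightarrow> ('g \<Rightarrow> rat) set \<Rightarrow> ('g \<Rightarrow> rat) set" where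
  "conjugation_action G h X =
     (\<Union>y\<in>h. group_H1_map (commutator_group G) (\<lambda>x. y \<otimes>\<^bsub>G\<^esub> x \<otimes>\<^bsub>G\<^esub> inv\<^bsub>G\<^esub> y) X)"

definition alexander_module ::
    "('g, 'm) monoid_scheme \<Rightarrow> ('g set \<Rightarrow> rat, ('g \<Rightarrow> rat) set) module" where
  "alexander_module G =
     group_algebra_module (group_H1 (commutator_group G)) (conjugation_action G)"

definition johnson_module ::
    "'a::topological_space set \<Rightarrow> 'a
       \<Rightarrow> (('a \<Rightarrow> 'a) set \<Rightarrow> rat, ((real \<Rightarrow> 'a) set \<Rightarrow> rat) set) module" where
  "johnson_module S p =
     (let \<pi>2 = commutator_group (fundamental_group S p) in
      group_algebra_module (group_H1 \<pi>2) (\<lambda>\<Phi>. group_H1_map \<pi>2 (mapping_class_action S \<Phi>)))"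

definition johnson_coinvariants ::
    "'a::topological_space set \<Rightarrow> 'a
       \<Rightarrow> ((real \<Rightarrow> 'a) set set \<Rightarrow> rat, ((real \<Rightarrow> 'a) set \<Rightarrow> rat) set set) module" where
  "johnson_coinvariants S p =
     quotient_module (alexander_module (fundamental_group S p))
       (module_span (johnson_module S p) (augmentation_ideal (johnson_kernel S p))
          (carrier (johnson_module S p)))"

definition adic_filtration ::
    "('g, 'm) monoid_scheme \<Rightarrow> ('g \<Rightarrow> rat, 'v, 'n) module_scheme \<Rightarrow> nat \<Rightarrow> 'v set" where
  "adic_filtration G M k =
     module_span M (ideal_power (group_algebra G) (augmentation_ideal G) k) (carrier M)"

end

theory Submission
  imports Defs "HOL-Library.Function_Algebras" "HOL-Analysis.Abstract_Topological_Spaces"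
begin

text \<open>
  Write \<open>\<pi>\<close> for the fundamental group, \<open>N\<close> for its commutator subgroup and \<open>K\<close> for the Johnson
  kernel. The filtration is stationary from \<open>J\<^sup>2\<close> on if every homomorphism \<open>\<lambda>\<close> from \<open>N\<close> to the
  rationals that is invariant under \<open>K\<close> and vanishes on \<open>J\<^sup>3 A\<close> already vanishes on \<open>J\<^sup>2 A\<close>.
  For such a \<open>\<lambda>\<close> the number \<open>F x y z w = \<lambda> ((x - 1) (y - 1) [z, w])\<close> is additive in the
  classes of \<open>x, y, z, w\<close> in \<open>H\<close>, symmetric in \<open>x, y\<close>, antisymmetric in \<open>z, w\<close>, satisfies a
  Jacobi identity in \<open>y, z, w\<close>, and \<open>F x y\<close> summed over the pairs \<open>a\<^sub>i, b\<^sub>i\<close> is zero, by the relation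
  of the surface group.

  Composing \<open>\<lambda>\<close> with a homeomorphism gives a functional of the same kind. The twist about a curve
  that bounds the \<open>i\<close>-th handle lies in \<open>K\<close>; it is the fourth power of a product of three twists
  and conjugates the handle by its boundary \<open>[a\<^sub>i, b\<^sub>i]\<close>. Its invariance gives \<open>F x y a\<^sub>i b\<^sub>i = 0\<close> for \<open>x\<close> in
  the \<open>i\<close>-th handle and \<open>y\<close> in another one. Transporting this identity by the
  twists \<open>a\<^sub>i \<mapsto> a\<^sub>i b\<^sub>i\<close>, \<open>b\<^sub>i \<mapsto> b\<^sub>i a\<^sub>i\<^sup>-\<^sup>1\<close> and by one that mixes two handles, and comparing with the
  Jacobi identity and the relation, yields \<open>F = 0\<close>.

  The twists are realized in the polygon: an annulus is made of one or two strips bounded by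
  parallel chords, and its twist moves an edge that crosses the strip to a path across the
  polygon, which in the convex disc is determined up to homotopy by its end points. A twist is the
  identity near the marked point, hence it preserves the orientation there by excision. The edge
  loops generate \<open>\<pi>\<close> because every point of the surface has a neighbourhood that contracts, along
  paths in the polygon, to the centre or to the vertex.
\<close>

section \<open>Curvature forms of a surface group\<close>

text \<open>A failure of J^2 = J^3 on the coinvariants is witnessed by one rational functional,
  because the stages are rational subspaces; the module theory thereby turns into identities between
  numbers. The hypotheses on the functional survive composition with a homeomorphism since the
  Johnson kernel is normal, and so every identity is stated for all translates by geometric
  automorphisms. Polarization takes the place of representation theory of the symplectic group: a
  transvection and its inverse separate odd from even terms. The target is the symmetrization of
  \<open>F\<close> in three arguments, a cubic form that can be tested on cubes; once it vanishes,
  the Jacobi identity leaves no room for \<open>F\<close>. Rational coefficients enter through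
  division by 2g - 1 and by 8.

  The obstacle on the topological side is the marked point, which is arbitrary: it may be the
  vertex, lie on an edge, or lie inside the polygon where the strips run. The annuli are therefore
  confined to a window of every edge, chosen with regard to the point, and for an inner point the
  polygon is first reparametrized.\<close>

definition additive_on :: "('g, 'm) monoid_scheme \<Rightarrow> ('g \<Rightarrow> rat) \<Rightarrow> bool" where
  "additive_on G f \<longleftrightarrow> (\<forall>x\<in>carrier G. \<forall>y\<in>carrier G. f (x \<otimes>\<^bsub>G\<^esub> y) = f x + f y)"

text \<open>Equality in \<open>H\<close> tensored with the rationals, tested on all functionals, so
  that torsion is ignored and no quotient group is formed.\<close>

definition homologous :: "('g, 'm) monoid_scheme \<Rightarrow> 'g \<Rightarrow> 'g \<Rightarrow> bool" where
  "homologous G x y \<longleftrightarrow> (\<forall>f. additive_on G f \<longrightarrow> f x = f y)"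

lemma homologousD: "homologous G x y \<Longrightarrow> additive_on G f \<Longrightarrow> f x = f y"
  by (simp add: homologous_def)

context group
begin

lemma additive_on_mult:
  "additive_on G f \<Longrightarrow> x \<in> carrier G \<Longrightarrow> y \<in> carrier G \<Longrightarrow> f (x \<otimes> y) = f x + f y"
  by (simp add: additive_on_def)

lemma additive_on_one: "additive_on G f \<Longrightarrow> f \<one> = 0"
  using additive_on_mult[of f \<one> \<one>] by simp

lemma additive_on_inv:
  assumes "additive_on G f" "x \<in> carrier G"
  shows "f (inv x) = - f x"
  using additive_on_mult[of f x "inv x"] additive_on_one[of f] assms by simp

lemma additive_on_generate_zero:
  assumes f: "additive_on G f" and X: "X \<subseteq> carrier G" "\<And>x. x \<in> X \<Longrightarrow> f x = 0"
    and x: "x \<in> generate G X"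
  shows "f x = 0"
  using x
proof (induction rule: generate.induct)
  case one then show ?case using additive_on_one f by simp
next
  case (incl h) then show ?case using X by simp
next
  case (inv h) then show ?case using X additive_on_inv[OF f] by auto
next
  case (eng h1 h2)
  then show ?case using additive_on_mult[OF f] generate_in_carrier[OF X(1)] by simp
qed

lemma additive_on_hom:
  "additive_on G f \<Longrightarrow> \<psi> \<in> hom G G \<Longrightarrow> additive_on G (\<lambda>x. f (\<psi> x))"
  by (simp add: additive_on_def hom_def Pi_iff)

end

text \<open>On homology \<open>sw i\<close> is a quarter turn of one handle, \<open>tv i\<close> the
  transvection along \<open>b i\<close> and \<open>mx i j\<close> the transvection along
  \<open>b i\<close> + \<open>b j\<close>; only these classes are recorded. \<open>rel\<close> and
  \<open>base\<close> are required after every \<psi>, so that an identity is transported simply by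
  composing \<psi> with another member.\<close>

locale curvature_form = group G for G (structure) +
  fixes F :: "'a \<Rightarrow> 'a \<Rightarrow> 'a \<Rightarrow> 'a \<Rightarrow> rat" and g :: nat and a b :: "nat \<Rightarrow> 'a"
    and \<G> :: "('a \<Rightarrow> 'a) set" and sw tv :: "nat \<Rightarrow> 'a \<Rightarrow> 'a" and mx :: "nat \<Rightarrow> nat \<Rightarrow> 'a \<Rightarrow> 'a"
  assumes g2: "g \<ge> 2"
    and a_closed [simp]: "i < g \<Longrightarrow> a i \<in> carrier G"
    and b_closed [simp]: "i < g \<Longrightarrow> b i \<in> carrier G"
    and gen: "carrier G = generate G (a ` {..<g} \<union> b ` {..<g})"
    and Gr_hom: "\<psi> \<in> \<G> \<Longrightarrow> \<psi> \<in> hom G G"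
    and Gr_id: "id \<in> \<G>"
    and Gr_comp: "\<psi> \<in> \<G> \<Longrightarrow> \<phi> \<in> \<G> \<Longrightarrow> \<psi> \<circ> \<phi> \<in> \<G>"
    and Gr_inv: "\<psi> \<in> \<G> \<Longrightarrow> \<exists>\<psi>'\<in>\<G>. \<forall>x\<in>carrier G. \<psi> (\<psi>' x) = x \<and> \<psi>' (\<psi> x) = x"
    and sw_Gr: "i < g \<Longrightarrow> sw i \<in> \<G>"
    and tv_Gr: "i < g \<Longrightarrow> tv i \<in> \<G>"
    and mx_Gr: "i < g \<Longrightarrow> j < g \<Longrightarrow> i \<noteq> j \<Longrightarrow> mx i j \<in> \<G>"
    and sw_a_homologous: "i < g \<Longrightarrow> homologous G (sw i (a i)) (b i)"
    and sw_b_homologous: "i < g \<Longrightarrow> homologous G (sw i (b i)) (inv (a i))"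
    and sw_other_homologous: "i < g \<Longrightarrow> j < g \<Longrightarrow> j \<noteq> i \<Longrightarrow> x \<in> {a j, b j} \<Longrightarrow> homologous G (sw i x) x"
    and tv_a_homologous: "i < g \<Longrightarrow> homologous G (tv i (a i)) (a i \<otimes> b i)"
    and tv_b_homologous: "i < g \<Longrightarrow> homologous G (tv i (b i)) (b i)"
    and mx_a_homologous: "i < g \<Longrightarrow> j < g \<Longrightarrow> i \<noteq> j \<Longrightarrow> k \<in> {i, j} \<Longrightarrow>
                  homologous G (mx i j (a k)) (a k \<otimes> b i \<otimes> b j)"
    and mx_a'_homologous: "i < g \<Longrightarrow> j < g \<Longrightarrow> i \<noteq> j \<Longrightarrow> k < g \<Longrightarrow> k \<noteq> i \<Longrightarrow> k \<noteq> j \<Longrightarrow>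
                  homologous G (mx i j (a k)) (a k)"
    and mx_b_homologous: "i < g \<Longrightarrow> j < g \<Longrightarrow> i \<noteq> j \<Longrightarrow> k < g \<Longrightarrow> homologous G (mx i j (b k)) (b k)"
    and F1: "\<And>y z w. y \<in> carrier G \<Longrightarrow> z \<in> carrier G \<Longrightarrow> w \<in> carrier G \<Longrightarrow> additive_on G (\<lambda>x. F x y z w)"
    and F3: "\<And>x y w. x \<in> carrier G \<Longrightarrow> y \<in> carrier G \<Longrightarrow> w \<in> carrier G \<Longrightarrow> additive_on G (\<lambda>z. F x y z w)"
    and F12: "\<And>x y z w. x \<in> carrier G \<Longrightarrow> y \<in> carrier G \<Longrightarrow> z \<in> carrier G \<Longrightarrow> w \<in> carrier G \<Longrightarrow>
                  F x y z w = F y x z w"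
    and F34: "\<And>x y z w. x \<in> carrier G \<Longrightarrow> y \<in> carrier G \<Longrightarrow> z \<in> carrier G \<Longrightarrow> w \<in> carrier G \<Longrightarrow>
                  F x y z w = - F x y w z"
    and jac: "\<And>t x y z. t \<in> carrier G \<Longrightarrow> x \<in> carrier G \<Longrightarrow> y \<in> carrier G \<Longrightarrow> z \<in> carrier G \<Longrightarrow>
                  F t x y z + F t y z x + F t z x y = 0"
    and rel: "\<And>\<psi> x y. \<psi> \<in> \<G> \<Longrightarrow> x \<in> carrier G \<Longrightarrow> y \<in> carrier G \<Longrightarrow> (\<Sum>i<g. F x y (\<psi> (a i)) (\<psi> (b i))) = 0"
    and base: "\<And>\<psi> i j x y. \<psi> \<in> \<G> \<Longrightarrow> i < g \<Longrightarrow> j < g \<Longrightarrow> i \<noteq> j \<Longrightarrow> x \<in> {a i, b i} \<Longrightarrow> y \<in> {a j, b j} \<Longrightarrow>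
                  F (\<psi> x) (\<psi> y) (\<psi> (a i)) (\<psi> (b i)) = 0"
begin

context
  fixes f assumes f: "additive_on G f"
begin

lemma sw_a: "i < g \<Longrightarrow> f (sw i (a i)) = f (b i)"
  and sw_b: "i < g \<Longrightarrow> f (sw i (b i)) = - f (a i)"
  and sw_a': "i < g \<Longrightarrow> j < g \<Longrightarrow> j \<noteq> i \<Longrightarrow> f (sw i (a j)) = f (a j)"
  and sw_b': "i < g \<Longrightarrow> j < g \<Longrightarrow> j \<noteq> i \<Longrightarrow> f (sw i (b j)) = f (b j)"
  using homologousD[OF sw_a_homologous f] homologousD[OF sw_b_homologous f] homologousD[OF sw_other_homologous f]
  by (simp_all add: additive_on_inv[OF f])

lemma tv_a: "i < g \<Longrightarrow> f (tv i (a i)) = f (a i) + f (b i)"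
  and tv_b: "i < g \<Longrightarrow> f (tv i (b i)) = f (b i)"
  using homologousD[OF tv_a_homologous f] homologousD[OF tv_b_homologous f] by (simp_all add: additive_on_mult[OF f])

lemma mx_a: "i < g \<Longrightarrow> j < g \<Longrightarrow> i \<noteq> j \<Longrightarrow> k \<in> {i, j} \<Longrightarrow> f (mx i j (a k)) = f (a k) + f (b i) + f (b j)"
  using homologousD[OF mx_a_homologous f, of i j k] by (auto simp: additive_on_mult[OF f])

lemma mx_a1: "i < g \<Longrightarrow> j < g \<Longrightarrow> i \<noteq> j \<Longrightarrow> f (mx i j (a i)) = f (a i) + f (b i) + f (b j)"
  and mx_a2: "i < g \<Longrightarrow> j < g \<Longrightarrow> i \<noteq> j \<Longrightarrow> f (mx i j (a j)) = f (a j) + f (b i) + f (b j)"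
  using mx_a by blast+

lemma mx_a': "i < g \<Longrightarrow> j < g \<Longrightarrow> i \<noteq> j \<Longrightarrow> k < g \<Longrightarrow> k \<noteq> i \<Longrightarrow> k \<noteq> j \<Longrightarrow> f (mx i j (a k)) = f (a k)"
  and mx_b: "i < g \<Longrightarrow> j < g \<Longrightarrow> i \<noteq> j \<Longrightarrow> k < g \<Longrightarrow> f (mx i j (b k)) = f (b k)"
  by (rule homologousD[OF mx_a'_homologous f] homologousD[OF mx_b_homologous f], assumption+)+

end

lemma Gr_closed [simp]: "\<psi> \<in> \<G> \<Longrightarrow> x \<in> carrier G \<Longrightarrow> \<psi> x \<in> carrier G"
  using Gr_hom by (auto simp: hom_def)

lemma F2:
  assumes "x \<in> carrier G" "z \<in> carrier G" "w \<in> carrier G"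
  shows "additive_on G (\<lambda>y. F x y z w)"
  using F1[OF assms] assms by (simp add: additive_on_def F12[of x _ z w])

lemma F4:
  assumes "x \<in> carrier G" "y \<in> carrier G" "z \<in> carrier G"
  shows "additive_on G (\<lambda>w. F x y z w)"
  using F3[OF assms] assms by (simp add: additive_on_def F34[of x y z])

lemma F_refl: "x \<in> carrier G \<Longrightarrow> y \<in> carrier G \<Longrightarrow> z \<in> carrier G \<Longrightarrow> F x y z z = 0"
  using F34[of x y z z] by simp

lemma ext_zero:
  assumes f: "additive_on G f" and "\<And>i. i < g \<Longrightarrow> f (a i) = 0" "\<And>i. i < g \<Longrightarrow> f (b i) = 0"
    and x: "x \<in> carrier G"
  shows "f x = 0"
proof (rule additive_on_generate_zero[OF f, of "a ` {..<g} \<union> b ` {..<g}"])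
  show "x \<in> generate G (a ` {..<g} \<union> b ` {..<g})" using x gen by simp
qed (use assms(2,3) in auto)

lemmas F1\<psi> = additive_on_hom[OF F1 Gr_hom]
lemmas F2\<psi> = additive_on_hom[OF F2 Gr_hom]
lemmas F3\<psi> = additive_on_hom[OF F3 Gr_hom]
lemmas F4\<psi> = additive_on_hom[OF F4 Gr_hom]

lemmas sw_simps = sw_a[OF F1\<psi>] sw_a[OF F2\<psi>] sw_a[OF F3\<psi>] sw_a[OF F4\<psi>]
   sw_b[OF F1\<psi>] sw_b[OF F2\<psi>] sw_b[OF F3\<psi>] sw_b[OF F4\<psi>]
   sw_a'[OF F1\<psi>] sw_a'[OF F2\<psi>] sw_a'[OF F3\<psi>] sw_a'[OF F4\<psi>]
   sw_b'[OF F1\<psi>] sw_b'[OF F2\<psi>] sw_b'[OF F3\<psi>] sw_b'[OF F4\<psi>]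
lemmas mx_simps = mx_a1[OF F1\<psi>] mx_a1[OF F2\<psi>] mx_a1[OF F3\<psi>] mx_a1[OF F4\<psi>]
   mx_a2[OF F1\<psi>] mx_a2[OF F2\<psi>] mx_a2[OF F3\<psi>] mx_a2[OF F4\<psi>]
   mx_a'[OF F1\<psi>] mx_a'[OF F2\<psi>] mx_a'[OF F3\<psi>] mx_a'[OF F4\<psi>]
   mx_b[OF F1\<psi>] mx_b[OF F2\<psi>] mx_b[OF F3\<psi>] mx_b[OF F4\<psi>]

text \<open>For the inverse transvection the added vector changes its sign. Comparing an identity
  after \<open>mx i j\<close> with the same identity after \<open>m\<close> separates the terms of
  odd and of even degree in \<open>b i\<close> + \<open>b j\<close>.\<close>

lemma mx_inverse:
  assumes ij: "i < g" "j < g" "i \<noteq> j"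
  obtains m where "m \<in> \<G>"
    "\<And>f. additive_on G f \<Longrightarrow> f (m (a i)) = f (a i) - f (b i) - f (b j)"
    "\<And>f. additive_on G f \<Longrightarrow> f (m (a j)) = f (a j) - f (b i) - f (b j)"
    "\<And>f k. additive_on G f \<Longrightarrow> k < g \<Longrightarrow> k \<noteq> i \<Longrightarrow> k \<noteq> j \<Longrightarrow> f (m (a k)) = f (a k)"
    "\<And>f k. additive_on G f \<Longrightarrow> k < g \<Longrightarrow> f (m (b k)) = f (b k)"
proof -
  obtain m where m: "m \<in> \<G>" and inv: "\<And>x. x \<in> carrier G \<Longrightarrow> m (mx i j x) = x"
    using Gr_inv[OF mx_Gr[OF ij]] by blast
  have B: "f (m (b k)) = f (b k)" if f: "additive_on G f" and "k < g" for f k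
    using mx_b[OF additive_on_hom[OF f Gr_hom[OF m]] ij that(2)] inv[of "b k"] that(2) by simp
  show ?thesis
  proof (rule that[OF m])
    fix f assume f: "additive_on G f"
    note f' = additive_on_hom[OF f Gr_hom[OF m]]
    show "f (m (a i)) = f (a i) - f (b i) - f (b j)"
      using mx_a1[OF f' ij] inv[of "a i"] ij B[OF f] by simp
    show "f (m (a j)) = f (a j) - f (b i) - f (b j)"
      using mx_a2[OF f' ij] inv[of "a j"] ij B[OF f] by simp
    show "f (m (a k)) = f (a k)" if "k < g" "k \<noteq> i" "k \<noteq> j" for k
      using mx_a'[OF f' ij that] inv[of "a k"] that by simp
    show "f (m (b k)) = f (b k)" if "k < g" for k using B[OF f that] .
  qed
qed

lemma tv_inverse:
  assumes i: "i < g"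
  obtains t where "t \<in> \<G>"
    "\<And>f. additive_on G f \<Longrightarrow> f (t (a i)) = f (a i) - f (b i)"
    "\<And>f. additive_on G f \<Longrightarrow> f (t (b i)) = f (b i)"
proof -
  obtain t where t: "t \<in> \<G>" and inv: "\<And>x. x \<in> carrier G \<Longrightarrow> t (tv i x) = x"
    using Gr_inv[OF tv_Gr[OF i]] by blast
  have B: "f (t (b i)) = f (b i)" if f: "additive_on G f" for f
    using tv_b[OF additive_on_hom[OF f Gr_hom[OF t]] i] inv[of "b i"] i by simp
  show ?thesis
  proof (rule that[OF t])
    fix f assume f: "additive_on G f"
    note f' = additive_on_hom[OF f Gr_hom[OF t]]
    show "f (t (a i)) = f (a i) - f (b i)"
      using tv_a[OF f' i] inv[of "a i"] i B[OF f] by simp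
    show "f (t (b i)) = f (b i)" using B[OF f] .
  qed
qed

text \<open>Mixing handles i and j in the base identities, together with the Jacobi identity, shows
  that handle j contributes to the surface relation exactly twice what handle i contributes. The
  relation then says that (2g - 1) times one number is zero.\<close>

lemma cube_b:
  assumes \<psi>: "\<psi> \<in> \<G>" and i: "i < g" and x: "x \<in> carrier G"
  shows "F (\<psi> (b i)) (\<psi> (b i)) (\<psi> (b i)) x = 0"
proof -
  let ?F = "\<lambda>\<psi> u v w x. F (\<psi> u) (\<psi> v) (\<psi> w) (\<psi> x)"
  have E: "?F \<psi> (b i) (b i) (b j) (b i) = 0"
     "?F \<psi> (b i) (b i) (a j) (b i) = 0"
     "?F \<psi> (b i) (b i) (a j) (b j) = 2 * ?F \<psi> (b i) (b i) (a i) (b i)"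
    if \<psi>: "\<psi> \<in> \<G>" and j: "j < g" "j \<noteq> i" for \<psi> j
  proof -
    have ij: "i < g" "j < g" "i \<noteq> j" using i j by auto
    obtain m where m: "m \<in> \<G>"
     and m_add: "\<And>f. additive_on G f \<Longrightarrow> f (m (a i)) = f (a i) - f (b i) - f (b j)"
      "\<And>f. additive_on G f \<Longrightarrow> f (m (a j)) = f (a j) - f (b i) - f (b j)"
      "\<And>f k. additive_on G f \<Longrightarrow> k < g \<Longrightarrow> f (m (b k)) = f (b k)"
      using mx_inverse[OF ij] by metis
    note m_simps = m_add(1)[OF F1\<psi>] m_add(1)[OF F2\<psi>] m_add(1)[OF F3\<psi>] m_add(1)[OF F4\<psi>]
      m_add(2)[OF F1\<psi>] m_add(2)[OF F2\<psi>] m_add(2)[OF F3\<psi>] m_add(2)[OF F4\<psi>]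
      m_add(3)[OF F1\<psi>] m_add(3)[OF F2\<psi>] m_add(3)[OF F3\<psi>] m_add(3)[OF F4\<psi>]
    \<comment> \<open>The first equation is the translate by \<open>mx i j\<close> of the base
      identity for \<open>b j\<close>. For \<open>a j\<close> the translates by
      \<open>mx i j\<close> and by \<open>m\<close> differ in the sign of the linear terms; their
      sum and difference give the other two.\<close>
    have all: "?F \<psi> (b i) (b j) (b j) (b i) = 0 \<and> ?F \<psi> (b i) (b i) (b j) (b i) = 0 \<and>
      ?F \<psi> (b i) (a j) (b j) (b i) + ?F \<psi> (b i) (b i) (a i) (b i) = 0" if \<psi>: "\<psi> \<in> \<G>" for \<psi>
    proof -
      have b0: "?F \<psi> (b i) (b j) (a i) (b i) = 0" "?F \<psi> (b i) (a j) (a i) (b i) = 0"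
        using base[OF \<psi> ij] by auto
      have "?F (\<psi> \<circ> mx i j) (b i) (b j) (a i) (b i) = 0"
        using base[OF Gr_comp[OF \<psi> mx_Gr[OF ij]] ij] by auto
      then have e1: "?F \<psi> (b i) (b j) (b j) (b i) = 0"
        using ij \<psi> mx_Gr b0 by (simp add: mx_simps F_refl)
      have "?F (\<psi> \<circ> mx i j) (b i) (a j) (a i) (b i) = 0" "?F (\<psi> \<circ> m) (b i) (a j) (a i) (b i) = 0"
        using base[OF Gr_comp[OF \<psi> mx_Gr[OF ij]] ij] base[OF Gr_comp[OF \<psi> m] ij] by auto
      then show ?thesis
        using ij \<psi> mx_Gr m b0 e1 by (simp add: mx_simps m_simps F_refl)
    qed
    note sj = sw_Gr[OF j(1)]
    have "?F \<psi> (b i) (b i) (b j) (b i) = 0"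
      "?F \<psi> (b i) (a j) (b j) (b i) + ?F \<psi> (b i) (b i) (a i) (b i) = 0" using all[OF \<psi>] by auto
    \<comment> \<open>The quarter turn of handle j sends \<open>b j\<close> to minus
      \<open>a j\<close> and \<open>a j\<close> to \<open>b j\<close>, which doubles the stock of
      equations.\<close>
    moreover have "?F \<psi> (b i) (b i) (a j) (b i) = 0"
      "?F \<psi> (b i) (b i) (a i) (b i) = ?F \<psi> (b i) (b j) (a j) (b i)"
      using all[OF Gr_comp[OF \<psi> sj]] ij \<psi> sj by (simp_all add: sw_simps)
    moreover have "?F \<psi> (b i) (b i) (a j) (b j) + ?F \<psi> (b i) (a j) (b j) (b i) + ?F \<psi> (b i) (b j) (b i) (a j) = 0"
      by (rule jac) (use ij \<psi> in auto)
    moreover have "?F \<psi> (b i) (b j) (b i) (a j) = - ?F \<psi> (b i) (b j) (a j) (b i)"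
      by (rule F34) (use ij \<psi> in auto)
    ultimately show "?F \<psi> (b i) (b i) (b j) (b i) = 0" "?F \<psi> (b i) (b i) (a j) (b i) = 0"
      "?F \<psi> (b i) (b i) (a j) (b j) = 2 * ?F \<psi> (b i) (b i) (a i) (b i)"
      by linarith+
  qed
  \<comment> \<open>Handle i counts once, each of the g - 1 others twice.\<close>
  have "0 = (\<Sum>k<g. ?F \<psi> (b i) (b i) (a k) (b k))" using rel[OF \<psi>, of "\<psi> (b i)" "\<psi> (b i)"] i \<psi> by simp
  also have "\<dots> = (\<Sum>k<g. if k = i then ?F \<psi> (b i) (b i) (a i) (b i) else 2 * ?F \<psi> (b i) (b i) (a i) (b i))"
    using E(3)[OF \<psi>] by (intro sum.cong) auto
  also have "\<dots> = ?F \<psi> (b i) (b i) (a i) (b i) + (\<Sum>k\<in>{..<g}-{i}. 2 * ?F \<psi> (b i) (b i) (a i) (b i))"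
    using i by (subst sum.remove[of _ i]) auto
  also have "\<dots> = (1 + 2 * of_nat (g - 1)) * ?F \<psi> (b i) (b i) (a i) (b i)"
    using i by (simp add: algebra_simps)
  finally have "0 = (1 + 2 * of_nat (g - 1)) * ?F \<psi> (b i) (b i) (a i) (b i)" .
  moreover have "(1 + 2 * of_nat (g - 1) :: rat) > 0" by (intro add_pos_nonneg) auto
  ultimately have q: "?F \<psi> (b i) (b i) (a i) (b i) = 0" by auto
  let ?f = "\<lambda>y. ?F \<psi> (b i) (b i) (b i) y"
  have f: "additive_on G ?f" using F4\<psi> \<psi> i by simp
  have z: "?f (a j) = 0" "?f (b j) = 0" if j: "j < g" for j
  proof -
    have "?f y = - ?F \<psi> (b i) (b i) y (b i)" if "y \<in> carrier G" for y
      by (rule F34) (use \<psi> i that in auto)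
    then have *: "?f (a j) = - ?F \<psi> (b i) (b i) (a j) (b i)" "?f (b j) = - ?F \<psi> (b i) (b i) (b j) (b i)"
      using j by auto
    show "?f (a j) = 0" "?f (b j) = 0"
      unfolding * using E(1,2)[OF \<psi> j] q F_refl[of "\<psi> (b i)" "\<psi> (b i)" "\<psi> (b i)"] \<psi> i
      by (cases "j = i"; simp)+
  qed
  \<comment> \<open>\<psi> is onto, so that additivity in the last argument may be tested on images
    of generators.\<close>
  obtain x' where "x' \<in> carrier G" "x = \<psi> x'" using Gr_inv[OF \<psi>] x by (metis Gr_closed)
  then show ?thesis using ext_zero[OF f z] by simp
qed

text \<open>Half of the full symmetrization of \<open>F\<close> in its first three arguments, as
  \<open>F\<close> is already symmetric in two of them. For fixed \<open>x\<close> it is a symmetric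
  trilinear form, hence determined by its cubes.\<close>

definition T :: "'a \<Rightarrow> 'a \<Rightarrow> 'a \<Rightarrow> 'a \<Rightarrow> rat" where
  "T x u v w = F u v w x + F u w v x + F v w u x"

definition TZ :: "'a \<Rightarrow> 'a \<Rightarrow> 'a \<Rightarrow> bool" where
  "TZ u v w \<longleftrightarrow> (\<forall>\<psi>\<in>\<G>. \<forall>x\<in>carrier G. T x (\<psi> u) (\<psi> v) (\<psi> w) = 0)"

lemma T_swap: "x \<in> carrier G \<Longrightarrow> u \<in> carrier G \<Longrightarrow> v \<in> carrier G \<Longrightarrow> w \<in> carrier G \<Longrightarrow> T x u v w = T x v u w"
  "x \<in> carrier G \<Longrightarrow> u \<in> carrier G \<Longrightarrow> v \<in> carrier G \<Longrightarrow> w \<in> carrier G \<Longrightarrow> T x u v w = T x u w v"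
  by (simp_all add: T_def F12[of u v] F12[of v w])

lemma T1: "x \<in> carrier G \<Longrightarrow> v \<in> carrier G \<Longrightarrow> w \<in> carrier G \<Longrightarrow> additive_on G (\<lambda>u. T x u v w)"
  using F1[of v w x] F1[of w v x] F3[of v w x] by (simp add: T_def additive_on_def)

lemma T2: "x \<in> carrier G \<Longrightarrow> u \<in> carrier G \<Longrightarrow> w \<in> carrier G \<Longrightarrow> additive_on G (\<lambda>v. T x u v w)"
  using T1[of x u w] by (simp add: additive_on_def T_swap(1)[of x u _ w])

lemma T3: "x \<in> carrier G \<Longrightarrow> u \<in> carrier G \<Longrightarrow> v \<in> carrier G \<Longrightarrow> additive_on G (\<lambda>w. T x u v w)"
  using T2[of x u v] by (simp add: additive_on_def T_swap(2)[of x u v])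

lemmas T1\<psi> = additive_on_hom[OF T1 Gr_hom]
lemmas T2\<psi> = additive_on_hom[OF T2 Gr_hom]
lemmas T3\<psi> = additive_on_hom[OF T3 Gr_hom]

lemmas swT_simps = sw_a[OF T1\<psi>] sw_a[OF T2\<psi>] sw_a[OF T3\<psi>] sw_b[OF T1\<psi>] sw_b[OF T2\<psi>] sw_b[OF T3\<psi>]
   sw_a'[OF T1\<psi>] sw_a'[OF T2\<psi>] sw_a'[OF T3\<psi>] sw_b'[OF T1\<psi>] sw_b'[OF T2\<psi>] sw_b'[OF T3\<psi>]
lemmas tvT_simps = tv_a[OF T1\<psi>] tv_a[OF T2\<psi>] tv_a[OF T3\<psi>] tv_b[OF T1\<psi>] tv_b[OF T2\<psi>] tv_b[OF T3\<psi>]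
lemmas mxT_simps = mx_a1[OF T1\<psi>] mx_a1[OF T2\<psi>] mx_a1[OF T3\<psi>]
   mx_a2[OF T1\<psi>] mx_a2[OF T2\<psi>] mx_a2[OF T3\<psi>]
   mx_a'[OF T1\<psi>] mx_a'[OF T2\<psi>] mx_a'[OF T3\<psi>] mx_b[OF T1\<psi>] mx_b[OF T2\<psi>] mx_b[OF T3\<psi>]

lemma TZ_D: "TZ u v w \<Longrightarrow> \<psi> \<in> \<G> \<Longrightarrow> x \<in> carrier G \<Longrightarrow> T x (\<psi> u) (\<psi> v) (\<psi> w) = 0"
  by (simp add: TZ_def)

lemma TZ_D2: "TZ u v w \<Longrightarrow> \<psi> \<in> \<G> \<Longrightarrow> \<phi> \<in> \<G> \<Longrightarrow> x \<in> carrier G \<Longrightarrow> T x (\<psi> (\<phi> u)) (\<psi> (\<phi> v)) (\<psi> (\<phi> w)) = 0"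
  using TZ_D[of u v w "\<psi> \<circ> \<phi>" x] Gr_comp by simp

lemma TZ_perm:
  assumes "u \<in> carrier G" "v \<in> carrier G" "w \<in> carrier G" "TZ u v w"
  shows "TZ v u w" "TZ u w v"
  using assms T_swap by (simp_all add: TZ_def)

lemma TZ_bbb: "i < g \<Longrightarrow> TZ (b i) (b i) (b i)"
  by (simp add: TZ_def T_def cube_b)

lemma TZ_aaa:
  assumes i: "i < g" shows "TZ (a i) (a i) (a i)"
  unfolding TZ_def
proof (intro ballI)
  fix \<psi> x assume p: "\<psi> \<in> \<G>" "x \<in> carrier G"
  show "T x (\<psi> (a i)) (\<psi> (a i)) (\<psi> (a i)) = 0"
    using TZ_D2[OF TZ_bbb[OF i] p(1) sw_Gr[OF i] p(2)] p i sw_Gr by (simp add: swT_simps)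
qed

text \<open>The cubes of a + b and a - b are translates of the cube of a and vanish; their
  difference and sum isolate the two mixed terms.\<close>

lemma TZ_one_handle:
  assumes i: "i < g" shows "TZ (a i) (a i) (b i) \<and> TZ (a i) (b i) (b i)"
proof -
  obtain t where t: "t \<in> \<G>" 
    and t_add: "\<And>f. additive_on G f \<Longrightarrow> f (t (a i)) = f (a i) - f (b i)"
    "\<And>f. additive_on G f \<Longrightarrow> f (t (b i)) = f (b i)" using tv_inverse[OF i] by metis
  note t_simps = t_add(1)[OF T1\<psi>] t_add(1)[OF T2\<psi>] t_add(1)[OF T3\<psi>]
    t_add(2)[OF T1\<psi>] t_add(2)[OF T2\<psi>] t_add(2)[OF T3\<psi>]
  have "T x (\<psi> (a i)) (\<psi> (a i)) (\<psi> (b i)) = 0 \<and> T x (\<psi> (a i)) (\<psi> (b i)) (\<psi> (b i)) = 0"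
    if p: "\<psi> \<in> \<G>" "x \<in> carrier G" for \<psi> x
    using TZ_D2[OF TZ_aaa[OF i] p(1) tv_Gr[OF i] p(2)] TZ_D2[OF TZ_aaa[OF i] p(1) t p(2)] p i tv_Gr t
       TZ_D[OF TZ_aaa[OF i] p] TZ_D[OF TZ_bbb[OF i] p]
    by (simp add: tvT_simps t_simps T_swap)
  then show ?thesis by (simp add: TZ_def)
qed

text \<open>With A, B, C the images of \<open>a i\<close>, \<open>b i\<close>, \<open>b j\<close>,
  the cube of A + s (B + C) vanishes for s = 1, -1 and 2, hence so do its coefficients of s, s^2 and
  s^3. Two of these are still sums of two unknown terms.\<close>

lemma TZ_two_handles_aux:
  assumes ij: "i < g" "j < g" "i \<noteq> j"
  shows "TZ (a i) (a i) (b j) \<and> TZ (a i) (b i) (b j) \<and> TZ (b i) (b i) (b j)"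
proof -
  obtain m where m: "m \<in> \<G>"
     and m_add: "\<And>f. additive_on G f \<Longrightarrow> f (m (a i)) = f (a i) - f (b i) - f (b j)"
      "\<And>f k. additive_on G f \<Longrightarrow> k < g \<Longrightarrow> f (m (b k)) = f (b k)"
      using mx_inverse[OF ij] by metis
  note m_simps = m_add(1)[OF T1\<psi>] m_add(1)[OF T2\<psi>] m_add(1)[OF T3\<psi>]
    m_add(2)[OF T1\<psi>] m_add(2)[OF T2\<psi>] m_add(2)[OF T3\<psi>]
  have 1: "T x (\<psi> (a i)) (\<psi> (a i)) (\<psi> (b j)) = 0 \<and>
     2 * T x (\<psi> (a i)) (\<psi> (b i)) (\<psi> (b j)) + T x (\<psi> (a i)) (\<psi> (b j)) (\<psi> (b j)) = 0 \<and>
     T x (\<psi> (b i)) (\<psi> (b i)) (\<psi> (b j)) + T x (\<psi> (b i)) (\<psi> (b j)) (\<psi> (b j)) = 0"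
    if p: "\<psi> \<in> \<G>" "x \<in> carrier G" for \<psi> x
  proof -
    let ?A = "\<psi> (a i)" and ?B = "\<psi> (b i)" and ?C = "\<psi> (b j)"
    note z = TZ_D[OF TZ_aaa[OF ij(1)] p] TZ_D[OF TZ_bbb[OF ij(1)] p] TZ_D[OF TZ_bbb[OF ij(2)] p]
      TZ_D[OF conjunct1[OF TZ_one_handle[OF ij(1)]] p] TZ_D[OF conjunct2[OF TZ_one_handle[OF ij(1)]] p]
    have p1: "T x (\<psi> (mx i j (a i))) (\<psi> (mx i j (a i))) (\<psi> (mx i j (a i))) = 0"
      by (rule TZ_D2[OF TZ_aaa[OF ij(1)] p(1) mx_Gr[OF ij] p(2)])
    have p2: "T x (\<psi> (m (a i))) (\<psi> (m (a i))) (\<psi> (m (a i))) = 0"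
      by (rule TZ_D2[OF TZ_aaa[OF ij(1)] p(1) m p(2)])
    \<comment> \<open>The value s = 2, from applying \<open>mx i j\<close> twice: with s = 1 and s =
      -1 alone the linear and the cubic coefficient would stay together.\<close>
    have "T x ((\<psi> \<circ> mx i j) (mx i j (a i))) ((\<psi> \<circ> mx i j) (mx i j (a i))) ((\<psi> \<circ> mx i j) (mx i j (a i))) = 0"
      by (rule TZ_D2[OF TZ_aaa[OF ij(1)] Gr_comp[OF p(1) mx_Gr[OF ij]] mx_Gr[OF ij] p(2)])
    then have p3: "T x (\<psi> (mx i j (mx i j (a i)))) (\<psi> (mx i j (mx i j (a i)))) (\<psi> (mx i j (mx i j (a i)))) = 0"
      by simp
    have h: "T x (\<psi> (mx i j (mx i j (a i)))) (\<psi> (mx i j (mx i j (a i)))) (\<psi> (mx i j (mx i j (a i)))) = 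
      T x ?A ?A ?A + 6 * (T x ?A ?A ?B + T x ?A ?A ?C) + 12 * (T x ?A ?B ?B + 2 * T x ?A ?B ?C + T x ?A ?C ?C)
       + 8 * (T x ?B ?B ?B + 3 * T x ?B ?B ?C + 3 * T x ?B ?C ?C + T x ?C ?C ?C)"
    proof -
      let ?\<phi> = "\<psi> \<circ> mx i j"
      have c: "?\<phi> \<in> \<G>" using Gr_comp p mx_Gr ij by simp
      have e: "f (?\<phi> (mx i j (a i))) = f ?A + 2 * f ?B + 2 * f ?C" if f: "additive_on G f" for f
        using mx_a1[OF additive_on_hom[OF f Gr_hom[OF c]] ij] mx_a1[OF additive_on_hom[OF f Gr_hom[OF p(1)]] ij]
          mx_b[OF additive_on_hom[OF f Gr_hom[OF p(1)]] ij] ij by simp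
      have "T x (?\<phi> (mx i j (a i))) (?\<phi> (mx i j (a i))) (?\<phi> (mx i j (a i))) = 
      T x ?A ?A ?A + 6 * (T x ?A ?A ?B + T x ?A ?A ?C) + 12 * (T x ?A ?B ?B + 2 * T x ?A ?B ?C + T x ?A ?C ?C)
       + 8 * (T x ?B ?B ?B + 3 * T x ?B ?B ?C + 3 * T x ?B ?C ?C + T x ?C ?C ?C)"
        using c p ij mx_Gr
        by (simp only: e[OF T1] e[OF T2] e[OF T3] Gr_closed a_closed b_closed simp_thms) (simp add: algebra_simps T_swap)
      then show ?thesis by simp
    qed
    show ?thesis
      using p1 p2 p3[unfolded h] z p ij m mx_Gr
      by (simp add: mxT_simps m_simps T_swap)
  qed
  \<comment> \<open>The square of the quarter turn changes the sign of \<open>b j\<close> and fixes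
    the classes of handle i. This reverses the relative sign in both remaining sums and so splits
    them.\<close>
  have 2: "T x (\<psi> (a i)) (\<psi> (b i)) (\<psi> (b j)) = 0 \<and> T x (\<psi> (b i)) (\<psi> (b i)) (\<psi> (b j)) = 0"
    if p: "\<psi> \<in> \<G>" "x \<in> carrier G" for \<psi> x
  proof -
    let ?\<phi> = "\<psi> \<circ> sw j"
    have c: "?\<phi> \<in> \<G>" "?\<phi> \<circ> sw j \<in> \<G>" using Gr_comp p sw_Gr ij by simp_all
    have e: "f ((?\<phi> \<circ> sw j) (b j)) = - f (\<psi> (b j))" "f ((?\<phi> \<circ> sw j) (a i)) = f (\<psi> (a i))"
      "f ((?\<phi> \<circ> sw j) (b i)) = f (\<psi> (b i))" if f: "additive_on G f" for f
      using sw_b[OF additive_on_hom[OF f Gr_hom[OF c(1)]] ij(2)] sw_a[OF additive_on_hom[OF f Gr_hom[OF p(1)]] ij(2)]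
       sw_a'[OF additive_on_hom[OF f Gr_hom[OF c(1)]] ij(2,1,3)] sw_a'[OF additive_on_hom[OF f Gr_hom[OF p(1)]] ij(2,1,3)]
       sw_b'[OF additive_on_hom[OF f Gr_hom[OF c(1)]] ij(2,1,3)] sw_b'[OF additive_on_hom[OF f Gr_hom[OF p(1)]] ij(2,1,3)]
      by simp_all
    have "2 * T x (\<psi> (a i)) (\<psi> (b i)) (\<psi> (b j)) - T x (\<psi> (a i)) (\<psi> (b j)) (\<psi> (b j)) = 0 \<and>
     T x (\<psi> (b i)) (\<psi> (b i)) (\<psi> (b j)) - T x (\<psi> (b i)) (\<psi> (b j)) (\<psi> (b j)) = 0"
      using 1[OF c(2) p(2)] p(2) Gr_closed[OF c(2)] ij Gr_closed[OF p(1)]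
      by (simp add: e[OF T1] e[OF T2] e[OF T3] del: o_apply)
    then show ?thesis using 1[OF p] by linarith
  qed
  show ?thesis using 1 2 by (simp add: TZ_def)
qed

lemma TZ_sw:
  assumes "i < g" "j < g" "i \<noteq> j" "u \<in> {a i, b i}" "v \<in> {a i, b i}" "TZ u v (b j)"
  shows "TZ u v (a j)"
  unfolding TZ_def
proof (intro ballI)
  fix \<psi> x assume p: "\<psi> \<in> \<G>" "x \<in> carrier G"
  obtain s where s: "s \<in> \<G>" and inv: "\<And>x. x \<in> carrier G \<Longrightarrow> sw j (s x) = x" "\<And>x. x \<in> carrier G \<Longrightarrow> s (sw j x) = x"
    using Gr_inv[OF sw_Gr[OF assms(2)]] by blast
  have e: "T x (\<psi> (sw j u)) (\<psi> (sw j v)) (\<psi> (sw j (b j))) = 0"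
    using TZ_D2[OF assms(6) p(1) sw_Gr[OF assms(2)] p(2)] .
  show "T x (\<psi> u) (\<psi> v) (\<psi> (a j)) = 0" using e p assms sw_Gr by (auto simp: swT_simps)
qed

lemma TZ_two_handles:
  assumes ij: "i < g" "j < g" "i \<noteq> j" and "u \<in> {a i, b i}" "v \<in> {a i, b i}" "w \<in> {a j, b j}"
  shows "TZ u v w"
proof -
  have *: "TZ u v (b j)"
    using TZ_two_handles_aux[OF ij] assms TZ_perm(1)[of "a i" "b i" "b j"] by auto
  with TZ_sw[OF ij assms(4,5) this] assms(6) show ?thesis by auto
qed

text \<open>In the vanishing value at \<open>b i\<close>, \<open>a j\<close>, \<open>a j\<close> the
  vector \<open>b j\<close> + \<open>b l\<close> is added to or subtracted from \<open>a j\<close>.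
  All terms that touch at most two handles are known to vanish; the linear and the quadratic part
  each leave one term on three handles.\<close>

lemma TZ_three_handles_aux:
  assumes h: "i < g" "j < g" "l < g" "i \<noteq> j" "j \<noteq> l" "i \<noteq> l"
  shows "TZ (b i) (a j) (b l) \<and> TZ (b i) (b j) (b l)"
proof -
  obtain m where m: "m \<in> \<G>"
     and m_add: "\<And>f. additive_on G f \<Longrightarrow> f (m (a j)) = f (a j) - f (b j) - f (b l)"
      "\<And>f k. additive_on G f \<Longrightarrow> k < g \<Longrightarrow> f (m (b k)) = f (b k)"
      using mx_inverse[OF h(2,3,5)] by metis
  note m_simps = m_add(1)[OF T1\<psi>] m_add(1)[OF T2\<psi>] m_add(1)[OF T3\<psi>]
    m_add(2)[OF T1\<psi>] m_add(2)[OF T2\<psi>] m_add(2)[OF T3\<psi>]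
  have "T x (\<psi> (b i)) (\<psi> (a j)) (\<psi> (b l)) = 0 \<and> T x (\<psi> (b i)) (\<psi> (b j)) (\<psi> (b l)) = 0"
    if p: "\<psi> \<in> \<G>" "x \<in> carrier G" for \<psi> x
  proof -
    let ?U = "\<psi> (b i)" and ?A = "\<psi> (a j)" and ?B = "\<psi> (b j)" and ?C = "\<psi> (b l)"
    have c [simp]: "?U \<in> carrier G" "?A \<in> carrier G" "?B \<in> carrier G" "?C \<in> carrier G" "x \<in> carrier G"
      using p h by simp_all
    have q: "TZ (b i) (a j) (a j)"
      using TZ_two_handles[of j i "a j" "a j" "b i"] TZ_perm h by (metis (no_types) a_closed b_closed insertI1 insert_commute)
    note z = TZ_D[OF TZ_two_handles[of j i "a j" "a j" "b i"] p] TZ_D[OF TZ_two_handles[of j i "a j" "b j" "b i"] p]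
        TZ_D[OF TZ_two_handles[of j i "b j" "b j" "b i"] p] TZ_D[OF TZ_two_handles[of l i "b l" "b l" "b i"] p]
    show ?thesis
      using TZ_D2[OF q p(1) mx_Gr[OF h(2,3,5)] p(2)] TZ_D2[OF q p(1) m p(2)] p h m mx_Gr z
      by (simp add: mxT_simps m_simps T_swap)
  qed
  then show ?thesis by (simp add: TZ_def)
qed

lemma TZ_three_handles:
  assumes h: "i < g" "j < g" "l < g" "i \<noteq> j" "j \<noteq> l" "i \<noteq> l"
    and "u \<in> {a i, b i}" "v \<in> {a j, b j}" "w \<in> {a l, b l}"
  shows "TZ u v w"
proof -
  have 1: "TZ (b i) v (b l)" using TZ_three_handles_aux[OF h] assms by auto
  have 2: "TZ u v (b l)"
  proof (cases "u = b i")
    case False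
    then have u: "u = a i" using assms by auto
    have "T x (\<psi> (sw i (b i))) (\<psi> (sw i v)) (\<psi> (sw i (b l))) = 0" if p: "\<psi> \<in> \<G>" "x \<in> carrier G" for \<psi> x
      using TZ_D2[OF 1 p(1) sw_Gr[OF h(1)] p(2)] .
    then show ?thesis unfolding TZ_def u using assms sw_Gr by (auto simp: swT_simps)
  qed (use 1 in simp)
  show ?thesis
  proof (cases "w = b l")
    case False
    then have w: "w = a l" using assms by auto
    have "T x (\<psi> (sw l u)) (\<psi> (sw l v)) (\<psi> (sw l (b l))) = 0" if p: "\<psi> \<in> \<G>" "x \<in> carrier G" for \<psi> x
      using TZ_D2[OF 2 p(1) sw_Gr[OF h(3)] p(2)] .
    then show ?thesis unfolding TZ_def w using assms sw_Gr by (auto simp: swT_simps)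
  qed (use 2 in simp)
qed

lemma TZ_same_handle:
  assumes "i < g" "u \<in> {a i, b i}" "v \<in> {a i, b i}" "w \<in> {a i, b i}"
  shows "TZ u v w"
proof -
  have "TZ (a i) (a i) (b i)" "TZ (a i) (b i) (b i)" "TZ (a i) (a i) (a i)" "TZ (b i) (b i) (b i)"
    using TZ_one_handle TZ_aaa TZ_bbb assms by auto
  then have "TZ (a i) (b i) (a i)" "TZ (b i) (a i) (a i)" "TZ (b i) (a i) (b i)" "TZ (b i) (b i) (a i)"
    using TZ_perm assms(1) by (meson a_closed b_closed)+
  with assms show ?thesis using \<open>TZ (a i) (a i) (b i)\<close> \<open>TZ (a i) (b i) (b i)\<close> TZ_aaa TZ_bbb by auto
qed

lemma TZ_generators:
  assumes h: "i < g" "j < g" "l < g" and u: "u \<in> {a i, b i}" and v: "v \<in> {a j, b j}" and w: "w \<in> {a l, b l}"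
  shows "TZ u v w"
proof -
  have c: "u \<in> carrier G" "v \<in> carrier G" "w \<in> carrier G" using assms by auto
  consider "i = j" "j = l" | "i = j" "j \<noteq> l" | "i \<noteq> j" "j = l" | "i \<noteq> j" "i = l" | "i \<noteq> j" "j \<noteq> l" "i \<noteq> l" by blast
  then show ?thesis
  proof cases
    case 1 then show ?thesis using TZ_same_handle assms by blast
  next
    case 2 then show ?thesis using TZ_two_handles assms by blast
  next
    case 3
    then have "TZ v w u" using TZ_two_handles[of j i v w u] assms by auto
    then show ?thesis using TZ_perm c by blast
  next
    case 4
    then have "TZ u w v" using TZ_two_handles[of i j u w v] assms by auto
    then show ?thesis using TZ_perm c by blast
  next
    case 5 then show ?thesis using TZ_three_handles assms by blast
  qed
qed

lemma T_zero:
  assumes "x \<in> carrier G" "u \<in> carrier G" "v \<in> carrier G" "w \<in> carrier G"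
  shows "T x u v w = 0"
proof -
  have g0: "T x u v w = 0" if "i < g" "j < g" "l < g" "u \<in> {a i, b i}" "v \<in> {a j, b j}" "w \<in> {a l, b l}" for i j l u v w
    using TZ_D[OF TZ_generators[OF that] Gr_id assms(1)] by simp
  have g1: "T x u v w = 0" if "j < g" "l < g" "v \<in> {a j, b j}" "w \<in> {a l, b l}" "u \<in> carrier G" for j l u v w
    using ext_zero[OF T1[of x v w], of u] g0[OF _ that(1,2) _ that(3,4)] that assms(1) by auto
  have g2: "T x u v w = 0" if "l < g" "w \<in> {a l, b l}" "u \<in> carrier G" "v \<in> carrier G" for l u v w
    using ext_zero[OF T2[of x u w], of v] g1[OF _ that(1) _ that(2,3)] that assms(1) by auto
  show ?thesis
    using ext_zero[OF T3[of x u v], of w] g2[OF _ _ assms(2,3)] assms by auto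
qed

text \<open>Put X = F u e u w and Y = F u w u e. Vanishing of \<open>T\<close> and the Jacobi
  identity give 3 X = Y; exchanging e and w gives 3 Y = X, so 8 X = 0. Then F u u e w is zero as
  well, and polarization in u finishes.\<close>

theorem F_zero:
  assumes "x \<in> carrier G" "y \<in> carrier G" "z \<in> carrier G" "w \<in> carrier G"
  shows "F x y z w = 0"
proof -
  have 1: "3 * F u e u w = F u w u e" "2 * F u e u w + F u u e w = 0"
    if c: "u \<in> carrier G" "e \<in> carrier G" "w \<in> carrier G" for u e w
  proof -
    have t: "F u u e w + F u e u w + F u e u w = 0" using T_zero[of w u u e] c by (simp add: T_def)
    have "F u u e w + F u e w u + F u w u e = 0"
      using jac[of u u e w] c by simp
    then show "3 * F u e u w = F u w u e" "2 * F u e u w + F u u e w = 0" using t F34[of u e w u] c by simp_all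
  qed
  have 2: "F u u e w = 0" if "u \<in> carrier G" "e \<in> carrier G" "w \<in> carrier G" for u e w
    using 1[of u e w] 1[of u w e] that by simp
  have "F (x \<otimes> y) (x \<otimes> y) z w = F x x z w + F x y z w + (F y x z w + F y y z w)"
    using assms additive_on_mult[OF F1[of "x \<otimes> y" z w], of x y]
      additive_on_mult[OF F2[of x z w], of x y] additive_on_mult[OF F2[of y z w], of x y] by simp
  then show ?thesis using 2[of "x \<otimes> y" z w] 2[of x z w] 2[of y z w] assms F12[of x y z w] by simp
qed

end

section \<open>Second differences of functionals on the commutator subgroup\<close>

abbreviation (input) comm_in :: "('g, 'm) monoid_scheme \<Rightarrow> 'g \<Rightarrow> 'g \<Rightarrow> 'g" where
  "comm_in G x y \<equiv> x \<otimes>\<^bsub>G\<^esub> y \<otimes>\<^bsub>G\<^esub> inv\<^bsub>G\<^esub> x \<otimes>\<^bsub>G\<^esub> inv\<^bsub>G\<^esub> y"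

context group
begin

lemma inv_mult_cancel: "x \<in> carrier G \<Longrightarrow> y \<in> carrier G \<Longrightarrow> inv x \<otimes> (x \<otimes> y) = y"
  "x \<in> carrier G \<Longrightarrow> y \<in> carrier G \<Longrightarrow> x \<otimes> (inv x \<otimes> y) = y"
  by (simp_all flip: m_assoc)

lemmas word_simps = m_assoc inv_mult_group inv_mult_cancel

lemma lower_central_2: "lower_central G 2 = generate G {comm_in G x y | x y. x \<in> carrier G \<and> y \<in> carrier G}"
  by (simp add: numeral_2_eq_2)

lemma lower_central_3: "lower_central G 3 = generate G {comm_in G x y | x y. x \<in> carrier G \<and> y \<in> lower_central G 2}"
  by (simp add: numeral_2_eq_2 numeral_3_eq_3)

lemma normal_commutators:
  assumes N: "N \<lhd> G"
  shows "generate G {comm_in G x y | x y. x \<in> carrier G \<and> y \<in> N} \<lhd> G"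
proof (rule normal_generateI)
  interpret N: normal N G by (rule N)
  show "{comm_in G x y | x y. x \<in> carrier G \<and> y \<in> N} \<subseteq> carrier G"
    using N.subset by auto
  fix h z assume "h \<in> {comm_in G x y | x y. x \<in> carrier G \<and> y \<in> N}" and z: "z \<in> carrier G"
  then obtain x y where h: "h = comm_in G x y" "x \<in> carrier G" "y \<in> N" by blast
  have y: "y \<in> carrier G" using h N.subset by auto
  have "z \<otimes> h \<otimes> inv z = comm_in G (z \<otimes> x \<otimes> inv z) (z \<otimes> y \<otimes> inv z)"
    using h y z by (simp add: word_simps)
  moreover have "z \<otimes> y \<otimes> inv z \<in> N" using N.inv_op_closed2 h z by simp
  ultimately show "z \<otimes> h \<otimes> inv z \<in> {comm_in G x y | x y. x \<in> carrier G \<and> y \<in> N}"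
    using h z by blast
qed

lemma carrier_normal: "carrier G \<lhd> G"
  by (simp add: normal_inv_iff subgroup_self)

lemma lower_central_2_normal: "lower_central G 2 \<lhd> G"
  unfolding lower_central_2 by (rule normal_commutators[OF carrier_normal])

lemma lower_central_3_normal: "lower_central G 3 \<lhd> G"
  unfolding lower_central_3 by (rule normal_commutators[OF lower_central_2_normal])

lemma comm_in_lower_central_2: "x \<in> carrier G \<Longrightarrow> y \<in> carrier G \<Longrightarrow> comm_in G x y \<in> lower_central G 2"
  unfolding lower_central_2 by (rule generate.incl) blast

lemma comm_in_lower_central_3: "x \<in> carrier G \<Longrightarrow> y \<in> lower_central G 2 \<Longrightarrow> comm_in G x y \<in> lower_central G 3"
  unfolding lower_central_3 by (rule generate.incl) blast

lemma hom_group_hom: "\<psi> \<in> hom G G \<Longrightarrow> group_hom G G \<psi>"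
  by (simp add: group_hom_def group_hom_axioms_def is_group)

lemma hom_generate_commutators:
  assumes \<psi>: "\<psi> \<in> hom G G" and N: "N \<subseteq> carrier G" "\<psi> ` N \<subseteq> N"
    and u: "u \<in> generate G {comm_in G x y | x y. x \<in> carrier G \<and> y \<in> N}"
  shows "\<psi> u \<in> generate G {comm_in G x y | x y. x \<in> carrier G \<and> y \<in> N}" (is "_ \<in> generate G ?C")
proof -
  interpret h: group_hom G G \<psi> using \<psi> by (rule hom_group_hom)
  have C: "?C \<subseteq> carrier G" using N by auto
  have p: "\<psi> z \<in> ?C" if "z \<in> ?C" for z
  proof -
    from that obtain x y where "z = comm_in G x y" "x \<in> carrier G" "y \<in> N" by blast
    moreover from this have "\<psi> z = comm_in G (\<psi> x) (\<psi> y)" using N by auto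
    ultimately show ?thesis using N h.hom_closed by blast
  qed
  show ?thesis using u
  proof (induction rule: generate.induct)
    case one then show ?case by (simp add: generate.one)
  next
    case (incl h) show ?case by (rule generate.incl[OF p[OF incl]])
  next
    case (inv h)
    have "h \<in> carrier G" by (rule subsetD[OF C inv])
    then have "\<psi> (inv h) = inv (\<psi> h)" by simp
    then show ?case using generate.inv[OF p[OF inv]] by simp
  next
    case (eng x y)
    then show ?case using generate_in_carrier[OF C] generate.eng by simp
  qed
qed

lemma hom_lower_central_2: "\<psi> \<in> hom G G \<Longrightarrow> u \<in> lower_central G 2 \<Longrightarrow> \<psi> u \<in> lower_central G 2"
  unfolding lower_central_2 by (rule hom_generate_commutators) (auto simp: hom_def)

text \<open>The value of \<eta> at (x - 1) (y - 1) u, where the group ring acts on the abelianized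
  commutator subgroup by conjugation.\<close>

definition second_diff :: "('a \<Rightarrow> rat) \<Rightarrow> 'a \<Rightarrow> 'a \<Rightarrow> 'a \<Rightarrow> rat" where
  "second_diff \<eta> x y u = \<eta> (x \<otimes> y \<otimes> u \<otimes> inv (x \<otimes> y)) - \<eta> (x \<otimes> u \<otimes> inv x) - \<eta> (y \<otimes> u \<otimes> inv y) + \<eta> u"

definition N2hom :: "('a \<Rightarrow> rat) \<Rightarrow> bool" where
  "N2hom \<eta> \<longleftrightarrow> (\<forall>u\<in>lower_central G 2. \<forall>v\<in>lower_central G 2. \<eta> (u \<otimes> v) = \<eta> u + \<eta> v)"

lemma N2_closed [simp]: "u \<in> lower_central G 2 \<Longrightarrow> u \<in> carrier G"
  by (rule subsetD[OF subgroup.subset[OF normal_imp_subgroup[OF lower_central_2_normal]]])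

lemma N3_closed [simp]: "u \<in> lower_central G 3 \<Longrightarrow> u \<in> carrier G"
  by (rule subsetD[OF subgroup.subset[OF normal_imp_subgroup[OF lower_central_3_normal]]])

lemma N2_mult: "u \<in> lower_central G 2 \<Longrightarrow> v \<in> lower_central G 2 \<Longrightarrow> u \<otimes> v \<in> lower_central G 2"
  by (rule subgroup.m_closed[OF normal_imp_subgroup[OF lower_central_2_normal]])

lemma N2_inv: "u \<in> lower_central G 2 \<Longrightarrow> inv u \<in> lower_central G 2"
  by (rule subgroup.m_inv_closed[OF normal_imp_subgroup[OF lower_central_2_normal]])

lemma N2_one: "\<one> \<in> lower_central G 2"
  by (rule subgroup.one_closed[OF normal_imp_subgroup[OF lower_central_2_normal]])

lemma N2_conj: "x \<in> carrier G \<Longrightarrow> u \<in> lower_central G 2 \<Longrightarrow> x \<otimes> u \<otimes> inv x \<in> lower_central G 2"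
  by (rule normal.inv_op_closed2[OF lower_central_2_normal])

lemma hom_lower_central_3:
  assumes "\<psi> \<in> hom G G" "u \<in> lower_central G 3"
  shows "\<psi> u \<in> lower_central G 3"
proof -
  have "lower_central G 2 \<subseteq> carrier G" "\<psi> ` lower_central G 2 \<subseteq> lower_central G 2"
    using hom_lower_central_2 assms(1) by auto
  from hom_generate_commutators[OF assms(1) this] assms(2) show ?thesis by (simp add: lower_central_3)
qed

lemma N2hom_mult: "N2hom \<eta> \<Longrightarrow> u \<in> lower_central G 2 \<Longrightarrow> v \<in> lower_central G 2 \<Longrightarrow> \<eta> (u \<otimes> v) = \<eta> u + \<eta> v"
  by (simp add: N2hom_def)

lemma N2hom_one: "N2hom \<eta> \<Longrightarrow> \<eta> \<one> = 0"
  using N2hom_mult[of \<eta> \<one> \<one>] N2_one by simp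

lemma N2hom_inv: "N2hom \<eta> \<Longrightarrow> u \<in> lower_central G 2 \<Longrightarrow> \<eta> (inv u) = - \<eta> u"
  using N2hom_mult[of \<eta> u "inv u"] N2hom_one[of \<eta>] N2_inv by simp

lemma N2hom_conj: "N2hom \<eta> \<Longrightarrow> x \<in> carrier G \<Longrightarrow> N2hom (\<lambda>u. \<eta> (x \<otimes> u \<otimes> inv x))"
  unfolding N2hom_def
proof (intro ballI)
  fix u v assume *: "\<forall>u\<in>lower_central G 2. \<forall>v\<in>lower_central G 2. \<eta> (u \<otimes> v) = \<eta> u + \<eta> v" "x \<in> carrier G"
    "u \<in> lower_central G 2" "v \<in> lower_central G 2"
  have "x \<otimes> (u \<otimes> v) \<otimes> inv x = (x \<otimes> u \<otimes> inv x) \<otimes> (x \<otimes> v \<otimes> inv x)"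
    using * by (simp add: word_simps)
  then show "\<eta> (x \<otimes> (u \<otimes> v) \<otimes> inv x) = \<eta> (x \<otimes> u \<otimes> inv x) + \<eta> (x \<otimes> v \<otimes> inv x)"
    using * N2_conj by simp
qed

lemma N2hom_hom: "N2hom \<eta> \<Longrightarrow> \<psi> \<in> hom G G \<Longrightarrow> N2hom (\<lambda>u. \<eta> (\<psi> u))"
  using hom_lower_central_2 by (simp add: N2hom_def hom_mult)

lemma N2hom_second_diff:
  assumes "N2hom \<eta>" "x \<in> carrier G" "y \<in> carrier G"
  shows "N2hom (second_diff \<eta> x y)"
  using N2hom_conj[OF assms(1), of "x \<otimes> y"] N2hom_conj[OF assms(1,2)] N2hom_conj[OF assms(1,3)] assms
  by (simp add: N2hom_def second_diff_def)

lemma N2hom_inner: "N2hom \<eta> \<Longrightarrow> n \<in> lower_central G 2 \<Longrightarrow> u \<in> lower_central G 2 \<Longrightarrow> \<eta> (n \<otimes> u \<otimes> inv n) = \<eta> u"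
  by (simp add: N2hom_mult N2hom_inv N2_mult N2_inv)

text \<open>The products x y and y x differ by [x, y], which lies in the commutator subgroup, and
  conjugation by such an element is invisible to \<eta>.\<close>

lemma N2hom_conj_swap:
  assumes "N2hom \<eta>" "x \<in> carrier G" "y \<in> carrier G" "u \<in> lower_central G 2"
  shows "\<eta> (x \<otimes> y \<otimes> u \<otimes> inv (x \<otimes> y)) = \<eta> (y \<otimes> x \<otimes> u \<otimes> inv (y \<otimes> x))"
proof -
  have "x \<otimes> y \<otimes> u \<otimes> inv (x \<otimes> y) = comm_in G x y \<otimes> (y \<otimes> x \<otimes> u \<otimes> inv (y \<otimes> x)) \<otimes> inv (comm_in G x y)"
    using assms by (simp add: word_simps)
  then show ?thesis
    using N2hom_inner[OF assms(1) comm_in_lower_central_2[OF assms(2,3)] N2_conj[of "y \<otimes> x"]] assms by simp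
qed

lemma second_diff_sym:
  assumes "N2hom \<eta>" "x \<in> carrier G" "y \<in> carrier G" "u \<in> lower_central G 2"
  shows "second_diff \<eta> x y u = second_diff \<eta> y x u"
  using N2hom_conj_swap[OF assms] by (simp add: second_diff_def)

text \<open>From x x' - 1 = (x - 1) x' + (x' - 1): in the first summand the factor x' may be dropped
  because third differences vanish.\<close>

lemma second_diff_additive:
  assumes \<eta>: "N2hom \<eta>" and third: "\<And>x y z u. x \<in> carrier G \<Longrightarrow> y \<in> carrier G \<Longrightarrow> z \<in> carrier G \<Longrightarrow>
        u \<in> lower_central G 2 \<Longrightarrow> second_diff \<eta> x y (z \<otimes> u \<otimes> inv z) = second_diff \<eta> x y u"
    and y: "y \<in> carrier G" and u: "u \<in> lower_central G 2"
  shows "additive_on G (\<lambda>x. second_diff \<eta> x y u)"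
  unfolding additive_on_def
proof (intro ballI)
  fix x x' assume x: "x \<in> carrier G" "x' \<in> carrier G"
  have "x \<otimes> y \<otimes> (x' \<otimes> u \<otimes> inv x') \<otimes> inv (x \<otimes> y) = x \<otimes> (y \<otimes> x' \<otimes> u \<otimes> inv (y \<otimes> x')) \<otimes> inv x"
    "x \<otimes> (x' \<otimes> y \<otimes> u \<otimes> inv (x' \<otimes> y)) \<otimes> inv x = x \<otimes> x' \<otimes> y \<otimes> u \<otimes> inv (x \<otimes> x' \<otimes> y)"
    "x \<otimes> (x' \<otimes> u \<otimes> inv x') \<otimes> inv x = x \<otimes> x' \<otimes> u \<otimes> inv (x \<otimes> x')"
    "y \<otimes> (x' \<otimes> u \<otimes> inv x') \<otimes> inv y = y \<otimes> x' \<otimes> u \<otimes> inv (y \<otimes> x')"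
    using x y u by (simp_all add: word_simps)
  with third[OF x(1) y x(2) u] N2hom_conj_swap[OF N2hom_conj[OF \<eta> x(1)] y x(2) u] N2hom_conj_swap[OF \<eta> y x(2) u]
  show "second_diff \<eta> (x \<otimes> x') y u = second_diff \<eta> x y u + second_diff \<eta> x' y u"
    by (simp add: second_diff_def)
qed

text \<open>The commutator [x y, z] is expanded twice, once as it stands and once after writing x y
  = [x, y] y x. Comparing the two under \<xi> gives the Jacobi identity for (x - 1) [y, z].\<close>

lemma N2hom_jacobi:
  assumes \<xi>: "N2hom \<xi>" and c: "x \<in> carrier G" "y \<in> carrier G" "z \<in> carrier G"
  shows "(\<xi> (x \<otimes> comm_in G y z \<otimes> inv x) - \<xi> (comm_in G y z)) + (\<xi> (y \<otimes> comm_in G z x \<otimes> inv y) - \<xi> (comm_in G z x))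
    + (\<xi> (z \<otimes> comm_in G x y \<otimes> inv z) - \<xi> (comm_in G x y)) = 0"
proof -
  have i: "comm_in G z x = inv (comm_in G x z)" using c by (simp add: word_simps)
  have i': "z \<otimes> inv (comm_in G x y) \<otimes> inv z = inv (z \<otimes> comm_in G x y \<otimes> inv z)"
    "y \<otimes> inv (comm_in G x z) \<otimes> inv y = inv (y \<otimes> comm_in G x z \<otimes> inv y)" using c by (simp_all add: word_simps)
  note n = comm_in_lower_central_2[OF c(1,2)] comm_in_lower_central_2[OF c(1,3)] comm_in_lower_central_2[OF c(2,3)]
  have "(x \<otimes> comm_in G y z \<otimes> inv x) \<otimes> comm_in G x z =
     comm_in G x y \<otimes> ((y \<otimes> comm_in G x z \<otimes> inv y) \<otimes> comm_in G y z) \<otimes> (z \<otimes> inv (comm_in G x y) \<otimes> inv z)"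
    using c by (simp add: word_simps)
  from arg_cong[where f = \<xi>, OF this[unfolded i']]
  have "\<xi> (x \<otimes> comm_in G y z \<otimes> inv x) + \<xi> (comm_in G x z) = \<xi> (comm_in G x y) + 
     (\<xi> (y \<otimes> comm_in G x z \<otimes> inv y) + \<xi> (comm_in G y z)) - \<xi> (z \<otimes> comm_in G x y \<otimes> inv z)"
    using n N2_conj[OF c(1) n(3)] N2_conj[OF c(2) n(2)] N2_conj[OF c(3) n(1)]
    by (simp add: N2hom_mult[OF \<xi>] N2hom_inv[OF \<xi>] N2_mult N2_inv del: inv_mult_group m_assoc)
  then show ?thesis
    unfolding i i' using N2hom_inv[OF \<xi> n(2)] N2hom_inv[OF \<xi> N2_conj[OF c(2) n(2)]] by linarith
qed

end

text \<open>\<open>c\<close> runs through the partial products of the surface relation, so that the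
  relation is a recursion with equal ends. \<open>al\<close> and \<open>be\<close> are known exactly
  on the generators, because the twist about the boundary of a handle is computed from them as a
  word; for \<open>mx\<close> the homology classes are enough.\<close>

locale surface_automorphisms = group G for G (structure) +
  fixes g :: nat and a b c :: "nat \<Rightarrow> 'a"
    and \<G> :: "('a \<Rightarrow> 'a) set" and al be :: "nat \<Rightarrow> 'a \<Rightarrow> 'a" and mx :: "nat \<Rightarrow> nat \<Rightarrow> 'a \<Rightarrow> 'a"
  assumes g2: "g \<ge> 2"
    and a_closed [simp]: "i < g \<Longrightarrow> a i \<in> carrier G"
    and b_closed [simp]: "i < g \<Longrightarrow> b i \<in> carrier G"
    and gen: "carrier G = generate G (a ` {..<g} \<union> b ` {..<g})"
    and c_0: "c 0 = \<one>" and c_Suc: "i < g \<Longrightarrow> c (Suc i) = c i \<otimes> comm_in G (a i) (b i)" and c_g: "c g = \<one>"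
    and Gr_hom: "\<psi> \<in> \<G> \<Longrightarrow> \<psi> \<in> hom G G"
    and Gr_id: "id \<in> \<G>"
    and Gr_comp: "\<psi> \<in> \<G> \<Longrightarrow> \<phi> \<in> \<G> \<Longrightarrow> \<psi> \<circ> \<phi> \<in> \<G>"
    and Gr_inv: "\<psi> \<in> \<G> \<Longrightarrow> \<exists>\<psi>'\<in>\<G>. \<forall>x\<in>carrier G. \<psi> (\<psi>' x) = x \<and> \<psi>' (\<psi> x) = x"
    and al_Gr: "i < g \<Longrightarrow> al i \<in> \<G>"
    and be_Gr: "i < g \<Longrightarrow> be i \<in> \<G>"
    and mx_Gr: "i < g \<Longrightarrow> j < g \<Longrightarrow> i \<noteq> j \<Longrightarrow> mx i j \<in> \<G>"
    and al_a: "i < g \<Longrightarrow> al i (a i) = a i \<otimes> b i"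
    and al_a': "i < g \<Longrightarrow> j < g \<Longrightarrow> j \<noteq> i \<Longrightarrow> al i (a j) = a j"
    and al_b: "i < g \<Longrightarrow> j < g \<Longrightarrow> al i (b j) = b j"
    and be_b: "i < g \<Longrightarrow> be i (b i) = b i \<otimes> inv (a i)"
    and be_b': "i < g \<Longrightarrow> j < g \<Longrightarrow> j \<noteq> i \<Longrightarrow> be i (b j) = b j"
    and be_a: "i < g \<Longrightarrow> j < g \<Longrightarrow> be i (a j) = a j"
    and mx_a: "i < g \<Longrightarrow> j < g \<Longrightarrow> i \<noteq> j \<Longrightarrow> k \<in> {i, j} \<Longrightarrow> homologous G (mx i j (a k)) (a k \<otimes> b i \<otimes> b j)"
    and mx_a': "i < g \<Longrightarrow> j < g \<Longrightarrow> i \<noteq> j \<Longrightarrow> k < g \<Longrightarrow> k \<noteq> i \<Longrightarrow> k \<noteq> j \<Longrightarrow> homologous G (mx i j (a k)) (a k)"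
    and mx_b: "i < g \<Longrightarrow> j < g \<Longrightarrow> i \<noteq> j \<Longrightarrow> k < g \<Longrightarrow> homologous G (mx i j (b k)) (b k)"
begin

lemma Gr_closed [simp]: "\<psi> \<in> \<G> \<Longrightarrow> x \<in> carrier G \<Longrightarrow> \<psi> x \<in> carrier G"
  using Gr_hom by (auto simp: hom_def)

lemma Gr_mult: "\<psi> \<in> \<G> \<Longrightarrow> x \<in> carrier G \<Longrightarrow> y \<in> carrier G \<Longrightarrow> \<psi> (x \<otimes> y) = \<psi> x \<otimes> \<psi> y"
  using Gr_hom by (auto simp: hom_def)

lemma Gr_inverse: "\<psi> \<in> \<G> \<Longrightarrow> x \<in> carrier G \<Longrightarrow> \<psi> (inv x) = inv (\<psi> x)"
  using group_hom.hom_inv[OF hom_group_hom[OF Gr_hom]] by blast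

lemma Gr_one: "\<psi> \<in> \<G> \<Longrightarrow> \<psi> \<one> = \<one>"
  using group_hom.hom_one[OF hom_group_hom[OF Gr_hom]] by blast

text \<open>The braid word in the twists about the two curves of a handle; on homology it is a
  quarter turn.\<close>

definition sw :: "nat \<Rightarrow> 'a \<Rightarrow> 'a" where "sw i = al i \<circ> be i \<circ> al i"

lemma sw_Gr: "i < g \<Longrightarrow> sw i \<in> \<G>"
  by (simp add: sw_def Gr_comp al_Gr be_Gr)

lemma sw_a: "i < g \<Longrightarrow> sw i (a i) = a i \<otimes> b i \<otimes> inv (a i)"
  by (simp add: sw_def al_a al_b be_a be_b Gr_mult Gr_inverse al_Gr be_Gr word_simps)

lemma sw_b: "i < g \<Longrightarrow> sw i (b i) = inv (a i)"
  by (simp add: sw_def al_a al_b be_a be_b Gr_mult Gr_inverse al_Gr be_Gr word_simps)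

lemma sw_other: "i < g \<Longrightarrow> j < g \<Longrightarrow> j \<noteq> i \<Longrightarrow> sw i (a j) = a j" "i < g \<Longrightarrow> j < g \<Longrightarrow> j \<noteq> i \<Longrightarrow> sw i (b j) = b j"
  by (simp_all add: sw_def al_a' al_b be_a be_b')

definition tw :: "nat \<Rightarrow> 'a \<Rightarrow> 'a" where "tw i = (sw i \<circ> sw i) \<circ> (sw i \<circ> sw i)"

lemma tw_Gr: "i < g \<Longrightarrow> tw i \<in> \<G>"
  by (simp add: tw_def Gr_comp sw_Gr)

lemma tw_handle:
  assumes i: "i < g" and x: "x \<in> {a i, b i}"
  shows "tw i x = comm_in G (a i) (b i) \<otimes> x \<otimes> inv (comm_in G (a i) (b i))"
proof -
  have 2: "(sw i \<circ> sw i) (a i) = a i \<otimes> b i \<otimes> inv (a i) \<otimes> inv (b i) \<otimes> inv (a i)"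
    "(sw i \<circ> sw i) (b i) = a i \<otimes> inv (b i) \<otimes> inv (a i)"
    using i by (simp_all add: sw_a sw_b Gr_mult Gr_inverse sw_Gr word_simps)
  have s: "sw i \<circ> sw i \<in> \<G>" using Gr_comp sw_Gr i by simp
  have h: "tw i y = (sw i \<circ> sw i) ((sw i \<circ> sw i) y)" for y by (simp add: tw_def)
  show ?thesis
    using x i s unfolding h
    by (auto simp add: 2 Gr_mult Gr_inverse word_simps simp del: o_apply)
qed

lemma tw_other: "i < g \<Longrightarrow> j < g \<Longrightarrow> j \<noteq> i \<Longrightarrow> x \<in> {a j, b j} \<Longrightarrow> tw i x = x"
  by (auto simp add: tw_def sw_other)

text \<open>On a generator x of the handle the displacement \<open>tw i x \<otimes> inv x\<close> is
  the inverse of [x, [a, b]], on the other generators it is trivial. The displacement of a product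
  is a product of conjugates of displacements, so normality of the third term suffices.\<close>

lemma tw_johnson:
  assumes i: "i < g" and x: "x \<in> carrier G"
  shows "tw i x \<otimes> inv x \<in> lower_central G 3"
proof -
  interpret N: normal "lower_central G 3" G by (rule lower_central_3_normal)
  note t = tw_Gr[OF i]
  let ?X = "a ` {..<g} \<union> b ` {..<g}"
  have X: "?X \<subseteq> carrier G" by auto
  have inv': "inv (tw i x) \<otimes> x \<in> lower_central G 3" if "tw i x \<otimes> inv x \<in> lower_central G 3" "x \<in> carrier G" for x
  proof -
    have "inv (tw i x) \<otimes> x = inv x \<otimes> inv (tw i x \<otimes> inv x) \<otimes> inv (inv x)"
      using that t by (simp add: word_simps)
    then show ?thesis using that N.inv_op_closed2[of "inv x" "inv (tw i x \<otimes> inv x)"] N.m_inv_closed by simp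
  qed
  have gens: "tw i x \<otimes> inv x \<in> lower_central G 3" if x: "x \<in> ?X" for x
  proof -
    obtain j where j: "j < g" "x \<in> {a j, b j}" using x by auto
    have xc: "x \<in> carrier G" using j by auto
    show ?thesis
    proof (cases "j = i")
      case True
      have "tw i x \<otimes> inv x = inv (comm_in G x (comm_in G (a i) (b i)))"
        using tw_handle[OF i] j True i xc by (simp add: word_simps)
      then show ?thesis using N.m_inv_closed comm_in_lower_central_3[OF xc comm_in_lower_central_2] i by simp
    next
      case False
      then show ?thesis using tw_other[OF i j(1) False j(2)] xc N.one_closed by simp
    qed
  qed
  have "x \<in> generate G ?X" using x gen by simp
  then show ?thesis
  proof (induction rule: generate.induct)
    case one then show ?case using t N.one_closed by (simp add: Gr_one)
  next
    case (incl h) then show ?case using gens by simp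
  next
    case (inv h) 
    then have "h \<in> carrier G" using X by auto
    then show ?case using inv'[OF gens[OF inv]] t by (simp add: Gr_inverse)
  next
    case (eng x y)
    then have c: "x \<in> carrier G" "y \<in> carrier G" using generate_in_carrier[OF X] by auto
    have "tw i (x \<otimes> y) \<otimes> inv (x \<otimes> y) = (tw i x \<otimes> (tw i y \<otimes> inv y) \<otimes> inv (tw i x)) \<otimes> (tw i x \<otimes> inv x)"
      using c t by (simp add: Gr_mult word_simps)
    then show ?case using eng.IH N.inv_op_closed2[of "tw i x"] N.m_closed c t by simp
  qed
qed

theorem second_difference_zero:
  assumes \<eta>: "N2hom \<eta>"
    and inv: "\<And>\<phi> u. \<phi> \<in> \<G> \<Longrightarrow> (\<And>x. x \<in> carrier G \<Longrightarrow> \<phi> x \<otimes> inv x \<in> lower_central G 3) \<Longrightarrow>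
       u \<in> lower_central G 2 \<Longrightarrow> \<eta> (\<phi> u) = \<eta> u"
    and third: "\<And>x y z u. x \<in> carrier G \<Longrightarrow> y \<in> carrier G \<Longrightarrow> z \<in> carrier G \<Longrightarrow>
        u \<in> lower_central G 2 \<Longrightarrow> second_diff \<eta> x y (z \<otimes> u \<otimes> inv z) = second_diff \<eta> x y u"
    and x: "x \<in> carrier G" and y: "y \<in> carrier G" and u: "u \<in> lower_central G 2"
  shows "second_diff \<eta> x y u = 0"
proof -
  let ?F = "\<lambda>x y z w. second_diff \<eta> x y (comm_in G z w)"
  have base: "?F (\<psi> x) (\<psi> y) (\<psi> (a i)) (\<psi> (b i)) = 0"
    if \<psi>: "\<psi> \<in> \<G>" and h: "i < g" "j < g" "i \<noteq> j" "x \<in> {a i, b i}" "y \<in> {a j, b j}" for \<psi> i j x y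
  proof -
    obtain \<psi>' where \<psi>': "\<psi>' \<in> \<G>" "\<And>x. x \<in> carrier G \<Longrightarrow> \<psi> (\<psi>' x) = x" "\<And>x. x \<in> carrier G \<Longrightarrow> \<psi>' (\<psi> x) = x"
      using Gr_inv[OF \<psi>] by blast
    let ?\<phi> = "\<psi> \<circ> tw i \<circ> \<psi>'"
    let ?d = "comm_in G (a i) (b i)"
    have \<phi>: "?\<phi> \<in> \<G>" using Gr_comp \<psi> \<psi>' tw_Gr h by simp
    have \<phi>3: "?\<phi> x \<otimes> inv x \<in> lower_central G 3" if x: "x \<in> carrier G" for x
    proof -
      have "?\<phi> x \<otimes> inv x = \<psi> (tw i (\<psi>' x) \<otimes> inv (\<psi>' x))"
        using x \<psi> \<psi>' tw_Gr h by (simp add: Gr_mult Gr_inverse)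
      then show ?thesis using hom_lower_central_3[OF Gr_hom[OF \<psi>] tw_johnson[OF h(1)]] x \<psi>' by simp
    qed
    have c: "x \<in> carrier G" "y \<in> carrier G" "a i \<in> carrier G" "b i \<in> carrier G" using h by auto
    have d: "?d \<in> lower_central G 2" "?d \<in> carrier G" using comm_in_lower_central_2 c by auto
    have cxy: "comm_in G x y \<in> lower_central G 2" using comm_in_lower_central_2 c by auto
    define e where "e = comm_in G (a i) (b i)"
    note d' = d[folded e_def]
    let ?n = "e \<otimes> (x \<otimes> inv e \<otimes> inv x)"
    let ?\<mu> = "\<lambda>u. \<eta> (\<psi> u)"
    have \<mu>: "N2hom ?\<mu>" using N2hom_hom[OF \<eta> Gr_hom[OF \<psi>]] .
    have n: "?n \<in> lower_central G 2" using d' c N2_mult N2_conj N2_inv by simp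
    \<comment> \<open>The kernel element is the handle twist conjugated by \<psi>, evaluated at the
      \<psi>-image of [x, y], where x belongs to the twisted handle and y does not.\<close>
    have "\<eta> (?\<phi> (\<psi> (comm_in G x y))) = \<eta> (\<psi> (comm_in G x y))"
      by (rule inv[OF \<phi> \<phi>3]) (use cxy hom_lower_central_2 Gr_hom \<psi> in auto)
    moreover have "?\<phi> (\<psi> (comm_in G x y)) = \<psi> (tw i (comm_in G x y))" using \<psi>' c by simp
    moreover have "tw i (comm_in G x y) = comm_in G (e \<otimes> x \<otimes> inv e) y"
      using tw_handle[OF h(1,4)] tw_other[OF h(1,2) not_sym[OF h(3)] h(5)] c tw_Gr[OF h(1)]
      by (simp add: Gr_mult Gr_inverse e_def)
    \<comment> \<open>The twist replaces x by n x with n = [e, x], and [n x, y] = n [x, y] (y n^-1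
      y^-1). Additively n is (1 - x) e, so that invariance reads (1 - y) (1 - x) e = 0.\<close>
    moreover have "comm_in G (e \<otimes> x \<otimes> inv e) y = ?n \<otimes> comm_in G x y \<otimes> (y \<otimes> inv ?n \<otimes> inv y)"
      using c d' by (simp add: word_simps)
    ultimately have "?\<mu> (?n \<otimes> comm_in G x y \<otimes> (y \<otimes> inv ?n \<otimes> inv y)) = ?\<mu> (comm_in G x y)" by simp
    then have "?\<mu> ?n = - ?\<mu> (y \<otimes> inv ?n \<otimes> inv y)"
      using n cxy c N2_conj N2_inv N2_mult by (simp add: N2hom_mult[OF \<mu>] del: inv_mult_group)
    moreover have "?\<mu> (y \<otimes> inv ?n \<otimes> inv y) = - ?\<mu> (y \<otimes> ?n \<otimes> inv y)"
      using N2hom_inv[OF N2hom_conj[OF \<mu> c(2)] n] .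
    moreover have "?\<mu> ?n = ?\<mu> e - ?\<mu> (x \<otimes> e \<otimes> inv x)"
      using N2hom_mult[OF \<mu> d'(1) N2_conj[OF c(1) N2_inv[OF d'(1)]]] N2hom_inv[OF N2hom_conj[OF \<mu> c(1)] d'(1)] by simp
    moreover have "?\<mu> (y \<otimes> ?n \<otimes> inv y) = ?\<mu> (y \<otimes> e \<otimes> inv y) - ?\<mu> (y \<otimes> (x \<otimes> e \<otimes> inv x) \<otimes> inv y)"
      using N2hom_mult[OF N2hom_conj[OF \<mu> c(2)] d'(1) N2_conj[OF c(1) N2_inv[OF d'(1)]]]
        N2hom_inv[OF N2hom_conj[OF N2hom_conj[OF \<mu> c(2)] c(1)] d'(1)] by simp
    moreover have "y \<otimes> (x \<otimes> e \<otimes> inv x) \<otimes> inv y = y \<otimes> x \<otimes> e \<otimes> inv (y \<otimes> x)" using c d' by (simp add: word_simps)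
    ultimately have "?\<mu> (y \<otimes> x \<otimes> e \<otimes> inv (y \<otimes> x)) - ?\<mu> (y \<otimes> e \<otimes> inv y) - ?\<mu> (x \<otimes> e \<otimes> inv x) + ?\<mu> e = 0" by simp
    then have "second_diff \<eta> (\<psi> y) (\<psi> x) (\<psi> e) = 0"
      using c d' \<psi> by (simp add: second_diff_def Gr_mult Gr_inverse del: inv_mult_group)
    moreover have "\<psi> e = comm_in G (\<psi> (a i)) (\<psi> (b i))" using c \<psi> by (simp add: e_def Gr_mult Gr_inverse)
    ultimately show ?thesis
      using second_diff_sym[OF \<eta>, of "\<psi> x" "\<psi> y" "\<psi> e"] c \<psi> hom_lower_central_2[OF Gr_hom[OF \<psi>] d'(1)] by simp
  qed
  have rel: "(\<Sum>i<g. ?F x y (\<psi> (a i)) (\<psi> (b i))) = 0" if \<psi>: "\<psi> \<in> \<G>" and x: "x \<in> carrier G" and y: "y \<in> carrier G" for \<psi> x y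
  proof -
    have "N2hom (\<lambda>u. second_diff \<eta> x y (\<psi> u))" using N2hom_hom[OF N2hom_second_diff[OF \<eta> x y] Gr_hom[OF \<psi>]] .
    note h = N2hom_mult[OF this] N2hom_one[OF this]
    \<comment> \<open>Induction along the partial products, which lie in the commutator subgroup;
      the last one is the unit.\<close>
    have "k \<le> g \<Longrightarrow> c k \<in> lower_central G 2 \<and> second_diff \<eta> x y (\<psi> (c k)) = (\<Sum>i<k. ?F x y (\<psi> (a i)) (\<psi> (b i)))" for k
    proof (induction k)
      case 0 then show ?case using h(2) N2_one by (simp add: c_0)
    next
      case (Suc k)
      then have k: "k < g" by simp
      have n: "comm_in G (a k) (b k) \<in> lower_central G 2" using comm_in_lower_central_2 k by simp
      have "\<psi> (comm_in G (a k) (b k)) = comm_in G (\<psi> (a k)) (\<psi> (b k))" using k \<psi> by (simp add: Gr_mult Gr_inverse)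
      then show ?case using Suc h(1)[OF _ n, of "c k"] n N2_mult by (simp add: c_Suc[OF k])
    qed
    from this[of g] show ?thesis using h(2) by (simp add: c_g)
  qed
  interpret curvature_form G ?F g a b \<G> sw al mx
  proof (unfold_locales)
    show "additive_on G (\<lambda>x. ?F x y z w)" if "y \<in> carrier G" "z \<in> carrier G" "w \<in> carrier G" for y z w
      using second_diff_additive[OF \<eta> third that(1) comm_in_lower_central_2[OF that(2,3)]] .
    show "additive_on G (\<lambda>z. ?F x y z w)" if p: "x \<in> carrier G" "y \<in> carrier G" "w \<in> carrier G" for x y w
      unfolding additive_on_def
    proof (intro ballI)
      fix z z' assume z: "z \<in> carrier G" "z' \<in> carrier G"
      have "comm_in G (z \<otimes> z') w = (z \<otimes> comm_in G z' w \<otimes> inv z) \<otimes> comm_in G z w"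
        using z p by (simp add: word_simps)
      then show "?F x y (z \<otimes> z') w = ?F x y z w + ?F x y z' w"
        using N2hom_mult[OF N2hom_second_diff[OF \<eta> p(1,2)] N2_conj[OF z(1) comm_in_lower_central_2[OF z(2) p(3)]]
          comm_in_lower_central_2[OF z(1) p(3)]] third[OF p(1,2) z(1) comm_in_lower_central_2[OF z(2) p(3)]] by simp
    qed
    show "?F x y z w = ?F y x z w" if "x \<in> carrier G" "y \<in> carrier G" "z \<in> carrier G" "w \<in> carrier G" for x y z w
      using second_diff_sym[OF \<eta> that(1,2) comm_in_lower_central_2[OF that(3,4)]] .
    show "?F x y z w = - ?F x y w z" if p: "x \<in> carrier G" "y \<in> carrier G" "z \<in> carrier G" "w \<in> carrier G" for x y z w
    proof -
      have "comm_in G z w = inv (comm_in G w z)" using p by (simp add: word_simps)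
      then show ?thesis using N2hom_inv[OF N2hom_second_diff[OF \<eta> p(1,2)] comm_in_lower_central_2[OF p(4,3)]] by simp
    qed
    show "?F t x y z + ?F t y z x + ?F t z x y = 0"
      if p: "t \<in> carrier G" "x \<in> carrier G" "y \<in> carrier G" "z \<in> carrier G" for t x y z
    proof -
      \<comment> \<open>This is \<eta> after multiplication by t - 1, so that the Jacobi identity
        for first differences of \<xi> is the one for second differences of \<eta>.\<close>
      let ?\<xi> = "\<lambda>u. \<eta> (t \<otimes> u \<otimes> inv t) - \<eta> u"
      have \<xi>: "N2hom ?\<xi>" using N2hom_conj[OF \<eta> p(1)] \<eta> by (simp add: N2hom_def)
      have e: "t \<otimes> (x \<otimes> u \<otimes> inv x) \<otimes> inv t = t \<otimes> x \<otimes> u \<otimes> inv (t \<otimes> x)" if "x \<in> carrier G" "u \<in> carrier G" for x u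
        using that p(1) by (simp add: word_simps)
      have s: "second_diff \<eta> t x u = ?\<xi> (x \<otimes> u \<otimes> inv x) - ?\<xi> u" if "x \<in> carrier G" "u \<in> carrier G" for x u
        unfolding e[OF that] second_diff_def by simp
      show ?thesis using N2hom_jacobi[OF \<xi> p(2,3,4)] p
        by (subst (1 2 3) s) (auto simp del: inv_mult_group)
    qed
    show "(\<Sum>i<g. ?F x y (\<psi> (a i)) (\<psi> (b i))) = 0" if "\<psi> \<in> \<G>" "x \<in> carrier G" "y \<in> carrier G" for \<psi> x y
      using rel[OF that] .
    show "?F (\<psi> x) (\<psi> y) (\<psi> (a i)) (\<psi> (b i)) = 0"
      if "\<psi> \<in> \<G>" "i < g" "j < g" "i \<noteq> j" "x \<in> {a i, b i}" "y \<in> {a j, b j}" for \<psi> i j x y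
      using base[OF that] .
    show "homologous G (sw i (a i)) (b i)" "homologous G (sw i (b i)) (inv (a i))"
      "homologous G (al i (a i)) (a i \<otimes> b i)" "homologous G (al i (b i)) (b i)" if "i < g" for i
      using that by (simp_all add: sw_a sw_b al_a al_b homologous_def additive_on_mult additive_on_inv)
    show "homologous G (sw i x) x" if "i < g" "j < g" "j \<noteq> i" "x \<in> {a j, b j}" for i j x
      using that by (auto simp add: sw_other homologous_def)
    show "g \<ge> 2" by (rule g2)
    show "carrier G = generate G (a ` {..<g} \<union> b ` {..<g})" by (rule gen)
    show "a i \<in> carrier G" "b i \<in> carrier G" "sw i \<in> \<G>" "al i \<in> \<G>" if "i < g" for i
      using that by (rule a_closed b_closed sw_Gr al_Gr)+
    show "id \<in> \<G>" by (rule Gr_id)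
    show "\<psi> \<in> hom G G" "\<exists>\<psi>'\<in>\<G>. \<forall>x\<in>carrier G. \<psi> (\<psi>' x) = x \<and> \<psi>' (\<psi> x) = x" if "\<psi> \<in> \<G>" for \<psi>
      using that by (rule Gr_hom Gr_inv)+
    show "\<psi> \<circ> \<phi> \<in> \<G>" if "\<psi> \<in> \<G>" "\<phi> \<in> \<G>" for \<psi> \<phi> using that by (rule Gr_comp)
    show "mx i j \<in> \<G>" if "i < g" "j < g" "i \<noteq> j" for i j using that by (rule mx_Gr)
    show "homologous G (mx i j (a k)) (a k \<otimes> b i \<otimes> b j)"
      if "i < g" "j < g" "i \<noteq> j" "k \<in> {i, j}" for i j k using that by (rule mx_a)
    show "homologous G (mx i j (a k)) (a k)"
      if "i < g" "j < g" "i \<noteq> j" "k < g" "k \<noteq> i" "k \<noteq> j" for i j k using that by (rule mx_a')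
    show "homologous G (mx i j (b k)) (b k)"
      if "i < g" "j < g" "i \<noteq> j" "k < g" for i j k using that by (rule mx_b)
  qed
  have "u \<in> generate G {comm_in G x y | x y. x \<in> carrier G \<and> y \<in> carrier G}" using u unfolding lower_central_2 .
  moreover note h = N2hom_second_diff[OF \<eta> x y]
  ultimately show ?thesis
  proof (induction rule: generate.induct)
    case one then show ?case using N2hom_one by simp
  next
    case (incl v) then show ?case using F_zero x y by auto
  next
    case (inv v) 
    then obtain z w where v: "v = comm_in G z w" "z \<in> carrier G" "w \<in> carrier G" by blast
    show ?case using F_zero[OF x y v(2,3)] N2hom_inv[OF h comm_in_lower_central_2[OF v(2,3)]] v(1) by simp
  next
    case (eng v w) then show ?case using N2hom_mult[OF h, unfolded lower_central_2] by simp
  qed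
qed

end

section \<open>Modules over rational group algebras\<close>

text \<open>The scalars are a bare set with two operations, so that the type \<open>rat\<close> and
  the carrier of a group algebra are treated alike.\<close>

locale premodule = abelian_group M for C :: "'r set" and pl ml :: "'r \<Rightarrow> 'r \<Rightarrow> 'r"
    and M :: "('r, 'v, 'm) module_scheme" (structure) +
  assumes pl_closed: "r \<in> C \<Longrightarrow> s \<in> C \<Longrightarrow> pl r s \<in> C"
    and ml_closed: "r \<in> C \<Longrightarrow> s \<in> C \<Longrightarrow> ml r s \<in> C"
    and smult_closed [simp]: "r \<in> C \<Longrightarrow> x \<in> carrier M \<Longrightarrow> r \<odot> x \<in> carrier M"
    and smult_l_distr: "r \<in> C \<Longrightarrow> s \<in> C \<Longrightarrow> x \<in> carrier M \<Longrightarrow> pl r s \<odot> x = r \<odot> x \<oplus> s \<odot> x"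
    and smult_r_distr: "r \<in> C \<Longrightarrow> x \<in> carrier M \<Longrightarrow> y \<in> carrier M \<Longrightarrow> r \<odot> (x \<oplus> y) = r \<odot> x \<oplus> r \<odot> y"
    and smult_assoc: "r \<in> C \<Longrightarrow> s \<in> C \<Longrightarrow> x \<in> carrier M \<Longrightarrow> ml r s \<odot> x = r \<odot> (s \<odot> x)"

lemma additive_zero:
  assumes "abelian_group M" "abelian_group M'" "f \<zero>\<^bsub>M\<^esub> \<in> carrier M'"
    and "\<And>x y. x \<in> carrier M \<Longrightarrow> y \<in> carrier M \<Longrightarrow> f (x \<oplus>\<^bsub>M\<^esub> y) = f x \<oplus>\<^bsub>M'\<^esub> f y"
  shows "f \<zero>\<^bsub>M\<^esub> = \<zero>\<^bsub>M'\<^esub>"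
proof -
  interpret M: abelian_group M by fact
  interpret M': abelian_group M' by fact
  have "f \<zero>\<^bsub>M\<^esub> = f \<zero>\<^bsub>M\<^esub> \<oplus>\<^bsub>M'\<^esub> f \<zero>\<^bsub>M\<^esub>" using assms(4)[of "\<zero>\<^bsub>M\<^esub>" "\<zero>\<^bsub>M\<^esub>"] by simp
  then show ?thesis using M'.add.r_cancel_one'[OF assms(3,3)] by simp
qed

lemma additive_minus:
  assumes "abelian_group M" "abelian_group M'" "\<And>x. x \<in> carrier M \<Longrightarrow> f x \<in> carrier M'"
    and "\<And>x y. x \<in> carrier M \<Longrightarrow> y \<in> carrier M \<Longrightarrow> f (x \<oplus>\<^bsub>M\<^esub> y) = f x \<oplus>\<^bsub>M'\<^esub> f y"
    and "x \<in> carrier M"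
  shows "f (\<ominus>\<^bsub>M\<^esub> x) = \<ominus>\<^bsub>M'\<^esub> f x"
proof -
  interpret M: abelian_group M by fact
  interpret M': abelian_group M' by fact
  have "f x \<oplus>\<^bsub>M'\<^esub> f (\<ominus>\<^bsub>M\<^esub> x) = f \<zero>\<^bsub>M\<^esub>" using assms(4)[of x "\<ominus>\<^bsub>M\<^esub> x"] assms(5) by (simp add: M.r_neg)
  also have "\<dots> = \<zero>\<^bsub>M'\<^esub>" by (rule additive_zero[OF assms(1,2)]) (use assms in auto)
  finally show ?thesis using M'.minus_equality[of "f (\<ominus>\<^bsub>M\<^esub> x)" "f x"] assms(3)[of x] assms(3)[of "\<ominus>\<^bsub>M\<^esub> x"] assms(5)
    by (simp add: M'.a_comm)
qed

context premodule
begin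

lemma smult_zero: "r \<in> C \<Longrightarrow> r \<odot> \<zero> = \<zero>"
  by (rule additive_zero[OF abelian_group_axioms abelian_group_axioms, where f = "\<lambda>x. r \<odot> x"])
    (simp_all add: smult_r_distr)

lemma smult_minus: "r \<in> C \<Longrightarrow> x \<in> carrier M \<Longrightarrow> r \<odot> (\<ominus> x) = \<ominus> (r \<odot> x)"
  by (rule additive_minus[OF abelian_group_axioms abelian_group_axioms, where f = "\<lambda>x. r \<odot> x"])
    (simp_all add: smult_r_distr)

end

definition add_closed :: "('v, 'm) ring_scheme \<Rightarrow> 'v set \<Rightarrow> bool" where
  "add_closed M F \<longleftrightarrow> F \<subseteq> carrier M \<and> \<zero>\<^bsub>M\<^esub> \<in> F \<and> (\<forall>x\<in>F. \<ominus>\<^bsub>M\<^esub> x \<in> F) \<and> (\<forall>x\<in>F. \<forall>y\<in>F. x \<oplus>\<^bsub>M\<^esub> y \<in> F)"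

lemma add_closed_subgroup: "abelian_group M \<Longrightarrow> add_closed M F \<Longrightarrow> subgroup F (add_monoid M)"
  by (rule group.subgroupI[OF abelian_group.a_group]) (auto simp: add_closed_def a_inv_def)

lemma span_add_closed:
  assumes M: "abelian_group M" and X: "\<And>r x. r \<in> I \<Longrightarrow> x \<in> X \<Longrightarrow> r \<odot>\<^bsub>M\<^esub> x \<in> carrier M"
  shows "add_closed M (module_span M I X)"
proof -
  interpret M: abelian_group M by (rule M)
  have X': "{r \<odot>\<^bsub>M\<^esub> x | r x. r \<in> I \<and> x \<in> X} \<subseteq> carrier M" using X by auto
  interpret S: subgroup "module_span M I X" "add_monoid M"
    unfolding module_span_def by (rule M.add.generate_is_subgroup[OF X'])
  show ?thesis
    unfolding add_closed_def
    using S.subset S.one_closed S.m_closed S.m_inv_closed by (auto simp: a_inv_def)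
qed

lemma span_incl: "r \<in> I \<Longrightarrow> x \<in> X \<Longrightarrow> r \<odot>\<^bsub>M\<^esub> x \<in> module_span M I X"
  unfolding module_span_def by (rule generate.incl) blast

text \<open>Inclusions of spans and their invariance under maps are instances of this: an additive
  map has to be checked on the generating products only.\<close>

lemma span_map:
  assumes M: "abelian_group M" and M': "abelian_group M'"
    and X: "\<And>r x. r \<in> I \<Longrightarrow> x \<in> X \<Longrightarrow> r \<odot>\<^bsub>M\<^esub> x \<in> carrier M"
    and f: "\<And>x. x \<in> carrier M \<Longrightarrow> f x \<in> carrier M'"
      "\<And>x y. x \<in> carrier M \<Longrightarrow> y \<in> carrier M \<Longrightarrow> f (x \<oplus>\<^bsub>M\<^esub> y) = f x \<oplus>\<^bsub>M'\<^esub> f y"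
    and H: "add_closed M' H" "\<And>r x. r \<in> I \<Longrightarrow> x \<in> X \<Longrightarrow> f (r \<odot>\<^bsub>M\<^esub> x) \<in> H"
    and z: "z \<in> module_span M I X"
  shows "f z \<in> H"
proof -
  interpret M: abelian_group M by (rule M)
  have X': "{r \<odot>\<^bsub>M\<^esub> x | r x. r \<in> I \<and> x \<in> X} \<subseteq> carrier M" using X by auto
  show ?thesis
    using z unfolding module_span_def
  proof (induction rule: generate.induct)
    case one
    have "f \<zero>\<^bsub>M\<^esub> = \<zero>\<^bsub>M'\<^esub>" by (rule additive_zero[OF M M']) (use f in auto)
    then show ?case using H by (simp add: add_closed_def)
  next
    case (incl h) then show ?case using H by auto
  next
    case (inv h)
    then have h: "h \<in> carrier M" "f h \<in> H" using X H by auto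
    have "f (\<ominus>\<^bsub>M\<^esub> h) = \<ominus>\<^bsub>M'\<^esub> f h" by (rule additive_minus[OF M M']) (use f h in auto)
    then show ?case using H(1) h by (simp add: add_closed_def a_inv_def)
  next
    case (eng x y)
    then have "x \<in> carrier M" "y \<in> carrier M"
      using M.add.generate_in_carrier[OF X'] by auto
    then show ?case using eng H(1) f by (simp add: add_closed_def)
  qed
qed

lemma span_least:
  assumes M: "abelian_group M"
    and X: "\<And>r x. r \<in> I \<Longrightarrow> x \<in> X \<Longrightarrow> r \<odot>\<^bsub>M\<^esub> x \<in> carrier M"
    and H: "add_closed M H" "\<And>r x. r \<in> I \<Longrightarrow> x \<in> X \<Longrightarrow> r \<odot>\<^bsub>M\<^esub> x \<in> H"
  shows "module_span M I X \<subseteq> H"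
  using span_map[OF M M X, of I X "\<lambda>x. x" H] H by auto

locale quotient_premodule = premodule C pl ml M for C :: "'r set" and pl ml and M :: "('r, 'v, 'm) module_scheme" (structure) +
  fixes N
  assumes N: "add_closed M N" and N_smult: "r \<in> C \<Longrightarrow> x \<in> N \<Longrightarrow> r \<odot> x \<in> N"
begin

abbreviation Q where "Q \<equiv> quotient_module M N"

lemma N_sub: "abelian_subgroup N M"
  by (rule abelian_subgroupI3[OF additive_subgroup.intro[OF add_closed_subgroup[OF abelian_group_axioms N]] abelian_group_axioms])

lemma N_subset: "N \<subseteq> carrier M" and N_zero: "\<zero> \<in> N" using N by (auto simp: add_closed_def)

lemma Q_carrier: "carrier Q = {N +> x | x. x \<in> carrier M}"
  by (auto simp: quotient_module_def A_RCOSETS_def')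

lemma Q_closed [simp]: "x \<in> carrier M \<Longrightarrow> N +> x \<in> carrier Q"
  by (auto simp: Q_carrier)

lemma Q_add: "x \<in> carrier M \<Longrightarrow> y \<in> carrier M \<Longrightarrow> (N +> x) \<oplus>\<^bsub>Q\<^esub> (N +> y) = N +> (x \<oplus> y)"
  using abelian_subgroup.a_rcos_sum[OF N_sub] by (simp add: quotient_module_def)

lemma Q_zero: "\<zero>\<^bsub>Q\<^esub> = N +> \<zero>"
  by (simp add: quotient_module_def a_coset_add_zero N_subset)

lemma Q_eq: "x \<in> carrier M \<Longrightarrow> y \<in> carrier M \<Longrightarrow> n \<in> N \<Longrightarrow> y = n \<oplus> x \<Longrightarrow> N +> y = N +> x"
  using a_repr_independence[of y N x] add_closed_subgroup[OF abelian_group_axioms N] by (auto simp: a_r_coset_def')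

lemma Q_mem_zero: "x \<in> N \<Longrightarrow> N +> x = \<zero>\<^bsub>Q\<^esub>"
  unfolding Q_zero by (rule Q_eq[of _ _ x]) (use N_subset in auto)

text \<open>The scalar multiple of a coset is a union over its members. Stability of
  \<open>N\<close> under scalars makes all the cosets in this union equal.\<close>

lemma Q_smult:
  assumes r: "r \<in> C" and x: "x \<in> carrier M"
  shows "r \<odot>\<^bsub>Q\<^esub> (N +> x) = N +> (r \<odot> x)"
proof -
  have "N +> (r \<odot> y) = N +> (r \<odot> x)" if "y \<in> N +> x" for y
  proof -
    from that obtain n where n: "n \<in> N" "y = n \<oplus> x" by (auto simp: a_r_coset_def')
    have nc: "n \<in> carrier M" using n N_subset by auto
    have e: "r \<odot> y = r \<odot> n \<oplus> r \<odot> x" unfolding n(2) by (rule smult_r_distr[OF r nc x])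
    show ?thesis
      by (rule Q_eq[OF _ _ N_smult[OF r n(1)] e]) (use r x nc n(2) in simp_all)
  qed
  moreover have "x \<in> N +> x" using x N_zero by (auto simp: a_r_coset_def' intro: bexI[of _ \<zero>])
  ultimately have "(\<Union>y\<in>N +> x. N +> (r \<odot> y)) = N +> (r \<odot> x)"
    by (intro SUP_eq_const) blast+
  then show ?thesis by (simp add: quotient_module_def)
qed

lemma Q_abelian_group: "abelian_group Q"
proof (rule abelian_groupI)
  fix X Y assume "X \<in> carrier Q" "Y \<in> carrier Q"
  then obtain x y where xy: "x \<in> carrier M" "y \<in> carrier M" "X = N +> x" "Y = N +> y" by (auto simp: Q_carrier)
  show "X \<oplus>\<^bsub>Q\<^esub> Y \<in> carrier Q" using xy by (simp add: Q_add)
  show "X \<oplus>\<^bsub>Q\<^esub> Y = Y \<oplus>\<^bsub>Q\<^esub> X" using xy by (simp add: Q_add a_comm)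
  fix Z assume "Z \<in> carrier Q"
  then obtain z where "z \<in> carrier M" "Z = N +> z" by (auto simp: Q_carrier)
  with xy show "X \<oplus>\<^bsub>Q\<^esub> Y \<oplus>\<^bsub>Q\<^esub> Z = X \<oplus>\<^bsub>Q\<^esub> (Y \<oplus>\<^bsub>Q\<^esub> Z)" by (simp add: Q_add a_assoc)
next
  show "\<zero>\<^bsub>Q\<^esub> \<in> carrier Q" by (simp add: Q_zero)
next
  fix X assume "X \<in> carrier Q"
  then obtain x where x: "x \<in> carrier M" "X = N +> x" by (auto simp: Q_carrier)
  show "\<zero>\<^bsub>Q\<^esub> \<oplus>\<^bsub>Q\<^esub> X = X" using x by (simp add: Q_zero Q_add)
  show "\<exists>Y\<in>carrier Q. Y \<oplus>\<^bsub>Q\<^esub> X = \<zero>\<^bsub>Q\<^esub>"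
    using x by (intro bexI[of _ "N +> (\<ominus> x)"]) (simp_all add: Q_zero Q_add l_neg)
qed

lemma Q_premodule: "premodule C pl ml Q"
proof (intro premodule.intro premodule_axioms.intro)
  show "abelian_group Q" by (rule Q_abelian_group)
  show "pl r s \<in> C" "ml r s \<in> C" if "r \<in> C" "s \<in> C" for r s using that pl_closed ml_closed by auto
next
  fix r X assume r: "r \<in> C" "X \<in> carrier Q"
  then obtain x where x: "x \<in> carrier M" "X = N +> x" by (auto simp: Q_carrier)
  show "r \<odot>\<^bsub>Q\<^esub> X \<in> carrier Q" using r x by (simp add: Q_smult)
  show "r \<odot>\<^bsub>Q\<^esub> (X \<oplus>\<^bsub>Q\<^esub> Y) = r \<odot>\<^bsub>Q\<^esub> X \<oplus>\<^bsub>Q\<^esub> r \<odot>\<^bsub>Q\<^esub> Y" if "Y \<in> carrier Q" for Y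
    using that r x by (auto simp: Q_carrier Q_smult Q_add smult_r_distr)
  fix s assume s: "s \<in> C"
  show "pl s r \<odot>\<^bsub>Q\<^esub> X = s \<odot>\<^bsub>Q\<^esub> X \<oplus>\<^bsub>Q\<^esub> r \<odot>\<^bsub>Q\<^esub> X" using r s x by (simp add: Q_smult Q_add smult_l_distr pl_closed)
  show "ml s r \<odot>\<^bsub>Q\<^esub> X = s \<odot>\<^bsub>Q\<^esub> (r \<odot>\<^bsub>Q\<^esub> X)" using r s x by (simp add: Q_smult smult_assoc ml_closed)
qed

end

section \<open>The group algebra over the rationals\<close>

lemma supp_simps: "supp (\<lambda>_. 0) = {}" "supp (point_mass x) = {x}" "supp (\<lambda>x. u x + v x) \<subseteq> supp u \<union> supp v"
  "supp (\<lambda>x. q * u x) \<subseteq> supp u"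
  by (auto simp: supp_def point_mass_def)

lemma group_algebra_simps:
  "carrier (group_algebra G) = {u. finite (supp u) \<and> supp u \<subseteq> carrier G}"
  "\<zero>\<^bsub>group_algebra G\<^esub> = (\<lambda>_. 0)" "\<one>\<^bsub>group_algebra G\<^esub> = point_mass \<one>\<^bsub>G\<^esub>"
  "u \<oplus>\<^bsub>group_algebra G\<^esub> v = (\<lambda>x. u x + v x)" "q \<odot>\<^bsub>group_algebra G\<^esub> u = (\<lambda>x. q * u x)"
  by (simp_all add: group_algebra_def)

lemma finsupp_add: "finite (supp u) \<Longrightarrow> finite (supp v) \<Longrightarrow> finite (supp (\<lambda>x. u x + v x))"
  by (rule finite_subset[OF supp_simps(3)]) simp

lemma finsupp_scale: "finite (supp u) \<Longrightarrow> finite (supp (\<lambda>x. q * u x))"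
  by (rule finite_subset[OF supp_simps(4)])

lemma group_algebra_closed:
  "u \<in> carrier (group_algebra G) \<Longrightarrow> v \<in> carrier (group_algebra G) \<Longrightarrow> (\<lambda>x. u x + v x) \<in> carrier (group_algebra G)"
  "u \<in> carrier (group_algebra G) \<Longrightarrow> (\<lambda>x. q * u x) \<in> carrier (group_algebra G)"
  "x \<in> carrier G \<Longrightarrow> point_mass x \<in> carrier (group_algebra G)"
  "(\<lambda>_. 0) \<in> carrier (group_algebra G)"
  by (auto simp: group_algebra_simps(1) supp_simps(1,2) finsupp_add finsupp_scale
      dest!: subsetD[OF supp_simps(3)] subsetD[OF supp_simps(4)])

lemma group_algebra_abelian_group: "abelian_group (group_algebra G)"
proof (rule abelian_groupI)
  fix x assume "x \<in> carrier (group_algebra G)"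
  then show "\<exists>y\<in>carrier (group_algebra G). y \<oplus>\<^bsub>group_algebra G\<^esub> x = \<zero>\<^bsub>group_algebra G\<^esub>"
    using group_algebra_closed(2)[of x G "-1"]
    by (intro bexI[of _ "\<lambda>z. (-1) * x z"]) (auto simp: group_algebra_simps(2-))
qed (auto simp: group_algebra_simps(2-) group_algebra_closed)

lemma group_algebra_rat_premodule: "premodule UNIV (+) (*) (group_algebra G)"
  by (intro premodule.intro premodule_axioms.intro group_algebra_abelian_group)
    (auto simp: group_algebra_simps(2-) group_algebra_closed algebra_simps)

text \<open>One point of the support is peeled off at a time. The step allows any multiple of a
  point mass on top of any chain, the form in which linearity is used.\<close>

lemma group_algebra_induct [consumes 1, case_names zero add]:
  assumes "u \<in> carrier (group_algebra G)" and z: "P (\<lambda>_. 0)"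
    and s: "\<And>u h q. u \<in> carrier (group_algebra G) \<Longrightarrow> P u \<Longrightarrow> h \<in> carrier G \<Longrightarrow> P (\<lambda>x. u x + q * point_mass h x)"
  shows "P u"
proof -
  have "\<forall>u. supp u = A \<longrightarrow> P u" if "finite A" "A \<subseteq> carrier G" for A
    using that
  proof (induction A rule: finite_induct)
    case empty
    have "u = (\<lambda>_. 0)" if "supp u = {}" for u using that by (auto simp: supp_def)
    then show ?case using z by auto
  next
    case (insert h A)
    show ?case
    proof (intro allI impI)
      fix u assume u: "supp u = insert h A"
      let ?v = "u(h := 0)"
      have v: "supp ?v = A" using u insert by (auto simp: supp_def)
      then have "P ?v" using insert by auto
      moreover have "?v \<in> carrier (group_algebra G)" using v insert by (auto simp: group_algebra_simps)
      moreover have "h \<in> carrier G" using insert by auto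
      ultimately have "P (\<lambda>x. ?v x + u h * point_mass h x)" by (intro s[of ?v h "u h"])
      moreover have "(\<lambda>x. ?v x + u h * point_mass h x) = u" by (auto simp: point_mass_def)
      ultimately show "P u" by simp
    qed
  qed
  then show ?thesis using assms(1) by (auto simp: group_algebra_simps)
qed

text \<open>Linearity compares products of elements with different supports; a common finite range
  of summation makes the sums additive.\<close>

lemma group_algebra_mult_eq:
  assumes "finite Y" "supp r \<subseteq> Y" "finite Z" "supp s \<subseteq> Z"
  shows "(r \<otimes>\<^bsub>group_algebra G\<^esub> s) x = (\<Sum>y\<in>Y. \<Sum>z\<in>Z. if y \<otimes>\<^bsub>G\<^esub> z = x then r y * s z else 0)"
proof -
  have "(r \<otimes>\<^bsub>group_algebra G\<^esub> s) x = (\<Sum>(y, z) \<in> {(y, z) \<in> supp r \<times> supp s. y \<otimes>\<^bsub>G\<^esub> z = x}. r y * s z)"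
    by (simp add: group_algebra_def)
  also have "\<dots> = (\<Sum>(y, z) \<in> Y \<times> Z. if y \<otimes>\<^bsub>G\<^esub> z = x then r y * s z else 0)"
  proof (rule sum.mono_neutral_cong_left)
    show "finite (Y \<times> Z)" using assms by simp
    show "{(y, z) \<in> supp r \<times> supp s. y \<otimes>\<^bsub>G\<^esub> z = x} \<subseteq> Y \<times> Z" using assms by blast
    show "\<forall>i\<in>Y \<times> Z - {(y, z) \<in> supp r \<times> supp s. y \<otimes>\<^bsub>G\<^esub> z = x}. (case i of (y, z) \<Rightarrow> if y \<otimes>\<^bsub>G\<^esub> z = x then r y * s z else 0) = 0"
    proof
      fix i assume i: "i \<in> Y \<times> Z - {(y, z) \<in> supp r \<times> supp s. y \<otimes>\<^bsub>G\<^esub> z = x}"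
      obtain y z where yz: "i = (y, z)" by (cases i)
      have "r y = 0 \<or> s z = 0 \<or> y \<otimes>\<^bsub>G\<^esub> z \<noteq> x" using i unfolding yz by (simp add: supp_def)
      then show "(case i of (y, z) \<Rightarrow> if y \<otimes>\<^bsub>G\<^esub> z = x then r y * s z else 0) = 0" unfolding yz by auto
    qed
    show "(case i of (y, z) \<Rightarrow> r y * s z) = (case i of (y, z) \<Rightarrow> if y \<otimes>\<^bsub>G\<^esub> z = x then r y * s z else 0)"
      if "i \<in> {(y, z) \<in> supp r \<times> supp s. y \<otimes>\<^bsub>G\<^esub> z = x}" for i using that by auto
  qed
  also have "\<dots> = (\<Sum>y\<in>Y. \<Sum>z\<in>Z. if y \<otimes>\<^bsub>G\<^esub> z = x then r y * s z else 0)"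
    by (rule sum.cartesian_product[symmetric])
  finally show ?thesis .
qed

lemma group_algebra_mult_l:
  assumes "finite (supp r)" "finite (supp r')" "finite (supp s)"
  shows "(\<lambda>x. r x + q * r' x) \<otimes>\<^bsub>group_algebra G\<^esub> s = (\<lambda>x. (r \<otimes>\<^bsub>group_algebra G\<^esub> s) x + q * (r' \<otimes>\<^bsub>group_algebra G\<^esub> s) x)"
proof
  fix x
  let ?Y = "supp r \<union> supp r'"
  have "supp (\<lambda>x. r x + q * r' x) \<subseteq> ?Y" by (auto simp: supp_def)
  then show "((\<lambda>x. r x + q * r' x) \<otimes>\<^bsub>group_algebra G\<^esub> s) x = (r \<otimes>\<^bsub>group_algebra G\<^esub> s) x + q * (r' \<otimes>\<^bsub>group_algebra G\<^esub> s) x"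
    using assms by (subst (1 2 3) group_algebra_mult_eq[of ?Y _ "supp s"])
      (auto simp: sum_distrib_left sum.distrib[symmetric] algebra_simps intro!: sum.cong)
qed

lemma group_algebra_mult_r:
  assumes "finite (supp r)" "finite (supp s)" "finite (supp s')"
  shows "r \<otimes>\<^bsub>group_algebra G\<^esub> (\<lambda>x. s x + q * s' x) = (\<lambda>x. (r \<otimes>\<^bsub>group_algebra G\<^esub> s) x + q * (r \<otimes>\<^bsub>group_algebra G\<^esub> s') x)"
proof
  fix x
  let ?Y = "supp s \<union> supp s'"
  have "supp (\<lambda>x. s x + q * s' x) \<subseteq> ?Y" by (auto simp: supp_def)
  then show "(r \<otimes>\<^bsub>group_algebra G\<^esub> (\<lambda>x. s x + q * s' x)) x = (r \<otimes>\<^bsub>group_algebra G\<^esub> s) x + q * (r \<otimes>\<^bsub>group_algebra G\<^esub> s') x"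
    using assms by (subst (1 2 3) group_algebra_mult_eq[of "supp r" _ ?Y])
      (auto simp: sum_distrib_left sum.distrib[symmetric] algebra_simps intro!: sum.cong)
qed

lemma group_algebra_mult_zero:
  "(\<lambda>_. 0) \<otimes>\<^bsub>group_algebra G\<^esub> s = (\<lambda>_. 0)" "r \<otimes>\<^bsub>group_algebra G\<^esub> (\<lambda>_. 0) = (\<lambda>_. 0)"
  by (auto simp: group_algebra_def supp_simps)

lemma group_algebra_mult_point:
  "point_mass h \<otimes>\<^bsub>group_algebra G\<^esub> point_mass k = point_mass (h \<otimes>\<^bsub>G\<^esub> k)"
proof
  fix x
  have "supp (point_mass h) \<subseteq> {h}" "supp (point_mass k) \<subseteq> {k}" by (simp_all add: supp_simps)
  then show "(point_mass h \<otimes>\<^bsub>group_algebra G\<^esub> point_mass k) x = point_mass (h \<otimes>\<^bsub>G\<^esub> k) x"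
    by (subst group_algebra_mult_eq[of "{h}" _ "{k}"]) (auto simp: point_mass_def)
qed

lemma group_algebra_mult_closed:
  assumes "monoid G" "r \<in> carrier (group_algebra G)" "s \<in> carrier (group_algebra G)"
  shows "r \<otimes>\<^bsub>group_algebra G\<^esub> s \<in> carrier (group_algebra G)"
proof -
  interpret monoid G by fact
  have "supp (r \<otimes>\<^bsub>group_algebra G\<^esub> s) \<subseteq> (\<lambda>(y, z). y \<otimes>\<^bsub>G\<^esub> z) ` (supp r \<times> supp s)"
  proof
    fix x assume "x \<in> supp (r \<otimes>\<^bsub>group_algebra G\<^esub> s)"
    moreover have "(r \<otimes>\<^bsub>group_algebra G\<^esub> s) x = (\<Sum>(y, z) \<in> {(y, z) \<in> supp r \<times> supp s. y \<otimes>\<^bsub>G\<^esub> z = x}. r y * s z)"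
      by (simp add: group_algebra_def)
    moreover have "(\<Sum>(y, z) \<in> {}. r y * s z) = 0" by simp
    ultimately have "{(y, z) \<in> supp r \<times> supp s. y \<otimes>\<^bsub>G\<^esub> z = x} \<noteq> {}"
      unfolding supp_def[of "r \<otimes>\<^bsub>group_algebra G\<^esub> s"] mem_Collect_eq by metis
    then show "x \<in> (\<lambda>(y, z). y \<otimes>\<^bsub>G\<^esub> z) ` (supp r \<times> supp s)" by blast
  qed
  moreover have "finite ((\<lambda>(y, z). y \<otimes>\<^bsub>G\<^esub> z) ` (supp r \<times> supp s))" "(\<lambda>(y, z). y \<otimes>\<^bsub>G\<^esub> z) ` (supp r \<times> supp s) \<subseteq> carrier G"
    using assms(2,3) by (auto simp: group_algebra_simps)
  ultimately show ?thesis by (auto simp: group_algebra_simps intro: finite_subset)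
qed

lemma group_algebra_mult_one:
  assumes "monoid G" "r \<in> carrier (group_algebra G)"
  shows "(\<lambda>x. q * point_mass \<one>\<^bsub>G\<^esub> x) \<otimes>\<^bsub>group_algebra G\<^esub> r = (\<lambda>x. q * r x)"
    "r \<otimes>\<^bsub>group_algebra G\<^esub> (\<lambda>x. q * point_mass \<one>\<^bsub>G\<^esub> x) = (\<lambda>x. q * r x)"
proof -
  interpret monoid G by fact
  have f: "finite (supp (point_mass x))" for x :: 'a by (simp add: supp_simps)
  have f0: "finite (supp (\<lambda>_ :: 'a. 0))" by (simp add: supp_simps)
  note z = group_algebra_mult_l[OF f0, simplified] group_algebra_mult_r[OF _ f0, simplified]
  have fu: "finite (supp u)" if "u \<in> carrier (group_algebra G)" for u using that by (simp add: group_algebra_simps)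
  show "(\<lambda>x. q * point_mass \<one>\<^bsub>G\<^esub> x) \<otimes>\<^bsub>group_algebra G\<^esub> r = (\<lambda>x. q * r x)"
    using assms(2)
  proof (induction rule: group_algebra_induct)
    case (add u h p)
    have "(\<lambda>x. q * point_mass \<one>\<^bsub>G\<^esub> x) \<otimes>\<^bsub>group_algebra G\<^esub> point_mass h = (\<lambda>x. q * point_mass h x)"
      using z(1)[OF f f, where G = G] add by (simp add: group_algebra_mult_point group_algebra_mult_zero)
    then show ?case using add by (subst group_algebra_mult_r) (auto simp: f fu finsupp_scale algebra_simps)
  qed (simp add: group_algebra_mult_zero)
  show "r \<otimes>\<^bsub>group_algebra G\<^esub> (\<lambda>x. q * point_mass \<one>\<^bsub>G\<^esub> x) = (\<lambda>x. q * r x)"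
    using assms(2)
  proof (induction rule: group_algebra_induct)
    case (add u h p)
    have "point_mass h \<otimes>\<^bsub>group_algebra G\<^esub> (\<lambda>x. q * point_mass \<one>\<^bsub>G\<^esub> x) = (\<lambda>x. q * point_mass h x)"
      using z(2)[OF f f, where G = G] add by (simp add: group_algebra_mult_point group_algebra_mult_zero)
    then show ?case using add by (subst group_algebra_mult_l) (auto simp: f fu finsupp_scale algebra_simps)
  qed (simp add: group_algebra_mult_zero)
qed

section \<open>Linear group actions as modules over the group algebra\<close>

locale rat_rep = V: premodule UNIV "(+)" "(*)" V for V :: "(rat, 'v, 'm) module_scheme" +
  fixes H :: "('h, 'n) monoid_scheme" and \<rho> :: "'h \<Rightarrow> 'v \<Rightarrow> 'v"
  assumes smult_1: "x \<in> carrier V \<Longrightarrow> 1 \<odot>\<^bsub>V\<^esub> x = x"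
    and \<rho>_closed: "h \<in> carrier H \<Longrightarrow> x \<in> carrier V \<Longrightarrow> \<rho> h x \<in> carrier V"
    and \<rho>_add: "h \<in> carrier H \<Longrightarrow> x \<in> carrier V \<Longrightarrow> y \<in> carrier V \<Longrightarrow> \<rho> h (x \<oplus>\<^bsub>V\<^esub> y) = \<rho> h x \<oplus>\<^bsub>V\<^esub> \<rho> h y"
    and \<rho>_smult: "h \<in> carrier H \<Longrightarrow> x \<in> carrier V \<Longrightarrow> \<rho> h (q \<odot>\<^bsub>V\<^esub> x) = q \<odot>\<^bsub>V\<^esub> \<rho> h x"
begin

abbreviation W where "W \<equiv> group_algebra_module V \<rho>"

lemma W_simps: "carrier W = carrier V" "\<zero>\<^bsub>W\<^esub> = \<zero>\<^bsub>V\<^esub>" "x \<oplus>\<^bsub>W\<^esub> y = x \<oplus>\<^bsub>V\<^esub> y"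
  by (simp_all add: group_algebra_module_def)

lemma smult_0: "x \<in> carrier V \<Longrightarrow> 0 \<odot>\<^bsub>V\<^esub> x = \<zero>\<^bsub>V\<^esub>"
  using V.smult_l_distr[of 0 0 x] V.smult_closed[of 0 x] V.add.r_cancel_one' by (metis UNIV_I add_0)

lemma W_abelian_group: "abelian_group W"
proof (rule abelian_groupI)
  show "\<exists>y\<in>carrier W. y \<oplus>\<^bsub>W\<^esub> x = \<zero>\<^bsub>W\<^esub>" if "x \<in> carrier W" for x
    using that by (intro bexI[of _ "\<ominus>\<^bsub>V\<^esub> x"]) (simp_all add: W_simps V.l_neg)
qed (auto simp: W_simps V.a_assoc intro: V.a_comm)

lemma W_smult_on:
  assumes "finite A" "supp u \<subseteq> A" "A \<subseteq> carrier H" "m \<in> carrier V"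
  shows "u \<odot>\<^bsub>W\<^esub> m = (\<Oplus>\<^bsub>V\<^esub>h\<in>A. u h \<odot>\<^bsub>V\<^esub> \<rho> h m)"
proof -
  have "u \<odot>\<^bsub>W\<^esub> m = (\<Oplus>\<^bsub>V\<^esub>h\<in>supp u. u h \<odot>\<^bsub>V\<^esub> \<rho> h m)" by (simp add: group_algebra_module_def)
  also have "\<dots> = (\<Oplus>\<^bsub>V\<^esub>h\<in>A. u h \<odot>\<^bsub>V\<^esub> \<rho> h m)"
    using assms by (intro V.add.finprod_mono_neutral_cong_left) (auto simp: supp_def smult_0 \<rho>_closed subset_iff)
  finally show ?thesis .
qed

lemma W_zero_smult: "m \<in> carrier V \<Longrightarrow> (\<lambda>_. 0) \<odot>\<^bsub>W\<^esub> m = \<zero>\<^bsub>V\<^esub>"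
  using W_smult_on[of "{}" "\<lambda>_. 0" m] by (simp add: supp_simps)

lemma W_point_scaled: "h \<in> carrier H \<Longrightarrow> m \<in> carrier V \<Longrightarrow> (\<lambda>x. q * point_mass h x) \<odot>\<^bsub>W\<^esub> m = q \<odot>\<^bsub>V\<^esub> \<rho> h m"
  using W_smult_on[of "{h}" "\<lambda>x. q * point_mass h x" m] supp_simps(4)[of q "point_mass h"]
  by (simp add: supp_simps(2)) (simp add: point_mass_def \<rho>_closed)

lemma W_point: "h \<in> carrier H \<Longrightarrow> m \<in> carrier V \<Longrightarrow> point_mass h \<odot>\<^bsub>W\<^esub> m = \<rho> h m"
  using W_point_scaled[of h m 1] by (simp add: smult_1 \<rho>_closed)

lemma W_smult_closed: "u \<in> carrier (group_algebra H) \<Longrightarrow> m \<in> carrier V \<Longrightarrow> u \<odot>\<^bsub>W\<^esub> m \<in> carrier V"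
  using W_smult_on[of "supp u" u m] by (auto simp: group_algebra_simps \<rho>_closed subset_iff intro!: V.finsum_closed)

lemma W_l_distr:
  assumes "u \<in> carrier (group_algebra H)" "v \<in> carrier (group_algebra H)" "m \<in> carrier V"
  shows "(\<lambda>x. u x + v x) \<odot>\<^bsub>W\<^esub> m = u \<odot>\<^bsub>W\<^esub> m \<oplus>\<^bsub>V\<^esub> v \<odot>\<^bsub>W\<^esub> m"
proof -
  let ?A = "supp u \<union> supp v"
  have A: "finite ?A" "?A \<subseteq> carrier H" "supp (\<lambda>x. u x + v x) \<subseteq> ?A" using assms supp_simps(3)[of u v] by (auto simp: group_algebra_simps)
  have "(\<lambda>x. u x + v x) \<odot>\<^bsub>W\<^esub> m = (\<Oplus>\<^bsub>V\<^esub>h\<in>?A. u h \<odot>\<^bsub>V\<^esub> \<rho> h m \<oplus>\<^bsub>V\<^esub> v h \<odot>\<^bsub>V\<^esub> \<rho> h m)"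
    unfolding W_smult_on[OF A(1,3,2) assms(3)]
    using A assms by (intro V.add.finprod_cong') (auto simp: V.smult_l_distr \<rho>_closed subset_iff)
  also have "\<dots> = (\<Oplus>\<^bsub>V\<^esub>h\<in>?A. u h \<odot>\<^bsub>V\<^esub> \<rho> h m) \<oplus>\<^bsub>V\<^esub> (\<Oplus>\<^bsub>V\<^esub>h\<in>?A. v h \<odot>\<^bsub>V\<^esub> \<rho> h m)"
    using A assms by (intro V.finsum_addf) (auto simp: \<rho>_closed subset_iff)
  finally show ?thesis using W_smult_on[of ?A u m] W_smult_on[of ?A v m] A assms by simp
qed

lemma W_step:
  assumes "u \<in> carrier (group_algebra H)" "h \<in> carrier H" "m \<in> carrier V"
  shows "(\<lambda>x. u x + q * point_mass h x) \<odot>\<^bsub>W\<^esub> m = u \<odot>\<^bsub>W\<^esub> m \<oplus>\<^bsub>V\<^esub> q \<odot>\<^bsub>V\<^esub> \<rho> h m"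
  using W_l_distr[OF assms(1) group_algebra_closed(2)[OF group_algebra_closed(3)[OF assms(2)]] assms(3), of q]
    W_point_scaled[OF assms(2,3)] by simp

text \<open>\<open>m'\<close> stands in the place of \<open>f m\<close>, and equivariance is asked
  along the orbit of \<open>m\<close> only. This covers a rational multiple as well as the action of
  a second, commuting group.\<close>

lemma W_linear:
  assumes f: "\<And>x. x \<in> carrier V \<Longrightarrow> f x \<in> carrier V"
    "\<And>x y. x \<in> carrier V \<Longrightarrow> y \<in> carrier V \<Longrightarrow> f (x \<oplus>\<^bsub>V\<^esub> y) = f x \<oplus>\<^bsub>V\<^esub> f y"
    "\<And>q x. x \<in> carrier V \<Longrightarrow> f (q \<odot>\<^bsub>V\<^esub> x) = q \<odot>\<^bsub>V\<^esub> f x"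
    and c: "\<And>h. h \<in> carrier H \<Longrightarrow> f (\<rho> h m) = \<rho> h m'"
    and m: "m \<in> carrier V" "m' \<in> carrier V" and u: "u \<in> carrier (group_algebra H)"
  shows "f (u \<odot>\<^bsub>W\<^esub> m) = u \<odot>\<^bsub>W\<^esub> m'"
  using u
proof (induction rule: group_algebra_induct)
  case zero
  have "f \<zero>\<^bsub>V\<^esub> = \<zero>\<^bsub>V\<^esub>" by (rule additive_zero[OF V.abelian_group_axioms V.abelian_group_axioms]) (use f in auto)
  then show ?case using m by (simp add: W_zero_smult)
next
  case (add u h q)
  then show ?case using m by (simp add: W_step f c \<rho>_closed W_smult_closed)
qed

lemma W_r_distr:
  assumes u: "u \<in> carrier (group_algebra H)" and m: "m \<in> carrier V" "n \<in> carrier V"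
  shows "u \<odot>\<^bsub>W\<^esub> (m \<oplus>\<^bsub>V\<^esub> n) = u \<odot>\<^bsub>W\<^esub> m \<oplus>\<^bsub>V\<^esub> u \<odot>\<^bsub>W\<^esub> n"
  using u
proof (induction rule: group_algebra_induct)
  case (add u h q)
  have c: "u \<odot>\<^bsub>W\<^esub> m \<in> carrier V" "u \<odot>\<^bsub>W\<^esub> n \<in> carrier V" "q \<odot>\<^bsub>V\<^esub> \<rho> h m \<in> carrier V" "q \<odot>\<^bsub>V\<^esub> \<rho> h n \<in> carrier V"
    using add m by (auto simp: W_smult_closed \<rho>_closed)
  show ?case using add m c by (simp add: W_step \<rho>_add \<rho>_closed V.smult_r_distr V.a_ac)
qed (use m in \<open>simp add: W_zero_smult\<close>)

lemma W_smult_smult: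
  assumes u: "u \<in> carrier (group_algebra H)" and m: "m \<in> carrier V"
  shows "(\<lambda>x. q * u x) \<odot>\<^bsub>W\<^esub> m = q \<odot>\<^bsub>V\<^esub> (u \<odot>\<^bsub>W\<^esub> m)" "u \<odot>\<^bsub>W\<^esub> (q \<odot>\<^bsub>V\<^esub> m) = q \<odot>\<^bsub>V\<^esub> (u \<odot>\<^bsub>W\<^esub> m)"
proof -
  show "(\<lambda>x. q * u x) \<odot>\<^bsub>W\<^esub> m = q \<odot>\<^bsub>V\<^esub> (u \<odot>\<^bsub>W\<^esub> m)"
    using u
  proof (induction rule: group_algebra_induct)
    case (add u h p)
    have "(\<lambda>x. q * (u x + p * point_mass h x)) = (\<lambda>x. q * u x + (q * p) * point_mass h x)" by (auto simp: algebra_simps)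
    then show ?case using add m group_algebra_closed(2)[OF add.hyps(1), of q] by (simp add: W_step \<rho>_closed W_smult_closed V.smult_r_distr V.smult_assoc)
  qed (use m in \<open>simp add: W_zero_smult V.smult_zero\<close>)
  show "u \<odot>\<^bsub>W\<^esub> (q \<odot>\<^bsub>V\<^esub> m) = q \<odot>\<^bsub>V\<^esub> (u \<odot>\<^bsub>W\<^esub> m)"
    by (rule sym, rule W_linear[OF _ _ _ _ _ _ u]) 
      (use m in \<open>simp_all add: V.smult_r_distr \<rho>_smult mult.commute flip: V.smult_assoc\<close>)
qed

lemma W_premodule:
  assumes mon: "monoid H" and mult: "\<And>h k x. h \<in> carrier H \<Longrightarrow> k \<in> carrier H \<Longrightarrow> x \<in> carrier V \<Longrightarrow>
     \<rho> (h \<otimes>\<^bsub>H\<^esub> k) x = \<rho> h (\<rho> k x)"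
  shows "premodule (carrier (group_algebra H)) (add (group_algebra H)) (monoid.mult (group_algebra H)) W"
proof (intro premodule.intro premodule_axioms.intro)
  let ?R = "group_algebra H"
  note fin = group_algebra_simps(1)[of H]
  interpret H: monoid H by (rule mon)
  have f: "finite (supp (point_mass h))" for h :: 'h by (simp add: supp_simps)
  show "abelian_group W" by (rule W_abelian_group)
  fix r s assume rs: "r \<in> carrier ?R" "s \<in> carrier ?R"
  show "r \<oplus>\<^bsub>?R\<^esub> s \<in> carrier ?R" using rs by (simp add: group_algebra_simps(4) group_algebra_closed)
  show "r \<otimes>\<^bsub>?R\<^esub> s \<in> carrier ?R" using rs by (rule group_algebra_mult_closed[OF mon])
  fix m assume "m \<in> carrier W"
  then have m: "m \<in> carrier V" by (simp add: W_simps)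
  show "(r \<oplus>\<^bsub>?R\<^esub> s) \<odot>\<^bsub>W\<^esub> m = r \<odot>\<^bsub>W\<^esub> m \<oplus>\<^bsub>W\<^esub> s \<odot>\<^bsub>W\<^esub> m"
    using rs m by (simp add: group_algebra_simps(4) W_simps W_l_distr)
  have pt: "(point_mass h \<otimes>\<^bsub>?R\<^esub> s) \<odot>\<^bsub>W\<^esub> m = \<rho> h (s \<odot>\<^bsub>W\<^esub> m)" if h: "h \<in> carrier H" for h
    using rs(2)
  proof (induction rule: group_algebra_induct)
    case zero
    have "\<rho> h \<zero>\<^bsub>V\<^esub> = \<zero>\<^bsub>V\<^esub>" by (rule additive_zero[OF V.abelian_group_axioms V.abelian_group_axioms]) (use h \<rho>_closed \<rho>_add in auto)
    then show ?case using m by (simp add: W_zero_smult group_algebra_mult_zero)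
  next
    case (add u k q)
    have "point_mass h \<otimes>\<^bsub>?R\<^esub> (\<lambda>x. u x + q * point_mass k x) = (\<lambda>x. (point_mass h \<otimes>\<^bsub>?R\<^esub> u) x + q * point_mass (h \<otimes>\<^bsub>H\<^esub> k) x)"
      using add by (subst group_algebra_mult_r) (auto simp: f fin group_algebra_mult_point)
    moreover have "point_mass h \<otimes>\<^bsub>?R\<^esub> u \<in> carrier ?R"
      using group_algebra_mult_closed[OF mon group_algebra_closed(3)[OF h] add.hyps(1)] .
    ultimately show ?case using add h m
      by (simp add: W_step \<rho>_closed W_smult_closed \<rho>_add \<rho>_smult mult)
  qed
  show "(r \<otimes>\<^bsub>?R\<^esub> s) \<odot>\<^bsub>W\<^esub> m = r \<odot>\<^bsub>W\<^esub> (s \<odot>\<^bsub>W\<^esub> m)"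
    using rs(1)
  proof (induction rule: group_algebra_induct)
    case zero then show ?case using m rs by (simp add: W_zero_smult group_algebra_mult_zero W_smult_closed)
  next
    case (add u h q)
    have ph: "point_mass h \<otimes>\<^bsub>?R\<^esub> s \<in> carrier ?R" "u \<otimes>\<^bsub>?R\<^esub> s \<in> carrier ?R"
      using group_algebra_mult_closed[OF mon group_algebra_closed(3)[OF add.hyps(2)] rs(2)] group_algebra_mult_closed[OF mon add.hyps(1) rs(2)] by auto
    have "(\<lambda>x. u x + q * point_mass h x) \<otimes>\<^bsub>?R\<^esub> s = (\<lambda>x. (u \<otimes>\<^bsub>?R\<^esub> s) x + q * (point_mass h \<otimes>\<^bsub>?R\<^esub> s) x)"
      using add rs by (subst group_algebra_mult_l) (auto simp: f fin)
    then show ?case using add m rs ph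
      by (simp add: W_l_distr[OF ph(2) group_algebra_closed(2)[OF ph(1)]] W_smult_smult(1)[OF ph(1)] pt W_step W_smult_closed)
  qed
next
  show "r \<odot>\<^bsub>W\<^esub> m \<in> carrier W" if "r \<in> carrier (group_algebra H)" "m \<in> carrier W" for r m
    using that by (simp add: W_simps W_smult_closed)
  show "r \<odot>\<^bsub>W\<^esub> (m \<oplus>\<^bsub>W\<^esub> n) = r \<odot>\<^bsub>W\<^esub> m \<oplus>\<^bsub>W\<^esub> r \<odot>\<^bsub>W\<^esub> n"
    if "r \<in> carrier (group_algebra H)" "m \<in> carrier W" "n \<in> carrier W" for r m n
    using that by (simp add: W_simps W_r_distr)
qed

end

section \<open>First homology of the commutator subgroup\<close>

lemma push_chain_eq:
  assumes "finite A" "supp u \<subseteq> A"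
  shows "push_chain \<phi> u y = (\<Sum>x\<in>A. if \<phi> x = y then u x else 0)"
  unfolding push_chain_def using assms
  by (subst sum.inter_filter[symmetric, where P = "\<lambda>x. \<phi> x = y"]) (auto simp: supp_def intro!: sum.mono_neutral_left)

lemma push_chain_add:
  assumes "finite (supp u)" "finite (supp v)"
  shows "push_chain \<phi> (\<lambda>x. u x + q * v x) = (\<lambda>y. push_chain \<phi> u y + q * push_chain \<phi> v y)"
proof
  fix y
  have "supp (\<lambda>x. u x + q * v x) \<subseteq> supp u \<union> supp v" by (auto simp: supp_def)
  then show "push_chain \<phi> (\<lambda>x. u x + q * v x) y = push_chain \<phi> u y + q * push_chain \<phi> v y"
    using assms by (subst (1 2 3) push_chain_eq[of "supp u \<union> supp v"])
      (auto simp: sum_distrib_left sum.distrib[symmetric] intro!: sum.cong)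
qed

lemma push_chain_zero: "push_chain \<phi> (\<lambda>_. 0) = (\<lambda>_. 0)"
  by (auto simp: push_chain_def supp_simps)

lemma push_chain_point: "push_chain \<phi> (point_mass x) = point_mass (\<phi> x)"
proof
  fix y have "supp (point_mass x) \<subseteq> {x}" by (simp add: supp_simps)
  then show "push_chain \<phi> (point_mass x) y = point_mass (\<phi> x) y"
    by (subst push_chain_eq[of "{x}"]) (auto simp: point_mass_def)
qed

lemma push_chain_closed:
  assumes "u \<in> carrier (group_algebra G)" "\<And>x. x \<in> carrier G \<Longrightarrow> \<phi> x \<in> carrier G'"
  shows "push_chain \<phi> u \<in> carrier (group_algebra G')"
  using assms(1)
proof (induction rule: group_algebra_induct)
  case (add u h q)
  then show ?case using assms(2)
    by (subst push_chain_add) (auto simp: push_chain_point group_algebra_simps(1)[of G] supp_simps intro!: group_algebra_closed)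
qed (simp add: push_chain_zero group_algebra_closed)

context group
begin

abbreviation "N2 \<equiv> lower_central G 2"
abbreviation "G2 \<equiv> commutator_group G"
abbreviation "GA \<equiv> group_algebra (commutator_group G)"
abbreviation "BB \<equiv> bar_boundaries (commutator_group G)"
abbreviation "HH \<equiv> group_H1 (commutator_group G)"

definition endo :: "('a \<Rightarrow> 'a) \<Rightarrow> bool" where
  "endo \<phi> \<longleftrightarrow> (\<forall>x\<in>N2. \<phi> x \<in> N2) \<and> (\<forall>x\<in>N2. \<forall>y\<in>N2. \<phi> (x \<otimes> y) = \<phi> x \<otimes> \<phi> y)"

lemma G2_simps: "carrier G2 = N2" "x \<otimes>\<^bsub>G2\<^esub> y = x \<otimes> y"
  by (simp_all add: commutator_group_def)

lemma boundary_closed: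
  assumes "x \<in> N2" "y \<in> N2"
  shows "(\<lambda>z. point_mass y z - point_mass (x \<otimes> y) z + point_mass x z) \<in> carrier GA"
proof -
  have c: "point_mass x \<in> carrier GA" "point_mass y \<in> carrier GA" "point_mass (x \<otimes> y) \<in> carrier GA"
    using assms N2_mult by (simp_all add: group_algebra_closed G2_simps)
  from group_algebra_closed(1)[OF group_algebra_closed(1)[OF c(2) group_algebra_closed(2)[OF c(3), of "-1"]] c(1)]
  show ?thesis by simp
qed

lemma BB_gen_closed:
  "q \<in> UNIV \<Longrightarrow> b \<in> {(\<lambda>z. point_mass y z - point_mass (x \<otimes>\<^bsub>G2\<^esub> y) z + point_mass x z) | x y. x \<in> carrier G2 \<and> y \<in> carrier G2}
    \<Longrightarrow> q \<odot>\<^bsub>GA\<^esub> b \<in> carrier GA"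
  using boundary_closed by (auto simp: group_algebra_simps(5) G2_simps intro!: group_algebra_closed(2))

lemma BB_add_closed: "add_closed GA BB"
  unfolding bar_boundaries_def by (rule span_add_closed[OF group_algebra_abelian_group BB_gen_closed])

lemma BB_boundary: "x \<in> N2 \<Longrightarrow> y \<in> N2 \<Longrightarrow> (\<lambda>z. q * (point_mass y z - point_mass (x \<otimes> y) z + point_mass x z)) \<in> BB"
proof -
  assume xy: "x \<in> N2" "y \<in> N2"
  let ?b = "\<lambda>z. point_mass y z - point_mass (x \<otimes> y) z + point_mass x z"
  have "?b \<in> {(\<lambda>z. point_mass y z - point_mass (x \<otimes>\<^bsub>G2\<^esub> y) z + point_mass x z) | x y. x \<in> carrier G2 \<and> y \<in> carrier G2}"
    using xy unfolding G2_simps by blast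
  from span_incl[OF UNIV_I this, where M = GA and r = q] show ?thesis
    unfolding bar_boundaries_def group_algebra_simps(5) .
qed

lemma BB_smult:
  assumes "u \<in> BB" shows "q \<odot>\<^bsub>GA\<^esub> u \<in> BB"
proof (rule span_map[OF group_algebra_abelian_group group_algebra_abelian_group BB_gen_closed, where f = "\<lambda>u. q \<odot>\<^bsub>GA\<^esub> u" and H = BB])
  fix r b assume "b \<in> {(\<lambda>z. point_mass y z - point_mass (x \<otimes>\<^bsub>G2\<^esub> y) z + point_mass x z) | x y. x \<in> carrier G2 \<and> y \<in> carrier G2}"
  then show "q \<odot>\<^bsub>GA\<^esub> (r \<odot>\<^bsub>GA\<^esub> b) \<in> BB"
    using BB_boundary[of _ _ "q * r"] by (auto simp: group_algebra_simps(5) G2_simps mult.assoc)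
qed (use assms BB_add_closed in \<open>auto simp: group_algebra_simps(4,5) bar_boundaries_def algebra_simps intro: group_algebra_closed\<close>)

lemma HH_quotient: "quotient_premodule UNIV (+) (*) GA BB"
  by (rule quotient_premodule.intro[OF group_algebra_rat_premodule quotient_premodule_axioms.intro[OF BB_add_closed BB_smult]])

end

text \<open>A copy of \<open>group\<close>, so that the quotient interpretations below attach to it
  alone.\<close>

locale h1_group = group

sublocale h1_group \<subseteq> HQ: quotient_premodule UNIV "(+)" "(*)" GA BB
  by (rule HH_quotient)

context h1_group
begin

lemma HH_premodule: "premodule UNIV (+) (*) HH"
  using HQ.Q_premodule by (simp add: group_H1_def)

end

sublocale h1_group \<subseteq> HH: premodule UNIV "(+)" "(*)" HH
  by (rule HH_premodule)

context h1_group
begin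

definition cls :: "('a \<Rightarrow> rat) \<Rightarrow> ('a \<Rightarrow> rat) set" where
  "cls u = BB +>\<^bsub>GA\<^esub> u"

lemma HH_carrier: "carrier HH = cls ` carrier GA"
  using HQ.Q_carrier by (auto simp: group_H1_def cls_def)

lemma cls_closed: "u \<in> carrier GA \<Longrightarrow> cls u \<in> carrier HH"
  by (simp add: HH_carrier)

lemma cls_add: "u \<in> carrier GA \<Longrightarrow> v \<in> carrier GA \<Longrightarrow> cls (\<lambda>x. u x + v x) = cls u \<oplus>\<^bsub>HH\<^esub> cls v"
  using HQ.Q_add[of u v] by (simp add: group_H1_def cls_def group_algebra_simps(4))

lemma cls_smult: "u \<in> carrier GA \<Longrightarrow> cls (\<lambda>x. q * u x) = q \<odot>\<^bsub>HH\<^esub> cls u"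
  using HQ.Q_smult[of q u] by (simp add: group_H1_def cls_def group_algebra_simps(5))

lemma cls_zero: "cls (\<lambda>_. 0) = \<zero>\<^bsub>HH\<^esub>"
  using HQ.Q_zero by (simp add: group_H1_def cls_def group_algebra_simps(2))

lemma cls_boundary: "u \<in> BB \<Longrightarrow> cls u = \<zero>\<^bsub>HH\<^esub>"
  using HQ.Q_mem_zero by (simp add: group_H1_def cls_def)

lemma HH_smult_1: "X \<in> carrier HH \<Longrightarrow> 1 \<odot>\<^bsub>HH\<^esub> X = X"
proof -
  assume "X \<in> carrier HH"
  then obtain u where u: "u \<in> carrier GA" "X = cls u" by (auto simp: HH_carrier)
  show ?thesis using cls_smult[OF u(1), of 1, symmetric] unfolding u(2) by simp
qed

lemma pm_closed: "x \<in> N2 \<Longrightarrow> point_mass x \<in> carrier GA"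
  by (simp add: group_algebra_closed G2_simps)

lemma cls_step:
  assumes "u \<in> carrier GA" "x \<in> N2"
  shows "cls (\<lambda>z. u z + q * point_mass x z) = cls u \<oplus>\<^bsub>HH\<^esub> q \<odot>\<^bsub>HH\<^esub> cls (point_mass x)"
  using assms cls_add[OF assms(1) group_algebra_closed(2)[OF pm_closed[OF assms(2)]], of q] cls_smult[OF pm_closed[OF assms(2)], of q] by simp

lemma cls_mult:
  assumes "x \<in> N2" "y \<in> N2"
  shows "cls (point_mass (x \<otimes> y)) = cls (point_mass x) \<oplus>\<^bsub>HH\<^esub> cls (point_mass y)"
proof -
  let ?b = "\<lambda>z. point_mass y z - point_mass (x \<otimes> y) z + point_mass x z"
  have "?b \<in> BB" using BB_boundary[OF assms, of 1] by simp
  then have "cls ?b = \<zero>\<^bsub>HH\<^esub>" by (rule cls_boundary)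
  moreover have "(\<lambda>z. point_mass (x \<otimes> y) z + ?b z) = (\<lambda>z. point_mass x z + point_mass y z)" by auto
  ultimately show ?thesis
    using cls_add[OF pm_closed[OF N2_mult[OF assms]] boundary_closed[OF assms]] cls_add[OF pm_closed[OF assms(1)] pm_closed[OF assms(2)]]
      cls_closed[OF pm_closed[OF N2_mult[OF assms]]] by simp
qed

lemma cls_inner:
  assumes n: "n \<in> N2" and x: "x \<in> N2"
  shows "cls (point_mass (n \<otimes> x \<otimes> inv n)) = cls (point_mass x)"
proof -
  have "cls (point_mass (n \<otimes> x \<otimes> inv n \<otimes> n)) = cls (point_mass (n \<otimes> x \<otimes> inv n)) \<oplus>\<^bsub>HH\<^esub> cls (point_mass n)"
    by (intro cls_mult N2_mult N2_inv n x)
  moreover have "n \<otimes> x \<otimes> inv n \<otimes> n = n \<otimes> x" using n x by (simp add: m_assoc)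
  moreover have "cls (point_mass (n \<otimes> x)) = cls (point_mass x) \<oplus>\<^bsub>HH\<^esub> cls (point_mass n)"
    using cls_mult[OF n x] cls_closed[OF pm_closed[OF n]] cls_closed[OF pm_closed[OF x]] by (simp add: HH.a_comm)
  moreover have "n \<otimes> x \<otimes> inv n \<in> N2" by (intro N2_mult N2_inv n x)
  ultimately show ?thesis
    using HH.add.right_cancel[of "cls (point_mass n)" "cls (point_mass (n \<otimes> x \<otimes> inv n))" "cls (point_mass x)"]
      cls_closed[OF pm_closed] n x by simp
qed

definition linear_HH :: "(('a \<Rightarrow> rat) set \<Rightarrow> ('a \<Rightarrow> rat) set) \<Rightarrow> bool" where
  "linear_HH f \<longleftrightarrow> (\<forall>X\<in>carrier HH. f X \<in> carrier HH) \<and> (\<forall>X\<in>carrier HH. \<forall>Y\<in>carrier HH. f (X \<oplus>\<^bsub>HH\<^esub> Y) = f X \<oplus>\<^bsub>HH\<^esub> f Y)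
     \<and> (\<forall>q. \<forall>X\<in>carrier HH. f (q \<odot>\<^bsub>HH\<^esub> X) = q \<odot>\<^bsub>HH\<^esub> f X)"

lemma linear_HH_comp: "linear_HH f \<Longrightarrow> linear_HH f' \<Longrightarrow> linear_HH (\<lambda>X. f (f' X))"
  by (simp add: linear_HH_def)

lemma linear_HH_zero: "linear_HH f \<Longrightarrow> f \<zero>\<^bsub>HH\<^esub> = \<zero>\<^bsub>HH\<^esub>"
  by (rule additive_zero[OF HH.abelian_group_axioms HH.abelian_group_axioms]) (auto simp: linear_HH_def)

text \<open>The homology is spanned by the classes of single group elements; equalities of operators
  thereby become equalities of words.\<close>

lemma linear_HH_ext:
  assumes "linear_HH f" "linear_HH f'" "\<And>x. x \<in> N2 \<Longrightarrow> f (cls (point_mass x)) = f' (cls (point_mass x))"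
    and X: "X \<in> carrier HH"
  shows "f X = f' X"
proof -
  obtain u where u: "u \<in> carrier GA" "X = cls u" using X by (auto simp: HH_carrier)
  have "f (cls u) = f' (cls u)" using u(1)
  proof (induction rule: group_algebra_induct)
    case zero show ?case using linear_HH_zero[OF assms(1)] linear_HH_zero[OF assms(2)] by (simp add: cls_zero)
  next
    case (add u h q)
    then have h: "h \<in> N2" by (simp add: G2_simps)
    have "cls u \<in> carrier HH" "cls (point_mass h) \<in> carrier HH" using add h cls_closed pm_closed by auto
    then show ?case using add assms h by (simp add: cls_step linear_HH_def)
  qed
  then show ?thesis using u by simp
qed

lemma push_BB:
  assumes \<phi>: "endo \<phi>" and u: "u \<in> BB"
  shows "push_chain \<phi> u \<in> BB"
proof (rule span_map[OF group_algebra_abelian_group group_algebra_abelian_group BB_gen_closed, where f = "push_chain \<phi>" and H = BB])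
  fix r :: rat and b assume "b \<in> {(\<lambda>z. point_mass y z - point_mass (x \<otimes>\<^bsub>G2\<^esub> y) z + point_mass x z) | x y. x \<in> carrier G2 \<and> y \<in> carrier G2}"
  then obtain x y where xy: "x \<in> N2" "y \<in> N2" and b: "b = (\<lambda>z. point_mass y z - point_mass (x \<otimes> y) z + point_mass x z)"
    by (auto simp: G2_simps)
  have f: "finite (supp (point_mass z))" for z :: 'a by (simp add: supp_simps)
  have f0: "finite (supp (\<lambda>_ :: 'a. 0))" by (simp add: supp_simps)
  have "r \<odot>\<^bsub>GA\<^esub> b = (\<lambda>z. ((0 + r * point_mass y z) + (- r) * point_mass (x \<otimes> y) z) + r * point_mass x z)"
    by (auto simp: group_algebra_simps(5) b algebra_simps)
  then have "push_chain \<phi> (r \<odot>\<^bsub>GA\<^esub> b) = (\<lambda>z. ((0 + r * point_mass (\<phi> y) z) + (- r) * point_mass (\<phi> (x \<otimes> y)) z) + r * point_mass (\<phi> x) z)"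
    using f f0 finsupp_add[OF f0 finsupp_scale[OF f, of r y]]
      finsupp_add[OF finsupp_add[OF f0 finsupp_scale[OF f, of r y]] finsupp_scale[OF f, of "-r" "x \<otimes> y"]]
    by (simp only: push_chain_add push_chain_point push_chain_zero)
  also have "\<dots> = (\<lambda>z. r * (point_mass (\<phi> y) z - point_mass (\<phi> x \<otimes> \<phi> y) z + point_mass (\<phi> x) z))"
    using \<phi> xy by (auto simp: endo_def algebra_simps)
  finally show "push_chain \<phi> (r \<odot>\<^bsub>GA\<^esub> b) \<in> BB" using BB_boundary[of "\<phi> x" "\<phi> y" r] \<phi> xy by (auto simp: endo_def)
next
  fix u assume "u \<in> carrier GA"
  then show "push_chain \<phi> u \<in> carrier GA" using \<phi> by (intro push_chain_closed[of u G2]) (auto simp: G2_simps endo_def)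
next
  fix u v assume "u \<in> carrier GA" "v \<in> carrier GA"
  then show "push_chain \<phi> (u \<oplus>\<^bsub>GA\<^esub> v) = push_chain \<phi> u \<oplus>\<^bsub>GA\<^esub> push_chain \<phi> v"
    using push_chain_add[of u v \<phi> 1] by (simp add: group_algebra_simps)
qed (use u BB_add_closed in \<open>auto simp: bar_boundaries_def\<close>)

lemma push_closed: "endo \<phi> \<Longrightarrow> u \<in> carrier GA \<Longrightarrow> push_chain \<phi> u \<in> carrier GA"
  by (rule push_chain_closed[of u G2]) (auto simp: G2_simps endo_def)

lemma H1_map_cls:
  assumes \<phi>: "endo \<phi>" and u: "u \<in> carrier GA"
  shows "group_H1_map G2 \<phi> (cls u) = cls (push_chain \<phi> u)"
proof -
  have "cls (push_chain \<phi> v) = cls (push_chain \<phi> u)" if v: "v \<in> cls u" for v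
  proof -
    obtain b where b: "b \<in> BB" "v = (\<lambda>x. b x + u x)"
      using v by (auto simp: cls_def a_r_coset_def' group_algebra_simps(4))
    have bc: "b \<in> carrier GA" using b BB_add_closed by (auto simp: add_closed_def)
    have "push_chain \<phi> v = (\<lambda>y. push_chain \<phi> b y + push_chain \<phi> u y)"
      using push_chain_add[of b u \<phi> 1] bc u b by (simp add: group_algebra_simps)
    then show ?thesis
      using cls_add[OF push_closed[OF \<phi> bc] push_closed[OF \<phi> u]] cls_boundary[OF push_BB[OF \<phi> b(1)]]
        cls_closed[OF push_closed[OF \<phi> u]] by simp
  qed
  moreover have "u \<in> cls u"
    using u HQ.N_zero by (auto simp: cls_def a_r_coset_def' group_algebra_simps(2,4) intro: bexI[of _ "\<lambda>_. 0"])
  ultimately have "(\<Union>v\<in>cls u. cls (push_chain \<phi> v)) = cls (push_chain \<phi> u)" by (intro SUP_eq_const) blast+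
  then show ?thesis by (simp add: group_H1_map_def cls_def)
qed

lemma H1_map_point: "endo \<phi> \<Longrightarrow> x \<in> N2 \<Longrightarrow> group_H1_map G2 \<phi> (cls (point_mass x)) = cls (point_mass (\<phi> x))"
  by (simp add: H1_map_cls pm_closed push_chain_point)

lemma H1_map_linear:
  assumes \<phi>: "endo \<phi>" shows "linear_HH (group_H1_map G2 \<phi>)"
  unfolding linear_HH_def
proof (intro conjI ballI allI)
  fix X assume "X \<in> carrier HH"
  then obtain u where u: "u \<in> carrier GA" "X = cls u" by (auto simp: HH_carrier)
  show "group_H1_map G2 \<phi> X \<in> carrier HH" using u H1_map_cls[OF \<phi> u(1)] cls_closed push_closed[OF \<phi>] by simp
  show "group_H1_map G2 \<phi> (q \<odot>\<^bsub>HH\<^esub> X) = q \<odot>\<^bsub>HH\<^esub> group_H1_map G2 \<phi> X" for q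
  proof -
    have "push_chain \<phi> (\<lambda>x. q * u x) = (\<lambda>y. q * push_chain \<phi> u y)"
      using push_chain_add[of "\<lambda>_. 0" u \<phi> q] u by (simp add: push_chain_zero supp_simps group_algebra_simps)
    then show ?thesis
      using H1_map_cls[OF \<phi> u(1)] H1_map_cls[OF \<phi> group_algebra_closed(2)[OF u(1)], of q] u(2)
        cls_smult[OF u(1), of q] cls_smult[OF push_closed[OF \<phi> u(1)], of q] by simp
  qed
  fix Y assume "Y \<in> carrier HH"
  then obtain v where v: "v \<in> carrier GA" "Y = cls v" by (auto simp: HH_carrier)
  have "push_chain \<phi> (\<lambda>x. u x + v x) = (\<lambda>y. push_chain \<phi> u y + push_chain \<phi> v y)"
    using push_chain_add[of u v \<phi> 1] u v by (simp add: group_algebra_simps)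
  then show "group_H1_map G2 \<phi> (X \<oplus>\<^bsub>HH\<^esub> Y) = group_H1_map G2 \<phi> X \<oplus>\<^bsub>HH\<^esub> group_H1_map G2 \<phi> Y"
    using H1_map_cls[OF \<phi> u(1)] H1_map_cls[OF \<phi> v(1)] H1_map_cls[OF \<phi> group_algebra_closed(1)[OF u(1) v(1)]] u(2) v(2)
      cls_add[OF u(1) v(1)] cls_add[OF push_closed[OF \<phi> u(1)] push_closed[OF \<phi> v(1)]] by simp
qed

lemma endo_conj: "y \<in> carrier G \<Longrightarrow> endo (\<lambda>x. y \<otimes> x \<otimes> inv y)"
  using N2_conj by (auto simp: endo_def word_simps)

lemma endo_hom: "\<psi> \<in> hom G G \<Longrightarrow> endo \<psi>"
  using hom_lower_central_2 by (simp add: endo_def hom_mult)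

lemma ab_carrier: "h \<in> carrier (abelianization G) \<longleftrightarrow> (\<exists>y\<in>carrier G. h = N2 #> y)"
  by (auto simp: abelianization_def FactGroup_def RCOSETS_def)

lemma ab_group: "group (abelianization G)"
  unfolding abelianization_def by (rule normal.factorgroup_is_group[OF lower_central_2_normal])

lemma ab_mult: "x \<in> carrier G \<Longrightarrow> y \<in> carrier G \<Longrightarrow> (N2 #> x) \<otimes>\<^bsub>abelianization G\<^esub> (N2 #> y) = N2 #> (x \<otimes> y)"
  unfolding abelianization_def FactGroup_def by (simp add: normal.rcos_sum[OF lower_central_2_normal])

lemma ab_one: "\<one>\<^bsub>abelianization G\<^esub> = N2 #> \<one>"
proof -
  have "N2 #> \<one> = N2" by (rule coset_mult_one) auto
  then show ?thesis by (simp add: abelianization_def FactGroup_def)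
qed

text \<open>Two representatives of a coset differ by an element of the commutator subgroup, whose
  conjugation is trivial on homology, so that the union in the definition has a single
  value.\<close>

lemma conjugation_action_eq:
  assumes y: "y \<in> carrier G" and X: "X \<in> carrier HH"
  shows "conjugation_action G (N2 #> y) X = group_H1_map G2 (\<lambda>x. y \<otimes> x \<otimes> inv y) X"
proof -
  have "group_H1_map G2 (\<lambda>x. z \<otimes> x \<otimes> inv z) X = group_H1_map G2 (\<lambda>x. y \<otimes> x \<otimes> inv y) X" if z: "z \<in> N2 #> y" for z
  proof -
    obtain n where n: "n \<in> N2" "z = n \<otimes> y" using z by (auto simp: r_coset_def)
    then have zc: "z \<in> carrier G" using y by simp
    show ?thesis
    proof (rule linear_HH_ext[OF H1_map_linear[OF endo_conj[OF zc]] H1_map_linear[OF endo_conj[OF y]] _ X])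
      fix x assume x: "x \<in> N2"
      have "z \<otimes> x \<otimes> inv z = n \<otimes> (y \<otimes> x \<otimes> inv y) \<otimes> inv n" using n y x by (simp add: word_simps)
      then show "group_H1_map G2 (\<lambda>x. z \<otimes> x \<otimes> inv z) (cls (point_mass x)) = group_H1_map G2 (\<lambda>x. y \<otimes> x \<otimes> inv y) (cls (point_mass x))"
        using cls_inner[OF n(1) N2_conj[OF y x]] H1_map_point[OF endo_conj[OF zc] x] H1_map_point[OF endo_conj[OF y] x] by simp
    qed
  qed
  moreover have "y \<in> N2 #> y" using y N2_one by (auto simp: r_coset_def intro!: bexI[of _ \<one>])
  ultimately have "(\<Union>z\<in>N2 #> y. group_H1_map G2 (\<lambda>x. z \<otimes> x \<otimes> inv z) X) = group_H1_map G2 (\<lambda>x. y \<otimes> x \<otimes> inv y) X"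
    by (intro SUP_eq_const) blast+
  then show ?thesis by (simp add: conjugation_action_def)
qed

lemma linear_rat_rep:
  assumes "\<And>h. h \<in> carrier K \<Longrightarrow> linear_HH (\<rho> h)"
  shows "rat_rep HH K \<rho>"
  using assms HH_smult_1 by (intro rat_rep.intro HH_premodule rat_rep_axioms.intro) (auto simp: linear_HH_def)

lemma conjugation_linear: "h \<in> carrier (abelianization G) \<Longrightarrow> linear_HH (conjugation_action G h)"
  using H1_map_linear[OF endo_conj] by (auto simp: ab_carrier linear_HH_def conjugation_action_eq)

end

sublocale h1_group \<subseteq> AR: rat_rep HH "abelianization G" "conjugation_action G"
  by (rule linear_rat_rep[OF conjugation_linear])

context h1_group
begin

lemma conjugation_point:
  "y \<in> carrier G \<Longrightarrow> x \<in> N2 \<Longrightarrow> conjugation_action G (N2 #> y) (cls (point_mass x)) = cls (point_mass (y \<otimes> x \<otimes> inv y))"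
  by (simp add: conjugation_action_eq cls_closed pm_closed H1_map_point endo_conj)

lemma conjugation_mult:
  assumes "h \<in> carrier (abelianization G)" "k \<in> carrier (abelianization G)" "X \<in> carrier HH"
  shows "conjugation_action G (h \<otimes>\<^bsub>abelianization G\<^esub> k) X = conjugation_action G h (conjugation_action G k X)"
proof -
  obtain y z where yz: "y \<in> carrier G" "z \<in> carrier G" "h = N2 #> y" "k = N2 #> z" using assms by (auto simp: ab_carrier)
  have c: "N2 #> (y \<otimes> z) \<in> carrier (abelianization G)" using yz by (auto simp: ab_carrier)
  show ?thesis
    unfolding yz ab_mult[OF yz(1,2)]
  proof (rule linear_HH_ext[OF conjugation_linear[OF c] linear_HH_comp[OF conjugation_linear conjugation_linear] _ assms(3)])
    fix x assume x: "x \<in> N2"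
    have "y \<otimes> z \<otimes> x \<otimes> inv (y \<otimes> z) = y \<otimes> (z \<otimes> x \<otimes> inv z) \<otimes> inv y" using yz x by (simp add: word_simps)
    then show "conjugation_action G (N2 #> (y \<otimes> z)) (cls (point_mass x)) =
      conjugation_action G (N2 #> y) (conjugation_action G (N2 #> z) (cls (point_mass x)))"
      using yz x N2_conj by (simp add: conjugation_point)
  qed (use assms yz in auto)
qed

lemma alexander_premodule:
  "premodule (carrier (group_algebra (abelianization G))) (add (group_algebra (abelianization G)))
     (monoid.mult (group_algebra (abelianization G))) (alexander_module G)"
  unfolding alexander_module_def by (rule AR.W_premodule[OF group.is_monoid[OF ab_group] conjugation_mult])

end

section \<open>Functionals on the coinvariants\<close>

text \<open>A basis of \<open>L\<close> stays independent after \<open>w\<close> is added, so a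
  functional may be prescribed on both. It is defined on all functions, which keeps carriers and
  quotient spaces out of the argument.\<close>

lemma rational_separation:
  fixes L :: "('a \<Rightarrow> rat) set"
  assumes z: "(\<lambda>_. 0) \<in> L" and L: "\<And>u v q. u \<in> L \<Longrightarrow> v \<in> L \<Longrightarrow> (\<lambda>x. u x + q * v x) \<in> L" and w: "w \<notin> L"
  obtains l :: "('a \<Rightarrow> rat) \<Rightarrow> rat" where "\<And>u v q. l (\<lambda>x. u x + q * v x) = l u + q * l v"
    "\<And>u. u \<in> L \<Longrightarrow> l u = 0" "l w \<noteq> 0"
proof -
  define sc where "sc = (\<lambda>q (u :: 'a \<Rightarrow> rat) x. q * u x)"
  interpret vp: vector_space_pair sc "(*) :: rat \<Rightarrow> rat \<Rightarrow> rat"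
    by unfold_locales (auto simp: sc_def fun_eq_iff algebra_simps)
  have pw: "(\<lambda>x. u x + q * v x) = u + sc q v" for u v q by (auto simp: sc_def fun_eq_iff)
  have L0: "vp.vs1.subspace L"
  proof (rule vp.vs1.subspaceI)
    show "0 \<in> L" using z by (simp add: zero_fun_def)
    show "u + v \<in> L" if "u \<in> L" "v \<in> L" for u v using L[OF that, of 1] by (simp add: plus_fun_def)
    show "sc q u \<in> L" if "u \<in> L" for q u using L[OF z that, of q] by (simp add: sc_def)
  qed
  obtain B where B: "B \<subseteq> L" "vp.vs1.independent B" "L \<subseteq> vp.vs1.span B"
    using vp.vs1.maximal_independent_subset by blast
  have "vp.vs1.span B \<subseteq> L" by (rule vp.vs1.span_minimal[OF B(1) L0])
  then have "w \<notin> vp.vs1.span B" using w by blast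
  then have ind: "vp.vs1.independent (insert w B)" by (rule vp.vs1.independent_insertI[OF _ B(2)])
  obtain l where l: "Vector_Spaces.linear sc (*) l" "\<forall>x\<in>insert w B. l x = (if x = w then 1 else 0)"
    using vp.linear_independent_extend[OF ind, of "\<lambda>x. if x = w then 1 else 0"] by blast
  interpret l: Vector_Spaces.linear sc "(*)" l by (rule l(1))
  show ?thesis
  proof (rule that)
    show "l (\<lambda>x. u x + q * v x) = l u + q * l v" for u v q unfolding pw by (simp add: l.add l.scale)
    show "l w \<noteq> 0" using l(2) by simp
    fix u assume "u \<in> L"
    then have "u \<in> vp.vs1.span B" using B by blast
    moreover have "vp.vs1.subspace {u. l u = 0}" by (rule l.subspace_kernel)
    moreover have "B \<subseteq> {u. l u = 0}" using l(2) w B(1) by auto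
    ultimately show "l u = 0" using vp.vs1.span_minimal by blast
  qed
qed

lemma augmentation_sum:
  assumes "finite (supp u)"
  shows "(\<Sum>x\<in>supp (\<lambda>x. u x + q * point_mass h x). u x + q * point_mass h x) = (\<Sum>x\<in>supp u. u x) + q"
proof -
  let ?A = "insert h (supp u)"
  have A: "finite ?A" "supp (\<lambda>x. u x + q * point_mass h x) \<subseteq> ?A" using assms by (auto simp: supp_def point_mass_def)
  have "(\<Sum>x\<in>supp (\<lambda>x. u x + q * point_mass h x). u x + q * point_mass h x) = (\<Sum>x\<in>?A. u x + q * point_mass h x)"
    by (rule sum.mono_neutral_left[OF A]) (auto simp: supp_def)
  also have "\<dots> = (\<Sum>x\<in>?A. u x) + (\<Sum>x\<in>?A. if x = h then q else 0)"
    by (simp only: sum.distrib[symmetric]) (rule sum.cong, auto simp: point_mass_def)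
  also have "(\<Sum>x\<in>?A. u x) = (\<Sum>x\<in>supp u. u x)"
    by (rule sum.mono_neutral_right) (use assms in \<open>auto simp: supp_def\<close>)
  finally show ?thesis using A(1) by simp
qed

lemma augmentation_scale: "u \<in> augmentation_ideal H \<Longrightarrow> (\<lambda>x. q * u x) \<in> augmentation_ideal H"
proof -
  assume u: "u \<in> augmentation_ideal H"
  then have "finite (supp u)" by (auto simp: augmentation_ideal_def group_algebra_simps)
  then have "(\<Sum>x\<in>supp (\<lambda>x. q * u x). q * u x) = (\<Sum>x\<in>supp u. q * u x)"
    by (intro sum.mono_neutral_left supp_simps(4)) (auto simp: supp_def)
  then show ?thesis using u by (simp add: augmentation_ideal_def group_algebra_closed flip: sum_distrib_left)
qed

lemma augmentation_diff:
  assumes "h \<in> carrier H" "k \<in> carrier H"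
  shows "(\<lambda>x. point_mass h x + (-1) * point_mass k x) \<in> augmentation_ideal H"
proof -
  have "finite (supp (point_mass h))" by (simp add: supp_simps)
  from augmentation_sum[OF this, of "-1" k]
  have "(\<Sum>x\<in>supp (\<lambda>x. point_mass h x + (-1) * point_mass k x). point_mass h x + (-1) * point_mass k x) = 0"
    by (simp add: supp_simps(2)) (simp add: point_mass_def)
  then show ?thesis
    unfolding augmentation_ideal_def using group_algebra_closed(1)[OF group_algebra_closed(3)[OF assms(1)]
      group_algebra_closed(2)[OF group_algebra_closed(3)[OF assms(2)], of "-1"]] by blast
qed

section \<open>Coinvariants of a group that acts trivially on the abelianization\<close>

locale torelli_coinvariants = h1_group G for G (structure) +
  fixes K :: "('k, 'n) monoid_scheme" and act :: "'k \<Rightarrow> 'a \<Rightarrow> 'a"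
  assumes act_hom: "k \<in> carrier K \<Longrightarrow> act k \<in> hom G G"
    and act_triv: "k \<in> carrier K \<Longrightarrow> x \<in> carrier G \<Longrightarrow> act k x \<otimes> inv x \<in> N2"
    and one_K: "\<one>\<^bsub>K\<^esub> \<in> carrier K"
    and act_one: "x \<in> N2 \<Longrightarrow> act \<one>\<^bsub>K\<^esub> x = x"
begin

abbreviation "JM \<equiv> group_algebra_module HH (\<lambda>k. group_H1_map G2 (act k))"
abbreviation "LL \<equiv> module_span JM (augmentation_ideal K) (carrier JM)"
abbreviation "AM \<equiv> alexander_module G"
abbreviation "CM \<equiv> quotient_module AM LL"
abbreviation "R \<equiv> group_algebra (abelianization G)"
abbreviation "I \<equiv> augmentation_ideal (abelianization G)"
abbreviation "J \<equiv> ideal_power R I"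
abbreviation "F k \<equiv> adic_filtration (abelianization G) CM k"

lemma KR: "rat_rep HH K (\<lambda>k. group_H1_map G2 (act k))"
  by (rule linear_rat_rep[OF H1_map_linear[OF endo_hom[OF act_hom]]])

lemma AM_eq: "AM = group_algebra_module HH (conjugation_action G)" by (simp add: alexander_module_def)

lemma AM_simps: "carrier AM = carrier HH" "\<zero>\<^bsub>AM\<^esub> = \<zero>\<^bsub>HH\<^esub>" "x \<oplus>\<^bsub>AM\<^esub> y = x \<oplus>\<^bsub>HH\<^esub> y"
  by (simp_all add: AM_eq AR.W_simps)

lemma JM_simps: "carrier JM = carrier HH" "\<zero>\<^bsub>JM\<^esub> = \<zero>\<^bsub>HH\<^esub>" "x \<oplus>\<^bsub>JM\<^esub> y = x \<oplus>\<^bsub>HH\<^esub> y"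
  by (simp_all add: group_algebra_module_def)

lemma I_carrier: "u \<in> I \<Longrightarrow> u \<in> carrier R" by (simp add: augmentation_ideal_def)

text \<open>Negation refers to a whole record, and the homology occurs in several records with the
  same underlying group.\<close>

lemma minus_eq:
  assumes "abelian_group W" "carrier W = carrier HH" "\<zero>\<^bsub>W\<^esub> = \<zero>\<^bsub>HH\<^esub>" "\<And>x y. x \<oplus>\<^bsub>W\<^esub> y = x \<oplus>\<^bsub>HH\<^esub> y" "x \<in> carrier HH"
  shows "\<ominus>\<^bsub>W\<^esub> x = \<ominus>\<^bsub>HH\<^esub> x"
proof -
  interpret W: abelian_group W by fact
  show ?thesis using W.l_neg[of x] W.a_inv_closed[of x] assms HH.minus_equality[of "\<ominus>\<^bsub>W\<^esub> x" x] by simp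
qed

lemma JM_abelian: "abelian_group JM" by (rule rat_rep.W_abelian_group[OF KR])

lemma AM_abelian: "abelian_group AM" unfolding AM_eq by (rule AR.W_abelian_group)

lemma LL_gen: "r \<in> augmentation_ideal K \<Longrightarrow> x \<in> carrier JM \<Longrightarrow> r \<odot>\<^bsub>JM\<^esub> x \<in> carrier JM"
  using rat_rep.W_smult_closed[OF KR, of r x] by (simp add: JM_simps augmentation_ideal_def)

lemma LL_add_closed: "add_closed AM LL"
proof -
  have "add_closed JM LL" by (rule span_add_closed[OF JM_abelian LL_gen])
  moreover have "\<ominus>\<^bsub>AM\<^esub> x = \<ominus>\<^bsub>JM\<^esub> x" if "x \<in> carrier HH" for x
    using minus_eq[OF AM_abelian AM_simps that] minus_eq[OF JM_abelian JM_simps that] by simp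
  ultimately show ?thesis unfolding add_closed_def AM_simps JM_simps by (auto simp: subset_iff)
qed

text \<open>Here triviality of \<open>K\<close> on the abelianization enters: y and
  \<open>act k y\<close> lie in one coset, so that conjugation by either of them represents
  h.\<close>

lemma conj_act_commute:
  assumes k: "k \<in> carrier K" and h: "h \<in> carrier (abelianization G)" and X: "X \<in> carrier HH"
  shows "conjugation_action G h (group_H1_map G2 (act k) X) = group_H1_map G2 (act k) (conjugation_action G h X)"
proof -
  note e = endo_hom[OF act_hom[OF k]]
  show ?thesis
  proof (rule linear_HH_ext[OF linear_HH_comp[OF conjugation_linear[OF h] H1_map_linear[OF e]]
        linear_HH_comp[OF H1_map_linear[OF e] conjugation_linear[OF h]] _ X])
    fix x assume x: "x \<in> N2"
    obtain y where y: "y \<in> carrier G" "h = N2 #> y" using h by (auto simp: ab_carrier)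
    have yc: "act k y \<in> carrier G" "act k x \<in> N2" using act_hom[OF k] y x e by (auto simp: hom_def endo_def)
    have "act k y = (act k y \<otimes> inv y) \<otimes> y" using y yc by (simp add: m_assoc)
    then have "act k y \<in> N2 #> y" using act_triv[OF k y(1)] unfolding r_coset_def by blast
    then have h': "h = N2 #> act k y"
      unfolding y(2) by (rule repr_independence[OF _ y(1) normal_imp_subgroup[OF lower_central_2_normal]])
    interpret ak: group_hom G G "act k" by (rule hom_group_hom[OF act_hom[OF k]])
    have "conjugation_action G h (group_H1_map G2 (act k) (cls (point_mass x))) = cls (point_mass (act k y \<otimes> act k x \<otimes> inv (act k y)))"
      unfolding H1_map_point[OF e x] h' by (rule conjugation_point[OF yc])
    also have "act k y \<otimes> act k x \<otimes> inv (act k y) = act k (y \<otimes> x \<otimes> inv y)" using y x by simp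
    also have "cls (point_mass (act k (y \<otimes> x \<otimes> inv y))) = group_H1_map G2 (act k) (conjugation_action G h (cls (point_mass x)))"
      unfolding y(2) conjugation_point[OF y(1) x] by (rule H1_map_point[OF e N2_conj[OF y(1) x], symmetric])
    finally show "conjugation_action G h (group_H1_map G2 (act k) (cls (point_mass x))) =
       group_H1_map G2 (act k) (conjugation_action G h (cls (point_mass x)))" .
  qed
qed

text \<open>The two group algebras commute on the homology, so r carries a generator u m to the
  generator u (r m).\<close>

lemma LL_smult:
  assumes r: "r \<in> carrier R" and x: "x \<in> LL"
  shows "r \<odot>\<^bsub>AM\<^esub> x \<in> LL"
proof (rule span_map[OF JM_abelian AM_abelian LL_gen, where f = "\<lambda>x. r \<odot>\<^bsub>AM\<^esub> x" and H = LL])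
  note cl = AR.W_smult_closed[OF r, folded AM_eq]
  show "r \<odot>\<^bsub>AM\<^esub> x \<in> carrier AM" if "x \<in> carrier JM" for x using cl that by (simp add: AM_simps JM_simps)
  show "r \<odot>\<^bsub>AM\<^esub> (x \<oplus>\<^bsub>JM\<^esub> y) = r \<odot>\<^bsub>AM\<^esub> x \<oplus>\<^bsub>AM\<^esub> r \<odot>\<^bsub>AM\<^esub> y" if "x \<in> carrier JM" "y \<in> carrier JM" for x y
    using AR.W_r_distr[OF r, folded AM_eq] that by (simp add: AM_simps JM_simps)
  fix u m assume u: "u \<in> augmentation_ideal K" and "m \<in> carrier JM"
  then have m: "m \<in> carrier HH" and uc: "u \<in> carrier (group_algebra K)" by (simp_all add: JM_simps augmentation_ideal_def)
  note Kc = rat_rep.W_smult_closed[OF KR uc] and Kd = rat_rep.W_r_distr[OF KR uc] and Ks = rat_rep.W_smult_smult(2)[OF KR uc]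
  have c: "u \<odot>\<^bsub>JM\<^esub> conjugation_action G h m = conjugation_action G h (u \<odot>\<^bsub>JM\<^esub> m)" if h: "h \<in> carrier (abelianization G)" for h
  proof (rule sym, rule rat_rep.W_linear[OF KR _ _ _ _ m _ uc])
    show "conjugation_action G h m \<in> carrier HH" using conjugation_linear[OF h] m by (simp add: linear_HH_def)
    show "conjugation_action G h (group_H1_map G2 (act k) m) = group_H1_map G2 (act k) (conjugation_action G h m)" if "k \<in> carrier K" for k
      by (rule conj_act_commute[OF that h m])
  qed (use conjugation_linear[OF h] in \<open>auto simp: linear_HH_def\<close>)
  have "u \<odot>\<^bsub>JM\<^esub> (r \<odot>\<^bsub>AM\<^esub> m) = r \<odot>\<^bsub>AM\<^esub> (u \<odot>\<^bsub>JM\<^esub> m)"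
    unfolding AM_eq by (rule AR.W_linear[OF Kc Kd Ks c m Kc[OF m] r])
  then show "r \<odot>\<^bsub>AM\<^esub> (u \<odot>\<^bsub>JM\<^esub> m) \<in> LL"
    using span_incl[OF u, of "r \<odot>\<^bsub>AM\<^esub> m" "carrier JM" JM] cl[OF m] by (simp add: JM_simps)
qed (use x LL_add_closed in auto)

lemma AMQ: "quotient_premodule (carrier R) (add R) (monoid.mult R) AM LL"
  by (rule quotient_premodule.intro[OF alexander_premodule quotient_premodule_axioms.intro[OF LL_add_closed LL_smult]])

lemma CM_premodule: "premodule (carrier R) (add R) (monoid.mult R) CM"
  by (rule quotient_premodule.Q_premodule[OF AMQ])

end

sublocale torelli_coinvariants \<subseteq> CM: premodule "carrier R" "add R" "monoid.mult R" CM
  by (rule CM_premodule)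

context torelli_coinvariants
begin

definition P :: "('a \<Rightarrow> rat) \<Rightarrow> ('a \<Rightarrow> rat) set set" where
  "P u = LL +>\<^bsub>AM\<^esub> cls u"

definition D :: "'a set \<Rightarrow> 'a set \<Rightarrow> rat" where
  "D h = (\<lambda>x. point_mass h x + (-1) * point_mass \<one>\<^bsub>abelianization G\<^esub> x)"

text \<open>The coinvariants carry scalars from the group algebra only; a rational number acts
  through its multiple of the unit.\<close>

abbreviation one_scaled :: "rat \<Rightarrow> 'a set \<Rightarrow> rat" where
  "one_scaled q \<equiv> (\<lambda>x. q * point_mass \<one>\<^bsub>abelianization G\<^esub> x)"

lemma ab_one_closed: "\<one>\<^bsub>abelianization G\<^esub> \<in> carrier (abelianization G)"
  using ab_group by (rule group.is_monoid[THEN monoid.one_closed])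

lemma os_closed: "one_scaled q \<in> carrier R"
  by (rule group_algebra_closed(2)[OF group_algebra_closed(3)[OF ab_one_closed]])

lemma D_I: "h \<in> carrier (abelianization G) \<Longrightarrow> D h \<in> I"
  unfolding D_def by (rule augmentation_diff[OF _ ab_one_closed])

lemma ab_monoid: "monoid (abelianization G)" by (rule group.is_monoid[OF ab_group])

lemma CM_carrier: "carrier CM = P ` carrier GA"
  using quotient_premodule.Q_carrier[OF AMQ] HH_carrier AM_simps(1) by (auto simp: P_def)

lemma P_closed: "u \<in> carrier GA \<Longrightarrow> P u \<in> carrier CM" by (simp add: CM_carrier)

lemma P_add: "u \<in> carrier GA \<Longrightarrow> v \<in> carrier GA \<Longrightarrow> P (\<lambda>x. u x + v x) = P u \<oplus>\<^bsub>CM\<^esub> P v"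
  using quotient_premodule.Q_add[OF AMQ, of "cls u" "cls v"] cls_add[of u v] by (simp add: P_def AM_simps cls_closed)

lemma P_smult: "r \<in> carrier R \<Longrightarrow> u \<in> carrier GA \<Longrightarrow> r \<odot>\<^bsub>CM\<^esub> P u = LL +>\<^bsub>AM\<^esub> (r \<odot>\<^bsub>AM\<^esub> cls u)"
  using quotient_premodule.Q_smult[OF AMQ, of r "cls u"] by (simp add: P_def AM_simps cls_closed)

lemma conj_one: "X \<in> carrier HH \<Longrightarrow> conjugation_action G \<one>\<^bsub>abelianization G\<^esub> X = X"
proof (rule linear_HH_ext[OF conjugation_linear[OF ab_one_closed], of "\<lambda>X. X"])
  fix x assume "x \<in> N2"
  then show "conjugation_action G \<one>\<^bsub>abelianization G\<^esub> (cls (point_mass x)) = cls (point_mass x)"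
    unfolding ab_one by (simp add: conjugation_point)
qed (auto simp: linear_HH_def)

lemma P_scale: "u \<in> carrier GA \<Longrightarrow> P (\<lambda>x. q * u x) = one_scaled q \<odot>\<^bsub>CM\<^esub> P u"
proof -
  assume u: "u \<in> carrier GA"
  have "one_scaled q \<odot>\<^bsub>AM\<^esub> cls u = q \<odot>\<^bsub>HH\<^esub> cls u"
    unfolding AM_eq using AR.W_point_scaled[OF ab_one_closed cls_closed[OF u], of q] conj_one[OF cls_closed[OF u]] by simp
  then show ?thesis unfolding P_smult[OF os_closed u] by (simp add: P_def cls_smult[OF u])
qed

lemma P_lin: "u \<in> carrier GA \<Longrightarrow> v \<in> carrier GA \<Longrightarrow> P (\<lambda>x. u x + q * v x) = P u \<oplus>\<^bsub>CM\<^esub> one_scaled q \<odot>\<^bsub>CM\<^esub> P v"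
  using P_add[of u "\<lambda>x. q * v x"] group_algebra_closed(2)[of v G2 q] by (simp add: P_scale)

lemma P_zero_of_cls: "u \<in> carrier GA \<Longrightarrow> cls u \<in> LL \<Longrightarrow> P u = \<zero>\<^bsub>CM\<^esub>"
  using quotient_premodule.Q_mem_zero[OF AMQ, of "cls u"] by (simp add: P_def)

text \<open>A chain that represents y - 1 applied to the class of \<open>u\<close>.\<close>

definition dchain :: "'a \<Rightarrow> ('a \<Rightarrow> rat) \<Rightarrow> 'a \<Rightarrow> rat" where
  "dchain y u = (\<lambda>z. push_chain (\<lambda>x. y \<otimes> x \<otimes> inv y) u z + (-1) * u z)"

lemma dchain_closed: "y \<in> carrier G \<Longrightarrow> u \<in> carrier GA \<Longrightarrow> dchain y u \<in> carrier GA"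
  unfolding dchain_def by (intro group_algebra_closed push_closed endo_conj)

lemma dchain_lin: "finite (supp u) \<Longrightarrow> finite (supp v) \<Longrightarrow> dchain y (\<lambda>x. u x + q * v x) = (\<lambda>x. dchain y u x + q * dchain y v x)"
  by (auto simp: dchain_def push_chain_add algebra_simps)

lemma dchain_point: "dchain y (point_mass n) = (\<lambda>z. point_mass (y \<otimes> n \<otimes> inv y) z + (-1) * point_mass n z)"
  by (simp add: dchain_def push_chain_point)

lemma P_dchain:
  assumes y: "y \<in> carrier G" and u: "u \<in> carrier GA"
  shows "D (N2 #> y) \<odot>\<^bsub>CM\<^esub> P u = P (dchain y u)"
proof -
  let ?c = "\<lambda>x. y \<otimes> x \<otimes> inv y"
  have h: "N2 #> y \<in> carrier (abelianization G)" using y by (auto simp: ab_carrier)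
  note pc = push_closed[OF endo_conj[OF y] u]
  have "D (N2 #> y) \<odot>\<^bsub>AM\<^esub> cls u = conjugation_action G (N2 #> y) (cls u) \<oplus>\<^bsub>HH\<^esub> (-1) \<odot>\<^bsub>HH\<^esub> cls u"
    unfolding D_def AM_eq
    using AR.W_step[OF group_algebra_closed(3)[OF h] ab_one_closed cls_closed[OF u], of "-1"] conj_one[OF cls_closed[OF u]]
      AR.W_point[OF h cls_closed[OF u]] by simp
  also have "\<dots> = cls (push_chain ?c u) \<oplus>\<^bsub>HH\<^esub> cls (\<lambda>z. (-1) * u z)"
    using conjugation_action_eq[OF y cls_closed[OF u]] H1_map_cls[OF endo_conj[OF y] u] cls_smult[OF u, of "-1"] by simp
  also have "\<dots> = cls (dchain y u)"
    unfolding dchain_def by (rule cls_add[OF pc group_algebra_closed(2)[OF u], symmetric])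
  finally show ?thesis using P_smult[OF I_carrier[OF D_I[OF h]] u] by (simp add: P_def)
qed

lemma J_carrier: "r \<in> J k \<Longrightarrow> r \<in> carrier R"
proof (induction k arbitrary: r)
  case (Suc k)
  from Suc.prems[simplified] show ?case
  proof (induction rule: ideal_prod.induct)
    case (prod i j) then show ?case using Suc.IH I_carrier CM.ml_closed by blast
  next
    case (sum s t) then show ?case using CM.pl_closed by blast
  qed
qed simp

lemma ideal_prod_mono:
  assumes "A \<subseteq> B" "r \<in> ideal_prod R I A"
  shows "r \<in> ideal_prod R I B"
  using assms(2) by (induction rule: ideal_prod.induct) (use assms(1) in \<open>auto intro: ideal_prod.intros\<close>)

lemma J_mono: "J (Suc k) \<subseteq> J k"
proof (induction k)
  case 0 show ?case using J_carrier[of _ 1] by auto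
next
  case (Suc k) show ?case using ideal_prod_mono[OF Suc] by auto
qed

lemma J_scale: "r \<in> J (Suc k) \<Longrightarrow> (\<lambda>x. q * r x) \<in> J (Suc k)"
  unfolding ideal_power.simps
proof (induction rule: ideal_prod.induct)
  case (prod i j)
  have f: "finite (supp i)" "finite (supp j)" using I_carrier[OF prod(1)] J_carrier[OF prod(2)] by (auto simp: group_algebra_simps)
  have "(\<lambda>x. q * i x) \<otimes>\<^bsub>R\<^esub> j = (\<lambda>x. q * (i \<otimes>\<^bsub>R\<^esub> j) x)"
    using group_algebra_mult_l[of "\<lambda>_. 0" i j "abelianization G" q] f by (simp add: supp_simps group_algebra_mult_zero)
  then show ?case using ideal_prod.prod[OF augmentation_scale[OF prod(1), where q = q] prod(2), where R = R] by simp
next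
  case (sum s t)
  then show ?case using ideal_prod.sum[OF sum(3,4)] by (simp add: group_algebra_simps(4) algebra_simps)
qed

lemma F_eq: "F k = module_span CM (J k) (carrier CM)" by (simp add: adic_filtration_def)

lemma F_gen: "r \<in> J k \<Longrightarrow> x \<in> carrier CM \<Longrightarrow> r \<odot>\<^bsub>CM\<^esub> x \<in> carrier CM"
  using J_carrier by simp

lemma F_closed: "add_closed CM (F k)"
  unfolding F_eq by (rule span_add_closed[OF CM.abelian_group_axioms F_gen])

lemma F_incl: "r \<in> J k \<Longrightarrow> x \<in> carrier CM \<Longrightarrow> r \<odot>\<^bsub>CM\<^esub> x \<in> F k"
  unfolding F_eq by (rule span_incl)

lemma F_mono: "F (Suc k) \<subseteq> F k"
proof -
  have "module_span CM (J (Suc k)) (carrier CM) \<subseteq> F k"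
    by (rule span_least[OF CM.abelian_group_axioms F_gen F_closed F_incl]) (use J_mono in blast)+
  then show ?thesis by (simp only: F_eq)
qed

text \<open>An element i (j m) of the next stage has j m in stage k, hence by assumption in stage k
  + 1, and i raises this by one more.\<close>

lemma F_step:
  assumes "F k \<subseteq> F (Suc k)" shows "F (Suc k) \<subseteq> F (Suc (Suc k))"
proof -
  have "r \<odot>\<^bsub>CM\<^esub> m \<in> F (Suc (Suc k))" if r: "r \<in> J (Suc k)" and m: "m \<in> carrier CM" for r m
    using r unfolding ideal_power.simps(2)[of R I k]
  proof (induction rule: ideal_prod.induct)
    case (prod i j)
    have i: "i \<in> carrier R" using prod I_carrier by blast
    have "j \<odot>\<^bsub>CM\<^esub> m \<in> module_span CM (J (Suc k)) (carrier CM)" using assms F_incl[OF prod(2) m] by (auto simp: F_eq)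
    then have "i \<odot>\<^bsub>CM\<^esub> (j \<odot>\<^bsub>CM\<^esub> m) \<in> F (Suc (Suc k))"
    proof (rule span_map[OF CM.abelian_group_axioms CM.abelian_group_axioms F_gen CM.smult_closed[OF i] CM.smult_r_distr[OF i] F_closed, rotated -1])
      fix s x assume s: "s \<in> J (Suc k)" "x \<in> carrier CM"
      have "i \<otimes>\<^bsub>R\<^esub> s \<in> J (Suc (Suc k))"
        using ideal_prod.prod[OF prod(1) s(1)] by simp
      then show "i \<odot>\<^bsub>CM\<^esub> (s \<odot>\<^bsub>CM\<^esub> x) \<in> F (Suc (Suc k))"
        using F_incl[OF _ s(2)] unfolding CM.smult_assoc[OF i J_carrier[OF s(1)] s(2), symmetric] by blast
    qed
    then show ?case using CM.smult_assoc[OF i J_carrier[OF prod(2)] m] by simp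
  next
    case (sum s t)
    have "s \<in> carrier R" "t \<in> carrier R" using sum J_carrier[of _ "Suc k"] by auto
    then show ?case using sum F_closed m by (simp add: CM.smult_l_distr add_closed_def)
  qed
  from span_least[OF CM.abelian_group_axioms F_gen F_closed this] show ?thesis unfolding F_eq .
qed

lemma os_mult: "r \<in> carrier R \<Longrightarrow> one_scaled q \<otimes>\<^bsub>R\<^esub> r = (\<lambda>x. q * r x)" "r \<in> carrier R \<Longrightarrow> r \<otimes>\<^bsub>R\<^esub> one_scaled q = (\<lambda>x. q * r x)"
  using group_algebra_mult_one[OF ab_monoid] by auto

lemma os_smult:
  assumes "r \<in> carrier R" "x \<in> carrier CM"
  shows "one_scaled q \<odot>\<^bsub>CM\<^esub> (r \<odot>\<^bsub>CM\<^esub> x) = (\<lambda>x. q * r x) \<odot>\<^bsub>CM\<^esub> x"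
    "r \<odot>\<^bsub>CM\<^esub> (one_scaled q \<odot>\<^bsub>CM\<^esub> x) = one_scaled q \<odot>\<^bsub>CM\<^esub> (r \<odot>\<^bsub>CM\<^esub> x)"
  using CM.smult_assoc[OF os_closed assms, of q] CM.smult_assoc[OF assms(1) os_closed assms(2), of q] os_mult[OF assms(1), of q] by simp_all

lemma F_scale:
  assumes "x \<in> F (Suc k)" shows "one_scaled q \<odot>\<^bsub>CM\<^esub> x \<in> F (Suc k)"
proof (rule span_map[OF CM.abelian_group_axioms CM.abelian_group_axioms F_gen CM.smult_closed[OF os_closed] CM.smult_r_distr[OF os_closed] F_closed])
  show "x \<in> module_span CM (J (Suc k)) (carrier CM)" using assms by (simp only: F_eq)
  show "one_scaled q \<odot>\<^bsub>CM\<^esub> (r \<odot>\<^bsub>CM\<^esub> x) \<in> F (Suc k)" if "r \<in> J (Suc k)" "x \<in> carrier CM" for r x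
    using os_smult(1)[OF J_carrier[OF that(1)] that(2)] F_incl[OF J_scale[OF that(1)] that(2)] by simp
qed

text \<open>The augmentation ideal is spanned by the elements h - 1. The induction has to run over
  the whole group algebra, and so it is carried out for r minus its augmentation, which is r itself
  on the ideal.\<close>

lemma augmentation_smult:
  assumes i: "i \<in> I" and x: "x \<in> carrier CM" and E: "add_closed CM E" "\<And>q x. x \<in> E \<Longrightarrow> one_scaled q \<odot>\<^bsub>CM\<^esub> x \<in> E"
    and D: "\<And>h. h \<in> carrier (abelianization G) \<Longrightarrow> D h \<odot>\<^bsub>CM\<^esub> x \<in> E"
  shows "i \<odot>\<^bsub>CM\<^esub> x \<in> E"
proof -
  have "(\<lambda>z. r z + (- (\<Sum>z\<in>supp r. r z)) * point_mass \<one>\<^bsub>abelianization G\<^esub> z) \<odot>\<^bsub>CM\<^esub> x \<in> E" if "r \<in> carrier R" for r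
    using that
  proof (induction rule: group_algebra_induct)
    case zero
    have "(\<lambda>_. 0) \<odot>\<^bsub>CM\<^esub> x \<oplus>\<^bsub>CM\<^esub> (\<lambda>_. 0) \<odot>\<^bsub>CM\<^esub> x = (\<lambda>_. 0) \<odot>\<^bsub>CM\<^esub> x"
      using CM.smult_l_distr[OF group_algebra_closed(4) group_algebra_closed(4) x] by (simp add: group_algebra_simps(4))
    then have "(\<lambda>_. 0) \<odot>\<^bsub>CM\<^esub> x = \<zero>\<^bsub>CM\<^esub>" using x group_algebra_closed(4)[of "abelianization G"] CM.add.r_cancel_one by simp
    then show ?case using E(1) by (simp add: supp_simps add_closed_def)
  next
    case (add u h q)
    let ?s = "\<Sum>z\<in>supp u. u z"
    have D': "D h \<in> carrier R" using D_I[OF add.hyps(2)] I_carrier by blast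
    have f: "finite (supp u)" using add.hyps by (simp add: group_algebra_simps)
    let ?v = "\<lambda>z. u z + (- ?s) * point_mass \<one>\<^bsub>abelianization G\<^esub> z"
    have vc: "?v \<in> carrier R" by (intro group_algebra_closed ab_one_closed add.hyps)
    have qc: "(\<lambda>z. q * D h z) \<in> carrier R" by (rule group_algebra_closed(2)[OF D'])
    have "(\<lambda>z. (u z + q * point_mass h z) + (- (?s + q)) * point_mass \<one>\<^bsub>abelianization G\<^esub> z) = (\<lambda>z. ?v z + q * D h z)"
      by (auto simp: D_def algebra_simps)
    moreover have "(\<lambda>z. ?v z + q * D h z) \<odot>\<^bsub>CM\<^esub> x = ?v \<odot>\<^bsub>CM\<^esub> x \<oplus>\<^bsub>CM\<^esub> one_scaled q \<odot>\<^bsub>CM\<^esub> (D h \<odot>\<^bsub>CM\<^esub> x)"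
      using CM.smult_l_distr[OF vc qc x] os_smult(1)[OF D' x, of q] by (simp add: group_algebra_simps(4))
    moreover have "\<dots> \<in> E" using add.IH E D[OF add.hyps(2)] by (simp add: add_closed_def)
    ultimately show ?case unfolding augmentation_sum[OF f] by simp
  qed
  from this[OF I_carrier[OF i]] show ?thesis using i by (simp add: augmentation_ideal_def)
qed

lemma D_carrier: "h \<in> carrier (abelianization G) \<Longrightarrow> D h \<in> carrier R"
  using D_I I_carrier by blast

lemma F2_subset_F3:
  assumes pts: "\<And>x y n. x \<in> carrier G \<Longrightarrow> y \<in> carrier G \<Longrightarrow> n \<in> N2 \<Longrightarrow>
     D (N2 #> x) \<odot>\<^bsub>CM\<^esub> (D (N2 #> y) \<odot>\<^bsub>CM\<^esub> P (point_mass n)) \<in> F (Suc (Suc (Suc 0)))"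
  shows "F (Suc (Suc 0)) \<subseteq> F (Suc (Suc (Suc 0)))"
proof -
  let ?F = "F (Suc (Suc (Suc 0)))"
  have 1: "D h \<odot>\<^bsub>CM\<^esub> (D k \<odot>\<^bsub>CM\<^esub> m) \<in> ?F"
    if h: "h \<in> carrier (abelianization G)" and k: "k \<in> carrier (abelianization G)" and m: "m \<in> carrier CM" for h k m
  proof -
    obtain x y where xy: "x \<in> carrier G" "y \<in> carrier G" "h = N2 #> x" "k = N2 #> y" using h k by (auto simp: ab_carrier)
    obtain u where u: "u \<in> carrier GA" "m = P u" using m by (auto simp: CM_carrier)
    have "D h \<odot>\<^bsub>CM\<^esub> (D k \<odot>\<^bsub>CM\<^esub> P u) \<in> ?F" using u(1)
    proof (induction rule: group_algebra_induct)
      case zero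
      have "P (\<lambda>_. 0) = \<zero>\<^bsub>CM\<^esub>"
        by (rule P_zero_of_cls) (use LL_add_closed in \<open>auto simp: group_algebra_closed cls_zero add_closed_def AM_simps\<close>)
      then show ?case using D_carrier h k F_closed by (simp add: CM.smult_zero add_closed_def)
    next
      case (add u n q)
      have n: "n \<in> N2" using add.hyps by (simp add: G2_simps)
      note c = P_closed[OF add.hyps(1)] P_closed[OF pm_closed[OF n]] D_carrier[OF h] D_carrier[OF k]
      have "D h \<odot>\<^bsub>CM\<^esub> (D k \<odot>\<^bsub>CM\<^esub> P (\<lambda>z. u z + q * point_mass n z)) =
        D h \<odot>\<^bsub>CM\<^esub> (D k \<odot>\<^bsub>CM\<^esub> P u) \<oplus>\<^bsub>CM\<^esub> one_scaled q \<odot>\<^bsub>CM\<^esub> (D h \<odot>\<^bsub>CM\<^esub> (D k \<odot>\<^bsub>CM\<^esub> P (point_mass n)))"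
        using c by (simp add: P_lin[OF add.hyps(1) pm_closed[OF n]] CM.smult_r_distr os_closed os_smult(2))
      then show ?case using add.IH F_closed F_scale[OF pts[OF xy(1,2) n], of q] xy by (simp add: add_closed_def)
    qed
    then show ?thesis using u by simp
  qed
  have 2: "D h \<odot>\<^bsub>CM\<^esub> (j \<odot>\<^bsub>CM\<^esub> m) \<in> ?F" if h: "h \<in> carrier (abelianization G)" and j: "j \<in> I" and m: "m \<in> carrier CM" for h j m
  proof -
    let ?E = "{x \<in> carrier CM. D h \<odot>\<^bsub>CM\<^esub> x \<in> ?F}"
    note dc = D_carrier[OF h]
    have "j \<odot>\<^bsub>CM\<^esub> m \<in> ?E"
    proof (rule augmentation_smult[OF j m])
      show "add_closed CM ?E"
        using F_closed[of "Suc (Suc (Suc 0))"] dc by (auto simp: add_closed_def CM.smult_zero CM.smult_minus CM.smult_r_distr)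
      show "one_scaled q \<odot>\<^bsub>CM\<^esub> x \<in> ?E" if "x \<in> ?E" for q x
        using that F_scale os_smult(2)[OF dc] os_closed by auto
      show "D k \<odot>\<^bsub>CM\<^esub> m \<in> ?E" if "k \<in> carrier (abelianization G)" for k using 1[OF h that m] D_carrier[OF that] m by simp
    qed
    then show ?thesis by simp
  qed
  have 3: "i \<odot>\<^bsub>CM\<^esub> (j \<odot>\<^bsub>CM\<^esub> m) \<in> ?F" if "i \<in> I" "j \<in> I" "m \<in> carrier CM" for i j m
    by (rule augmentation_smult[OF that(1) _ F_closed F_scale 2[OF _ that(2,3)]]) (use that I_carrier in auto)
  have 4: "i \<odot>\<^bsub>CM\<^esub> (s \<odot>\<^bsub>CM\<^esub> m) \<in> ?F" if i: "i \<in> I" and s: "s \<in> J (Suc 0)" and m: "m \<in> carrier CM" for i s m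
    using s unfolding ideal_power.simps
  proof (induction rule: ideal_prod.induct)
    case (prod j t)
    then show ?case using 3[OF i prod(1), of "t \<odot>\<^bsub>CM\<^esub> m"] CM.smult_assoc[OF I_carrier[OF prod(1)] prod(2) m] m by simp
  next
    case (sum s t)
    have "s \<in> carrier R" "t \<in> carrier R" using sum J_carrier[of _ "Suc 0"] by auto
    then show ?case using sum F_closed m I_carrier[OF i] by (simp add: CM.smult_l_distr CM.smult_r_distr add_closed_def)
  qed
  have "r \<odot>\<^bsub>CM\<^esub> m \<in> ?F" if r: "r \<in> J (Suc (Suc 0))" and m: "m \<in> carrier CM" for r m
    using r unfolding ideal_power.simps(2)[of R I "Suc 0"]
  proof (induction rule: ideal_prod.induct)
    case (prod i s)
    then show ?case using 4[OF prod m] CM.smult_assoc[OF I_carrier[OF prod(1)] J_carrier[OF prod(2)] m] by simp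
  next
    case (sum s t)
    have "s \<in> carrier R" "t \<in> carrier R" using sum J_carrier[of _ "Suc (Suc 0)"] by auto
    then show ?case using sum F_closed m by (simp add: CM.smult_l_distr add_closed_def)
  qed
  from span_least[OF CM.abelian_group_axioms F_gen F_closed this] show ?thesis unfolding F_eq .
qed

lemma triple_diff_F3:
  assumes "h \<in> carrier (abelianization G)" "k \<in> carrier (abelianization G)" "l \<in> carrier (abelianization G)" and m: "m \<in> carrier CM"
  shows "D h \<odot>\<^bsub>CM\<^esub> (D k \<odot>\<^bsub>CM\<^esub> (D l \<odot>\<^bsub>CM\<^esub> m)) \<in> F (Suc (Suc (Suc 0)))"
proof -
  note c = D_carrier[OF assms(1)] D_carrier[OF assms(2)] D_carrier[OF assms(3)]
  have 1: "D l \<otimes>\<^bsub>R\<^esub> one_scaled 1 = D l" using os_mult(2)[OF c(3), of 1] by simp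
  have l: "D l \<in> J (Suc 0)" using ideal_prod.prod[OF D_I[OF assms(3)] os_closed[of 1], where R = R] 1 by simp
  have kl: "D k \<otimes>\<^bsub>R\<^esub> D l \<in> J (Suc (Suc 0))" using ideal_prod.prod[OF D_I[OF assms(2)] l, where R = R] by simp
  have hkl: "D h \<otimes>\<^bsub>R\<^esub> (D k \<otimes>\<^bsub>R\<^esub> D l) \<in> J (Suc (Suc (Suc 0)))" using ideal_prod.prod[OF D_I[OF assms(1)] kl, where R = R] by simp
  show ?thesis
    using F_incl[OF hkl m]
    unfolding CM.smult_assoc[OF c(1) CM.ml_closed[OF c(2,3)] m] CM.smult_assoc[OF c(2,3) m] .
qed

theorem adic_filtration_stable:
  assumes vanish: "\<And>\<eta> x y u. N2hom \<eta> \<Longrightarrow> (\<And>k u. k \<in> carrier K \<Longrightarrow> u \<in> N2 \<Longrightarrow> \<eta> (act k u) = \<eta> u) \<Longrightarrow>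
     (\<And>x y z u. x \<in> carrier G \<Longrightarrow> y \<in> carrier G \<Longrightarrow> z \<in> carrier G \<Longrightarrow> u \<in> N2 \<Longrightarrow>
        second_diff \<eta> x y (z \<otimes> u \<otimes> inv z) = second_diff \<eta> x y u) \<Longrightarrow>
     x \<in> carrier G \<Longrightarrow> y \<in> carrier G \<Longrightarrow> u \<in> N2 \<Longrightarrow> second_diff \<eta> x y u = 0"
  shows "\<forall>k\<ge>2. F k = F 2"
proof -
  let ?F = "F (Suc (Suc (Suc 0)))"
  have f: "finite (supp (point_mass x))" for x :: 'a by (simp add: supp_simps)
  have base: "F (Suc (Suc 0)) \<subseteq> ?F"
  proof (rule F2_subset_F3, rule ccontr)
    fix x y n assume xyn: "x \<in> carrier G" "y \<in> carrier G" "n \<in> N2"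
    \<comment> \<open>The functional is taken on chains. \<open>L\<close> contains the boundaries,
      the displacements by \<open>K\<close> and the third differences; vanishing on these makes
      \<eta> a homomorphism, invariant, and subject to \<open>third\<close>.\<close>
    define L where "L = {u \<in> carrier GA. P u \<in> ?F}"
    define w where "w = dchain x (dchain y (point_mass n))"
    have wc: "w \<in> carrier GA" using xyn by (simp add: w_def dchain_closed pm_closed)
    assume "D (N2 #> x) \<odot>\<^bsub>CM\<^esub> (D (N2 #> y) \<odot>\<^bsub>CM\<^esub> P (point_mass n)) \<notin> ?F"
    then have "w \<notin> L" using xyn by (simp add: L_def w_def P_dchain dchain_closed pm_closed)
    moreover have "(\<lambda>_. 0) \<in> L"
    proof -
      have "P (\<lambda>_. 0) = \<zero>\<^bsub>CM\<^esub>"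
        by (rule P_zero_of_cls) (use LL_add_closed in \<open>auto simp: group_algebra_closed cls_zero add_closed_def AM_simps\<close>)
      then show ?thesis using F_closed by (simp add: L_def group_algebra_closed add_closed_def)
    qed
    moreover have "(\<lambda>x. u x + q * v x) \<in> L" if "u \<in> L" "v \<in> L" for u v q
      using that P_lin[of u v q] F_scale[of "P v" "Suc (Suc 0)" q] F_closed[of "Suc (Suc (Suc 0))"]
        group_algebra_closed(1)[OF _ group_algebra_closed(2), of u G2 v q] by (simp add: L_def add_closed_def)
    ultimately obtain l where l: "\<And>u v q. l (\<lambda>x. u x + q * v x) = l u + q * l v" "\<And>u. u \<in> L \<Longrightarrow> l u = 0" "l w \<noteq> 0"
      using rational_separation[of L w] by blast
    have lP: "l u = 0" if "u \<in> carrier GA" "P u = \<zero>\<^bsub>CM\<^esub>" for u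
      using that F_closed l(2) by (simp add: L_def add_closed_def)
    define \<eta> where "\<eta> n = l (point_mass n)" for n
    have dd: "l (dchain x (dchain y (point_mass n))) = second_diff \<eta> x y n"
      if "x \<in> carrier G" "y \<in> carrier G" "n \<in> N2" for x y n
    proof -
      have e: "x \<otimes> (y \<otimes> n \<otimes> inv y) \<otimes> inv x = x \<otimes> y \<otimes> n \<otimes> inv (x \<otimes> y)" using that by (simp add: word_simps)
      have "dchain x (dchain y (point_mass n)) = (\<lambda>z. (point_mass (x \<otimes> y \<otimes> n \<otimes> inv (x \<otimes> y)) z + (-1) * point_mass (y \<otimes> n \<otimes> inv y) z)
         + (-1) * (point_mass (x \<otimes> n \<otimes> inv x) z + (-1) * point_mass n z))"
        unfolding dchain_point dchain_lin[OF f f] e by simp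
      then show ?thesis by (simp only: l(1)) (simp add: second_diff_def \<eta>_def)
    qed
    have hom: "N2hom \<eta>"
      unfolding N2hom_def
    proof (intro ballI)
      fix x y assume xy: "x \<in> N2" "y \<in> N2"
      let ?b = "\<lambda>z. point_mass y z - point_mass (x \<otimes> y) z + point_mass x z"
      have "?b \<in> BB" using BB_boundary[OF xy, of 1] by simp
      then have "cls ?b \<in> LL" using cls_boundary LL_add_closed by (simp add: add_closed_def AM_simps)
      then have "l ?b = 0" by (intro lP boundary_closed xy P_zero_of_cls)
      moreover have e: "?b = (\<lambda>z. (point_mass y z + (-1) * point_mass (x \<otimes> y) z) + 1 * point_mass x z)" by auto
      have "l ?b = \<eta> y - \<eta> (x \<otimes> y) + \<eta> x"
        unfolding e l(1) by (simp add: \<eta>_def)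
      ultimately show "\<eta> (x \<otimes> y) = \<eta> x + \<eta> y" by linarith
    qed
    have inv: "\<eta> (act k u) = \<eta> u" if k: "k \<in> carrier K" and u: "u \<in> N2" for k u
    proof -
      note e = endo_hom[OF act_hom[OF k]]
      have au: "act k u \<in> N2" using e u by (simp add: endo_def)
      let ?d = "\<lambda>z. point_mass (act k u) z + (-1) * point_mass u z"
      have dc: "?d \<in> carrier GA" by (intro group_algebra_closed pm_closed au u)
      interpret KR: rat_rep HH K "\<lambda>k. group_H1_map G2 (act k)" by (rule KR)
      note cu = cls_closed[OF pm_closed[OF u]]
      have "cls ?d = cls (point_mass (act k u)) \<oplus>\<^bsub>HH\<^esub> (-1) \<odot>\<^bsub>HH\<^esub> cls (point_mass u)"
        by (rule cls_step[OF pm_closed[OF au] u])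
      also have "\<dots> = (\<lambda>z. point_mass k z + (-1) * point_mass \<one>\<^bsub>K\<^esub> z) \<odot>\<^bsub>JM\<^esub> cls (point_mass u)"
        using KR.W_step[OF group_algebra_closed(3)[OF k] one_K cu, of "-1"] KR.W_point[OF k cu]
          H1_map_point[OF e u] H1_map_point[OF endo_hom[OF act_hom[OF one_K]] u] act_one[OF u] by simp
      also have "\<dots> \<in> LL"
        by (rule span_incl[OF augmentation_diff[OF k one_K]]) (simp add: JM_simps cu)
      finally have "l ?d = 0" by (intro lP dc P_zero_of_cls)
      then show ?thesis unfolding l(1) by (simp add: \<eta>_def)
    qed
    have third: "second_diff \<eta> x y (z \<otimes> u \<otimes> inv z) = second_diff \<eta> x y u"
      if c: "x \<in> carrier G" "y \<in> carrier G" "z \<in> carrier G" "u \<in> N2" for x y z u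
    proof -
      have zu: "z \<otimes> u \<otimes> inv z \<in> N2" using N2_conj c by simp
      have fd: "finite (supp (dchain y (point_mass n)))" if "n \<in> N2" for n
        using dchain_closed[OF c(2) pm_closed[OF that]] by (simp add: group_algebra_simps)
      have "dchain x (dchain y (dchain z (point_mass u))) =
         (\<lambda>w. dchain x (dchain y (point_mass (z \<otimes> u \<otimes> inv z))) w + (-1) * dchain x (dchain y (point_mass u)) w)"
        unfolding dchain_point[of z] dchain_lin[OF f f] dchain_lin[OF fd[OF zu] fd[OF c(4)]] ..
      then have "l (dchain x (dchain y (dchain z (point_mass u)))) = second_diff \<eta> x y (z \<otimes> u \<otimes> inv z) - second_diff \<eta> x y u"
        by (simp only: l(1) dd[OF c(1,2) zu] dd[OF c(1,2,4)])
      moreover have "dchain x (dchain y (dchain z (point_mass u))) \<in> L"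
      proof -
        have h: "N2 #> v \<in> carrier (abelianization G)" if "v \<in> carrier G" for v using that by (auto simp: ab_carrier)
        show ?thesis
          using triple_diff_F3[OF h[OF c(1)] h[OF c(2)] h[OF c(3)] P_closed[OF pm_closed[OF c(4)]]] c
          by (simp add: L_def P_dchain dchain_closed pm_closed)
      qed
      ultimately show ?thesis using l(2) by simp
    qed
    have "second_diff \<eta> x y n = 0" by (rule vanish[OF hom inv third xyn])
    then show False using l(3) dd[OF xyn] by (simp add: w_def)
  qed
  have up: "F (Suc (Suc k)) \<subseteq> F (Suc (Suc (Suc k)))" for k
    by (induction k) (use base F_step in auto)
  have "F (Suc (Suc k)) = F (Suc (Suc 0))" for k
    by (induction k) (use up F_mono in blast)+
  then have "F k = F 2" if "k \<ge> 2" for k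
    using le_Suc_ex[OF that] by (auto simp: numeral_2_eq_2)
  then show ?thesis by blast
qed

end

section \<open>Fundamental groups\<close>

definition pth :: "'a::topological_space set \<Rightarrow> (real \<Rightarrow> 'a) \<Rightarrow> 'a \<Rightarrow> 'a \<Rightarrow> bool" where
  "pth S \<gamma> x y \<longleftrightarrow> path \<gamma> \<and> path_image \<gamma> \<subseteq> S \<and> pathstart \<gamma> = x \<and> pathfinish \<gamma> = y"

lemma pth_join: "pth S \<gamma> x y \<Longrightarrow> pth S \<delta> y z \<Longrightarrow> pth S (\<gamma> +++ \<delta>) x z"
  by (auto simp: pth_def path_image_join)

lemma pth_reverse: "pth S \<gamma> x y \<Longrightarrow> pth S (reversepath \<gamma>) y x"
  by (auto simp: pth_def)

lemma pth_const: "x \<in> S \<Longrightarrow> pth S (\<lambda>_. x) x x"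
  by (auto simp: pth_def path_def path_image_def pathstart_def pathfinish_def)

lemma pth_ends: "pth S \<gamma> x y \<Longrightarrow> x \<in> S \<and> y \<in> S"
  by (auto simp: pth_def path_image_def pathstart_def pathfinish_def)

lemma pth_continuous_image:
  assumes "pth S \<gamma> x y" "continuous_on S f" "f ` S \<subseteq> T"
  shows "pth T (f \<circ> \<gamma>) (f x) (f y)"
  using assms path_continuous_image[of \<gamma> f] continuous_on_subset[of S f "path_image \<gamma>"]
  by (auto simp: pth_def path_image_compose pathstart_compose pathfinish_compose)

lemma pth_homotopic: "pth S \<gamma> x y \<Longrightarrow> homotopic_paths S \<gamma> \<delta> \<Longrightarrow> pth S \<delta> x y"
  using homotopic_paths_imp_path homotopic_paths_imp_subset homotopic_paths_imp_pathstart homotopic_paths_imp_pathfinish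
  by (metis pth_def)

lemma hp_refl: "pth S \<gamma> x y \<Longrightarrow> homotopic_paths S \<gamma> \<gamma>"
  by (simp add: pth_def)

lemma hp_join:
  "homotopic_paths S \<gamma> \<gamma>' \<Longrightarrow> homotopic_paths S \<delta> \<delta>' \<Longrightarrow> pth S \<gamma> x y \<Longrightarrow> pth S \<delta> y z \<Longrightarrow>
    homotopic_paths S (\<gamma> +++ \<delta>) (\<gamma>' +++ \<delta>')"
  by (rule homotopic_paths_join) (auto simp: pth_def)

lemma hp_assoc:
  "pth S \<alpha> x y \<Longrightarrow> pth S \<beta> y z \<Longrightarrow> pth S \<gamma> z w \<Longrightarrow> homotopic_paths S (\<alpha> +++ (\<beta> +++ \<gamma>)) ((\<alpha> +++ \<beta>) +++ \<gamma>)"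
  by (rule homotopic_paths_assoc) (auto simp: pth_def)

lemma hp_const_left: "pth S \<gamma> x y \<Longrightarrow> homotopic_paths S ((\<lambda>_. x) +++ \<gamma>) \<gamma>"
proof -
  assume g: "pth S \<gamma> x y"
  then show ?thesis
    by (intro homotopic_paths_sym[OF homotopic_paths_reparametrize[where f = "\<lambda>t. if t \<le> 1/2 then 0 else 2 * t - 1"]])
      (auto simp: pth_def joinpaths_def pathstart_def intro!: continuous_on_cases_le continuous_intros)
qed

text \<open>The path followed by its reverse factors through a tent function of the unit interval,
  and this contracts linearly to 0.\<close>

lemma hp_inverse_right:
  assumes g: "pth S \<gamma> x y"
  shows "homotopic_paths S (\<gamma> +++ reversepath \<gamma>) (\<lambda>_. x)"
proof -
  let ?k = "\<lambda>t :: real. if t \<le> 1/2 then 2 * t else 2 - 2 * t"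
  have pk: "path ?k" unfolding path_def by (intro continuous_on_cases_le continuous_intros) auto
  have c: "continuous_on {0..1} \<gamma>" "\<gamma> ` {0..1} \<subseteq> S" using g by (auto simp: pth_def path_def path_image_def)
  have "homotopic_paths {0..1::real} ?k (\<lambda>_. 0)"
    by (rule homotopic_paths_linear[OF pk])
      (auto simp: path_def pathstart_def pathfinish_def closed_segment_eq_real_ivl)
  then have "homotopic_paths S (\<gamma> \<circ> ?k) (\<gamma> \<circ> (\<lambda>_ :: real. 0))"
    by (rule homotopic_paths_continuous_image) (use c in auto)
  moreover have "\<gamma> \<circ> ?k = \<gamma> +++ reversepath \<gamma>" by (auto simp: fun_eq_iff joinpaths_def reversepath_def)
  moreover have "\<gamma> \<circ> (\<lambda>_ :: real. 0) = (\<lambda>_. x)" using g by (auto simp: pth_def pathstart_def)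
  ultimately show ?thesis by (simp only:)
qed

lemma hp_inverse_left:
  assumes g: "pth S \<gamma> x y"
  shows "homotopic_paths S (reversepath \<gamma> +++ \<gamma>) (\<lambda>_. y)"
  using hp_inverse_right[OF pth_reverse[OF g]] by simp

lemma path_class_cong: "homotopic_paths S \<gamma> \<delta> \<Longrightarrow> path_class S \<gamma> = path_class S \<delta>"
  unfolding path_class_def by (auto intro: homotopic_paths_trans homotopic_paths_sym)

lemma mem_path_class: "pth S \<gamma> x y \<Longrightarrow> \<gamma> \<in> path_class S \<gamma>"
  by (simp add: path_class_def pth_def)

lemma pi1_carrier: "carrier (fundamental_group S p) = path_class S ` {\<gamma>. pth S \<gamma> p p}"
  by (simp add: fundamental_group_def pth_def)

lemma pi1_closed: "pth S \<gamma> p p \<Longrightarrow> path_class S \<gamma> \<in> carrier (fundamental_group S p)"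
  by (auto simp: pi1_carrier)

lemma pi1_cases:
  assumes "X \<in> carrier (fundamental_group S p)"
  obtains \<gamma> where "pth S \<gamma> p p" "X = path_class S \<gamma>"
  using assms by (auto simp: pi1_carrier)

lemma pi1_mult:
  assumes "pth S \<gamma> p p" "pth S \<delta> p p"
  shows "path_class S \<gamma> \<otimes>\<^bsub>fundamental_group S p\<^esub> path_class S \<delta> = path_class S (\<gamma> +++ \<delta>)"
proof -
  have "path_class S (\<gamma>' +++ \<delta>') = path_class S (\<gamma> +++ \<delta>)" if "\<gamma>' \<in> path_class S \<gamma>" "\<delta>' \<in> path_class S \<delta>" for \<gamma>' \<delta>'
    using that hp_join[OF _ _ assms] by (intro path_class_cong[symmetric]) (auto simp: path_class_def)
  moreover have "\<gamma> \<in> path_class S \<gamma>" "\<delta> \<in> path_class S \<delta>" using assms mem_path_class by blast+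
  ultimately have "(\<Union>\<gamma>'\<in>path_class S \<gamma>. \<Union>\<delta>'\<in>path_class S \<delta>. path_class S (\<gamma>' +++ \<delta>')) = path_class S (\<gamma> +++ \<delta>)"
    by blast
  then show ?thesis by (simp add: fundamental_group_def)
qed

lemma pi1_one: "\<one>\<^bsub>fundamental_group S p\<^esub> = path_class S (\<lambda>_. p)"
  by (simp add: fundamental_group_def)

lemma pi1_group:
  assumes p: "p \<in> S"
  shows "group (fundamental_group S p)"
proof (rule groupI)
  let ?P = "fundamental_group S p"
  show "\<one>\<^bsub>?P\<^esub> \<in> carrier ?P" unfolding pi1_one by (rule pi1_closed[OF pth_const[OF p]])
  fix X assume "X \<in> carrier ?P"
  then obtain \<gamma> where g: "pth S \<gamma> p p" "X = path_class S \<gamma>" by (rule pi1_cases)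
  show "\<one>\<^bsub>?P\<^esub> \<otimes>\<^bsub>?P\<^esub> X = X"
    unfolding pi1_one g(2) pi1_mult[OF pth_const[OF p] g(1)] by (rule path_class_cong[OF hp_const_left[OF g(1)]])
  show "\<exists>Y\<in>carrier ?P. Y \<otimes>\<^bsub>?P\<^esub> X = \<one>\<^bsub>?P\<^esub>"
  proof
    show "path_class S (reversepath \<gamma>) \<otimes>\<^bsub>?P\<^esub> X = \<one>\<^bsub>?P\<^esub>"
      unfolding pi1_one g(2) pi1_mult[OF pth_reverse[OF g(1)] g(1)] by (rule path_class_cong[OF hp_inverse_left[OF g(1)]])
    show "path_class S (reversepath \<gamma>) \<in> carrier ?P" by (rule pi1_closed[OF pth_reverse[OF g(1)]])
  qed
  fix Y assume "Y \<in> carrier ?P"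
  then obtain \<delta> where d: "pth S \<delta> p p" "Y = path_class S \<delta>" by (rule pi1_cases)
  show "X \<otimes>\<^bsub>?P\<^esub> Y \<in> carrier ?P"
    unfolding g(2) d(2) pi1_mult[OF g(1) d(1)] by (rule pi1_closed[OF pth_join[OF g(1) d(1)]])
  fix Z assume "Z \<in> carrier ?P"
  then obtain \<epsilon> where e: "pth S \<epsilon> p p" "Z = path_class S \<epsilon>" by (rule pi1_cases)
  show "X \<otimes>\<^bsub>?P\<^esub> Y \<otimes>\<^bsub>?P\<^esub> Z = X \<otimes>\<^bsub>?P\<^esub> (Y \<otimes>\<^bsub>?P\<^esub> Z)"
    unfolding g(2) d(2) e(2) pi1_mult[OF g(1) d(1)] pi1_mult[OF d(1) e(1)]
      pi1_mult[OF pth_join[OF g(1) d(1)] e(1)] pi1_mult[OF g(1) pth_join[OF d(1) e(1)]]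
    by (rule path_class_cong[OF homotopic_paths_sym[OF hp_assoc[OF g(1) d(1) e(1)]]])
qed

lemma pi1_inv:
  assumes g: "pth S \<gamma> p p"
  shows "inv\<^bsub>fundamental_group S p\<^esub> (path_class S \<gamma>) = path_class S (reversepath \<gamma>)"
proof -
  have p: "p \<in> S" using pth_ends[OF g] by blast
  interpret group "fundamental_group S p" by (rule pi1_group[OF p])
  show ?thesis
  proof (rule inv_equality)
    show "path_class S (reversepath \<gamma>) \<otimes>\<^bsub>fundamental_group S p\<^esub> path_class S \<gamma> = \<one>\<^bsub>fundamental_group S p\<^esub>"
      unfolding pi1_one pi1_mult[OF pth_reverse[OF g] g] by (rule path_class_cong[OF hp_inverse_left[OF g]])
  qed (auto intro: pi1_closed g pth_reverse)
qed

text \<open>Connectedness of the unit interval takes the place of a subdivision: that the piece from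
  s to t is good is an equivalence relation in s and t which holds locally, hence everywhere. Pieces
  with s > t are run backwards.\<close>

lemma path_local_induct:
  assumes good_hp: "\<And>\<gamma> \<delta> x y. pth S \<gamma> x y \<Longrightarrow> good \<gamma> \<Longrightarrow> homotopic_paths S \<gamma> \<delta> \<Longrightarrow> good \<delta>"
    and good_join: "\<And>\<gamma> \<delta> x y z. pth S \<gamma> x y \<Longrightarrow> pth S \<delta> y z \<Longrightarrow> good \<gamma> \<Longrightarrow> good \<delta> \<Longrightarrow> good (\<gamma> +++ \<delta>)"
    and good_rev: "\<And>\<gamma> x y. pth S \<gamma> x y \<Longrightarrow> good \<gamma> \<Longrightarrow> good (reversepath \<gamma>)"
    and cover: "\<And>x. x \<in> S \<Longrightarrow> \<exists>U. openin (top_of_set S) U \<and> x \<in> U \<and>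
        (\<forall>\<gamma> y z. pth U \<gamma> y z \<longrightarrow> good \<gamma>)"
    and g: "pth S \<gamma> x y"
  shows "good \<gamma>"
proof -
  have c: "continuous_on {0..1} \<gamma>" and im: "path_image \<gamma> \<subseteq> S" and pg: "path \<gamma>" using g by (auto simp: pth_def path_def)
  define sb where "sb s t = \<gamma> \<circ> linepath s t" for s t :: real
  have seg: "closed_segment s t \<subseteq> {0..1}" if "s \<in> {0..1}" "t \<in> {0..1}" for s t :: real
    using that by (intro closed_segment_subset convex_real_interval) auto
  have sp: "pth S (sb s t) (\<gamma> s) (\<gamma> t)" if "s \<in> {0..1}" "t \<in> {0..1}" for s t
  proof -
    have "pth {0..1} (linepath s t) s t" using seg[OF that] by (simp add: pth_def)
    from pth_continuous_image[OF this c] show ?thesis using im by (simp add: sb_def path_image_def)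
  qed
  have "good (sb 0 1)"
  proof (rule connected_equivalence_relation[where S = "{0..1::real}" and R = "\<lambda>s t. good (sb s t)"])
    show "good (sb t s)" if "good (sb s t)" "s \<in> {0..1}" "t \<in> {0..1}" for s t
    proof -
      have "reversepath (sb s t) = sb t s" by (auto simp: sb_def reversepath_def linepath_def fun_eq_iff algebra_simps)
      then show ?thesis using good_rev[OF sp[OF that(2,3)] that(1)] by simp
    qed
    show "good (sb s u)" if h: "good (sb s t)" "good (sb t u)" "s \<in> {0..1}" "t \<in> {0..1}" "u \<in> {0..1}" for s t u
    proof (rule good_hp[OF pth_join[OF sp[OF h(3,4)] sp[OF h(4,5)]] good_join[OF sp[OF h(3,4)] sp[OF h(4,5)] h(1,2)]])
      have "homotopic_paths {0..1} (linepath s t +++ linepath t u) (linepath s u)"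
      proof (rule homotopic_paths_linear)
        fix v :: real assume v: "v \<in> {0..1}"
        have "path_image (linepath s t +++ linepath t u) \<subseteq> {0..1}"
          using seg[OF h(3,4)] seg[OF h(4,5)] by (simp add: path_image_join)
        then have "(linepath s t +++ linepath t u) v \<in> {0..1}" using v by (simp add: path_image_def image_subset_iff)
        moreover have "linepath s u v \<in> {0..1}"
          using seg[OF h(3,5)] v path_image_linepath[of s u] unfolding path_image_def by blast
        ultimately show "closed_segment ((linepath s t +++ linepath t u) v) (linepath s u v) \<subseteq> {0..1}" by (rule seg)
      qed auto
      from homotopic_paths_continuous_image[OF this c] have "homotopic_paths S (\<gamma> \<circ> (linepath s t +++ linepath t u)) (\<gamma> \<circ> linepath s u)"
        using im by (auto simp: path_image_def)
      then show "homotopic_paths S (sb s t +++ sb t u) (sb s u)" by (simp add: sb_def path_compose_join)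
    qed
    fix s :: real assume s: "s \<in> {0..1}"
    then have "\<gamma> s \<in> S" using im by (auto simp: path_image_def)
    from cover[OF this] obtain U where U: "openin (top_of_set S) U" "\<gamma> s \<in> U"
      "\<And>\<gamma> y z. pth U \<gamma> y z \<Longrightarrow> good \<gamma>" by auto
    have "openin (top_of_set {0..1}) ({0..1} \<inter> \<gamma> -` U)"
      by (rule continuous_openin_preimage[OF c _ U(1)]) (use im in \<open>auto simp: path_image_def\<close>)
    moreover have "s \<in> {0..1} \<inter> \<gamma> -` U" using s U(2) by simp
    ultimately have "\<exists>e>0. ball s e \<inter> {0..1} \<subseteq> {0..1} \<inter> \<gamma> -` U"
      unfolding openin_contains_ball by (elim conjE) (drule bspec, assumption+)
    then obtain e where e: "e > 0" "ball s e \<inter> {0..1} \<subseteq> \<gamma> -` U" by auto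
    have "good (sb s t)" if t: "t \<in> ball s e \<inter> {0..1}" for t
    proof -
      have "closed_segment s t \<subseteq> ball s e \<inter> {0..1}"
        using s t e by (intro closed_segment_subset convex_Int convex_ball convex_real_interval) auto
      then have "path_image (sb s t) \<subseteq> U" using e(2) by (auto simp: sb_def path_image_compose)
      then show ?thesis using U(3)[of "sb s t" "\<gamma> s" "\<gamma> t"] sp[OF s, of t] t by (auto simp: pth_def)
    qed
    moreover have "openin (top_of_set {0..1}) (ball s e \<inter> {0..1})" by (subst Int_commute) (rule openin_open_Int, simp)
    ultimately show "\<exists>T. openin (top_of_set {0..1}) T \<and> s \<in> T \<and> (\<forall>t\<in>T. good (sb s t))"
      using s e(1) by (intro exI[of _ "ball s e \<inter> {0..1}"]) auto
  qed auto
  moreover have "sb 0 1 = \<gamma>" by (simp add: sb_def linepath_def fun_eq_iff)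
  ultimately show ?thesis by simp
qed

definition pi1_map :: "'a::topological_space set \<Rightarrow> ('a \<Rightarrow> 'a) \<Rightarrow> (real \<Rightarrow> 'a) set \<Rightarrow> (real \<Rightarrow> 'a) set" where
  "pi1_map S f X = (\<Union>\<gamma>\<in>X. path_class S (f \<circ> \<gamma>))"

lemma pi1_map_class:
  assumes "pth S \<gamma> x y" "continuous_on S f" "f ` S \<subseteq> S"
  shows "pi1_map S f (path_class S \<gamma>) = path_class S (f \<circ> \<gamma>)"
proof -
  have "path_class S (f \<circ> \<delta>) = path_class S (f \<circ> \<gamma>)" if "\<delta> \<in> path_class S \<gamma>" for \<delta>
    using that assms homotopic_paths_continuous_image[of S \<gamma> \<delta> f S]
    by (intro path_class_cong[symmetric]) (auto simp: path_class_def)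
  then show ?thesis unfolding pi1_map_def using mem_path_class[OF assms(1)] by blast
qed

lemma homeo_continuous:
  assumes "pointed_homeo S p f"
  shows "continuous_on S f" "f ` S \<subseteq> S" "f p = p" "f \<in> S \<rightarrow> S"
proof -
  have "continuous_map (top_of_set S) (top_of_set S) f"
    by (rule homeomorphic_imp_continuous_map) (use assms in \<open>simp add: pointed_homeo_def\<close>)
  then show "continuous_on S f" "f \<in> S \<rightarrow> S" by simp_all
  then show "f ` S \<subseteq> S" by (simp add: image_subset_iff_funcset)
  show "f p = p" using assms by (simp add: pointed_homeo_def)
qed

lemma pi1_map_hom:
  assumes f: "pointed_homeo S p f"
  shows "pi1_map S f \<in> hom (fundamental_group S p) (fundamental_group S p)"
proof (rule homI)
  note fc = homeo_continuous[OF f]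
  note im = pth_continuous_image[OF _ fc(1,2), of _ p p, unfolded fc(3)]
  fix X assume "X \<in> carrier (fundamental_group S p)"
  then obtain \<gamma> where g: "pth S \<gamma> p p" "X = path_class S \<gamma>" by (rule pi1_cases)
  show "pi1_map S f X \<in> carrier (fundamental_group S p)"
    unfolding g(2) pi1_map_class[OF g(1) fc(1,2)] by (rule pi1_closed[OF im[OF g(1)]])
  fix Y assume "Y \<in> carrier (fundamental_group S p)"
  then obtain \<delta> where d: "pth S \<delta> p p" "Y = path_class S \<delta>" by (rule pi1_cases)
  show "pi1_map S f (X \<otimes>\<^bsub>fundamental_group S p\<^esub> Y) = pi1_map S f X \<otimes>\<^bsub>fundamental_group S p\<^esub> pi1_map S f Y"
    unfolding g(2) d(2) pi1_mult[OF g(1) d(1)] pi1_map_class[OF g(1) fc(1,2)] pi1_map_class[OF d(1) fc(1,2)]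
      pi1_map_class[OF pth_join[OF g(1) d(1)] fc(1,2)] pi1_mult[OF im[OF g(1)] im[OF d(1)]]
    by (simp add: path_compose_join)
qed

lemma pi1_map_comp:
  assumes "pointed_homeo S p f" "pointed_homeo S p f'" "X \<in> carrier (fundamental_group S p)"
  shows "pi1_map S (f \<circ> f') X = pi1_map S f (pi1_map S f' X)"
proof -
  obtain \<gamma> where g: "pth S \<gamma> p p" "X = path_class S \<gamma>" using assms(3) by (rule pi1_cases)
  note fc = homeo_continuous[OF assms(1)] and fc' = homeo_continuous[OF assms(2)]
  have "continuous_on S (f \<circ> f')" by (rule continuous_on_compose[OF fc'(1) continuous_on_subset[OF fc(1) fc'(2)]])
  moreover have "(f \<circ> f') ` S \<subseteq> S" using fc(2) fc'(2) by auto
  ultimately show ?thesis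
    unfolding g(2) using pth_continuous_image[OF g(1) fc'(1,2)]
    by (simp add: pi1_map_class[OF g(1)] fc fc' pi1_map_class comp_assoc)
qed

definition homeo_plus :: "'a::topological_space set \<Rightarrow> 'a \<Rightarrow> ('a \<Rightarrow> 'a) set" where
  "homeo_plus S p = {f. pointed_homeo S p f \<and> orientation_preserving_at S p f}"

text \<open>An isotopy keeps the marked point fixed at all times and so carries a loop through
  loops; all members of the class act alike and the union collapses.\<close>

lemma mapping_class_action_eq:
  assumes f: "pointed_homeo S p f" and X: "X \<in> carrier (fundamental_group S p)"
  shows "mapping_class_action S (isotopy_class S p f) X = pi1_map S f X"
proof -
  obtain \<gamma> where g: "pth S \<gamma> p p" "X = path_class S \<gamma>" using X by (rule pi1_cases)
  note fc = homeo_continuous[OF f]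
  have "pi1_map S f' X = pi1_map S f X" if "f' \<in> isotopy_class S p f" for f'
  proof -
    have h: "homotopic_with (pointed_homeo S p) (top_of_set S) (top_of_set S) f f'" using that by (simp add: isotopy_class_def)
    then have f': "pointed_homeo S p f'" using homotopic_with_imp_property by blast
    note fc' = homeo_continuous[OF f']
    have "continuous_map (top_of_set {0..1}) (top_of_set S) \<gamma>"
      using g(1) by (auto simp: pth_def path_def path_image_def)
    then have "homotopic_paths S (f \<circ> \<gamma>) (f' \<circ> \<gamma>)"
      unfolding homotopic_paths_def
      by (rule homotopic_with_compose_continuous_map_right[OF h])
        (use g(1) fc(3) in \<open>auto simp: pth_def pathstart_def pathfinish_def dest!: homeo_continuous(3)\<close>)
    then show ?thesis
      unfolding g(2) pi1_map_class[OF g(1) fc(1,2)] pi1_map_class[OF g(1) fc'(1,2)] by (rule path_class_cong[symmetric])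
  qed
  moreover have "f \<in> isotopy_class S p f"
    using f fc by (simp add: isotopy_class_def)
  ultimately have "(\<Union>f'\<in>isotopy_class S p f. pi1_map S f' X) = pi1_map S f X" by blast
  then show ?thesis by (simp add: mapping_class_action_def pi1_map_def)
qed

lemma pointed_homeo_id: "pointed_homeo S p id"
  by (simp add: pointed_homeo_def)

lemma pointed_homeo_comp: "pointed_homeo S p f \<Longrightarrow> pointed_homeo S p f' \<Longrightarrow> pointed_homeo S p (f \<circ> f')"
  using homeomorphic_map_compose by (auto simp: pointed_homeo_def)

lemma pointed_homeo_maps:
  assumes "pointed_homeo S p f" "p \<in> S"
  shows "continuous_map (top_of_set S) (top_of_set S) f" "f \<in> (S - {p}) \<rightarrow> S - {p}"
proof -
  have h: "homeomorphic_map (top_of_set S) (top_of_set S) f" and fp: "f p = p" using assms(1) by (auto simp: pointed_homeo_def)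
  have "inj_on f S" "f ` S = S" using homeomorphic_imp_injective_map[OF h] homeomorphic_imp_surjective_map[OF h] by simp_all
  then show "f \<in> (S - {p}) \<rightarrow> S - {p}"
    using fp assms(2) by (auto simp: inj_on_def)
  show "continuous_map (top_of_set S) (top_of_set S) f" by (rule homeomorphic_imp_continuous_map[OF h])
qed

lemma homeo_plus_id: "id \<in> homeo_plus S p"
  by (simp add: homeo_plus_def pointed_homeo_id orientation_preserving_at_def hom_induced_id)

lemma homeo_plus_comp:
  assumes p: "p \<in> S" and f: "f \<in> homeo_plus S p" "f' \<in> homeo_plus S p"
  shows "f \<circ> f' \<in> homeo_plus S p"
proof -
  have h: "pointed_homeo S p f" "pointed_homeo S p f'" using f by (auto simp: homeo_plus_def)
  note m = pointed_homeo_maps[OF h(1) p] pointed_homeo_maps[OF h(2) p]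
  show ?thesis
    using f hom_induced_compose'[OF m(3,4,1,2), of 2, symmetric] pointed_homeo_comp[OF h]
    by (auto simp: homeo_plus_def orientation_preserving_at_def)
qed

lemma homeo_plus_inverse:
  assumes p: "p \<in> S" and f: "f \<in> homeo_plus S p"
  obtains f' where "f' \<in> homeo_plus S p" "\<And>x. x \<in> S \<Longrightarrow> f (f' x) = x" "\<And>x. x \<in> S \<Longrightarrow> f' (f x) = x"
proof -
  have h: "pointed_homeo S p f" using f by (auto simp: homeo_plus_def)
  then obtain f' where f': "homeomorphic_maps (top_of_set S) (top_of_set S) f f'"
    by (auto simp: pointed_homeo_def homeomorphic_map_maps)
  then have i: "\<And>x. x \<in> S \<Longrightarrow> f (f' x) = x" "\<And>x. x \<in> S \<Longrightarrow> f' (f x) = x" by (auto simp: homeomorphic_maps_def)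
  have "homeomorphic_map (top_of_set S) (top_of_set S) f'" using f' homeomorphic_maps_sym homeomorphic_map_maps by blast
  moreover have "f' p = p" using i(2)[OF p] homeo_continuous(3)[OF h] by simp
  ultimately have h': "pointed_homeo S p f'" by (simp add: pointed_homeo_def)
  note m = pointed_homeo_maps[OF h p] pointed_homeo_maps[OF h' p]
  have "orientation_preserving_at S p f'"
    unfolding orientation_preserving_at_def
  proof
    fix c assume c: "c \<in> carrier (relative_homology_group 2 (top_of_set S) (S - {p}))"
    let ?H = "\<lambda>f. hom_induced 2 (top_of_set S) (S - {p}) (top_of_set S) (S - {p}) f"
    have "?H f' c = ?H f' (?H f c)" using f c by (simp add: homeo_plus_def orientation_preserving_at_def)
    also have "\<dots> = ?H (f' \<circ> f) c" by (rule hom_induced_compose'[OF m])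
    also have "\<dots> = ?H id c" by (subst hom_induced_eq[of _ "f' \<circ> f" id]) (auto simp: i)
    also have "\<dots> = c" using c by (simp add: hom_induced_id)
    finally show "?H f' c = c" .
  qed
  then show ?thesis using that[of f'] h' i by (simp add: homeo_plus_def)
qed

section \<open>Mapping classes\<close>

text \<open>The unit of \<open>AutoGroup\<close> is the identity restricted to the carrier, so that
  lying in the kernel means mapping every coset onto itself as a set.\<close>

lemma johnson_kernel_carrier:
  "k \<in> carrier (johnson_kernel S p) \<longleftrightarrow>
    (\<exists>f\<in>homeo_plus S p. k = isotopy_class S p f) \<and>
    (\<forall>C\<in>carrier (fundamental_group S p Mod lower_central (fundamental_group S p) 3). mapping_class_action S k ` C = C)"
proof -
  let ?P = "fundamental_group S p"
  let ?Q = "carrier (?P Mod lower_central ?P 3)"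
  have "restrict ((`) (mapping_class_action S k)) ?Q = (\<lambda>x\<in>?Q. x) \<longleftrightarrow> (\<forall>C\<in>?Q. mapping_class_action S k ` C = C)"
    by (auto simp: fun_eq_iff restrict_def)
  then show ?thesis
    by (auto simp: johnson_kernel_def Let_def kernel_def mapping_class_group_def nilpotent_quotient_action_def
        AutoGroup_def BijGroup_def homeo_plus_def)
qed

lemma pi1_map_inverse:
  assumes y: "y \<in> carrier (fundamental_group S p)"
    and h: "pointed_homeo S p h" "pointed_homeo S p h'" "\<And>x. x \<in> S \<Longrightarrow> h (h' x) = x"
  shows "pi1_map S h (pi1_map S h' y) = y"
proof -
  obtain \<gamma> where g: "pth S \<gamma> p p" "y = path_class S \<gamma>" using y by (rule pi1_cases)
  have "homotopic_paths S (h \<circ> h' \<circ> \<gamma>) \<gamma>"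
    using g(1) h(3) by (intro homotopic_paths_sym[OF homotopic_paths_eq]) (auto simp: pth_def path_image_def image_subset_iff)
  from path_class_cong[OF this] show ?thesis
    using pi1_map_comp[OF h(1,2) y] pi1_map_class[OF g(1) homeo_continuous(1,2)[OF pointed_homeo_comp[OF h(1,2)]]]
    by (simp add: g(2))
qed

locale pointed_space =
  fixes S :: "'a::topological_space set" and p :: 'a
  assumes p: "p \<in> S"

sublocale pointed_space \<subseteq> h1_group "fundamental_group S p"
  by (simp add: h1_group_def pi1_group p)

context pointed_space
begin

abbreviation "\<pi> \<equiv> fundamental_group S p"

lemma N3_coset: "x \<in> carrier \<pi> \<Longrightarrow> lower_central \<pi> 3 #>\<^bsub>\<pi>\<^esub> x \<in> carrier (\<pi> Mod lower_central \<pi> 3)"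
  by (auto simp: FactGroup_def RCOSETS_def)

lemma johnson_kernel_act:
  assumes "k \<in> carrier (johnson_kernel S p)"
  shows "\<exists>f\<in>homeo_plus S p. \<forall>X\<in>carrier \<pi>. mapping_class_action S k X = pi1_map S f X"
proof -
  obtain f where f: "f \<in> homeo_plus S p" "k = isotopy_class S p f" using assms by (auto simp: johnson_kernel_carrier)
  then have "pointed_homeo S p f" by (simp add: homeo_plus_def)
  from mapping_class_action_eq[OF this] show ?thesis using f by blast
qed

lemma johnson_kernel_hom:
  assumes "k \<in> carrier (johnson_kernel S p)"
  shows "mapping_class_action S k \<in> hom \<pi> \<pi>"
proof -
  obtain f where f: "f \<in> homeo_plus S p" "\<And>X. X \<in> carrier \<pi> \<Longrightarrow> mapping_class_action S k X = pi1_map S f X"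
    using johnson_kernel_act[OF assms] by blast
  have "pi1_map S f \<in> hom \<pi> \<pi>" using pi1_map_hom f(1) by (auto simp: homeo_plus_def)
  then show ?thesis using f(2) by (auto simp: hom_def Pi_iff)
qed

lemma johnson_kernel_trivial:
  assumes k: "k \<in> carrier (johnson_kernel S p)" and x: "x \<in> carrier \<pi>"
  shows "mapping_class_action S k x \<otimes>\<^bsub>\<pi>\<^esub> inv\<^bsub>\<pi>\<^esub> x \<in> lower_central \<pi> 3"
proof -
  interpret N: normal "lower_central \<pi> 3" \<pi> by (rule lower_central_3_normal)
  have "mapping_class_action S k ` (lower_central \<pi> 3 #>\<^bsub>\<pi>\<^esub> x) = lower_central \<pi> 3 #>\<^bsub>\<pi>\<^esub> x"
    using k N3_coset[OF x] by (simp add: johnson_kernel_carrier)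
  moreover have "x \<in> lower_central \<pi> 3 #>\<^bsub>\<pi>\<^esub> x" using x N.one_closed by (force simp: r_coset_def)
  ultimately have "mapping_class_action S k x \<in> lower_central \<pi> 3 #>\<^bsub>\<pi>\<^esub> x" by blast
  then obtain n where "n \<in> lower_central \<pi> 3" "mapping_class_action S k x = n \<otimes>\<^bsub>\<pi>\<^esub> x" by (auto simp: r_coset_def)
  then show ?thesis using x by (simp add: m_assoc)
qed

lemma N3_subset_N2: "lower_central \<pi> 3 \<subseteq> lower_central \<pi> 2"
proof -
  have "{comm_in \<pi> x y | x y. x \<in> carrier \<pi> \<and> y \<in> lower_central \<pi> 2} \<subseteq> {comm_in \<pi> x y | x y. x \<in> carrier \<pi> \<and> y \<in> carrier \<pi>}"
    using N2_closed by blast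
  from mono_generate[OF this] show ?thesis by (simp only: lower_central_3 flip: lower_central_2)
qed

text \<open>The cosets are compared as sets, so a coset has to be filled by its image as well;
  preimages come from the inverse homeomorphism.\<close>

lemma mapping_class_in_johnson_kernel:
  assumes f: "f \<in> homeo_plus S p" and t: "\<And>x. x \<in> carrier \<pi> \<Longrightarrow> pi1_map S f x \<otimes>\<^bsub>\<pi>\<^esub> inv\<^bsub>\<pi>\<^esub> x \<in> lower_central \<pi> 3"
  shows "isotopy_class S p f \<in> carrier (johnson_kernel S p)"
  unfolding johnson_kernel_carrier
proof (intro conjI ballI bexI[OF _ f] refl)
  interpret N: normal "lower_central \<pi> 3" \<pi> by (rule lower_central_3_normal)
  let ?N = "lower_central \<pi> 3"
  have pf: "pointed_homeo S p f" using f by (simp add: homeo_plus_def)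
  obtain f' where f': "f' \<in> homeo_plus S p" "\<And>x. x \<in> S \<Longrightarrow> f (f' x) = x" "\<And>x. x \<in> S \<Longrightarrow> f' (f x) = x"
    using homeo_plus_inverse[OF p f] by blast
  have pf': "pointed_homeo S p f'" using f' by (simp add: homeo_plus_def)
  note h = pi1_map_hom[OF pf] and h' = pi1_map_hom[OF pf']
  note inv = pi1_map_inverse[OF _ pf pf' f'(2)]
  fix C assume "C \<in> carrier (\<pi> Mod ?N)"
  then obtain x where x: "x \<in> carrier \<pi>" "C = ?N #>\<^bsub>\<pi>\<^esub> x" by (auto simp: FactGroup_def RCOSETS_def)
  have C: "C \<subseteq> carrier \<pi>" unfolding x(2) by (rule r_coset_subset_G[OF _ x(1)]) auto
  have mem: "y \<in> C \<longleftrightarrow> y \<in> carrier \<pi> \<and> y \<otimes>\<^bsub>\<pi>\<^esub> inv\<^bsub>\<pi>\<^esub> x \<in> ?N" for y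
  proof
    assume "y \<in> C"
    then obtain n where "n \<in> ?N" "y = n \<otimes>\<^bsub>\<pi>\<^esub> x" by (auto simp: x(2) r_coset_def)
    then show "y \<in> carrier \<pi> \<and> y \<otimes>\<^bsub>\<pi>\<^esub> inv\<^bsub>\<pi>\<^esub> x \<in> ?N" using x by (simp add: m_assoc)
  next
    assume y: "y \<in> carrier \<pi> \<and> y \<otimes>\<^bsub>\<pi>\<^esub> inv\<^bsub>\<pi>\<^esub> x \<in> ?N"
    then have "y = (y \<otimes>\<^bsub>\<pi>\<^esub> inv\<^bsub>\<pi>\<^esub> x) \<otimes>\<^bsub>\<pi>\<^esub> x" using x by (simp add: m_assoc)
    then show "y \<in> C" unfolding x(2) r_coset_def using y by blast
  qed
  have tr: "pi1_map S f y \<in> C \<longleftrightarrow> y \<in> C" if y: "y \<in> carrier \<pi>" for y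
  proof -
    have c: "pi1_map S f y \<in> carrier \<pi>" using h y by (auto simp: hom_def)
    have "pi1_map S f y \<otimes>\<^bsub>\<pi>\<^esub> inv\<^bsub>\<pi>\<^esub> x = (pi1_map S f y \<otimes>\<^bsub>\<pi>\<^esub> inv\<^bsub>\<pi>\<^esub> y) \<otimes>\<^bsub>\<pi>\<^esub> (y \<otimes>\<^bsub>\<pi>\<^esub> inv\<^bsub>\<pi>\<^esub> x)"
      "y \<otimes>\<^bsub>\<pi>\<^esub> inv\<^bsub>\<pi>\<^esub> x = inv\<^bsub>\<pi>\<^esub> (pi1_map S f y \<otimes>\<^bsub>\<pi>\<^esub> inv\<^bsub>\<pi>\<^esub> y) \<otimes>\<^bsub>\<pi>\<^esub> (pi1_map S f y \<otimes>\<^bsub>\<pi>\<^esub> inv\<^bsub>\<pi>\<^esub> x)"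
      using c x(1) y by (simp_all add: word_simps)
    then have "pi1_map S f y \<otimes>\<^bsub>\<pi>\<^esub> inv\<^bsub>\<pi>\<^esub> x \<in> ?N \<longleftrightarrow> y \<otimes>\<^bsub>\<pi>\<^esub> inv\<^bsub>\<pi>\<^esub> x \<in> ?N"
      using t[OF y] N.m_closed N.m_inv_closed by metis
    then show ?thesis using c y mem by blast
  qed
  have "mapping_class_action S (isotopy_class S p f) ` C = pi1_map S f ` C"
    using C mapping_class_action_eq[OF pf] by (intro image_cong) auto
  also have "\<dots> = C"
  proof
    show "pi1_map S f ` C \<subseteq> C" using tr C by blast
    show "C \<subseteq> pi1_map S f ` C"
    proof
      fix y assume y: "y \<in> C"
      have c: "pi1_map S f' y \<in> carrier \<pi>" using h' y C by (auto simp: hom_def)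
      have e: "pi1_map S f (pi1_map S f' y) = y" using inv y C by blast
      then have "pi1_map S f' y \<in> C" using tr[OF c] y by simp
      then show "y \<in> pi1_map S f ` C" using e by (metis imageI)
    qed
  qed
  finally show "mapping_class_action S (isotopy_class S p f) ` C = C" .
qed

lemma pi1_map_id: "X \<in> carrier \<pi> \<Longrightarrow> pi1_map S id X = X"
  by (erule pi1_cases) (simp add: pi1_map_class)

lemma johnson_kernel_one: "isotopy_class S p id \<in> carrier (johnson_kernel S p)"
  by (rule mapping_class_in_johnson_kernel[OF homeo_plus_id])
    (simp add: pi1_map_id subgroup.one_closed[OF normal_imp_subgroup[OF lower_central_3_normal]])

end

lemma one_johnson_kernel: "\<one>\<^bsub>johnson_kernel S p\<^esub> = isotopy_class S p id"
  by (simp add: johnson_kernel_def Let_def mapping_class_group_def)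

sublocale pointed_space \<subseteq> torelli_coinvariants "fundamental_group S p" "johnson_kernel S p" "mapping_class_action S"
proof
  show "mapping_class_action S k \<in> hom \<pi> \<pi>" if "k \<in> carrier (johnson_kernel S p)" for k
    by (rule johnson_kernel_hom[OF that])
  show "mapping_class_action S k x \<otimes>\<^bsub>\<pi>\<^esub> inv\<^bsub>\<pi>\<^esub> x \<in> lower_central \<pi> 2"
    if "k \<in> carrier (johnson_kernel S p)" "x \<in> carrier \<pi>" for k x
    using johnson_kernel_trivial[OF that] N3_subset_N2 by blast
  show "\<one>\<^bsub>johnson_kernel S p\<^esub> \<in> carrier (johnson_kernel S p)"
    unfolding one_johnson_kernel by (rule johnson_kernel_one)
  show "mapping_class_action S \<one>\<^bsub>johnson_kernel S p\<^esub> x = x" if "x \<in> lower_central \<pi> 2" for x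
    unfolding one_johnson_kernel using that mapping_class_action_eq[OF pointed_homeo_id, of x S p] by (simp add: pi1_map_id)
qed

context pointed_space
begin

text \<open>The values off the carrier are arbitrary, so that the inverse of a member can be chosen inside.\<close>

definition geometric :: "((real \<Rightarrow> 'a) set \<Rightarrow> (real \<Rightarrow> 'a) set) set" where
  "geometric = {\<phi>. \<exists>f\<in>homeo_plus S p. \<forall>X\<in>carrier \<pi>. \<phi> X = pi1_map S f X}"

lemma geometricI: "f \<in> homeo_plus S p \<Longrightarrow> pi1_map S f \<in> geometric"
  by (auto simp: geometric_def)

lemma geometric_hom: "\<phi> \<in> geometric \<Longrightarrow> \<phi> \<in> hom \<pi> \<pi>"
proof -
  assume "\<phi> \<in> geometric"
  then obtain f where f: "pointed_homeo S p f" "\<And>X. X \<in> carrier \<pi> \<Longrightarrow> \<phi> X = pi1_map S f X"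
    unfolding geometric_def homeo_plus_def by blast
  from pi1_map_hom[OF f(1)] show ?thesis using f(2) by (auto simp: hom_def Pi_iff)
qed

lemma geometric_id: "id \<in> geometric"
  unfolding geometric_def using homeo_plus_id pi1_map_id by (auto intro!: bexI[of _ id])

lemma geometric_comp:
  assumes "\<phi> \<in> geometric" "\<psi> \<in> geometric" shows "\<phi> \<circ> \<psi> \<in> geometric"
proof -
  obtain f f' where f: "f \<in> homeo_plus S p" "\<And>X. X \<in> carrier \<pi> \<Longrightarrow> \<phi> X = pi1_map S f X"
    and f': "f' \<in> homeo_plus S p" "\<And>X. X \<in> carrier \<pi> \<Longrightarrow> \<psi> X = pi1_map S f' X"
    using assms by (auto simp: geometric_def)
  have "(\<phi> \<circ> \<psi>) X = pi1_map S (f \<circ> f') X" if X: "X \<in> carrier \<pi>" for X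
  proof -
    have "\<psi> X \<in> carrier \<pi>" using geometric_hom[OF assms(2)] X by (auto simp: hom_def)
    then show ?thesis using f f' X pi1_map_comp[of S p f f' X] by (auto simp: homeo_plus_def)
  qed
  then show ?thesis unfolding geometric_def using homeo_plus_comp[OF p f(1) f'(1)] by blast
qed

lemma geometric_inv:
  assumes "\<phi> \<in> geometric"
  shows "\<exists>\<psi>\<in>geometric. \<forall>x\<in>carrier \<pi>. \<phi> (\<psi> x) = x \<and> \<psi> (\<phi> x) = x"
proof -
  obtain f where f: "f \<in> homeo_plus S p" "\<And>X. X \<in> carrier \<pi> \<Longrightarrow> \<phi> X = pi1_map S f X"
    using assms by (auto simp: geometric_def)
  obtain f' where f': "f' \<in> homeo_plus S p" "\<And>x. x \<in> S \<Longrightarrow> f (f' x) = x" "\<And>x. x \<in> S \<Longrightarrow> f' (f x) = x"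
    using homeo_plus_inverse[OF p f(1)] by blast
  have ph: "pointed_homeo S p f" "pointed_homeo S p f'" using f(1) f'(1) by (auto simp: homeo_plus_def)
  have "\<phi> (pi1_map S f' x) = x \<and> pi1_map S f' (\<phi> x) = x" if x: "x \<in> carrier \<pi>" for x
  proof -
    have "pi1_map S f' x \<in> carrier \<pi>" using pi1_map_hom[OF ph(2)] x by (auto simp: hom_def)
    then show ?thesis using f(2) pi1_map_inverse[OF x ph f'(2)] pi1_map_inverse[OF x ph(2,1) f'(3)] x by simp
  qed
  then show ?thesis using geometricI[OF f'(1)] by blast
qed

lemma geometric_johnson:
  assumes \<phi>: "\<phi> \<in> geometric" and t: "\<And>x. x \<in> carrier \<pi> \<Longrightarrow> \<phi> x \<otimes>\<^bsub>\<pi>\<^esub> inv\<^bsub>\<pi>\<^esub> x \<in> lower_central \<pi> 3"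
  shows "\<exists>k\<in>carrier (johnson_kernel S p). \<forall>x\<in>carrier \<pi>. mapping_class_action S k x = \<phi> x"
proof -
  obtain f where f: "f \<in> homeo_plus S p" "\<And>X. X \<in> carrier \<pi> \<Longrightarrow> \<phi> X = pi1_map S f X"
    using \<phi> by (auto simp: geometric_def)
  have "isotopy_class S p f \<in> carrier (johnson_kernel S p)"
    by (rule mapping_class_in_johnson_kernel[OF f(1)]) (use t f(2) in simp)
  moreover have "mapping_class_action S (isotopy_class S p f) x = \<phi> x" if "x \<in> carrier \<pi>" for x
    using mapping_class_action_eq[OF _ that, of f] f that by (simp add: homeo_plus_def)
  ultimately show ?thesis by blast
qed

text \<open>The meeting point of algebra and topology: what is left is to realize a list of
  automorphisms by homeomorphisms.\<close>

theorem stable_if_surface_automorphisms: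
  assumes "surface_automorphisms \<pi> g a b c geometric al be mx"
  shows "\<forall>k\<ge>2. adic_filtration (abelianization \<pi>) (johnson_coinvariants S p) k =
    adic_filtration (abelianization \<pi>) (johnson_coinvariants S p) 2"
proof -
  interpret sa: surface_automorphisms \<pi> g a b c geometric al be mx by (rule assms)
  have "\<forall>k\<ge>2. adic_filtration (abelianization \<pi>) CM k = adic_filtration (abelianization \<pi>) CM 2"
  proof (rule adic_filtration_stable)
    fix \<eta> x y u
    assume 1: "N2hom \<eta>" and 2: "\<And>k u. k \<in> carrier (johnson_kernel S p) \<Longrightarrow> u \<in> lower_central \<pi> 2 \<Longrightarrow> \<eta> (mapping_class_action S k u) = \<eta> u"
      and 3: "\<And>x y z u. x \<in> carrier \<pi> \<Longrightarrow> y \<in> carrier \<pi> \<Longrightarrow> z \<in> carrier \<pi> \<Longrightarrow> u \<in> lower_central \<pi> 2 \<Longrightarrow>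
         second_diff \<eta> x y (z \<otimes>\<^bsub>\<pi>\<^esub> u \<otimes>\<^bsub>\<pi>\<^esub> inv\<^bsub>\<pi>\<^esub> z) = second_diff \<eta> x y u"
      and 4: "x \<in> carrier \<pi>" "y \<in> carrier \<pi>" "u \<in> lower_central \<pi> 2"
    show "second_diff \<eta> x y u = 0"
    proof (rule sa.second_difference_zero[OF 1 _ 3 4])
      fix \<phi> u assume "\<phi> \<in> geometric" "\<And>x. x \<in> carrier \<pi> \<Longrightarrow> \<phi> x \<otimes>\<^bsub>\<pi>\<^esub> inv\<^bsub>\<pi>\<^esub> x \<in> lower_central \<pi> 3"
        and u: "u \<in> lower_central \<pi> 2"
      from geometric_johnson[OF this(1,2)] obtain k where
        "k \<in> carrier (johnson_kernel S p)" "\<forall>x\<in>carrier \<pi>. mapping_class_action S k x = \<phi> x" by blast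
      then show "\<eta> (\<phi> u) = \<eta> u" using 2[of k u] u by simp
    qed
  qed
  then show ?thesis unfolding johnson_coinvariants_def johnson_module_def Let_def .
qed

end

section \<open>Twists along annuli\<close>

text \<open>The first coordinate runs across the annulus and the second around it. By
  \<open>opn\<close> the complement of the open annulus is closed, so that a map may be defined
  separately inside and outside.\<close>

locale annulus =
  fixes S :: "'a::topological_space set" and \<kappa> :: "real \<times> real \<Rightarrow> 'a"
  assumes haus: "Hausdorff_space (top_of_set S)"
    and cont: "continuous_on ({0..1} \<times> {0..1}) \<kappa>"
    and im: "\<kappa> ` ({0..1} \<times> {0..1}) \<subseteq> S"
    and wrap: "s \<in> {0..1} \<Longrightarrow> \<kappa> (s, 0) = \<kappa> (s, 1)"
    and inj: "s \<in> {0..1} \<Longrightarrow> t \<in> {0..1} \<Longrightarrow> s' \<in> {0..1} \<Longrightarrow> t' \<in> {0..1} \<Longrightarrow> \<kappa> (s, t) = \<kappa> (s', t') \<Longrightarrow>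
       s = s' \<and> (t = t' \<or> (t = 0 \<and> t' = 1) \<or> (t = 1 \<and> t' = 0))"
    and opn: "openin (top_of_set S) (\<kappa> ` ({0<..<1} \<times> {0..1}))"
begin

text \<open>An angle in [0, 2] reduced modulo 1; the value 1 is kept, as \<kappa> identifies it with
  0.\<close>

definition wind :: "real \<Rightarrow> real" where "wind t = (if t \<le> 1 then t else t - 1)"

text \<open>The angle advances by s, from no turn on the circle s = 0 to a full turn on the circle s
  = 1, so that both circles are fixed pointwise.\<close>

definition twist :: "'a \<Rightarrow> 'a" where
  "twist x = (if x \<in> \<kappa> ` ({0..1} \<times> {0..1})
     then let (s, t) = (SOME st. st \<in> {0..1} \<times> {0..1} \<and> \<kappa> st = x) in \<kappa> (s, wind (s + t)) else x)"

lemma twist_in: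
  assumes s: "s \<in> {0..1}" and t: "t \<in> {0..1}"
  shows "twist (\<kappa> (s, t)) = \<kappa> (s, wind (s + t))"
proof -
  let ?P = "\<lambda>st. st \<in> {0..1} \<times> {0..1} \<and> \<kappa> st = \<kappa> (s, t)"
  have "?P (SOME st. ?P st)" by (rule someI[of ?P "(s, t)"]) (use s t in auto)
  then obtain s' t' where st: "(SOME st. ?P st) = (s', t')" "s' \<in> {0..1}" "t' \<in> {0..1}" "\<kappa> (s', t') = \<kappa> (s, t)"
    by (metis (no_types, lifting) mem_Sigma_iff surj_pair)
  have e: "s' = s" "t' = t \<or> (t' = 0 \<and> t = 1) \<or> (t' = 1 \<and> t = 0)" using inj[OF st(2,3) s t st(4)] by auto
  \<comment> \<open>The only freedom in the choice is between the angles 0 and 1. Both lead to the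
    same point, for s = 0 by a second use of \<open>wrap\<close>.\<close>
  have "\<kappa> (s, wind (s + t')) = \<kappa> (s, wind (s + t))"
    using e(2) s wrap[OF s] wrap[of 0] by (cases "s = 0") (auto simp: wind_def)
  moreover have "twist (\<kappa> (s, t)) = \<kappa> (s', wind (s' + t'))"
  proof -
    have "\<kappa> (s, t) \<in> \<kappa> ` ({0..1} \<times> {0..1})" using s t by blast
    then show ?thesis unfolding twist_def st(1) by simp
  qed
  ultimately show ?thesis by (simp add: e(1))
qed

lemma twist_out:
  assumes x: "x \<notin> \<kappa> ` ({0<..<1} \<times> {0..1})"
  shows "twist x = x"
proof (cases "x \<in> \<kappa> ` ({0..1} \<times> {0..1})")
  case True
  then obtain s t where st: "s \<in> {0..1}" "t \<in> {0..1}" "x = \<kappa> (s, t)" by auto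
  then have "s = 0 \<or> s = 1" using x by (force simp: image_iff)
  then show ?thesis using st wrap[of 1] twist_in[OF st(1,2)] by (auto simp: wind_def)
next
  case False then show ?thesis by (simp add: twist_def)
qed

lemma twist_S: "x \<in> S \<Longrightarrow> twist x \<in> S"
proof (cases "x \<in> \<kappa> ` ({0..1} \<times> {0..1})")
  case True
  then obtain s t where st: "s \<in> {0..1}" "t \<in> {0..1}" "x = \<kappa> (s, t)" by auto
  then have "wind (s + t) \<in> {0..1}" by (auto simp: wind_def)
  then show ?thesis using st im twist_in[OF st(1,2)] by (auto simp: image_subset_iff)
next
  case False
  then have "twist x = x" by (simp add: twist_def)
  then show "x \<in> S \<Longrightarrow> twist x \<in> S" by simp
qed

lemma annulus_closed: "closedin (top_of_set S) (\<kappa> ` ({0..1} \<times> {0..1}))"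
proof (rule compactin_imp_closedin[OF haus])
  show "compactin (top_of_set S) (\<kappa> ` ({0..1} \<times> {0..1}))"
    using im by (simp add: compactin_subtopology compact_continuous_image[OF cont] compact_Times)
qed

lemma twist_continuous: "continuous_on S twist"
proof -
  let ?Q = "{0..1::real} \<times> {0..1::real}"
  let ?A = "\<kappa> ` ?Q" and ?B = "S - \<kappa> ` ({0<..<1} \<times> {0..1})"
  have AB: "?A \<union> ?B = S" using im by force
  have cA: "closedin (top_of_set (?A \<union> ?B)) ?A" unfolding AB by (rule annulus_closed)
  have cB: "closedin (top_of_set (?A \<union> ?B)) ?B" unfolding AB using closedin_diff[OF closedin_topspace opn] by simp
  \<comment> \<open>Continuity on the closed annulus is tested on the square, which maps onto it by
    a quotient map since it is compact and the surface is Hausdorff.\<close>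
  have qm: "quotient_map (top_of_set ?Q) (top_of_set ?A) \<kappa>"
  proof (rule continuous_imp_quotient_map)
    show "continuous_map (top_of_set ?Q) (top_of_set ?A) \<kappa>" using cont by auto
    show "compact_space (top_of_set ?Q)" by (simp add: compact_space_subtopology compact_Times)
    have "top_of_set ?A = subtopology (top_of_set S) ?A" using im by (simp add: subtopology_subtopology Int_absorb1)
    then show "Hausdorff_space (top_of_set ?A)" using Hausdorff_space_subtopology[OF haus] by simp
  qed auto
  have "continuous_on ?Q (\<lambda>st. if fst st + snd st \<le> 1 then \<kappa> (fst st, fst st + snd st) else \<kappa> (fst st, fst st + snd st - 1))"
  proof (rule continuous_on_cases_le)
    show "continuous_on {st \<in> ?Q. fst st + snd st \<le> 1} (\<lambda>st. \<kappa> (fst st, fst st + snd st))"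
      by (rule continuous_on_compose2[OF cont]) (auto intro!: continuous_intros)
    show "continuous_on {st \<in> ?Q. 1 \<le> fst st + snd st} (\<lambda>st. \<kappa> (fst st, fst st + snd st - 1))"
      by (rule continuous_on_compose2[OF cont]) (auto intro!: continuous_intros)
    show "\<kappa> (fst st, fst st + snd st) = \<kappa> (fst st, fst st + snd st - 1)" if "st \<in> ?Q" "fst st + snd st = 1" for st
      using that wrap[of "fst st"] by auto
  qed (auto intro!: continuous_intros)
  moreover have "(if fst st + snd st \<le> 1 then \<kappa> (fst st, fst st + snd st) else \<kappa> (fst st, fst st + snd st - 1)) = (twist \<circ> \<kappa>) st"
    if "st \<in> ?Q" for st using that twist_in[of "fst st" "snd st"] by (auto simp: wind_def)
  ultimately have "continuous_on ?Q (twist \<circ> \<kappa>)" by (simp cong: continuous_on_cong)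
  then have "continuous_map (top_of_set ?Q) (top_of_set UNIV) (twist \<circ> \<kappa>)" by simp
  then have "continuous_map (top_of_set ?A) (top_of_set UNIV) twist" by (rule continuous_compose_quotient_map[OF qm])
  then have "continuous_on ?A twist" by simp
  moreover have "continuous_on ?B twist"
    by (rule continuous_on_eq[OF continuous_on_id]) (simp add: twist_out)
  ultimately have "continuous_on (?A \<union> ?B) twist" by (rule continuous_on_Un_local[OF cA cB])
  then show ?thesis by (simp only: AB)
qed

text \<open>Reversing the angle reverses the twist. The inverse of a twist is thus a twist of
  another annulus, and its continuity comes for free.\<close>

lemma mirror: "annulus S (\<lambda>st. \<kappa> (fst st, 1 - snd st))"
proof
  have e: "(\<lambda>st. \<kappa> (fst st, 1 - snd st)) ` (A \<times> {0..1}) = \<kappa> ` (A \<times> {0..1})" for A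
  proof -
    have "(\<lambda>st :: real \<times> real. (fst st, 1 - snd st)) ` (A \<times> {0..1}) = A \<times> {0..1}"
    proof
      show "A \<times> {0..1} \<subseteq> (\<lambda>st :: real \<times> real. (fst st, 1 - snd st)) ` (A \<times> {0..1})"
      proof
        fix st :: "real \<times> real" assume "st \<in> A \<times> {0..1}"
        then show "st \<in> (\<lambda>st. (fst st, 1 - snd st)) ` (A \<times> {0..1})"
          by (intro image_eqI[of _ _ "(fst st, 1 - snd st)"]) auto
      qed
    qed auto
    moreover have "(\<lambda>st. \<kappa> (fst st, 1 - snd st)) ` (A \<times> {0..1}) = \<kappa> ` ((\<lambda>st. (fst st, 1 - snd st)) ` (A \<times> {0..1}))"
      by (simp only: image_image)
    ultimately show ?thesis by simp
  qed
  show "Hausdorff_space (top_of_set S)" by (rule haus)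
  show "continuous_on ({0..1} \<times> {0..1}) (\<lambda>st. \<kappa> (fst st, 1 - snd st))"
    by (rule continuous_on_compose2[OF cont]) (auto intro!: continuous_intros)
  show "(\<lambda>st. \<kappa> (fst st, 1 - snd st)) ` ({0..1} \<times> {0..1}) \<subseteq> S" unfolding e by (rule im)
  show "openin (top_of_set S) ((\<lambda>st. \<kappa> (fst st, 1 - snd st)) ` ({0<..<1} \<times> {0..1}))" unfolding e by (rule opn)
  show "\<kappa> (fst (s, 0), 1 - snd (s, 0 :: real)) = \<kappa> (fst (s, 1), 1 - snd (s, 1 :: real))" if "s \<in> {0..1}" for s
    using wrap[OF that] by simp
  show "s = s' \<and> (t = t' \<or> (t = 0 \<and> t' = 1) \<or> (t = 1 \<and> t' = 0))"
    if "s \<in> {0..1}" "t \<in> {0..1}" "s' \<in> {0..1}" "t' \<in> {0..1}" "\<kappa> (fst (s, t), 1 - snd (s, t)) = \<kappa> (fst (s', t'), 1 - snd (s', t'))"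
    for s t s' t'
    using inj[of s "1 - t" s' "1 - t'"] that by auto
qed

lemma mirror_twist:
  assumes "x \<in> S" shows "annulus.twist (\<lambda>st. \<kappa> (fst st, 1 - snd st)) (twist x) = x"
proof -
  interpret m: annulus S "\<lambda>st. \<kappa> (fst st, 1 - snd st)" by (rule mirror)
  show ?thesis
  proof (cases "x \<in> \<kappa> ` ({0..1} \<times> {0..1})")
    case True
    then obtain s t where st: "s \<in> {0..1}" "t \<in> {0..1}" "x = \<kappa> (s, t)" by auto
    define t' where "t' = wind (s + t)"
    have t': "t' \<in> {0..1}" "1 - t' \<in> {0..1}" using st by (auto simp: t'_def wind_def)
    have "twist x = \<kappa> (s, t')" using twist_in[OF st(1,2)] st(3) by (simp add: t'_def)
    then have "m.twist (twist x) = \<kappa> (s, 1 - m.wind (s + (1 - t')))"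
      using m.twist_in[OF st(1) t'(2)] by simp
    also have "\<dots> = \<kappa> (s, t)"
    proof (cases "s + t \<le> 1")
      case True then show ?thesis using st by (auto simp: t'_def wind_def m.wind_def)
    next
      case False
      show ?thesis
      proof (cases "t = 1")
        case True then show ?thesis using False st wrap[OF st(1)] by (auto simp: t'_def wind_def m.wind_def)
      next
        case f: False
        then show ?thesis using False st by (auto simp: t'_def wind_def m.wind_def)
      qed
    qed
    finally show ?thesis using st by simp
  next
    case False
    then have "x \<notin> \<kappa> ` ({0<..<1} \<times> {0..1})" by auto
    moreover have "(\<lambda>st. \<kappa> (fst st, 1 - snd st)) ` ({0<..<1} \<times> {0..1}) \<subseteq> \<kappa> ` ({0<..<1} \<times> {0..1})" by auto
    ultimately show ?thesis using twist_out[of x] m.twist_out[of x] by auto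
  qed
qed

lemma twist_homeo: "homeomorphic_map (top_of_set S) (top_of_set S) twist"
proof -
  interpret m: annulus S "\<lambda>st. \<kappa> (fst st, 1 - snd st)" by (rule mirror)
  have "annulus.twist (\<lambda>st. \<kappa> (fst st, 1 - (1 - snd st))) (m.twist x) = x" if "x \<in> S" for x
    using m.mirror_twist[OF that] by simp
  then have "twist (m.twist x) = x" if "x \<in> S" for x using that by simp
  then have "homeomorphic_maps (top_of_set S) (top_of_set S) twist m.twist"
    using mirror_twist twist_continuous m.twist_continuous twist_S m.twist_S
    unfolding homeomorphic_maps_def by auto
  then show ?thesis using homeomorphic_map_maps by blast
qed

lemma twist_homeo_plus:
  assumes p: "p \<in> S" and out: "p \<notin> \<kappa> ` ({0..1} \<times> {0..1})" and closed_p: "closedin (top_of_set S) {p}"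
  shows "twist \<in> homeo_plus S p"
proof -
  let ?C = "\<kappa> ` ({0..1} \<times> {0..1})" and ?X = "top_of_set S"
  have "twist p = p" by (rule twist_out) (use out in auto)
  then have h: "pointed_homeo S p twist" using twist_homeo by (simp add: pointed_homeo_def)
  have op: "openin ?X (S - {p})" using openin_diff[OF openin_topspace closed_p] by simp
  have "?X closure_of ?C \<subseteq> ?X interior_of (S - {p})"
    using closure_of_closedin[OF annulus_closed] interior_of_openin[OF op] im out by auto
  from homology_excision_axiom[OF this, of S 2]
  have iso: "hom_induced 2 (subtopology ?X (S - ?C)) (S - {p} - ?C) ?X (S - {p}) id
      \<in> iso (relative_homology_group 2 (subtopology ?X (S - ?C)) (S - {p} - ?C)) (relative_homology_group 2 ?X (S - {p}))"
    by (simp add: subtopology_subtopology)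
  have "orientation_preserving_at S p twist"
    unfolding orientation_preserving_at_def
  proof
    fix c assume "c \<in> carrier (relative_homology_group 2 ?X (S - {p}))"
    then obtain c' where c: "c = hom_induced 2 (subtopology ?X (S - ?C)) (S - {p} - ?C) ?X (S - {p}) id c'"
      using iso by (auto simp: iso_def bij_betw_def)
    have m: "continuous_map (subtopology ?X (S - ?C)) ?X id" by (simp add: continuous_map_from_subtopology)
    have "hom_induced 2 ?X (S - {p}) ?X (S - {p}) twist c = hom_induced 2 (subtopology ?X (S - ?C)) (S - {p} - ?C) ?X (S - {p}) (twist \<circ> id) c'"
      unfolding c by (rule hom_induced_compose'[OF m]) (use pointed_homeo_maps[OF h p] in auto)
    also have "\<dots> = c"
      unfolding c by (subst hom_induced_eq[of _ "twist \<circ> id" id]) (auto intro!: twist_out)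
    finally show "hom_induced 2 ?X (S - {p}) ?X (S - {p}) twist c = c" .
  qed
  then show ?thesis using h by (simp add: homeo_plus_def)
qed

end

section \<open>The glued polygon\<close>

locale polygon_surface =
  fixes g :: nat and S :: "'a::topological_space set" and q :: "complex \<Rightarrow> 'a"
  assumes g: "g \<ge> 1"
    and quot: "quotient_map (top_of_set (cball 0 1)) (top_of_set S) q"
    and fib_iff: "z \<in> cball 0 1 \<Longrightarrow> w \<in> cball 0 1 \<Longrightarrow>
      q z = q w \<longleftrightarrow> (z, w) \<in> (polygon_gluing g \<union> (polygon_gluing g)\<inverse>)\<^sup>*"
begin

abbreviation "P \<equiv> polygon_point g"
abbreviation "D \<equiv> cball (0::complex) 1"
abbreviation "n \<equiv> real (4 * g)"
abbreviation "v \<equiv> q 1"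

lemma n_pos: "n > 0" "n \<ge> 4" using g by auto

lemma P_norm [simp]: "norm (P x) = 1" by (simp add: polygon_point_def)

lemma P_in_D [simp]: "P x \<in> D" by simp

lemma P_0 [simp]: "P 0 = 1" by (simp add: polygon_point_def)

lemma P_add: "P (x + y) = P x * P y"
  by (simp add: polygon_point_def cis_mult algebra_simps add_divide_distrib)

lemma P_minus: "P (- x) = cnj (P x)"
  by (simp add: polygon_point_def cis_cnj)

lemma P_cnj: "P x * cnj (P x) = 1"
  by (simp add: P_add[symmetric] P_minus[symmetric])

lemma angle_eq: "2 * pi * x / n = 2 * pi * y / n + 2 * pi * of_int k \<longleftrightarrow> x = y + n * of_int k"
proof -
  have "2 * pi * y / n + 2 * pi * of_int k = 2 * pi * (y + n * of_int k) / n"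
    using n_pos by (simp add: field_simps)
  then show ?thesis using n_pos by (simp add: divide_cancel_right)
qed

lemma P_eq: "P x = P y \<longleftrightarrow> (\<exists>k::int. x = y + n * of_int k)"
proof -
  have "P x = P y \<longleftrightarrow> sin (2 * pi * x / n) = sin (2 * pi * y / n) \<and> cos (2 * pi * x / n) = cos (2 * pi * y / n)"
    by (auto simp: polygon_point_def complex_eq_iff)
  also have "\<dots> \<longleftrightarrow> (\<exists>k::int. 2 * pi * x / n = 2 * pi * y / n + 2 * pi * of_int k)"
    by (rule sin_cos_eq_iff)
  finally show ?thesis unfolding angle_eq .
qed

lemma P_period: "P (x + n * of_int k) = P x"
  unfolding P_eq by blast

lemma P_surj:
  assumes "norm z = 1" obtains x where "0 \<le> x" "x < n" "z = P x"
proof -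
  have "z \<noteq> 0" using assms by auto
  then have "cis (Arg z) = z" using assms by (simp add: cis_Arg sgn_eq)
  then have z: "z = P (n * Arg z / (2 * pi))" using n_pos by (simp add: polygon_point_def)
  define y where "y = n * Arg z / (2 * pi)"
  define x where "x = y + n * of_int (- \<lfloor>y / n\<rfloor>)"
  have "z = P x" unfolding x_def P_period using z by (simp add: y_def)
  moreover have "0 \<le> x" "x < n"
    using n_pos floor_divide_lower[of n y] floor_divide_upper[of n y] by (simp_all add: x_def algebra_simps)
  ultimately show ?thesis using that by blast
qed

text \<open>
  The canonical representative of the class of a boundary point: \<open>1\<close> for a vertex, and the
  point on the edge of the type \<open>a\<close> or \<open>b\<close> (index \<open>0\<close> or \<open>1\<close> modulo \<open>4\<close>) otherwise.
\<close>

definition cx :: "real \<Rightarrow> complex" where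
  "cx x = (if x \<in> \<int> then 1 else if \<lfloor>x\<rfloor> mod 4 < 2 then P x else P (of_int (2 * \<lfloor>x\<rfloor> - 1) - x))"

definition canon :: "complex \<Rightarrow> complex" where
  "canon z = (if norm z < 1 then z else cx (SOME x. z = P x))"

lemma cx_period: "cx (x + n * of_int k) = cx x"
proof -
  have nk: "n * of_int k = of_int (4 * int g * k)" by simp
  have fl: "\<lfloor>x + n * of_int k\<rfloor> = \<lfloor>x\<rfloor> + 4 * int g * k" unfolding nk by (rule floor_add_int[symmetric])
  have "(\<lfloor>x\<rfloor> + 4 * int g * k) mod 4 = \<lfloor>x\<rfloor> mod 4" by (metis mod_mult_self2 mult.assoc)
  moreover have "x + n * of_int k \<in> \<int> \<longleftrightarrow> x \<in> \<int>" unfolding nk by (simp add: add_in_Ints_iff_right)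
  moreover have "of_int (2 * (\<lfloor>x\<rfloor> + 4 * int g * k) - 1) - (x + n * of_int k) = (of_int (2 * \<lfloor>x\<rfloor> - 1) - x) + n * of_int k"
    by (simp add: algebra_simps)
  ultimately show ?thesis unfolding cx_def fl by (simp only: P_period)
qed

lemma canon_P: "canon (P x) = cx x"
proof -
  define y where "y = (SOME y. P x = P y)"
  have "P x = P y" unfolding y_def by (rule someI[of "\<lambda>y. P x = P y" x]) simp
  then obtain k :: int where "x = y + n * of_int k" by (auto simp: P_eq)
  moreover have "canon (P x) = cx y" by (simp add: canon_def y_def)
  ultimately show ?thesis using cx_period[of y k] by simp
qed

lemma canon_interior: "norm z < 1 \<Longrightarrow> canon z = z" by (simp add: canon_def)

lemma norm_cx [simp]: "norm (cx x) = 1" by (simp add: cx_def)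

lemma floor_frac: "0 \<le> u \<Longrightarrow> u < 1 \<Longrightarrow> \<lfloor>of_int k + u\<rfloor> = k" by (simp add: floor_unique)

lemma not_int: "0 < u \<Longrightarrow> u < 1 \<Longrightarrow> of_int k + u \<notin> (\<int> :: real set)"
proof
  assume u: "0 < u" "u < 1" and "of_int k + u \<in> (\<int> :: real set)"
  then obtain l where l: "of_int k + u = (of_int l :: real)" by (auto elim: Ints_cases)
  then have "u = of_int (l - k)" by simp
  with u have "0 < l - k" "l - k < 1" by (metis of_int_0_less_iff, metis of_int_less_1_iff)
  then show False by simp
qed

lemma cx_int: "cx (of_int k) = 1" by (simp add: cx_def)

lemma cx_low: "k mod 4 < 2 \<Longrightarrow> 0 < u \<Longrightarrow> u < 1 \<Longrightarrow> cx (of_int k + u) = P (of_int k + u)"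
  using not_int[of u k] floor_frac[of u k] by (simp add: cx_def)

text \<open>The point x = k + 3 - u lies on the edge k + 2, and the reflection 2 (k + 2) - 1 - x in
  the definition of \<open>cx\<close> is k + u.\<close>

lemma cx_high:
  assumes "k mod 4 < 2" "0 < u" "u < 1"
  shows "cx (of_int k + 3 - u) = P (of_int k + u)"
proof -
  have e: "of_int k + 3 - u = of_int (k + 2) + (1 - u)" by simp
  have f: "\<lfloor>of_int k + 3 - u\<rfloor> = k + 2" unfolding e by (rule floor_frac) (use assms in auto)
  have "of_int k + 3 - u \<notin> (\<int> :: real set)" unfolding e by (rule not_int) (use assms in auto)
  moreover have "\<not> (k + 2) mod 4 < 2" using assms(1) by presburger
  ultimately show ?thesis unfolding cx_def f by (simp add: algebra_simps)
qed

lemma gluing_canon: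
  assumes "(z, w) \<in> polygon_gluing g" shows "canon z = canon w"
proof -
  have *: "cx (of_int k + s) = cx (of_int k + 3 - s)" if k: "k mod 4 < 2" and s: "s \<in> {0..1}" for k s
  proof (cases "s = 0 \<or> s = 1")
    case True
    moreover have "of_int k + 3 - 1 = (of_int (k + 2) :: real)" by simp
    ultimately show ?thesis using cx_int[of k] cx_int[of "k + 3"] cx_int[of "k + 1"] cx_int[of "k + 2"] by (auto simp: add.commute)
  next
    case False
    then show ?thesis using cx_low[OF k, of s] cx_high[OF k, of s] s by auto
  qed
  from assms obtain j :: nat and s where s: "s \<in> {0..1}" and
    "(z = P (real (4 * j) + s) \<and> w = P (real (4 * j + 3) - s)) \<or> (z = P (real (4 * j + 1) + s) \<and> w = P (real (4 * j + 4) - s))"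
    by (auto simp: polygon_gluing_def)
  moreover have "(4 * int j) mod 4 < 2" "(4 * int j + 1) mod 4 < 2" by presburger+
  ultimately show ?thesis
    using *[of "4 * int j" s] *[of "4 * int j + 1" s] by (auto simp: canon_P algebra_simps)
qed

lemma q_eq_canon:
  assumes "z \<in> D" "w \<in> D" "q z = q w" shows "canon z = canon w"
proof -
  have "(z, w) \<in> (polygon_gluing g \<union> (polygon_gluing g)\<inverse>)\<^sup>*" using assms fib_iff by blast
  then show ?thesis by (induction rule: rtrancl_induct) (use gluing_canon in auto)
qed

lemma q_interior: "z \<in> D \<Longrightarrow> w \<in> D \<Longrightarrow> norm z < 1 \<Longrightarrow> q z = q w \<Longrightarrow> z = w"
  using q_eq_canon[of z w] canon_interior[of z] canon_interior[of w]
  by (cases "norm w < 1") (auto simp: canon_def)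

text \<open>Both families in \<open>polygon_gluing\<close> have this form, with k congruent to 0 or
  to 1 modulo 4. An arbitrary integer k is brought into the range of handles by the period
  4g.\<close>

lemma glue:
  assumes k: "k mod 4 < 2" and u: "0 \<le> u" "u \<le> 1"
  shows "q (P (of_int k + u)) = q (P (of_int k + 3 - u))"
proof -
  define r where "r = k mod 4"
  define j where "j = nat ((k div 4) mod int g)"
  have jg: "j < g" using g by (simp add: j_def nat_less_iff)
  have gi: "int g > 0" using g by simp
  have kdiv: "k = 4 * (k div 4) + r" by (simp add: r_def)
  have "k div 4 = int j + int g * ((k div 4) div int g)" using gi by (simp add: j_def)
  then have kk: "k = 4 * int j + r + 4 * int g * ((k div 4) div int g)" using kdiv by (simp add: algebra_simps)
  define l where "l = (k div 4) div int g"
  have kr: "of_int k = real (4 * j) + of_int r + n * of_int l" using kk unfolding l_def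
    by (metis (no_types, opaque_lifting) of_int_add of_int_mult of_int_numeral of_int_of_nat_eq of_nat_mult of_nat_numeral)
  have p1: "P (of_int k + u) = P (real (4 * j) + of_int r + u)"
    unfolding kr P_eq by (intro exI[of _ l]) simp
  have p2: "P (of_int k + 3 - u) = P (real (4 * j) + of_int r + 3 - u)"
    unfolding kr P_eq by (intro exI[of _ l]) simp
  have "r = 0 \<or> r = 1" using k unfolding r_def by presburger
  then have "(P (real (4 * j) + of_int r + u), P (real (4 * j) + of_int r + 3 - u)) \<in> polygon_gluing g"
  proof
    assume "r = 0"
    then show ?thesis using jg u unfolding polygon_gluing_def
      by (intro UnI1 CollectI exI[of _ j] exI[of _ u]) (auto simp: algebra_simps)
  next
    assume "r = 1"
    then show ?thesis using jg u unfolding polygon_gluing_def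
      by (intro UnI2 CollectI exI[of _ j] exI[of _ u]) (auto simp: algebra_simps)
  qed
  then have "(P (real (4 * j) + of_int r + u), P (real (4 * j) + of_int r + 3 - u)) \<in> (polygon_gluing g \<union> (polygon_gluing g)\<inverse>)\<^sup>*"
    by blast
  then show ?thesis unfolding p1 p2 by (subst fib_iff) auto
qed

text \<open>Within a block of four edges that starts at c the gluing links the corners in the order
  c, c + 3, c + 2, c + 1, c + 4, and neighbouring blocks share a corner.\<close>

lemma q_vertex: "q (P (of_int k)) = v"
proof -
  have st: "q (P (of_int (k + 1))) = q (P (of_int k))" for k
  proof -
    define r where "r = k mod 4"
    have r: "r = 0 \<or> r = 1 \<or> r = 2 \<or> r = 3" unfolding r_def by presburger
    define c where "c = k - r"
    have c: "c mod 4 < 2" "(c + 1) mod 4 < 2" unfolding c_def r_def by presburger+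
    have 1: "q (P (of_int c)) = q (P (of_int (c + 3)))" "q (P (of_int (c + 1))) = q (P (of_int (c + 2)))"
      using glue[OF c(1), of 0] glue[OF c(1), of 1] by (simp_all add: algebra_simps)
    have 2: "q (P (of_int (c + 1))) = q (P (of_int (c + 4)))" "q (P (of_int (c + 2))) = q (P (of_int (c + 3)))"
      using glue[OF c(2), of 0] glue[OF c(2), of 1] by (simp_all add: algebra_simps)
    have k: "k = c + r" by (simp add: c_def)
    from r show ?thesis unfolding k using 1 2 by (elim disjE) (simp_all add: algebra_simps)
  qed
  show ?thesis
  proof (induction k rule: int_induct[of _ 0])
    case base show ?case by simp
  next
    case (step1 i) then show ?case using st[of i] by simp
  next
    case (step2 i) then show ?case using st[of "i - 1"] by simp
  qed
qed

lemma q_edge_eq: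
  assumes "k mod 4 < 2" "l mod 4 < 2" "0 < u" "u < 1" "0 < w" "w < 1" and e: "q (P (of_int k + u)) = q (P (of_int l + w))"
  shows "u = w" "\<exists>m::int. k = l + 4 * int g * m"
proof -
  have "P (of_int k + u) = P (of_int l + w)"
    using q_eq_canon[OF P_in_D P_in_D e] assms by (simp add: canon_P cx_low)
  then obtain m :: int where "of_int k + u = of_int l + w + n * of_int m" by (auto simp: P_eq)
  then have m: "of_int k + u = of_int (l + 4 * int g * m) + w" by simp
  have "k = l + 4 * int g * m" using arg_cong[OF m, of floor] assms by (simp only: floor_frac)
  then show "u = w" "\<exists>m::int. k = l + 4 * int g * m" using m by auto
qed

text \<open>Points with one image have one canonical representative, which removes all chains of
  gluings: an inner point is alone, the vertices form one class, and any other boundary point has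
  exactly one partner.\<close>

lemma fiber_cases [consumes 3, case_names same vertex edge edge']:
  assumes "z \<in> D" "w \<in> D" "q z = q w"
  obtains "z = w"
  | k l :: int where "z = P (of_int k)" "w = P (of_int l)"
  | k :: int and u where "k mod 4 < 2" "0 < u" "u < 1" "z = P (of_int k + u)" "w = P (of_int k + 3 - u)"
  | k :: int and u where "k mod 4 < 2" "0 < u" "u < 1" "w = P (of_int k + u)" "z = P (of_int k + 3 - u)"
proof -
  have rep: "(\<exists>k::int. z = P (of_int k)) \<or> (\<exists>(k::int) u. k mod 4 < 2 \<and> 0 < u \<and> u < 1 \<and> cx x = P (of_int k + u) \<and>
     (z = P (of_int k + u) \<or> z = P (of_int k + 3 - u)))" if z: "z = P x" for z x
  proof (cases "x \<in> \<int>")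
    case True then show ?thesis using z by (auto elim: Ints_cases)
  next
    case False
    define k where "k = \<lfloor>x\<rfloor>"
    define u where "u = x - of_int k"
    have "u \<noteq> 0" using False unfolding u_def by (metis Ints_of_int eq_iff_diff_eq_0)
    moreover have "0 \<le> u" "u < 1" unfolding u_def k_def by linarith+
    ultimately have u: "0 < u" "u < 1" "x = of_int k + u" by (simp_all add: u_def)
    show ?thesis
    proof (cases "k mod 4 < 2")
      case True then show ?thesis using u z cx_low[OF True u(1,2)] by blast
    next
      case f: False
      then have k2: "(k - 2) mod 4 < 2" by presburger
      have e: "x = of_int (k - 2) + 3 - (1 - u)" using u by simp
      have "cx x = P (of_int (k - 2) + (1 - u))" unfolding e by (rule cx_high) (use k2 u in auto)
      then show ?thesis using k2 u z e
        by (intro disjI2 exI[of _ "k - 2"] exI[of _ "1 - u"]) auto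
    qed
  qed
  show ?thesis
  proof (cases "norm z < 1")
    case True
    show ?thesis by (rule that(1)[OF q_interior[OF assms(1,2) True assms(3)]])
  next
    case zf: False
    show ?thesis
    proof (cases "norm w < 1")
      case True
      show ?thesis by (rule that(1)[OF sym[OF q_interior[OF assms(2,1) True sym[OF assms(3)]]]])
    next
      case wf: False
      obtain x where x: "z = P x" using P_surj[of z] zf assms(1) by auto
      obtain y where y: "w = P y" using P_surj[of w] wf assms(2) by auto
      have c: "cx x = cx y" using q_eq_canon[OF assms] by (simp add: x y canon_P)
      have nv: "P (of_int k + u) \<noteq> 1" if "0 < u" "u < 1" for k u
      proof
        assume "P (of_int k + u) = 1"
        then obtain m :: int where "of_int k + u = 0 + n * of_int m" using P_eq[of "of_int k + u" 0] by auto
        then have "of_int k + u = of_int (4 * int g * m)" by simp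
        then have "of_int k + u \<in> (\<int> :: real set)" by (metis Ints_of_int)
        then show False using not_int[OF that] by blast
      qed
      have vx: "cx t = 1" if "P t = P (of_int k)" for t k
      proof -
        have "cx t = cx (of_int k)" using that canon_P by metis
        then show ?thesis by (simp add: cx_int)
      qed
      from rep[OF x] show ?thesis
      proof
        assume "\<exists>k::int. z = P (of_int k)"
        then obtain k :: int where k: "z = P (of_int k)" by blast
        have "cx y = 1" using c vx[of x k] k x by simp
        with rep[OF y] nv obtain l :: int where "w = P (of_int l)" by metis
        then show ?thesis using that(2) k by blast
      next
        assume "\<exists>(k::int) u. k mod 4 < 2 \<and> 0 < u \<and> u < 1 \<and> cx x = P (of_int k + u) \<and> (z = P (of_int k + u) \<or> z = P (of_int k + 3 - u))"
        then obtain k :: int and u where k: "k mod 4 < 2" "0 < u" "u < 1" "cx x = P (of_int k + u)"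
            "z = P (of_int k + u) \<or> z = P (of_int k + 3 - u)" by blast
        have "\<not> (\<exists>l::int. w = P (of_int l))" using c k(4) nv[OF k(2,3), of k] vx[of y] y by auto
        with rep[OF y] obtain l :: int and t where l: "l mod 4 < 2" "0 < t" "t < 1" "cx y = P (of_int l + t)"
            "w = P (of_int l + t) \<or> w = P (of_int l + 3 - t)" by blast
        have "P (of_int k + u) = P (of_int l + t)" using c k(4) l(4) by simp
        then obtain m :: int where m: "of_int k + u = of_int l + t + n * of_int m" by (auto simp: P_eq)
        then have "of_int k + u = of_int (l + 4 * int g * m) + t" by simp
        from arg_cong[OF this, of floor] have kl: "k = l + 4 * int g * m" using k l by (simp only: floor_frac)
        then have "of_int k = of_int l + n * of_int m" by simp
        then have tu: "t = u" using m by simp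
        have "P (of_int l + 3 - u) = P (of_int k + 3 - u)" unfolding P_eq kl by (intro exI[of _ "-m"]) simp
        moreover have "P (of_int l + u) = P (of_int k + u)" unfolding P_eq kl by (intro exI[of _ "-m"]) simp
        ultimately have w: "w = P (of_int k + u) \<or> w = P (of_int k + 3 - u)" using l(5) tu by auto
        from k(5) w show ?thesis
          using that(1) that(3)[OF k(1-3)] that(4)[OF k(1-3)] by blast
      qed
    qed
  qed
qed

lemma q_continuous: "continuous_on D q" and q_image: "q ` D = S"
  using quotient_imp_continuous_map[OF quot] quotient_imp_surjective_map[OF quot] by simp_all

lemma q_in_S: "z \<in> D \<Longrightarrow> q z \<in> S" using q_image by blast

lemma q_open: "U \<subseteq> S \<Longrightarrow> openin (top_of_set D) {z \<in> D. q z \<in> U} \<longleftrightarrow> openin (top_of_set S) U"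
  using quot by (auto simp: quotient_map_def)

lemma q_closed_iff: "U \<subseteq> S \<Longrightarrow> closedin (top_of_set D) {z \<in> D. q z \<in> U} \<longleftrightarrow> closedin (top_of_set S) U"
  using quot by (simp add: quotient_map_closedin)

text \<open>The equivalence relation is compact, so \<open>q\<close> is a closed map and the surface is Hausdorff.\<close>

lemma q_closed_map: "closed_map (top_of_set D) (top_of_set S) q"
proof -
  define K where "K = {k :: int. 0 \<le> k \<and> k < 4 * int g \<and> k mod 4 < 2}"
  define A where "A = (\<lambda>(k, u). (P (of_int k + u), P (of_int k + 3 - u))) ` (K \<times> {0..1})"
  \<comment> \<open>The relation as a union of compact pieces: the diagonal, the finitely many pairs
    of vertices, the glued pairs and their transposes. Indices are reduced modulo 4g to keep the
    union finite.\<close>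
  define R where "R = (\<lambda>z. (z, z)) ` D \<union> ((\<lambda>k. P (of_int k)) ` {0..<4 * int g}) \<times> ((\<lambda>k. P (of_int k)) ` {0..<4 * int g}) \<union> A \<union> (\<lambda>x. (snd x, fst x)) ` A"
  have finK: "finite K" by (rule finite_subset[of _ "{0..<4 * int g}"]) (auto simp: K_def)
  have "A = (\<Union>k\<in>K. (\<lambda>u. (P (of_int k + u), P (of_int k + 3 - u))) ` {0..1})" by (auto simp: A_def)
  moreover have "compact ((\<lambda>u. (P (of_int k + u), P (of_int k + 3 - u))) ` {0..1})" for k
    unfolding polygon_point_def by (intro compact_continuous_image continuous_intros) (use n_pos in auto)
  ultimately have cA: "compact A" using finK by (simp add: compact_UN)
  have "compact ((\<lambda>z :: complex. (z, z)) ` D)" by (intro compact_continuous_image continuous_intros) auto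
  moreover have "compact ((\<lambda>x. (snd x, fst x)) ` A)" by (intro compact_continuous_image continuous_intros cA)
  ultimately have cR: "compact R" unfolding R_def using cA by (intro compact_Un compact_Times) (auto intro: finite_imp_compact)
  have dm: "real_of_int k = of_int (k mod (4 * int g)) + n * of_int (k div (4 * int g))" for k
  proof -
    have "real_of_int k = real_of_int (k mod (4 * int g) + (4 * int g) * (k div (4 * int g)))"
      by (simp only: mod_mult_div_eq)
    also have "\<dots> = of_int (k mod (4 * int g)) + n * of_int (k div (4 * int g))"
      by (simp only: of_int_add of_int_mult of_int_numeral of_int_of_nat_eq of_nat_mult of_nat_numeral)
    finally show ?thesis .
  qed
  have vred: "P (of_int k) \<in> (\<lambda>k. P (of_int k)) ` {0..<4 * int g}" for k
  proof -
    have "P (of_int k) = P (of_int (k mod (4 * int g)))" by (subst dm) (rule P_period)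
    then show ?thesis using g by (intro image_eqI) auto
  qed
  have ered: "(P (of_int k + u), P (of_int k + 3 - u)) \<in> A" if k: "k mod 4 < 2" and u: "u \<in> {0..1}" for k u
  proof -
    define k' where "k' = k mod (4 * int g)"
    have e: "of_int k = of_int k' + n * of_int (k div (4 * int g))"
      unfolding k'_def by (rule dm)
    have "k' mod 4 = k mod 4" unfolding k'_def by (simp add: mod_mod_cancel)
    then have k': "k' \<in> K" using k g by (auto simp: K_def k'_def)
    have "P (of_int k + u) = P (of_int k' + u)" "P (of_int k + 3 - u) = P (of_int k' + 3 - u)"
      unfolding P_eq e by (intro exI[of _ "k div (4 * int g)"]; simp)+
    then show ?thesis using k' u unfolding A_def by (intro image_eqI[of _ _ "(k', u)"]) auto
  qed
  have R_iff: "(z, w) \<in> R \<longleftrightarrow> z \<in> D \<and> w \<in> D \<and> q z = q w" for z w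
  proof
    assume "(z, w) \<in> R"
    then show "z \<in> D \<and> w \<in> D \<and> q z = q w"
      using glue q_vertex by (auto simp: R_def A_def K_def)
  next
    assume h: "z \<in> D \<and> w \<in> D \<and> q z = q w"
    then have "z \<in> D" "w \<in> D" "q z = q w" by auto
    then show "(z, w) \<in> R"
    proof (cases rule: fiber_cases)
      case same then show ?thesis using h by (auto simp: R_def)
    next
      case (vertex k l) then show ?thesis using vred by (auto simp: R_def)
    next
      case (edge k u) then show ?thesis using ered[of k u] by (auto simp: R_def)
    next
      case (edge' k u)
      then have "(z, w) \<in> (\<lambda>x. (snd x, fst x)) ` A" using ered[of k u] by (intro image_eqI[of _ _ "(w, z)"]) auto
      then show ?thesis by (simp add: R_def)
    qed
  qed
  show ?thesis
    unfolding closed_map_def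
  proof (intro allI impI)
    fix C assume C: "closedin (top_of_set D) C"
    then have cC: "compact C" "C \<subseteq> D" using closedin_compact[of D C] closedin_subset[OF C] by auto
    have "compact (R \<inter> (C \<times> D))" by (intro compact_Int cR compact_Times cC compact_cball)
    then have "compact (snd ` (R \<inter> (C \<times> D)))" by (intro compact_continuous_image continuous_intros)
    moreover have "snd ` (R \<inter> (C \<times> D)) = {z \<in> D. q z \<in> q ` C}"
    proof
      show "snd ` (R \<inter> (C \<times> D)) \<subseteq> {z \<in> D. q z \<in> q ` C}"
      proof
        fix w assume "w \<in> snd ` (R \<inter> (C \<times> D))"
        then obtain z where "(z, w) \<in> R" "z \<in> C" by auto
        then show "w \<in> {z \<in> D. q z \<in> q ` C}" unfolding R_iff by (auto intro: image_eqI[of _ _ z])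
      qed
      show "{z \<in> D. q z \<in> q ` C} \<subseteq> snd ` (R \<inter> (C \<times> D))"
      proof
        fix w assume w: "w \<in> {z \<in> D. q z \<in> q ` C}"
        then obtain z where z: "z \<in> C" "q w = q z" by auto
        then have "(z, w) \<in> R \<inter> C \<times> D" using w cC(2) unfolding Int_iff R_iff by auto
        then show "w \<in> snd ` (R \<inter> (C \<times> D))" by (metis imageI snd_conv)
      qed
    qed
    ultimately have "closedin (top_of_set D) {z \<in> D. q z \<in> q ` C}"
      by (metis (no_types, lifting) closed_subset compact_imp_closed mem_Collect_eq subsetI)
    then show "closedin (top_of_set S) (q ` C)" using q_closed_iff[of "q ` C"] cC(2) q_image by blast
  qed
qed

lemma Hausdorff: "Hausdorff_space (top_of_set S)"
proof -
  have "normal_space (top_of_set D)"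
    by (rule compact_Hausdorff_or_regular_imp_normal_space) (auto simp: compact_space_subtopology Hausdorff_space_subtopology)
  then have "normal_space (top_of_set S)"
    by (rule normal_space_continuous_closed_map_image)
      (use q_closed_map q_image q_continuous q_in_S in auto)
  moreover have "t1_space (top_of_set S)"
  proof -
    have "closedin (top_of_set S) {x}" if x: "x \<in> S" for x
    proof -
      obtain z where z: "z \<in> D" "x = q z" using x q_image by blast
      have "closedin (top_of_set D) {z}" using z by (intro closed_subset) auto
      then have "closedin (top_of_set S) (q ` {z})" using q_closed_map unfolding closed_map_def by blast
      then show ?thesis using z by simp
    qed
    then show ?thesis by (simp add: t1_space_closedin_singleton)
  qed
  ultimately show ?thesis by (simp add: normal_t1_imp_Hausdorff_space)
qed

lemma point_closed: "x \<in> S \<Longrightarrow> closedin (top_of_set S) {x}"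
  using Hausdorff_imp_t1_space[OF Hausdorff] by (simp add: t1_space_closedin_singleton)

end

section \<open>Annuli in the polygon\<close>

context polygon_surface
begin

definition Cs :: "real \<Rightarrow> real" where "Cs h = cos (2 * pi * h / n)"
definition Sn :: "real \<Rightarrow> real" where "Sn h = sin (2 * pi * h / n)"

lemma Cs_Sn: "(Cs h)\<^sup>2 + (Sn h)\<^sup>2 = 1" by (simp add: Cs_def Sn_def)

lemma Cs_minus [simp]: "Cs (- h) = Cs h" and Sn_minus [simp]: "Sn (- h) = - Sn h"
  by (simp_all add: Cs_def Sn_def)

lemma Cs_abs: "Cs \<bar>h\<bar> = Cs h" by (cases "h \<ge> 0") auto

lemma Cs_Sn_continuous [continuous_intros]:
  assumes "continuous_on A f"
  shows "continuous_on A (\<lambda>x. Cs (f x))" "continuous_on A (\<lambda>x. Sn (f x))"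
proof -
  have "isCont Cs x" "isCont Sn x" for x
    unfolding Cs_def Sn_def using n_pos by (intro continuous_intros; simp)+
  then have "continuous_on UNIV Cs" "continuous_on UNIV Sn" by (simp_all add: continuous_at_imp_continuous_on)
  from this[THEN continuous_on_compose2, OF assms] show "continuous_on A (\<lambda>x. Cs (f x))" "continuous_on A (\<lambda>x. Sn (f x))" by auto
qed

text \<open>
  \<open>ch m h\<close> runs along the chord from \<open>P (m - h)\<close> to \<open>P (m + h)\<close>, and \<open>xc m\<close> is the coordinate
  in the direction of \<open>P m\<close>, which is constant on these chords.
\<close>

definition ch :: "real \<Rightarrow> real \<Rightarrow> real \<Rightarrow> complex" where
  "ch m h t = P m * (of_real (Cs h) + \<i> * of_real ((2 * t - 1) * Sn h))"

definition xc :: "real \<Rightarrow> complex \<Rightarrow> real" where "xc m z = Re (z * cnj (P m))"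

lemma P_polar: "P x = of_real (Cs x) + \<i> * of_real (Sn x)"
  by (simp add: Cs_def Sn_def polygon_point_def complex_eq_iff)

lemma ch_eq: "ch m h t = of_real (1 - t) * P (m - h) + of_real t * P (m + h)"
proof -
  have "P (m - h) = P m * cnj (P h)" using P_add[of m "-h"] by (simp add: P_minus)
  then have "of_real (1 - t) * P (m - h) + of_real t * P (m + h) = P m * (of_real (1 - t) * cnj (P h) + of_real t * P h)"
    by (simp add: P_add algebra_simps)
  also have "of_real (1 - t) * cnj (P h) + of_real t * P h = of_real (Cs h) + \<i> * of_real ((2 * t - 1) * Sn h)"
    unfolding P_polar[of h] by (simp add: complex_eq_iff algebra_simps)
  finally show ?thesis by (simp add: ch_def)
qed

lemma ch_0: "ch m h 0 = P (m - h)" and ch_1: "ch m h 1 = P (m + h)" by (simp_all add: ch_eq)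

lemma ch_in_D: "0 \<le> t \<Longrightarrow> t \<le> 1 \<Longrightarrow> ch m h t \<in> D"
proof -
  assume t: "0 \<le> t" "t \<le> 1"
  have "norm (ch m h t) \<le> norm (of_real (1 - t) * P (m - h)) + norm (of_real t * P (m + h))"
    unfolding ch_eq by (rule norm_triangle_ineq)
  also have "\<dots> = 1" using t unfolding norm_mult by (simp del: of_real_diff)
  finally show ?thesis by simp
qed

lemma ch_continuous [continuous_intros]:
  "continuous_on A h \<Longrightarrow> continuous_on A t \<Longrightarrow> continuous_on A (\<lambda>x. ch m (h x) (t x))"
  unfolding ch_def by (intro continuous_intros) auto

lemma P_continuous [continuous_intros]: "continuous_on A f \<Longrightarrow> continuous_on A (\<lambda>x. P (f x))"
  unfolding polygon_point_def using n_pos by (intro continuous_intros) auto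

lemma xc_continuous: "continuous_on A (xc m)"
  unfolding xc_def by (intro continuous_intros)

lemma ch_coords: "ch m h t * cnj (P m) = of_real (Cs h) + \<i> * of_real ((2 * t - 1) * Sn h)"
proof -
  have "ch m h t * cnj (P m) = (P m * cnj (P m)) * (of_real (Cs h) + \<i> * of_real ((2 * t - 1) * Sn h))"
    unfolding ch_def by (simp only: ac_simps)
  then show ?thesis unfolding P_cnj by simp
qed

lemma xc_ch: "xc m (ch m h t) = Cs h"
  unfolding xc_def ch_coords by simp

lemma xc_P: "xc m (P y) = Cs (y - m)"
proof -
  have "P y * cnj (P m) = P (y - m)" using P_add[of y "-m"] by (simp add: P_minus)
  then show ?thesis by (simp add: xc_def P_polar)
qed

lemma norm_coords: "norm (z * cnj (P m)) = norm z" by (simp add: norm_mult)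

lemma angle_range: "0 < h \<Longrightarrow> h < n / 2 \<Longrightarrow> 0 < 2 * pi * h / n \<and> 2 * pi * h / n < pi"
  using n_pos by (simp add: field_simps)

lemma sin_nz:
  assumes "0 < \<bar>h\<bar>" "\<bar>h\<bar> < n / 2" shows "Sn h \<noteq> 0"
proof (cases "h > 0")
  case True then show ?thesis using angle_range[of h] assms sin_gt_zero[of "2 * pi * h / n"] by (simp add: Sn_def)
next
  case False
  then have "Sn (- h) > 0" unfolding Sn_def using angle_range[of "-h"] assms by (intro sin_gt_zero) auto
  then show ?thesis by simp
qed

lemma ch_boundary:
  assumes h: "0 < \<bar>h\<bar>" "\<bar>h\<bar> < n / 2" and "norm (ch m h t) = 1"
  shows "t = 0 \<or> t = 1"
proof -
  let ?c = "Cs h" and ?s = "Sn h"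
  have "norm (ch m h t * cnj (P m)) = 1" using assms(3) by (simp add: norm_coords)
  then have "?c\<^sup>2 + ((2 * t - 1) * ?s)\<^sup>2 = 1"
    unfolding ch_coords cmod_def by (simp add: real_sqrt_eq_1_iff)
  moreover note Cs_Sn[of h]
  ultimately have "((2 * t - 1) * ?s)\<^sup>2 = ?s\<^sup>2" by linarith
  then have "(2 * t - 1)\<^sup>2 = 1" using sin_nz[OF h] by (simp only: power_mult_distrib) simp
  then have "4 * (t * (t - 1)) = 0" by (simp add: power2_eq_square algebra_simps)
  then show ?thesis by auto
qed

lemma ch_inj:
  assumes h: "0 < \<bar>h\<bar>" "\<bar>h\<bar> < n / 2" and h': "0 < \<bar>h'\<bar>" "\<bar>h'\<bar> < n / 2" and e: "ch m h t = ch m h' t'"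
  shows "\<bar>h\<bar> = \<bar>h'\<bar>" "h = h' \<Longrightarrow> t = t'"
proof -
  have "Cs h = Cs h'" using xc_ch[of m h t] xc_ch[of m h' t'] e by simp
  then have e': "Cs \<bar>h\<bar> = Cs \<bar>h'\<bar>" by (simp only: Cs_abs)
  have r: "0 \<le> 2 * pi * \<bar>h\<bar> / n" "2 * pi * \<bar>h\<bar> / n \<le> pi" "0 \<le> 2 * pi * \<bar>h'\<bar> / n" "2 * pi * \<bar>h'\<bar> / n \<le> pi"
    using angle_range[OF h] angle_range[OF h'] by linarith+
  have "2 * pi * \<bar>h\<bar> / n = 2 * pi * \<bar>h'\<bar> / n" by (rule cos_inj_pi[OF r e'[unfolded Cs_def]])
  then show "\<bar>h\<bar> = \<bar>h'\<bar>" using n_pos by (simp add: divide_cancel_right)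
  assume "h = h'"
  then have "ch m h t * cnj (P m) = ch m h t' * cnj (P m)" using e by simp
  then have "(2 * t - 1) * Sn h = (2 * t' - 1) * Sn h"
    unfolding ch_coords by (simp add: complex_eq_iff)
  then show "t = t'" using sin_nz[OF h] by simp
qed

lemma ch_onto:
  assumes h: "0 < \<bar>h\<bar>" "\<bar>h\<bar> < n / 2" and z: "z \<in> D" and x: "xc m z = Cs h"
  obtains t where "0 \<le> t" "t \<le> 1" "z = ch m h t"
proof -
  let ?c = "Cs h" and ?s = "Sn h"
  define y where "y = Im (z * cnj (P m))"
  define t where "t = (y / ?s + 1) / 2"
  have s: "?s \<noteq> 0" by (rule sin_nz[OF h])
  have zz: "z * cnj (P m) = of_real ?c + \<i> * of_real y"
    using x by (simp add: complex_eq_iff xc_def y_def)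
  have "norm (z * cnj (P m)) \<le> 1" using z by (simp add: norm_coords)
  then have "?c\<^sup>2 + y\<^sup>2 \<le> 1" unfolding zz cmod_def by simp
  moreover note Cs_Sn[of h]
  ultimately have "y\<^sup>2 \<le> ?s\<^sup>2" by linarith
  then have "\<bar>y\<bar> \<le> \<bar>?s\<bar>" by (simp add: abs_le_square_iff)
  then have "\<bar>y / ?s\<bar> \<le> 1" using s by (simp add: abs_divide)
  then have "-1 \<le> y / ?s" "y / ?s \<le> 1" by linarith+
  then have "0 \<le> t" "t \<le> 1" unfolding t_def by auto
  moreover have "z = ch m h t"
  proof -
    have "(2 * t - 1) * ?s = y" using s by (simp add: t_def field_simps)
    then have "ch m h t * cnj (P m) = z * cnj (P m)" unfolding ch_coords zz by simp
    then show ?thesis using P_norm[of m] by (metis complex_cnj_zero_iff mult_right_cancel norm_zero zero_neq_one)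
  qed
  ultimately show ?thesis using that by blast
qed

lemma Cs_eq: "Cs (y - m) = Cs h \<longleftrightarrow> (\<exists>k::int. y = m + h + n * of_int k \<or> y = m - h + n * of_int k)"
proof -
  have "Cs (y - m) = Cs h \<longleftrightarrow> P (y - m) = P h \<or> P (y - m) = P (- h)"
  proof
    assume c: "Cs (y - m) = Cs h"
    have "(Sn (y - m))\<^sup>2 = (Sn h)\<^sup>2" using Cs_Sn[of "y - m"] Cs_Sn[of h] unfolding c by linarith
    then have "Sn (y - m) = Sn h \<or> Sn (y - m) = - Sn h" unfolding power2_eq_iff .
    then show "P (y - m) = P h \<or> P (y - m) = P (- h)" unfolding P_polar c by auto
  next
    have Re: "Re (P x) = Cs x" for x by (simp add: P_polar)
    assume "P (y - m) = P h \<or> P (y - m) = P (- h)"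
    then show "Cs (y - m) = Cs h" using Re Cs_minus by metis
  qed
  then show ?thesis unfolding P_eq by (force simp: algebra_simps)
qed

lemma Cs_bounds: "-1 \<le> Cs h" "Cs h \<le> 1" by (simp_all add: Cs_def)

text \<open>Described by the values of \<open>xc m\<close> instead of chords, so that openness is
  that of an interval of values; \<open>strip_eq_ch\<close> recovers the chords.\<close>

definition strip :: "real \<Rightarrow> real set \<Rightarrow> complex set" where
  "strip m H = {z \<in> D. \<exists>h\<in>H. xc m z = Cs h}"

lemma Cs_strict: "0 \<le> h \<Longrightarrow> h < h' \<Longrightarrow> h' \<le> n / 2 \<Longrightarrow> Cs h' < Cs h"
  unfolding Cs_def using n_pos by (intro cos_monotone_0_pi) (auto simp: field_simps)

lemma Cs_arccos:
  assumes "-1 \<le> x" "x \<le> 1"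
  shows "Cs (n * arccos x / (2 * pi)) = x" "0 \<le> n * arccos x / (2 * pi)" "n * arccos x / (2 * pi) \<le> n / 2"
  using assms arccos_lbound[of x] arccos_ubound[of x] n_pos by (auto simp: Cs_def field_simps)

lemma strip_ivl:
  assumes "0 \<le> h0" "h0 < h1" "h1 \<le> n / 2"
  shows "strip m {h0<..<h1} = {z \<in> D. Cs h1 < xc m z \<and> xc m z < Cs h0}"
proof -
  have "(\<exists>h\<in>{h0<..<h1}. x = Cs h) \<longleftrightarrow> Cs h1 < x \<and> x < Cs h0" for x
  proof
    assume "\<exists>h\<in>{h0<..<h1}. x = Cs h"
    then show "Cs h1 < x \<and> x < Cs h0" using Cs_strict assms by auto
  next
    assume x: "Cs h1 < x \<and> x < Cs h0"
    have x1: "-1 \<le> x" "x \<le> 1" using x Cs_bounds[of h1] Cs_bounds[of h0] by linarith+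
    define h where "h = n * arccos x / (2 * pi)"
    note h = Cs_arccos[OF x1, folded h_def]
    have "h0 < h" proof (rule ccontr) assume "\<not> h0 < h" then have "h = h0 \<or> h < h0" by auto
      then show False using x h Cs_strict[of h h0] assms by auto qed
    moreover have "h < h1" proof (rule ccontr) assume "\<not> h < h1" then have "h = h1 \<or> h1 < h" by auto
      then show False using x h Cs_strict[of h1 h] assms by auto qed
    ultimately show "\<exists>h\<in>{h0<..<h1}. x = Cs h" using h(1) by (intro bexI[of _ h]) auto
  qed
  then show ?thesis unfolding strip_def by simp
qed

lemma strip_open:
  assumes "0 \<le> h0" "h0 < h1" "h1 \<le> n / 2"
  shows "openin (top_of_set D) (strip m {h0<..<h1})"
proof -
  have "strip m {h0<..<h1} = D \<inter> xc m -` {Cs h1<..<Cs h0}" by (auto simp: strip_ivl[OF assms])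
  then show ?thesis using continuous_openin_preimage_gen[OF xc_continuous, of "{Cs h1<..<Cs h0}" D m] by simp
qed

lemma strip_eq_ch:
  assumes "\<And>h. h \<in> H \<Longrightarrow> 0 < \<bar>h\<bar> \<and> \<bar>h\<bar> < n / 2"
  shows "strip m H = (\<lambda>(h, t). ch m h t) ` (H \<times> {0..1})"
proof
  show "strip m H \<subseteq> (\<lambda>(h, t). ch m h t) ` (H \<times> {0..1})"
  proof
    fix z assume "z \<in> strip m H"
    then obtain h where h: "z \<in> D" "h \<in> H" "xc m z = Cs h" by (auto simp: strip_def)
    obtain t where "0 \<le> t" "t \<le> 1" "z = ch m h t" using ch_onto[of h z m] assms h by blast
    then show "z \<in> (\<lambda>(h, t). ch m h t) ` (H \<times> {0..1})" using h by (intro image_eqI[of _ _ "(h, t)"]) auto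
  qed
  show "(\<lambda>(h, t). ch m h t) ` (H \<times> {0..1}) \<subseteq> strip m H"
    using ch_in_D xc_ch unfolding strip_def by fastforce
qed

lemma strip_closed:
  assumes "0 < h0" "h1 < n / 2"
  shows "closed (strip m {h0..h1})"
proof -
  have "strip m {h0..h1} = (\<lambda>(h, t). ch m h t) ` ({h0..h1} \<times> {0..1})" by (rule strip_eq_ch) (use assms in auto)
  moreover have "continuous_on ({h0..h1} \<times> {0..1}) (\<lambda>x. ch m (fst x) (snd x))" by (intro continuous_intros)
  then have "compact ((\<lambda>x. ch m (fst x) (snd x)) ` ({h0..h1} \<times> {0..1}))" by (intro compact_continuous_image compact_Times) auto
  ultimately show ?thesis by (simp add: case_prod_unfold compact_imp_closed)
qed

lemma P_strip: "P y \<in> strip m H \<longleftrightarrow> (\<exists>h\<in>H. \<exists>k::int. y = m + h + n * of_int k \<or> y = m - h + n * of_int k)"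
  unfolding strip_def mem_Collect_eq xc_P Cs_eq by simp

lemma arc_unique:
  assumes "of_int k + u = of_int l + w + n * of_int j" "0 \<le> u" "u < 1" "0 \<le> w" "w < 1"
  shows "k = l + 4 * int g * j \<and> u = w"
proof -
  have m: "of_int k + u = of_int (l + 4 * int g * j) + w" using assms(1) by simp
  have "k = l + 4 * int g * j" using arg_cong[OF m, of floor] assms(2-5) by (simp only: floor_frac)
  then show ?thesis using m by simp
qed

text \<open>
  \<open>Q\<close> meets the boundary exactly in the parameters \<open>W\<close> of the edges in \<open>E\<close> and in the points
  glued to them.
\<close>

definition arcs :: "int set \<Rightarrow> real set \<Rightarrow> complex set \<Rightarrow> bool" where
  "arcs E W Q \<longleftrightarrow> (\<forall>s\<in>E. s mod 4 < 2) \<and> (\<forall>y. P y \<in> Q \<longleftrightarrow>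
     (\<exists>s\<in>E. \<exists>w\<in>W. \<exists>k::int. y = of_int s + w + n * of_int k \<or> y = of_int s + 3 - w + n * of_int k))"

lemma mod4_shift: "(l + 4 * int g * j) mod 4 = l mod 4"
  by (metis mod_mult_self2 mult.assoc)

lemma arcs_edge:
  assumes Q: "arcs E W Q" and W: "W \<subseteq> {0<..<1}" and x: "0 \<le> x" "x < 1"
  shows "P (of_int k + x) \<in> Q \<longleftrightarrow> (\<exists>s\<in>E. \<exists>j. (k = s + 4 * int g * j \<and> x \<in> W) \<or> (k = s + 2 + 4 * int g * j \<and> 1 - x \<in> W))"
proof
  assume "P (of_int k + x) \<in> Q"
  then obtain s w j where s: "s \<in> E" "w \<in> W" "of_int k + x = of_int s + w + n * of_int j \<or> of_int k + x = of_int s + 3 - w + n * of_int j"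
    using Q by (auto simp: arcs_def)
  have w: "0 < w" "w < 1" using s W by auto
  from s(3) show "\<exists>s\<in>E. \<exists>j. (k = s + 4 * int g * j \<and> x \<in> W) \<or> (k = s + 2 + 4 * int g * j \<and> 1 - x \<in> W)"
  proof
    assume "of_int k + x = of_int s + w + n * of_int j"
    from arc_unique[OF this x] w s show ?thesis by auto
  next
    assume "of_int k + x = of_int s + 3 - w + n * of_int j"
    then have "of_int k + x = of_int (s + 2) + (1 - w) + n * of_int j" by simp
    from arc_unique[OF this x] w s show ?thesis by auto
  qed
next
  assume "\<exists>s\<in>E. \<exists>j. (k = s + 4 * int g * j \<and> x \<in> W) \<or> (k = s + 2 + 4 * int g * j \<and> 1 - x \<in> W)"
  then obtain s j where s: "s \<in> E" "(k = s + 4 * int g * j \<and> x \<in> W) \<or> (k = s + 2 + 4 * int g * j \<and> 1 - x \<in> W)" by blast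
  from s(2) have "\<exists>w\<in>W. of_int k + x = of_int s + w + n * of_int j \<or> of_int k + x = of_int s + 3 - w + n * of_int j"
  proof
    assume h: "k = s + 4 * int g * j \<and> x \<in> W"
    then show ?thesis by (intro bexI[of _ x] disjI1) simp_all
  next
    assume h: "k = s + 2 + 4 * int g * j \<and> 1 - x \<in> W"
    then show ?thesis by (intro bexI[of _ "1 - x"] disjI2) simp_all
  qed
  then show "P (of_int k + x) \<in> Q" using Q s(1) unfolding arcs_def by blast
qed

lemma arcs_vertex: "arcs E W Q \<Longrightarrow> W \<subseteq> {0<..<1} \<Longrightarrow> P (of_int k) \<notin> Q"
  using arcs_edge[of E W Q 0 k] by auto

text \<open>Edges of index 0 or 1 modulo 4 are only glued to edges of index 2 or 3, so a boundary
  point of \<open>Q\<close> reveals on which side of the gluing it lies, and its partner is in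
  \<open>Q\<close> by the shape of \<open>arcs\<close>. Vertices are excluded since \<open>W\<close>
  avoids 0 and 1.\<close>

lemma arcs_saturated:
  assumes Q: "arcs E W Q" and W: "W \<subseteq> {0<..<1}" and z: "z \<in> Q" "z \<in> D" "w \<in> D" "q z = q w"
  shows "w \<in> Q"
proof -
  have Emod: "s mod 4 < 2" if "s \<in> E" for s using Q that by (simp add: arcs_def)
  show ?thesis
  using z(2,3,4)
proof (cases rule: fiber_cases)
  case same then show ?thesis using z by simp
next
  case (vertex k l) then show ?thesis using arcs_vertex[OF Q W, of k] z by simp
next
    case (edge k u)
    have e: "of_int k + 3 - u = of_int (k + 2) + (1 - u)" by simp
    have "P (of_int k + u) \<in> Q" using edge z by simp
    then obtain s j where s: "s \<in> E" "(k = s + 4 * int g * j \<and> u \<in> W) \<or> (k = s + 2 + 4 * int g * j \<and> 1 - u \<in> W)"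
      using arcs_edge[OF Q W, of u k] edge by auto
    have "\<not> k = s + 2 + 4 * int g * j"
    proof
      assume "k = s + 2 + 4 * int g * j"
      then have "k mod 4 = (s + 2) mod 4" by (simp add: mod4_shift)
      then show False using Emod[OF s(1)] edge(1) by presburger
    qed
    with s(2) have "k = s + 4 * int g * j" "u \<in> W" by auto
    then show ?thesis unfolding edge e using arcs_edge[OF Q W, of "1 - u" "k + 2"] edge s(1) by auto
  next
    case (edge' k u)
    have e: "of_int k + 3 - u = of_int (k + 2) + (1 - u)" by simp
    have "P (of_int (k + 2) + (1 - u)) \<in> Q" using edge' z unfolding e by simp
    then obtain s j where s: "s \<in> E" "(k + 2 = s + 4 * int g * j \<and> 1 - u \<in> W) \<or> (k + 2 = s + 2 + 4 * int g * j \<and> u \<in> W)"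
      using arcs_edge[OF Q W, of "1 - u" "k + 2"] edge' by auto
    have "\<not> k + 2 = s + 4 * int g * j"
    proof
      assume "k + 2 = s + 4 * int g * j"
      then have "(k + 2) mod 4 = s mod 4" by (simp add: mod4_shift)
      then show False using Emod[OF s(1)] edge'(1) by presburger
    qed
    with s(2) have "k = s + 4 * int g * j" "u \<in> W" by auto
    then show ?thesis unfolding edge' using arcs_edge[OF Q W, of u k] edge' s(1) by auto
qed
qed

lemma arcs_image_open:
  assumes Q: "arcs E W Q" and W: "W \<subseteq> {0<..<1}" and o: "openin (top_of_set D) Q"
  shows "openin (top_of_set S) (q ` Q)"
proof -
  have sub: "Q \<subseteq> D" using openin_imp_subset[OF o] .
  have "{z \<in> D. q z \<in> q ` Q} = Q" using arcs_saturated[OF Q W] sub by fastforce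
  then show ?thesis using q_open[of "q ` Q"] o sub q_in_S by auto
qed

lemma arcs_image_iff:
  assumes Q: "arcs E W Q" and W: "W \<subseteq> {0<..<1}" and sub: "Q \<subseteq> D" and z: "z \<in> D"
  shows "q z \<in> q ` Q \<longleftrightarrow> z \<in> Q"
  using arcs_saturated[OF Q W] sub z by (metis image_iff subsetD)

end

section \<open>Annuli made of one strip and of two strips\<close>

locale polygon_windows = polygon_surface g S q for g and S :: "'a::topological_space set" and q +
  fixes w0 w1 :: real
  assumes w: "0 < w0" "w0 < w1" "w1 < 1"
begin

text \<open>The coordinate across an annulus becomes the position on an edge inside the
  window.\<close>

definition wt :: "real \<Rightarrow> real" where "wt s = w0 + (w1 - w0) * s"

lemma wt_range: "s \<in> {0..1} \<Longrightarrow> w0 \<le> wt s \<and> wt s \<le> w1"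
proof -
  assume s: "s \<in> {0..1}"
  have "(w1 - w0) * s \<le> w1 - w0" using s w mult_left_mono[of s 1 "w1 - w0"] by auto
  moreover have "0 \<le> (w1 - w0) * s" using s w by auto
  ultimately show ?thesis unfolding wt_def by linarith
qed

lemma wt_inj: "wt s = wt t \<longleftrightarrow> s = t" using w by (simp add: wt_def)

lemma wt_image: "wt ` {0<..<1} = {w0<..<w1}"
proof
  show "wt ` {0<..<1} \<subseteq> {w0<..<w1}"
  proof
    fix x assume "x \<in> wt ` {0<..<1}"
    then obtain s where s: "0 < s" "s < 1" "x = wt s" by auto
    have "(w1 - w0) * s < w1 - w0" using s w mult_strict_left_mono[of s 1 "w1 - w0"] by auto
    then have 1: "wt s < w1" unfolding wt_def by linarith
    have "0 < (w1 - w0) * s" using s w by (intro mult_pos_pos) auto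
    then have "w0 < wt s" unfolding wt_def by linarith
    with 1     show "x \<in> {w0<..<w1}" using s by simp
  qed
  show "{w0<..<w1} \<subseteq> wt ` {0<..<1}"
  proof
    fix x assume "x \<in> {w0<..<w1}"
    then show "x \<in> wt ` {0<..<1}" using w by (intro image_eqI[of _ _ "(x - w0) / (w1 - w0)"]) (auto simp: wt_def field_simps)
  qed
qed

lemma wt_continuous [continuous_intros]: "continuous_on A f \<Longrightarrow> continuous_on A (\<lambda>x. wt (f x))"
  unfolding wt_def by (intro continuous_intros)

lemma window_sub: "{w0<..<w1} \<subseteq> {0<..<1}" and window_sub': "{w0..w1} \<subseteq> {0<..<1}" using w by auto

lemma wt_image_closed: "wt ` {0..1} \<subseteq> {w0..w1}" using wt_range by fastforce

text \<open>The chord of half-width 3/2 - w about e + 3/2 joins the point e + w to its partner e + 3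
  - w, hence closes up to a circle on the surface.\<close>

definition strip1 :: "int \<Rightarrow> real set \<Rightarrow> complex set" where
  "strip1 e W = strip (of_int e + 3/2) ((\<lambda>w. 3/2 - w) ` W)"

text \<open>The annulus around the closed curve that crosses the edges \<open>e\<close> and \<open>e + 2\<close>.\<close>

definition ann1 :: "int \<Rightarrow> real \<times> real \<Rightarrow> 'a" where
  "ann1 e = (\<lambda>(s, t). q (ch (of_int e + 3/2) (3/2 - wt s) t))"

lemma refl_ivl: "(\<lambda>w. a - w) ` {x<..<y} = {a - y<..<a - x}" for a x y :: real
proof
  show "{a - y<..<a - x} \<subseteq> (\<lambda>w. a - w) ` {x<..<y}"
    by (rule subsetI) (rule_tac x = "a - xa" in image_eqI, auto)
qed auto

lemma shift_ivl: "(\<lambda>w. a + w) ` {x<..<y} = {a + x<..<a + y}" for a x y :: real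
proof
  show "{a + x<..<a + y} \<subseteq> (\<lambda>w. a + w) ` {x<..<y}"
    by (rule subsetI) (rule_tac x = "xa - a" in image_eqI, auto)
qed auto

lemma strip1_arcs:
  assumes e: "e mod 4 < 2" shows "arcs {e} W (strip1 e W)"
  unfolding arcs_def strip1_def P_strip bex_simps(7)
proof (intro conjI ballI allI)
  fix y
  have "3/2 + (3/2 - w) = 3 - w" for w :: real by simp
  then have "y = of_int e + 3 / 2 + (3 / 2 - w) + n * of_int k \<longleftrightarrow> y = of_int e + 3 - w + n * of_int k"
    and "y = of_int e + 3 / 2 - (3 / 2 - w) + n * of_int k \<longleftrightarrow> y = of_int e + w + n * of_int k" for w k by auto
  then show "(\<exists>w\<in>W. \<exists>k. y = of_int e + 3 / 2 + (3 / 2 - w) + n * of_int k \<or> y = of_int e + 3 / 2 - (3 / 2 - w) + n * of_int k) \<longleftrightarrow>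
    (\<exists>s\<in>{e}. \<exists>w\<in>W. \<exists>k. y = of_int s + w + n * of_int k \<or> y = of_int s + 3 - w + n * of_int k)" by blast
qed (use e in auto)

lemma h1_range: "s \<in> {0..1} \<Longrightarrow> 0 < \<bar>3/2 - wt s\<bar> \<and> \<bar>3/2 - wt s\<bar> < n / 2"
  using wt_range[of s] w n_pos by auto

lemma ann1_image:
  assumes "A \<subseteq> {0..1}" shows "ann1 e ` (A \<times> {0..1}) = q ` strip1 e (wt ` A)"
proof -
  have "strip1 e (wt ` A) = (\<lambda>(h, t). ch (of_int e + 3/2) h t) ` ((\<lambda>w. 3/2 - w) ` wt ` A \<times> {0..1})"
    unfolding strip1_def by (rule strip_eq_ch) (use h1_range assms in auto)
  then show ?thesis by (force simp: ann1_def image_image)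
qed

lemma ch_norm: "t \<in> {0..1} \<Longrightarrow> norm (ch m h t) \<le> 1" using ch_in_D[of t m h] by simp

lemma ann1_annulus:
  assumes e: "e mod 4 < 2" shows "annulus S (ann1 e)"
proof
  let ?m = "of_int e + 3/2"
  have ends: "ch ?m (3/2 - wt s) 0 = P (of_int e + wt s)" "ch ?m (3/2 - wt s) 1 = P (of_int e + 3 - wt s)" for s
    by (simp_all add: ch_0 ch_1 algebra_simps)
  have glued: "q (P (of_int e + wt s)) = q (P (of_int e + 3 - wt s))" if "s \<in> {0..1}" for s
    using glue[OF e, of "wt s"] wt_range[OF that] w by auto
  show "Hausdorff_space (top_of_set S)" by (rule Hausdorff)
  have "continuous_on ({0..1} \<times> {0..1}) (\<lambda>st. q (ch ?m (3/2 - wt (fst st)) (snd st)))"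
    by (rule continuous_on_compose2[OF q_continuous]) (auto intro!: continuous_intros simp: ch_norm)
  then show "continuous_on ({0..1} \<times> {0..1}) (ann1 e)" by (simp add: ann1_def case_prod_unfold)
  show "ann1 e ` ({0..1} \<times> {0..1}) \<subseteq> S" by (auto simp: ann1_def intro!: q_in_S ch_norm)
  show "ann1 e (s, 0) = ann1 e (s, 1)" if "s \<in> {0..1}" for s using glued[OF that] by (simp add: ann1_def ends)
  have "openin (top_of_set D) (strip1 e {w0<..<w1})" unfolding strip1_def refl_ivl by (rule strip_open) (use w n_pos in auto)
  from arcs_image_open[OF strip1_arcs[OF e] window_sub this]
  show "openin (top_of_set S) (ann1 e ` ({0<..<1} \<times> {0..1}))"
    by (subst ann1_image) (auto simp: wt_image)
  fix s t s' t' assume st: "s \<in> {0..1}" "t \<in> {0..1}" "s' \<in> {0..1}" "t' \<in> {0..1}" and eq: "ann1 e (s, t) = ann1 e (s', t')"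
  let ?z = "ch ?m (3/2 - wt s) t" and ?z' = "ch ?m (3/2 - wt s') t'"
  have D: "?z \<in> D" "?z' \<in> D" using ch_in_D st by auto
  have qe: "q ?z = q ?z'" using eq by (simp add: ann1_def)
  show "s = s' \<and> (t = t' \<or> (t = 0 \<and> t' = 1) \<or> (t = 1 \<and> t' = 0))"
  proof (cases "?z = ?z'")
    case True
    have "\<bar>3/2 - wt s\<bar> = \<bar>3/2 - wt s'\<bar>" using ch_inj(1) True h1_range st by blast
    then have "wt s = wt s'" using wt_range[OF st(1)] wt_range[OF st(3)] w by auto
    then show ?thesis using ch_inj(2)[of "3/2 - wt s" "3/2 - wt s'" ?m t t'] True h1_range st wt_inj by auto
  next
    case False
    \<comment> \<open>Different points with the same image lie on the boundary, so they are ends of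
      chords, and there the position on the edge determines s.\<close>
    have "\<not> norm ?z < 1" "\<not> norm ?z' < 1"
      using q_interior[OF D _ qe] q_interior[OF D(2,1) _ sym[OF qe]] False by auto
    then have "norm ?z = 1" "norm ?z' = 1" using D by auto
    then have tt: "t = 0 \<or> t = 1" "t' = 0 \<or> t' = 1" using ch_boundary h1_range st by blast+
    have "q ?z = q (P (of_int e + wt s))" "q ?z' = q (P (of_int e + wt s'))" using tt glued st by (auto simp: ends)
    then have qw: "q (P (of_int e + wt s)) = q (P (of_int e + wt s'))" using qe by simp
    have "wt s = wt s'" by (rule q_edge_eq(1)[OF e e _ _ _ _ qw]) (use wt_range[OF st(1)] wt_range[OF st(3)] w in linarith)+
    then show ?thesis using wt_inj tt by auto
  qed
qed

text \<open>The wide chord joins c + w to c + 4d + 3 - w, the narrow one joins c + 3 - w to c + 4d +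
  w. All are parallel with centre c + 2d + 3/2, and their ends are glued crosswise, so that a wide
  and a narrow chord form one circle.\<close>

definition strip2 :: "int \<Rightarrow> int \<Rightarrow> real set \<Rightarrow> complex set" where
  "strip2 c d W = strip (of_int c + 2 * of_int d + 3/2) ((\<lambda>w. 2 * of_int d + 3/2 - w) ` W) \<union>
     strip (of_int c + 2 * of_int d + 3/2) ((\<lambda>w. 2 * of_int d - 3/2 + w) ` W)"

text \<open>
  The annulus around the closed curve that crosses the edges \<open>c\<close>, \<open>c + 2\<close>, \<open>c + 4 d\<close> and
  \<open>c + 4 d + 2\<close>; it runs through the polygon in two parallel strips.
\<close>

definition ann2 :: "int \<Rightarrow> int \<Rightarrow> real \<times> real \<Rightarrow> 'a" where
  "ann2 c d = (\<lambda>(s, t). if t \<le> 1/2 then q (ch (of_int c + 2 * of_int d + 3/2) (2 * of_int d + 3/2 - wt s) (2 * t))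
     else q (ch (of_int c + 2 * of_int d + 3/2) (- (2 * of_int d - 3/2 + wt s)) (2 * t - 1)))"

lemma ch_minus: "ch m (- h) t = ch m h (1 - t)"
  unfolding ch_eq by simp

lemma strip2_arcs:
  assumes c: "c mod 4 < 2" shows "arcs {c, c + 4 * d} W (strip2 c d W)"
  unfolding arcs_def strip2_def Un_iff P_strip bex_simps(7)
proof (intro conjI ballI allI)
  fix y and s :: int
  show "s mod 4 < 2" if "s \<in> {c, c + 4 * d}" using that c by auto
  let ?m = "of_int c + 2 * of_int d + 3/2 :: real"
  have "y = ?m + (2 * of_int d + 3/2 - w) + n * of_int k \<longleftrightarrow> y = of_int (c + 4 * d) + 3 - w + n * of_int k"
    "y = ?m - (2 * of_int d + 3/2 - w) + n * of_int k \<longleftrightarrow> y = of_int c + w + n * of_int k"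
    "y = ?m + (2 * of_int d - 3/2 + w) + n * of_int k \<longleftrightarrow> y = of_int (c + 4 * d) + w + n * of_int k"
    "y = ?m - (2 * of_int d - 3/2 + w) + n * of_int k \<longleftrightarrow> y = of_int c + 3 - w + n * of_int k" for w k by auto
  note e = this
  show "(\<exists>w\<in>W. \<exists>k. y = ?m + (2 * of_int d + 3/2 - w) + n * of_int k \<or> y = ?m - (2 * of_int d + 3/2 - w) + n * of_int k) \<or>
     (\<exists>w\<in>W. \<exists>k. y = ?m + (2 * of_int d - 3/2 + w) + n * of_int k \<or> y = ?m - (2 * of_int d - 3/2 + w) + n * of_int k) \<longleftrightarrow>
    (\<exists>s\<in>{c, c + 4 * d}. \<exists>w\<in>W. \<exists>k. y = of_int s + w + n * of_int k \<or> y = of_int s + 3 - w + n * of_int k)"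
    unfolding e by blast
qed

lemma h2_range:
  assumes "s \<in> {0..1}" "1 \<le> d" "d < int g"
  shows "0 < \<bar>2 * of_int d + 3/2 - wt s\<bar> \<and> \<bar>2 * of_int d + 3/2 - wt s\<bar> < n / 2"
    "0 < \<bar>2 * of_int d - 3/2 + wt s\<bar> \<and> \<bar>2 * of_int d - 3/2 + wt s\<bar> < n / 2"
proof -
  have "1 \<le> (of_int d :: real)" using assms(2) by simp
  moreover have "of_int d + 1 \<le> real g" using assms(3) by (metis of_int_1 of_int_add of_int_le_iff of_int_of_nat_eq zless_imp_add1_zle)
  ultimately show "0 < \<bar>2 * of_int d + 3/2 - wt s\<bar> \<and> \<bar>2 * of_int d + 3/2 - wt s\<bar> < n / 2"
    "0 < \<bar>2 * of_int d - 3/2 + wt s\<bar> \<and> \<bar>2 * of_int d - 3/2 + wt s\<bar> < n / 2"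
    using wt_range[OF assms(1)] w by auto
qed

lemma ann2_image:
  assumes A: "A \<subseteq> {0..1}" and c: "c mod 4 < 2" and d: "1 \<le> d" "d < int g"
  shows "ann2 c d ` (A \<times> {0..1}) = q ` strip2 c d (wt ` A)"
proof -
  let ?m = "of_int c + 2 * of_int d + 3/2 :: real"
  let ?h = "\<lambda>s. 2 * of_int d + 3/2 - wt s" and ?h' = "\<lambda>s. 2 * of_int d - 3/2 + wt s"
  have s1: "strip ?m ((\<lambda>w. 2 * of_int d + 3/2 - w) ` wt ` A) = (\<lambda>(h, t). ch ?m h t) ` ((\<lambda>w. 2 * of_int d + 3/2 - w) ` wt ` A \<times> {0..1})"
    by (rule strip_eq_ch) (use h2_range(1)[OF _ d] A in \<open>blast\<close>)
  have s2: "strip ?m ((\<lambda>w. 2 * of_int d - 3/2 + w) ` wt ` A) = (\<lambda>(h, t). ch ?m h t) ` ((\<lambda>w. 2 * of_int d - 3/2 + w) ` wt ` A \<times> {0..1})"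
    by (rule strip_eq_ch) (use h2_range(2)[OF _ d] A in \<open>blast\<close>)
  show ?thesis
  proof
    show "ann2 c d ` (A \<times> {0..1}) \<subseteq> q ` strip2 c d (wt ` A)"
    proof
      fix x assume "x \<in> ann2 c d ` (A \<times> {0..1})"
      then obtain s t where st: "s \<in> A" "0 \<le> t" "t \<le> 1" "x = ann2 c d (s, t)" by auto
      show "x \<in> q ` strip2 c d (wt ` A)"
      proof (cases "t \<le> 1/2")
        case True
        then have "ch ?m (?h s) (2 * t) \<in> strip2 c d (wt ` A)" unfolding strip2_def s1
          using st by (intro UnI1 image_eqI[of _ _ "(?h s, 2 * t)"]) auto
        then show ?thesis using st True by (simp add: ann2_def)
      next
        case False
        then have "ch ?m (?h' s) (1 - (2 * t - 1)) \<in> strip2 c d (wt ` A)" unfolding strip2_def s2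
          using st by (intro UnI2 image_eqI[of _ _ "(?h' s, 1 - (2 * t - 1))"]) auto
        moreover have "x = q (ch ?m (?h' s) (1 - (2 * t - 1)))" unfolding ch_minus[symmetric] using st False by (simp add: ann2_def)
        ultimately show ?thesis by blast
      qed
    qed
    show "q ` strip2 c d (wt ` A) \<subseteq> ann2 c d ` (A \<times> {0..1})"
    proof
      fix x assume "x \<in> q ` strip2 c d (wt ` A)"
      then obtain z where z: "x = q z" "z \<in> strip2 c d (wt ` A)" by blast
      from z(2) show "x \<in> ann2 c d ` (A \<times> {0..1})"
        unfolding strip2_def s1 s2
      proof
        assume "z \<in> (\<lambda>(h, t). ch ?m h t) ` ((\<lambda>w. 2 * of_int d + 3/2 - w) ` wt ` A \<times> {0..1})"
        then obtain s t where st: "s \<in> A" "0 \<le> t" "t \<le> 1" "z = ch ?m (?h s) t" by auto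
        then have "x = ann2 c d (s, t / 2)" by (simp add: ann2_def z(1))
        then show ?thesis using st by (intro image_eqI[of _ _ "(s, t / 2)"]) auto
      next
        assume "z \<in> (\<lambda>(h, t). ch ?m h t) ` ((\<lambda>w. 2 * of_int d - 3/2 + w) ` wt ` A \<times> {0..1})"
        then obtain s t where st: "s \<in> A" "0 \<le> t" "t \<le> 1" "z = ch ?m (?h' s) t" by auto
        have ss: "s \<in> {0..1}" using A st by auto
        show ?thesis
        proof (cases "t = 1")
          case False
          have "z = ch ?m (- ?h' s) (2 * (1 - t / 2) - 1)" using st unfolding ch_minus by simp
          then have "x = ann2 c d (s, 1 - t / 2)" using st False by (simp add: ann2_def z(1))
          then show ?thesis using st by (intro image_eqI[of _ _ "(s, 1 - t / 2)"]) auto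
        next
          case True
          have "z = P (of_int (c + 4 * d) + wt s)" unfolding st True ch_1 by (rule arg_cong[of _ _ P]) simp
          then have "x = q (P (of_int (c + 4 * d) + 3 - wt s))"
            using glue[of "c + 4 * d" "wt s"] c wt_range[OF ss] w z by auto
          moreover have "ann2 c d (s, 1/2) = q (P (of_int (c + 4 * d) + 3 - wt s))" by (simp add: ann2_def ch_1 algebra_simps)
          ultimately show ?thesis using st by (intro image_eqI[of _ _ "(s, 1/2)"]) auto
        qed
      qed
    qed
  qed
qed

lemma ann2_annulus:
  assumes c: "c mod 4 < 2" and d: "1 \<le> d" "d < int g" shows "annulus S (ann2 c d)"
proof
  let ?m = "of_int c + 2 * of_int d + 3/2 :: real"
  let ?h = "\<lambda>s. 2 * of_int d + 3/2 - wt s" and ?h' = "\<lambda>s. 2 * of_int d - 3/2 + wt s"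
  let ?e = "\<lambda>i. if i then c + 4 * d else c"
  let ?z = "\<lambda>s t. if t \<le> 1/2 then ch ?m (?h s) (2 * t) else ch ?m (- ?h' s) (2 * t - 1)"
  have c': "?e i mod 4 < 2" for i using c by auto
  \<comment> \<open>The negative half-width runs the narrow chord backwards, from the partner of the
    point where the wide chord ended to the partner of the point where it began.\<close>
  have ends: "ch ?m (?h s) 0 = P (of_int c + wt s)" "ch ?m (?h s) 1 = P (of_int (c + 4 * d) + 3 - wt s)"
    "ch ?m (- ?h' s) 0 = P (of_int (c + 4 * d) + wt s)" "ch ?m (- ?h' s) 1 = P (of_int c + 3 - wt s)" for s
    unfolding ch_0 ch_1 by (rule arg_cong[of _ _ P]; simp)+
  have glued: "q (P (of_int (?e i) + 3 - wt s)) = q (P (of_int (?e i) + wt s))" if "s \<in> {0..1}" for s i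
    using glue[OF c', of "wt s" i] wt_range[OF that] w by simp
  have ann2_z: "ann2 c d (s, t) = q (?z s t)" for s t by (simp add: ann2_def)
  show "Hausdorff_space (top_of_set S)" by (rule Hausdorff)
  have 1: "continuous_on {st \<in> {0..1} \<times> {0..1}. snd st \<le> 1/2} (\<lambda>st. q (ch ?m (?h (fst st)) (2 * snd st)))"
    by (rule continuous_on_compose2[OF q_continuous]) (auto intro!: continuous_intros simp: ch_norm)
  have 2: "continuous_on {st \<in> {0..1} \<times> {0..1}. 1/2 \<le> snd st} (\<lambda>st. q (ch ?m (- ?h' (fst st)) (2 * snd st - 1)))"
    by (rule continuous_on_compose2[OF q_continuous]) (auto intro!: continuous_intros simp: ch_norm)
  have "continuous_on ({0..1} \<times> {0..1}) (\<lambda>st. if snd st \<le> 1/2 then q (ch ?m (?h (fst st)) (2 * snd st)) else q (ch ?m (- ?h' (fst st)) (2 * snd st - 1)))"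
  proof (rule continuous_on_cases_le[OF 1 2])
    show "continuous_on ({0..1} \<times> {0..1}) (snd :: real \<times> real \<Rightarrow> real)" by (intro continuous_intros)
    fix st :: "real \<times> real" assume st: "st \<in> {0..1} \<times> {0..1}" "snd st = 1/2"
    then have "fst st \<in> {0..1}" by auto
    from glued[OF this, of True] show "q (ch ?m (?h (fst st)) (2 * snd st)) = q (ch ?m (- ?h' (fst st)) (2 * snd st - 1))"
      unfolding st(2) using ends by simp
  qed
  then show "continuous_on ({0..1} \<times> {0..1}) (ann2 c d)" by (simp add: ann2_def case_prod_unfold)
  show "ann2 c d ` ({0..1} \<times> {0..1}) \<subseteq> S" by (auto simp: ann2_def intro!: q_in_S ch_norm)
  show "ann2 c d (s, 0) = ann2 c d (s, 1)" if "s \<in> {0..1}" for s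
    using glued[OF that, of False] ends[of s] by (simp add: ann2_def)
  have "1 \<le> (of_int d :: real)" using d(1) by simp
  moreover have "of_int d + 1 \<le> real g" using d(2) by (metis of_int_1 of_int_add of_int_le_iff of_int_of_nat_eq zless_imp_add1_zle)
  ultimately have "openin (top_of_set D) (strip2 c d {w0<..<w1})" unfolding strip2_def refl_ivl shift_ivl
    by (intro openin_Un strip_open) (use w in auto)
  from arcs_image_open[OF strip2_arcs[OF c] window_sub this]
  show "openin (top_of_set S) (ann2 c d ` ({0<..<1} \<times> {0..1}))"
    by (subst ann2_image) (auto simp: wt_image d c)
  have D: "?z s t \<in> D" if "t \<in> {0..1}" for s t using that by (auto intro!: ch_norm)
  text \<open>A point of the strips is determined by its chord, unless it lies on an edge.\<close>
  have bd: "t \<in> {0, 1/2, 1} \<and> q (?z s t) = q (P (of_int (?e (t = 1/2)) + wt s))"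
    if st: "s \<in> {0..1}" "t \<in> {0..1}" "norm (?z s t) = 1" for s t
  proof (cases "t \<le> 1/2")
    case True
    then have "2 * t = 0 \<or> 2 * t = 1" using ch_boundary[of "?h s" ?m "2 * t"] h2_range(1)[OF st(1) d] st(3) by simp
    then show ?thesis using ends[of s] glued[OF st(1), of True] by (elim disjE) auto
  next
    case False
    then have "norm (ch ?m (- ?h' s) (2 * t - 1)) = 1" using st(3) by (simp only: if_False)
    then have "2 * t - 1 = 0 \<or> 2 * t - 1 = 1" by (rule ch_boundary[rotated 2]) (use h2_range(2)[OF st(1) d] in auto)
    then have "t = 1" using False by linarith
    then show ?thesis using ends[of s] glued[OF st(1), of False] by auto
  qed
  fix s t s' t' assume st: "s \<in> {0..1}" "t \<in> {0..1}" "s' \<in> {0..1}" "t' \<in> {0..1}" and eq: "ann2 c d (s, t) = ann2 c d (s', t')"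
  have qe: "q (?z s t) = q (?z s' t')" using eq unfolding ann2_z .
  show "s = s' \<and> (t = t' \<or> (t = 0 \<and> t' = 1) \<or> (t = 1 \<and> t' = 0))"
  proof (cases "?z s t = ?z s' t'")
    case True
    have abs: "\<bar>?h s\<bar> = ?h s" "\<bar>- ?h' s\<bar> = ?h' s" "\<bar>?h s'\<bar> = ?h s'" "\<bar>- ?h' s'\<bar> = ?h' s'"
      using d wt_range[OF st(1)] wt_range[OF st(3)] w by auto
    \<comment> \<open>Every narrow chord is shorter than every wide one, as two positions in the
      window add up to less than 3; the strips are disjoint.\<close>
    have lt: "?h' s < ?h s'" "?h' s' < ?h s" using wt_range[OF st(1)] wt_range[OF st(3)] w by auto
    note r = h2_range[OF st(1) d] h2_range[OF st(3) d]
    show ?thesis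
    proof (cases "t \<le> 1/2"; cases "t' \<le> 1/2")
      assume t: "t \<le> 1/2" "t' \<le> 1/2"
      then have e: "ch ?m (?h s) (2 * t) = ch ?m (?h s') (2 * t')" using True by simp
      have "wt s = wt s'" using ch_inj(1)[OF _ _ _ _ e] r abs by auto
      then show ?thesis using ch_inj(2)[OF _ _ _ _ e] r wt_inj by auto
    next
      assume t: "\<not> t \<le> 1/2" "\<not> t' \<le> 1/2"
      then have e: "ch ?m (- ?h' s) (2 * t - 1) = ch ?m (- ?h' s') (2 * t' - 1)" using True by simp
      have "wt s = wt s'" using ch_inj(1)[OF _ _ _ _ e] r abs by auto
      then show ?thesis using ch_inj(2)[OF _ _ _ _ e] r wt_inj by auto
    next
      assume t: "t \<le> 1/2" "\<not> t' \<le> 1/2"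
      then have e: "ch ?m (?h s) (2 * t) = ch ?m (- ?h' s') (2 * t' - 1)" using True by simp
      show ?thesis using ch_inj(1)[OF _ _ _ _ e] r abs lt by auto
    next
      assume t: "\<not> t \<le> 1/2" "t' \<le> 1/2"
      then have e: "ch ?m (- ?h' s) (2 * t - 1) = ch ?m (?h s') (2 * t')" using True by simp
      show ?thesis using ch_inj(1)[OF _ _ _ _ e] r abs lt by auto
    qed
  next
    case False
    note D1 = D[OF st(2), of s] and D2 = D[OF st(4), of s']
    have "\<not> norm (?z s t) < 1" "\<not> norm (?z s' t') < 1"
      using q_interior[OF D1 D2 _ qe] q_interior[OF D2 D1 _ sym[OF qe]] False by metis+
    then have "norm (?z s t) = 1" "norm (?z s' t') = 1" using D1 D2 unfolding mem_cball_0 by linarith+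
    note b = bd[OF st(1,2) this(1)] bd[OF st(3,4) this(2)]
    have e: "q (P (of_int (?e (t = 1/2)) + wt s)) = q (P (of_int (?e (t' = 1/2)) + wt s'))" using b qe by metis
    have "0 < wt s" "wt s < 1" "0 < wt s'" "wt s' < 1" using wt_range[OF st(1)] wt_range[OF st(3)] w by linarith+
    note f = q_edge_eq[OF c' c' this e]
    \<comment> \<open>The edges c and c + 4d are different modulo 4g because 0 < d < g.\<close>
    have "(t = 1/2) = (t' = 1/2)"
    proof (rule ccontr)
      assume "(t = 1/2) \<noteq> (t' = 1/2)"
      then obtain k :: int where "c + 4 * d = c + 4 * int g * k \<or> c = c + 4 * d + 4 * int g * k" using f(2) by (auto split: if_splits)
      then have "int g dvd d" by (auto simp: dvd_def intro: exI[of _ k] exI[of _ "- k"])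
      then show False using d zdvd_imp_le by fastforce
    qed
    then show ?thesis using f(1) wt_inj b by auto
  qed
qed

end

section \<open>Action of the twists on the edge loops\<close>

text \<open>\<delta> joins a lift of the marked point to the vertex 1. It avoids every strip, so all
  twists fix its image pointwise, and loops at the vertex can be carried to the marked point
  independently of the twist.\<close>

locale based_polygon = polygon_windows g S q w0 w1
  for g and S :: "'a::topological_space set" and q w0 w1 +
  fixes p :: 'a and \<delta> :: "real \<Rightarrow> complex"
  assumes tail: "path \<delta>" "path_image \<delta> \<subseteq> D" "q (\<delta> 0) = p" "q (\<delta> 1) = v"
    and avoid1: "e \<in> {0..<4 * int g} \<Longrightarrow> e mod 4 < 2 \<Longrightarrow> t \<in> {0..1} \<Longrightarrow> \<delta> t \<notin> strip1 e {w0..w1}"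
    and avoid2: "c \<in> {0..<4 * int g} \<Longrightarrow> c mod 4 < 2 \<Longrightarrow> d \<in> {1..<int g} \<Longrightarrow> t \<in> {0..1} \<Longrightarrow> \<delta> t \<notin> strip2 c d {w0..w1}"
begin

abbreviation "\<pi> \<equiv> fundamental_group S p"

definition spoke where "spoke = q \<circ> \<delta>"

lemma pth_q: "pth D \<gamma> x y \<Longrightarrow> pth S (q \<circ> \<gamma>) (q x) (q y)"
  using pth_continuous_image[of D \<gamma> x y q S] q_continuous q_in_S by blast

lemma spoke_pth: "pth S spoke p v"
proof -
  have "pth D \<delta> (\<delta> 0) (\<delta> 1)" using tail by (simp add: pth_def pathstart_def pathfinish_def)
  from pth_q[OF this] show ?thesis using tail by (simp add: spoke_def)
qed

lemma p_in_S: "p \<in> S" using pth_ends[OF spoke_pth] by simp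

sublocale pi: group \<pi> using pi1_group[OF p_in_S] .

lemma v_in_S: "v \<in> S" using pth_ends[OF spoke_pth] by simp

text \<open>A chosen path from the marked point to every point of the surface; at the vertex it has
  to be the spoke itself, which the twists fix.\<close>

definition tau :: "'a \<Rightarrow> real \<Rightarrow> 'a" where
  "tau x = (if x = v then spoke else spoke +++ (q \<circ> linepath 1 (SOME z. z \<in> D \<and> q z = x)))"

lemma pth_line: "x \<in> D \<Longrightarrow> y \<in> D \<Longrightarrow> pth D (linepath x y) x y"
  using closed_segment_subset[of x D y] by (simp add: pth_def)

lemma tau_lift:
  assumes "x \<in> S" "x \<noteq> v"
  obtains z where "z \<in> D" "q z = x" "tau x = spoke +++ (q \<circ> linepath 1 z)"
proof -
  define z where "z = (SOME z. z \<in> D \<and> q z = x)"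
  have "\<exists>z. z \<in> D \<and> q z = x" using q_image assms by blast
  then have "z \<in> D \<and> q z = x" unfolding z_def by (rule someI_ex)
  then show ?thesis using that[of z] assms by (simp add: tau_def z_def)
qed

lemma tau_v: "tau v = spoke" by (simp add: tau_def)

lemma tau_pth: "x \<in> S \<Longrightarrow> pth S (tau x) p x"
proof (cases "x = v")
  case True then show ?thesis using spoke_pth by (simp add: tau_v)
next
  case False assume "x \<in> S"
  from tau_lift[OF this False] obtain z where z: "z \<in> D" "q z = x" "tau x = spoke +++ (q \<circ> linepath 1 z)" .
  show ?thesis unfolding z(3) using pth_join[OF spoke_pth pth_q[OF pth_line[of 1 z]]] z by simp
qed

text \<open>A functor from the fundamental groupoid to the group at the marked point. Open paths can
  thus be multiplied in the group piece by piece.\<close>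

definition Cl :: "'a \<Rightarrow> 'a \<Rightarrow> (real \<Rightarrow> 'a) \<Rightarrow> (real \<Rightarrow> 'a) set" where
  "Cl x y \<gamma> = path_class S (tau x +++ (\<gamma> +++ reversepath (tau y)))"

abbreviation "Lc \<equiv> Cl v v"

lemma Cl_pth: "pth S \<gamma> x y \<Longrightarrow> pth S (tau x +++ (\<gamma> +++ reversepath (tau y))) p p"
  by (meson pth_join pth_reverse tau_pth pth_ends)

lemma Cl_closed [simp]: "pth S \<gamma> x y \<Longrightarrow> Cl x y \<gamma> \<in> carrier \<pi>"
  unfolding Cl_def by (rule pi1_closed[OF Cl_pth])

lemma Cl_cong: "pth S \<gamma> x y \<Longrightarrow> homotopic_paths S \<gamma> \<gamma>' \<Longrightarrow> Cl x y \<gamma> = Cl x y \<gamma>'"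
  unfolding Cl_def
  by (meson hp_join hp_refl path_class_cong pth_join pth_reverse tau_pth pth_ends)

lemma Cl_mult:
  assumes 1: "pth S \<gamma> x y" "pth S \<gamma>' y z"
  shows "Cl x y \<gamma> \<otimes>\<^bsub>\<pi>\<^esub> Cl y z \<gamma>' = Cl x z (\<gamma> +++ \<gamma>')"
proof -
  let ?r = "reversepath (tau y)" and ?r' = "reversepath (tau z)"
  have t: "pth S (tau x) p x" "pth S (tau y) p y" "pth S (tau z) p z" using tau_pth pth_ends 1 by blast+
  have r: "pth S ?r y p" "pth S ?r' z p" by (intro pth_reverse t)+
  note j = pth_join
  have "homotopic_paths S ((tau x +++ (\<gamma> +++ ?r)) +++ (tau y +++ (\<gamma>' +++ ?r'))) (tau x +++ ((\<gamma> +++ ?r) +++ (tau y +++ (\<gamma>' +++ ?r'))))"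
    using hp_assoc[OF t(1) j[OF 1(1) r(1)] j[OF t(2) j[OF 1(2) r(2)]]] homotopic_paths_sym by blast
  also have "homotopic_paths S \<dots> (tau x +++ ((\<gamma> +++ \<gamma>') +++ ?r'))"
  proof (rule hp_join[OF hp_refl[OF t(1)] _ t(1)])
    show "pth S ((\<gamma> +++ ?r) +++ (tau y +++ (\<gamma>' +++ ?r'))) x p" by (rule j[OF j[OF 1(1) r(1)] j[OF t(2) j[OF 1(2) r(2)]]])
    have "homotopic_paths S ((\<gamma> +++ ?r) +++ (tau y +++ (\<gamma>' +++ ?r'))) (\<gamma> +++ (?r +++ (tau y +++ (\<gamma>' +++ ?r'))))"
      using hp_assoc[OF 1(1) r(1) j[OF t(2) j[OF 1(2) r(2)]]] homotopic_paths_sym by blast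
    also have "homotopic_paths S \<dots> (\<gamma> +++ (\<gamma>' +++ ?r'))"
    proof (rule hp_join[OF hp_refl[OF 1(1)] _ 1(1)])
      show "pth S (?r +++ (tau y +++ (\<gamma>' +++ ?r'))) y p" by (intro j[OF r(1)] j[OF t(2)] j[OF 1(2) r(2)])
      have "homotopic_paths S (?r +++ (tau y +++ (\<gamma>' +++ ?r'))) ((?r +++ tau y) +++ (\<gamma>' +++ ?r'))"
        by (rule hp_assoc[OF r(1) t(2) j[OF 1(2) r(2)]])
      also have "homotopic_paths S \<dots> ((\<lambda>_. y) +++ (\<gamma>' +++ ?r'))"
        by (rule hp_join[OF hp_inverse_left[OF t(2)] hp_refl[OF j[OF 1(2) r(2)]] j[OF r(1) t(2)] j[OF 1(2) r(2)]])
      also have "homotopic_paths S \<dots> (\<gamma>' +++ ?r')" by (rule hp_const_left[OF j[OF 1(2) r(2)]])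
      finally show "homotopic_paths S (?r +++ (tau y +++ (\<gamma>' +++ ?r'))) (\<gamma>' +++ ?r')" .
    qed
    also have "homotopic_paths S \<dots> ((\<gamma> +++ \<gamma>') +++ ?r')" by (rule hp_assoc[OF 1 r(2)])
    finally show "homotopic_paths S ((\<gamma> +++ ?r) +++ (tau y +++ (\<gamma>' +++ ?r'))) ((\<gamma> +++ \<gamma>') +++ ?r')" .
  qed
  finally show ?thesis unfolding Cl_def pi1_mult[OF Cl_pth[OF 1(1)] Cl_pth[OF 1(2)]] by (rule path_class_cong)
qed

lemma Cl_const: "x \<in> S \<Longrightarrow> Cl x x (\<lambda>_. x) = \<one>\<^bsub>\<pi>\<^esub>"
proof -
  assume x: "x \<in> S"
  have c: "pth S (\<lambda>_. x) x x" by (rule pth_const[OF x])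
  have "homotopic_paths S ((\<lambda>_. x) +++ (\<lambda>_. x)) (\<lambda>_. x)" by (rule hp_const_left[OF c])
  from Cl_cong[OF pth_join[OF c c] this] have "Cl x x (\<lambda>_. x) \<otimes>\<^bsub>\<pi>\<^esub> Cl x x (\<lambda>_. x) = Cl x x (\<lambda>_. x)" using Cl_mult[OF c c] by simp
  then show ?thesis using Cl_closed[OF c] pi.r_cancel_one' by metis
qed

lemma Cl_reverse:
  assumes "pth S \<gamma> x y" shows "Cl y x (reversepath \<gamma>) = inv\<^bsub>\<pi>\<^esub> Cl x y \<gamma>"
proof -
  note r = pth_reverse[OF assms]
  have y: "y \<in> S" using pth_ends[OF assms] by simp
  have "Cl y x (reversepath \<gamma>) \<otimes>\<^bsub>\<pi>\<^esub> Cl x y \<gamma> = \<one>\<^bsub>\<pi>\<^esub>"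
    unfolding Cl_mult[OF r assms] Cl_cong[OF pth_join[OF r assms] hp_inverse_left[OF assms]] by (rule Cl_const[OF y])
  then show ?thesis using assms r by (metis Cl_closed pi.inv_equality)
qed

lemma hp_D:
  assumes "pth D \<gamma> x y" "pth D \<gamma>' x y"
  shows "homotopic_paths S (q \<circ> \<gamma>) (q \<circ> \<gamma>')"
proof -
  have "homotopic_paths D \<gamma> \<gamma>'"
  proof (rule homotopic_paths_linear)
    fix t :: real assume t: "t \<in> {0..1}"
    then have "\<gamma> t \<in> D" "\<gamma>' t \<in> D" using assms unfolding pth_def path_image_def by blast+
    then show "closed_segment (\<gamma> t) (\<gamma>' t) \<subseteq> D" by (intro closed_segment_subset) auto
  qed (use assms in \<open>auto simp: pth_def\<close>)
  then show ?thesis by (rule homotopic_paths_continuous_image[OF _ q_continuous]) (use q_in_S in auto)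
qed

text \<open>The class of a diagonal of the polygon. By convexity any path in the disc between the
  two corners gives the same class, so diagonals compose like differences of their ends; together
  with the period 4g this contains the surface relation.\<close>

definition edge :: "int \<Rightarrow> int \<Rightarrow> (real \<Rightarrow> 'a) set" where
  "edge k l = Lc (q \<circ> linepath (P (of_int k)) (P (of_int l)))"

lemma pth_vertices: "pth D \<gamma> (P (of_int k)) (P (of_int l)) \<Longrightarrow> pth S (q \<circ> \<gamma>) v v"
  using pth_q[of \<gamma> "P (of_int k)" "P (of_int l)"] by (simp only: q_vertex)

lemma edge_eq: "pth D \<gamma> (P (of_int k)) (P (of_int l)) \<Longrightarrow> edge k l = Lc (q \<circ> \<gamma>)"
  unfolding edge_def by (rule Cl_cong[OF pth_vertices[OF pth_line] hp_D[OF pth_line]]) auto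

lemma edge_closed [simp]: "edge k l \<in> carrier \<pi>"
  unfolding edge_def by (rule Cl_closed[OF pth_vertices[OF pth_line]]) auto

lemma edge_mult: "edge k l \<otimes>\<^bsub>\<pi>\<^esub> edge l m = edge k m"
proof -
  let ?a = "linepath (P (of_int k)) (P (of_int l))" and ?b = "linepath (P (of_int l)) (P (of_int m))"
  have a: "pth D ?a (P (of_int k)) (P (of_int l))" "pth D ?b (P (of_int l)) (P (of_int m))" by (intro pth_line; simp)+
  have "edge k l \<otimes>\<^bsub>\<pi>\<^esub> edge l m = Lc ((q \<circ> ?a) +++ (q \<circ> ?b))" unfolding edge_def
    by (rule Cl_mult[OF pth_vertices[OF a(1)] pth_vertices[OF a(2)]])
  also have "(q \<circ> ?a) +++ (q \<circ> ?b) = q \<circ> (?a +++ ?b)" by (simp add: path_compose_join)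
  also have "Lc \<dots> = edge k m" by (rule edge_eq[OF pth_join[OF a], symmetric])
  finally show ?thesis .
qed

lemma edge_refl: "edge k k = \<one>\<^bsub>\<pi>\<^esub>"
proof -
  have "edge k k = Lc (q \<circ> (\<lambda>_. P (of_int k)))" by (rule edge_eq[OF pth_const]) simp
  then show ?thesis by (simp add: o_def q_vertex Cl_const[OF v_in_S])
qed

lemma edge_period: "edge k (l + 4 * int g * m) = edge k l"
  using P_period[of "of_int l" m] by (simp add: edge_def)

lemma arc_pth: "pth D (\<lambda>t. P (x + y * t)) (P x) (P (x + y))"
  by (auto simp: pth_def path_def path_image_def pathstart_def pathfinish_def intro!: continuous_intros)

lemma edge_step: "edge k (k + 1) = Lc (q \<circ> (\<lambda>t. P (of_int k + t)))"
  using edge_eq[of "\<lambda>t. P (of_int k + 1 * t)" k "k + 1"] arc_pth[of "of_int k" 1] by simp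

lemma edge_inv:
  assumes e: "e mod 4 < 2" shows "edge (e + 2) (e + 3) = inv\<^bsub>\<pi>\<^esub> edge e (e + 1)"
proof -
  let ?c = "q \<circ> (\<lambda>t. P (of_int e + t))" and ?d = "q \<circ> (\<lambda>t. P (of_int (e + 2) + t))"
  have c: "pth S ?c v v" by (rule pth_vertices[of _ e "e + 1"]) (use arc_pth[of "of_int e" 1] in simp)
  have d: "pth S ?d v v" by (rule pth_vertices[of _ "e + 2" "e + 3"]) (use arc_pth[of "of_int (e + 2)" 1] in \<open>simp add: add.assoc\<close>)
  have "homotopic_paths S (reversepath ?c) ?d"
  proof (rule homotopic_paths_eq)
    fix t :: real assume t: "t \<in> {0..1}"
    have e2: "of_int e + 3 - (1 - t) = of_int (e + 2) + t" by simp
    have "q (P (of_int e + (1 - t))) = q (P (of_int e + 3 - (1 - t)))" by (rule glue[OF e]) (use t in auto)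
    then have "q (P (of_int e + (1 - t))) = q (P (of_int (e + 2) + t))" unfolding e2 .
    then show "reversepath ?c t = ?d t" unfolding reversepath_def o_def .
  qed (use pth_reverse[OF c] in \<open>auto simp: pth_def\<close>)
  from Cl_cong[OF pth_reverse[OF c] this] have 1: "Lc ?d = inv\<^bsub>\<pi>\<^esub> Lc ?c" by (simp add: Cl_reverse[OF c])
  have e3: "e + 2 + 1 = e + 3" by simp
  have "edge (e + 2) (e + 3) = Lc ?d" using edge_step[of "e + 2"] unfolding e3 .
  with 1 show ?thesis by (simp add: edge_step)
qed

text \<open>A path that leaves the polygon through one edge and comes back through the glued one.\<close>

lemma crossing:
  assumes e: "e mod 4 < 2" and x: "0 \<le> x" "x \<le> 1"
    and 1: "pth D \<gamma> (P (of_int k)) (P (of_int e + 3 - x))" and 2: "pth D \<gamma>' (P (of_int e + x)) (P (of_int l))"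
  shows "pth S ((q \<circ> \<gamma>) +++ (q \<circ> \<gamma>')) v v"
    and "Lc ((q \<circ> \<gamma>) +++ (q \<circ> \<gamma>')) = edge k (e + 3) \<otimes>\<^bsub>\<pi>\<^esub> edge e l"
proof -
  define y where "y = q (P (of_int e + x))"
  have y: "y = q (P (of_int e + 3 - x))" unfolding y_def by (rule glue[OF e x])
  \<comment> \<open>The crossing point slides along the edge to a corner, simultaneously on both
    copies of the edge. By the gluing the two slides have the same image, so inserting one and the
    reverse of the other does not change the class.\<close>
  let ?u = "\<lambda>t. P (of_int e + 3 - x + x * t)" and ?u' = "\<lambda>t. P (of_int e + x + (- x) * t)"
  have u: "pth D ?u (P (of_int e + 3 - x)) (P (of_int (e + 3)))" using arc_pth[of "of_int e + 3 - x" x] by simp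
  have u': "pth D ?u' (P (of_int e + x)) (P (of_int e))" using arc_pth[of "of_int e + x" "- x"] by simp
  have c: "pth S (q \<circ> \<gamma>) v y" using pth_q[OF 1] by (simp add: y q_vertex)
  have c': "pth S (q \<circ> \<gamma>') y v" using pth_q[OF 2] by (simp add: y_def q_vertex)
  have w: "pth S (q \<circ> ?u) y v" using pth_q[OF u] by (simp only: y q_vertex)
  have w': "pth S (q \<circ> ?u') y v" using pth_q[OF u'] by (simp only: y_def q_vertex)
  note j = pth_join and r = pth_reverse
  show 0: "pth S ((q \<circ> \<gamma>) +++ (q \<circ> \<gamma>')) v v" by (rule j[OF c c'])
  have uu: "homotopic_paths S (q \<circ> ?u) (q \<circ> ?u')"
  proof (rule homotopic_paths_eq)
    fix t :: real assume t: "t \<in> {0..1}"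
    have "0 \<le> x * (1 - t)" "x * (1 - t) \<le> 1 * 1" using x t mult_mono[of x 1 "1 - t" 1] by auto
    then show "(q \<circ> ?u) t = (q \<circ> ?u') t" using glue[OF e, of "x * (1 - t)"] by (simp add: algebra_simps)
  qed (use w in \<open>auto simp: pth_def\<close>)
  have "homotopic_paths S ((q \<circ> \<gamma>) +++ (q \<circ> \<gamma>')) ((q \<circ> \<gamma>) +++ ((q \<circ> ?u) +++ (reversepath (q \<circ> ?u') +++ (q \<circ> \<gamma>'))))"
  proof (rule hp_join[OF hp_refl[OF c] _ c c'])
    have "homotopic_paths S ((q \<circ> ?u) +++ (reversepath (q \<circ> ?u') +++ (q \<circ> \<gamma>'))) (((q \<circ> ?u) +++ reversepath (q \<circ> ?u')) +++ (q \<circ> \<gamma>'))"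
      by (rule hp_assoc[OF w r[OF w'] c'])
    also have "homotopic_paths S \<dots> (((q \<circ> ?u') +++ reversepath (q \<circ> ?u')) +++ (q \<circ> \<gamma>'))"
      by (rule hp_join[OF hp_join[OF uu hp_refl[OF r[OF w']] w r[OF w']] hp_refl[OF c'] j[OF w r[OF w']] c'])
    also have "homotopic_paths S \<dots> ((\<lambda>_. y) +++ (q \<circ> \<gamma>'))"
      by (rule hp_join[OF hp_inverse_right[OF w'] hp_refl[OF c'] j[OF w' r[OF w']] c'])
    also have "homotopic_paths S \<dots> (q \<circ> \<gamma>')" by (rule hp_const_left[OF c'])
    finally show "homotopic_paths S (q \<circ> \<gamma>') ((q \<circ> ?u) +++ (reversepath (q \<circ> ?u') +++ (q \<circ> \<gamma>')))"
      by (rule homotopic_paths_sym)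
  qed
  also have "homotopic_paths S \<dots> (((q \<circ> \<gamma>) +++ (q \<circ> ?u)) +++ (reversepath (q \<circ> ?u') +++ (q \<circ> \<gamma>')))"
    by (rule hp_assoc[OF c w j[OF r[OF w'] c']])
  finally have "Lc ((q \<circ> \<gamma>) +++ (q \<circ> \<gamma>')) = Lc (((q \<circ> \<gamma>) +++ (q \<circ> ?u)) +++ (reversepath (q \<circ> ?u') +++ (q \<circ> \<gamma>')))"
    by (rule Cl_cong[OF 0])
  also have "\<dots> = Lc ((q \<circ> \<gamma>) +++ (q \<circ> ?u)) \<otimes>\<^bsub>\<pi>\<^esub> Lc (reversepath (q \<circ> ?u') +++ (q \<circ> \<gamma>'))"
    by (rule Cl_mult[symmetric, OF j[OF c w] j[OF r[OF w'] c']])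
  also have "(q \<circ> \<gamma>) +++ (q \<circ> ?u) = q \<circ> (\<gamma> +++ ?u)" by (simp only: path_compose_join)
  also have "Lc \<dots> = edge k (e + 3)" by (rule edge_eq[OF j[OF 1 u], symmetric])
  also have "reversepath (q \<circ> ?u') +++ (q \<circ> \<gamma>') = q \<circ> (reversepath ?u' +++ \<gamma>')" by (simp only: path_compose_join path_compose_reversepath)
  also have "Lc \<dots> = edge e l" by (rule edge_eq[OF j[OF r[OF u'] 2], symmetric])
  finally show "Lc ((q \<circ> \<gamma>) +++ (q \<circ> \<gamma>')) = edge k (e + 3) \<otimes>\<^bsub>\<pi>\<^esub> edge e l" .
qed

lemma hp_eq: "pth S \<gamma> x y \<Longrightarrow> (\<And>t. t \<in> {0..1} \<Longrightarrow> \<gamma> t = \<gamma>' t) \<Longrightarrow> homotopic_paths S \<gamma> \<gamma>'"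
  by (rule homotopic_paths_eq) (auto simp: pth_def)

lemma pi1_map_Lc:
  assumes T: "continuous_on S T" "T ` S \<subseteq> S" and fx: "\<And>t. t \<in> {0..1} \<Longrightarrow> T (spoke t) = spoke t" and g: "pth S \<gamma> v v"
    and g': "\<And>t. t \<in> {0..1} \<Longrightarrow> T (\<gamma> t) = \<gamma>' t"
  shows "pi1_map S T (Lc \<gamma>) = Lc \<gamma>'"
proof -
  have m: "pi1_map S T (Lc \<gamma>) = path_class S (T \<circ> (spoke +++ (\<gamma> +++ reversepath spoke)))"
    unfolding Cl_def tau_v by (rule pi1_map_class[OF Cl_pth[OF g, unfolded tau_v] T])
  have "T v = v" "T p = p" using fx[of 0] fx[of 1] spoke_pth by (auto simp: pth_def pathstart_def pathfinish_def)
  then have "pth S (T \<circ> (spoke +++ (\<gamma> +++ reversepath spoke))) p p"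
    using pth_continuous_image[OF Cl_pth[OF g, unfolded tau_v] T] by simp
  then have "homotopic_paths S (T \<circ> (spoke +++ (\<gamma> +++ reversepath spoke))) (spoke +++ (\<gamma>' +++ reversepath spoke))"
    by (rule hp_eq) (auto simp: joinpaths_def reversepath_def fx g')
  then show ?thesis unfolding m by (simp only: Cl_def tau_v path_class_cong)
qed

text \<open>Freezes the parameter outside the window, so that a whole edge has its twisted image
  given by one formula.\<close>

definition clamp :: "real \<Rightarrow> real" where "clamp x = max 0 (min 1 x)"

lemma clamp_continuous [continuous_intros]: "continuous_on A f \<Longrightarrow> continuous_on A (\<lambda>x. clamp (f x))"
  unfolding clamp_def by (intro continuous_intros)

lemma clamp_range [simp]: "0 \<le> clamp x" "clamp x \<le> 1" by (auto simp: clamp_def)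

lemma clamp_simps [simp]: "x \<le> 0 \<Longrightarrow> clamp x = 0" "1 \<le> x \<Longrightarrow> clamp x = 1" "0 \<le> x \<Longrightarrow> x \<le> 1 \<Longrightarrow> clamp x = x"
  by (auto simp: clamp_def)

definition tw :: "real \<Rightarrow> real" where "tw t = (t - w0) / (w1 - w0)"

lemma wt_tw: "wt (tw t) = t" using w by (simp add: wt_def tw_def)

lemma tw_continuous [continuous_intros]: "continuous_on A f \<Longrightarrow> continuous_on A (\<lambda>x. tw (f x))"
  unfolding tw_def using w by (intro continuous_intros) auto

lemma tw_le: "tw t \<le> 0 \<longleftrightarrow> t \<le> w0" "1 \<le> tw t \<longleftrightarrow> w1 \<le> t" "0 < tw t \<longleftrightarrow> w0 < t" "tw t < 1 \<longleftrightarrow> t < w1"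
  using w by (auto simp: tw_def divide_le_0_iff zero_less_divide_iff less_divide_eq pos_divide_less_eq le_divide_eq)

lemma ch_pth:
  assumes "continuous_on {0..1} h" "continuous_on {0..1} r" "\<And>t. t \<in> {0..1} \<Longrightarrow> r t \<in> {0..1}"
  shows "pth D (\<lambda>t. ch m (h t) (r t)) (ch m (h 0) (r 0)) (ch m (h 1) (r 1))"
  unfolding pth_def path_def path_image_def pathstart_def pathfinish_def
  using assms by (auto intro!: continuous_intros ch_norm)

end

text \<open>Common ground for the annuli of one and of two strips: \<open>Q W\<close> is the part of
  the polygon that meets the edges in \<open>E\<close> at the positions \<open>W\<close>.\<close>

locale twist_edge = based_polygon g S q w0 w1 p \<delta> + ann: annulus S \<kappa>
  for g and S :: "'a::topological_space set" and q w0 w1 p \<delta> \<kappa> +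
  fixes E :: "int set" and Q :: "real set \<Rightarrow> complex set"
  assumes Q: "arcs E W (Q W)" and Q_sub: "Q W \<subseteq> D" and Q_mono: "W \<subseteq> W' \<Longrightarrow> Q W \<subseteq> Q W'"
    and image: "A \<subseteq> {0..1} \<Longrightarrow> \<kappa> ` (A \<times> {0..1}) = q ` Q (wt ` A)"
    and avoid: "t \<in> {0..1} \<Longrightarrow> \<delta> t \<notin> Q {w0..w1}"
begin

abbreviation "T \<equiv> ann.twist"

lemma T_off: "z \<in> D \<Longrightarrow> z \<notin> Q {w0<..<w1} \<Longrightarrow> T (q z) = q z"
proof (rule ann.twist_out)
  assume z: "z \<in> D" "z \<notin> Q {w0<..<w1}"
  have "q z \<notin> q ` Q {w0<..<w1}" using arcs_image_iff[OF Q window_sub Q_sub z(1)] z(2) by blast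
  moreover have "\<kappa> ` ({0<..<1} \<times> {0..1}) = q ` Q {w0<..<w1}" using image[OF greaterThanLessThan_subseteq_atLeastAtMost_iff[THEN iffD2]] by (simp add: wt_image)
  ultimately show "q z \<notin> \<kappa> ` ({0<..<1} \<times> {0..1})" by simp
qed

lemma tail_D: "t \<in> {0..1} \<Longrightarrow> \<delta> t \<in> D" using tail(2) unfolding path_image_def by blast

lemma T_homeo_plus: "T \<in> homeo_plus S p"
proof (rule ann.twist_homeo_plus)
  show "p \<in> S" by (rule p_in_S)
  then show "closedin (top_of_set S) {p}" by (rule point_closed)
  have "q (\<delta> 0) \<notin> q ` Q {w0..w1}" using arcs_image_iff[OF Q window_sub' Q_sub tail_D[of 0]] avoid[of 0] by auto
  moreover have "\<kappa> ` ({0..1} \<times> {0..1}) \<subseteq> q ` Q {w0..w1}" using image[of "{0..1}"] Q_mono[OF wt_image_closed] by auto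
  ultimately show "p \<notin> \<kappa> ` ({0..1} \<times> {0..1})" using tail(3) by auto
qed

lemma T_spoke: "t \<in> {0..1} \<Longrightarrow> T (spoke t) = spoke t"
  using T_off[OF tail_D[of t]] avoid[of t] Q_mono[of "{w0<..<w1}" "{w0..w1}"] unfolding spoke_def o_def by force

lemma T_image: "T ` S \<subseteq> S" using ann.twist_S by auto

lemmas T_Lc = pi1_map_Lc[OF ann.twist_continuous T_image T_spoke]

lemma P_notin: "0 \<le> x \<Longrightarrow> x \<le> 1 \<Longrightarrow> (\<And>s j. s \<in> E \<Longrightarrow> k \<noteq> s + 4 * int g * j \<and> k \<noteq> s + 2 + 4 * int g * j) \<Longrightarrow> P (of_int k + x) \<notin> Q {w0<..<w1}"
proof -
  assume x: "0 \<le> x" "x \<le> 1" and k: "\<And>s j. s \<in> E \<Longrightarrow> k \<noteq> s + 4 * int g * j \<and> k \<noteq> s + 2 + 4 * int g * j"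
  show ?thesis
  proof (cases "x = 1")
    case True then show ?thesis using arcs_vertex[OF Q window_sub, of "k + 1"] by simp
  next
    case False
    then have "x < 1" using x by simp
    from arcs_edge[OF Q window_sub x(1) this, of k] k show ?thesis by blast
  qed
qed

lemma edge_fixed:
  assumes "\<And>s j. s \<in> E \<Longrightarrow> k \<noteq> s + 4 * int g * j \<and> k \<noteq> s + 2 + 4 * int g * j"
  shows "pi1_map S T (edge k (k + 1)) = edge k (k + 1)"
  unfolding edge_step
proof (rule T_Lc)
  show "pth S (q \<circ> (\<lambda>t. P (of_int k + t))) v v" by (rule pth_vertices[of _ k "k + 1"]) (use arc_pth[of "of_int k" 1] in simp)
  show "T ((q \<circ> (\<lambda>t. P (of_int k + t))) t) = (q \<circ> (\<lambda>t. P (of_int k + t))) t" if "t \<in> {0..1}" for t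
    using T_off[OF P_in_D P_notin[of t k]] assms that by simp
qed

lemma T_edge_out: "0 \<le> x \<Longrightarrow> x \<le> 1 \<Longrightarrow> x \<notin> {w0<..<w1} \<Longrightarrow> e mod 4 < 2 \<Longrightarrow> T (q (P (of_int e + x))) = q (P (of_int e + x))"
proof (rule T_off)
  assume x: "0 \<le> x" "x \<le> 1" "x \<notin> {w0<..<w1}" "e mod 4 < 2"
  show "P (of_int e + x) \<notin> Q {w0<..<w1}"
  proof (cases "x = 1")
    case True then show ?thesis using arcs_vertex[OF Q window_sub, of "e + 1"] by simp
  next
    case False
    have "e \<noteq> s + 2 + 4 * int g * j" if "s \<in> E" for s j
    proof
      assume "e = s + 2 + 4 * int g * j"
      then have "e mod 4 = (s + 2) mod 4" by (simp add: mod4_shift)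
      moreover have "s mod 4 < 2" using Q that by (auto simp: arcs_def)
      ultimately show False using x(4) by presburger
    qed
    moreover have "x < 1" using False x by simp
    ultimately show ?thesis using arcs_edge[OF Q window_sub x(1), of e] x(3) by blast
  qed
qed simp

end

context based_polygon
begin

lemma twist1:
  assumes e: "e \<in> {0..<4 * int g}" "e mod 4 < 2"
  shows "twist_edge g S q w0 w1 p \<delta> (ann1 e) {e} (strip1 e)"
proof -
  interpret annulus S "ann1 e" by (rule ann1_annulus[OF e(2)])
  show ?thesis
  proof
    show "arcs {e} W (strip1 e W)" for W by (rule strip1_arcs[OF e(2)])
    show "ann1 e ` (A \<times> {0..1}) = q ` strip1 e (wt ` A)" if "A \<subseteq> {0..1}" for A by (rule ann1_image[OF that])
  qed (use avoid1 e in \<open>auto simp: strip1_def strip_def\<close>)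
qed

lemma twist2:
  assumes c: "c \<in> {0..<4 * int g}" "c mod 4 < 2" "d \<in> {1..<int g}"
  shows "twist_edge g S q w0 w1 p \<delta> (ann2 c d) {c, c + 4 * d} (strip2 c d)"
proof -
  interpret annulus S "ann2 c d" by (rule ann2_annulus) (use c in auto)
  show ?thesis
  proof
    show "arcs {c, c + 4 * d} W (strip2 c d W)" for W by (rule strip2_arcs[OF c(2)])
    show "ann2 c d ` (A \<times> {0..1}) = q ` strip2 c d (wt ` A)" if "A \<subseteq> {0..1}" for A by (rule ann2_image[OF that]) (use c in auto)
  qed (use avoid2 c in \<open>auto simp: strip2_def strip_def\<close>)
qed

text \<open>While t runs through the window, the image of e + t travels along its chord from one end
  to the other. Before the window it stays on the edge e, afterwards on the glued edge, where it
  arrives at the corner e + 2; all of this is one path in the polygon.\<close>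

lemma twist1_edge:
  assumes e: "e \<in> {0..<4 * int g}" "e mod 4 < 2"
  shows "pi1_map S (annulus.twist (ann1 e)) (edge e (e + 1)) = edge e (e + 2)"
proof -
  interpret te: twist_edge g S q w0 w1 p \<delta> "ann1 e" "{e}" "strip1 e" by (rule twist1[OF e])
  let ?m = "of_int e + 3/2 :: real"
  let ?c = "\<lambda>t. P (of_int e + t)" and ?d = "\<lambda>t. ch ?m (3/2 - t) (clamp (tw t))"
  have c: "pth S (q \<circ> ?c) v v" by (rule pth_vertices[of _ e "e + 1"]) (use arc_pth[of "of_int e" 1] in simp)
  have "tw 0 \<le> 0" "1 \<le> tw 1" using tw_le w by auto
  then have d: "pth D ?d (P (of_int e)) (P (of_int (e + 2)))"
    using ch_pth[of "\<lambda>t. 3/2 - t" "\<lambda>t. clamp (tw t)" ?m] by (simp add: ch_0 ch_1 continuous_intros algebra_simps)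
  have "pi1_map S te.T (Lc (q \<circ> ?c)) = Lc (q \<circ> ?d)"
  proof (rule te.T_Lc[OF _ c])
    fix t :: real assume t: "t \<in> {0..1}"
    have g: "q (P (of_int e + t)) = q (P (of_int e + 3 - t))" by (rule glue) (use t e in auto)
    consider "t \<le> w0" | "w1 \<le> t" | "w0 < t" "t < w1" by linarith
    then show "te.T ((q \<circ> ?c) t) = (q \<circ> ?d) t"
    proof cases
      case 1
      then have "te.T (q (?c t)) = q (?c t)" using te.T_edge_out[of t e] t e by auto
      then show ?thesis using 1 by (simp add: tw_le ch_0)
    next
      case 2
      then have "te.T (q (?c t)) = q (?c t)" using te.T_edge_out[of t e] t e by auto
      moreover have "?d t = P (of_int e + 3 - t)" using 2 by (simp add: tw_le ch_1 algebra_simps)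
      ultimately show ?thesis using g by simp
    next
      case 3
      then have s: "tw t \<in> {0..1}" using tw_le[of t] by auto
      have "q (?c t) = ann1 e (tw t, 0)" by (simp add: ann1_def wt_tw ch_0)
      also have "te.T \<dots> = ann1 e (tw t, tw t)" using te.ann.twist_in[OF s, of 0] s by (simp add: te.ann.wind_def)
      also have "\<dots> = q (?d t)" using s by (simp add: ann1_def wt_tw)
      finally show ?thesis by simp
    qed
  qed
  then show ?thesis using edge_eq[OF d] by (simp add: edge_step)
qed

text \<open>
  The parameter at which the twisted edge leaves the polygon through the other pair of edges.
\<close>

definition wm :: real where "wm = wt (1/2)"

lemma wm: "w0 < wm" "wm < w1" "wt s = wm \<longleftrightarrow> s = 1/2"
proof -
  have "wm = (w0 + w1) / 2" by (simp add: wm_def wt_def field_simps)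
  then show "w0 < wm" "wm < w1" using w by auto
  show "wt s = wm \<longleftrightarrow> s = 1/2" unfolding wm_def by (rule wt_inj)
qed

text \<open>The edge cut where its twisted image leaves the polygon, so that the image becomes a
  join of two paths that both lift to the disc.\<close>

definition mid :: "int \<Rightarrow> real \<Rightarrow> complex" where
  "mid e = (\<lambda>t. P (of_int e + wm * t)) +++ (\<lambda>t. P (of_int e + (wm + (1 - wm) * t)))"

lemma mid_pth: "pth D (mid e) (P (of_int e)) (P (of_int (e + 1)))"
proof -
  have "pth D (\<lambda>t. P ((of_int e + wm) + (1 - wm) * t)) (P (of_int e + wm)) (P (of_int e + wm + (1 - wm)))" by (rule arc_pth)
  then have "pth D (\<lambda>t. P (of_int e + (wm + (1 - wm) * t))) (P (of_int e + wm)) (P (of_int (e + 1)))" by (simp add: add.assoc)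
  then show ?thesis unfolding mid_def by (rule pth_join[OF arc_pth])
qed

lemma mid_range: "t \<in> {0..1} \<Longrightarrow> wm * t \<in> {0..wm} \<and> wm + (1 - wm) * t \<in> {wm..1}"
proof -
  assume t: "t \<in> {0..1}"
  have "0 < wm" "wm < 1" using wm(1,2) w by auto
  then have "0 \<le> wm * t" "wm * t \<le> wm * 1" "0 \<le> (1 - wm) * t" "(1 - wm) * t \<le> (1 - wm) * 1"
    using t by (auto intro!: mult_left_mono)
  then show ?thesis by simp
qed

lemma tw_wm: "x \<le> wm \<longleftrightarrow> tw x \<le> 1/2" "wm \<le> x \<longleftrightarrow> 1/2 \<le> tw x"
proof -
  have "wm = (w0 + w1) / 2" by (simp add: wm_def wt_def field_simps)
  then show "x \<le> wm \<longleftrightarrow> tw x \<le> 1/2" "wm \<le> x \<longleftrightarrow> 1/2 \<le> tw x"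
    using w by (auto simp: tw_def divide_le_eq le_divide_eq)
qed

text \<open>The data are left free because the twist treats its two edges alike: for the second edge
  the wide and the narrow chord exchange their roles.\<close>

lemma twist2_edge_aux:
  assumes T: "twist_edge g S q w0 w1 p \<delta> \<kappa> E Q" and e: "e mod 4 < 2" and e': "e' mod 4 < 2"
    and 1: "\<And>t. t \<in> {0..wm} \<Longrightarrow> w0 < t \<Longrightarrow> annulus.twist \<kappa> (q (P (of_int e + t))) = q (ch m (h t) (2 * tw t))"
    and 2: "\<And>t. t \<in> {wm..1} \<Longrightarrow> t < w1 \<Longrightarrow> annulus.twist \<kappa> (q (P (of_int e + t))) = q (ch m (h' t) (2 * tw t - 1))"
    and h: "\<And>t. m - h t = of_int e + t" "\<And>t. m + h t = of_int e' + 3 - t"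
    and h': "\<And>t. m - h' t = of_int e' + t" "\<And>t. m + h' t = of_int e + 3 - t"
    and hc: "continuous_on UNIV h" "continuous_on UNIV h'"
  shows "pi1_map S (annulus.twist \<kappa>) (edge e (e + 1)) = edge e (e' + 3) \<otimes>\<^bsub>\<pi>\<^esub> edge e' (e + 2)"
proof -
  interpret te: twist_edge g S q w0 w1 p \<delta> \<kappa> E Q by (rule T)
  let ?x = "\<lambda>t. wm * t" and ?y = "\<lambda>t. wm + (1 - wm) * t"
  let ?c = "\<lambda>t. ch m (h (?x t)) (clamp (2 * tw (?x t)))" and ?d = "\<lambda>t. ch m (h' (?y t)) (clamp (2 * tw (?y t) - 1))"
  have t0: "tw 0 \<le> 0" "1 \<le> tw 1" "tw wm = 1/2" using tw_le w tw_wm[of wm] by auto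
  have c: "pth D ?c (P (of_int e)) (P (of_int e' + 3 - wm))"
  proof -
    have "pth D ?c (ch m (h (?x 0)) (clamp (2 * tw (?x 0)))) (ch m (h (?x 1)) (clamp (2 * tw (?x 1))))"
      by (intro ch_pth continuous_on_compose2[OF hc(1)]) (auto intro!: continuous_intros)
    then show ?thesis using t0 h(1)[of 0] h(2)[of wm] by (simp add: ch_0 ch_1)
  qed
  have d: "pth D ?d (P (of_int e' + wm)) (P (of_int (e + 2)))"
  proof -
    have "pth D ?d (ch m (h' (?y 0)) (clamp (2 * tw (?y 0) - 1))) (ch m (h' (?y 1)) (clamp (2 * tw (?y 1) - 1)))"
      by (intro ch_pth continuous_on_compose2[OF hc(2)]) (auto intro!: continuous_intros)
    then show ?thesis using t0 h'(1)[of wm] h'(2)[of 1] by (simp add: ch_0 ch_1 add.commute)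
  qed
  have x: "0 \<le> wm" "wm \<le> 1" using wm w by auto
  have C: "te.T (q (P (of_int e + ?x t))) = q (?c t)" if t: "t \<in> {0..1}" for t
  proof (cases "?x t \<le> w0")
    case True
    then have "te.T (q (P (of_int e + ?x t))) = q (P (of_int e + ?x t))" using te.T_edge_out[of "?x t" e] mid_range[OF t] x e by auto
    then show ?thesis using True h(1)[of "?x t"] by (simp add: ch_0 tw_le)
  next
    case False
    then have "0 < tw (?x t)" "tw (?x t) \<le> 1/2" using mid_range[OF t] tw_le tw_wm by auto
    then show ?thesis using 1[of "?x t"] False mid_range[OF t] by simp
  qed
  have Dd: "te.T (q (P (of_int e + ?y t))) = q (?d t)" if t: "t \<in> {0..1}" for t
  proof (cases "w1 \<le> ?y t")
    case True
    then have "te.T (q (P (of_int e + ?y t))) = q (P (of_int e + ?y t))" using te.T_edge_out[of "?y t" e] mid_range[OF t] x e by auto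
    also have "\<dots> = q (P (of_int e + 3 - ?y t))" by (rule glue[OF e]) (use mid_range[OF t] x in auto)
    moreover have "1 \<le> tw (?y t)" using True by (simp add: tw_le)
    ultimately show ?thesis using h'(2)[of "?y t"] by (simp add: ch_1)
  next
    case False
    have "wm \<le> ?y t" using mid_range[OF t] by auto
    then have "1/2 \<le> tw (?y t)" by (simp only: tw_wm(2))
    moreover have "tw (?y t) < 1" using False by (simp add: tw_le(4))
    ultimately have "tw (?y t) < 1" "1/2 \<le> tw (?y t)" by auto
    then show ?thesis using 2[of "?y t"] False mid_range[OF t] by simp
  qed
  have "pi1_map S te.T (Lc (q \<circ> mid e)) = Lc ((q \<circ> ?c) +++ (q \<circ> ?d))"
  proof (rule te.T_Lc)
    show "pth S (q \<circ> mid e) v v" by (rule pth_vertices[OF mid_pth])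
    fix t :: real assume t: "t \<in> {0..1}"
    have "t \<le> 1/2 \<Longrightarrow> 2 * t \<in> {0..1}" "\<not> t \<le> 1/2 \<Longrightarrow> 2 * t - 1 \<in> {0..1}" using t by auto
    then show "te.T ((q \<circ> mid e) t) = ((q \<circ> ?c) +++ (q \<circ> ?d)) t"
      using C[of "2 * t"] Dd[of "2 * t - 1"] by (cases "t \<le> 1/2") (simp_all add: mid_def joinpaths_def)
  qed
  also have "Lc (q \<circ> mid e) = edge e (e + 1)" by (rule edge_eq[OF mid_pth, symmetric])
  also have "Lc ((q \<circ> ?c) +++ (q \<circ> ?d)) = edge e (e' + 3) \<otimes>\<^bsub>\<pi>\<^esub> edge e' (e + 2)"
    by (rule crossing(2)[OF e' x c d])
  finally show ?thesis .
qed

lemma twist2_edge: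
  assumes c: "c \<in> {0..<4 * int g}" "c mod 4 < 2" "d \<in> {1..<int g}"
  defines "T \<equiv> annulus.twist (ann2 c d)"
  shows "pi1_map S T (edge c (c + 1)) = edge c (c + 4 * d + 3) \<otimes>\<^bsub>\<pi>\<^esub> edge (c + 4 * d) (c + 2)"
    and "pi1_map S T (edge (c + 4 * d) (c + 4 * d + 1)) = edge (c + 4 * d) (c + 3) \<otimes>\<^bsub>\<pi>\<^esub> edge c (c + 4 * d + 2)"
proof -
  interpret te: twist_edge g S q w0 w1 p \<delta> "ann2 c d" "{c, c + 4 * d}" "strip2 c d" by (rule twist2[OF c(1-3)])
  let ?m = "of_int c + 2 * of_int d + 3/2 :: real"
  let ?h = "\<lambda>t. 2 * of_int d + 3/2 - t :: real" and ?h' = "\<lambda>t. - (2 * of_int d - 3/2 + t) :: real"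
  have c4: "(c + 4 * d) mod 4 < 2" using c by simp
  have r: "0 \<le> tw t" "tw t \<le> 1" if "w0 \<le> t" "t \<le> w1" for t
  proof -
    show "0 \<le> tw t" using that w by (simp add: tw_def)
    show "tw t \<le> 1" using that w by (simp add: tw_def pos_divide_le_eq)
  qed
  have A: "q (P (of_int c + t)) = ann2 c d (tw t, 0)" for t by (simp add: ann2_def wt_tw ch_0)
  \<comment> \<open>The second edge sits half-way around the annulus, which accounts for the shift
    by 1/2 in the steps \<open>3\<close> and \<open>4\<close>.\<close>
  have B: "q (P (of_int (c + 4 * d) + t)) = ann2 c d (tw t, 1/2)" if "0 \<le> t" "t \<le> 1" for t
    using glue[OF c4 that] by (simp add: ann2_def wt_tw ch_1 algebra_simps)
  have G: "q (ch ?m (?h t) 1) = q (ch ?m (?h' t) 0)" if "0 \<le> t" "t \<le> 1" for t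
    using glue[OF c4 that] by (simp add: ch_0 ch_1 algebra_simps)
  have G': "q (ch ?m (?h' t) 1) = q (ch ?m (?h t) 0)" if "0 \<le> t" "t \<le> 1" for t
    using glue[OF c(2) that] by (simp add: ch_0 ch_1 algebra_simps)
  note tin = te.ann.twist_in[folded T_def]
  have 1: "T (q (P (of_int c + t))) = q (ch ?m (?h t) (2 * tw t))" if "t \<in> {0..wm}" "w0 < t" for t
  proof -
    have s: "tw t \<in> {0..1}" "tw t \<le> 1/2" using r[of t] that wm tw_wm[of t] by auto
    show ?thesis unfolding A tin[OF s(1), of 0, simplified] using s by (simp add: te.ann.wind_def ann2_def wt_tw)
  qed
  have 2: "T (q (P (of_int c + t))) = q (ch ?m (?h' t) (2 * tw t - 1))" if "t \<in> {wm..1}" "t < w1" for t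
  proof -
    have s: "tw t \<in> {0..1}" "1/2 \<le> tw t" using r[of t] that wm tw_wm[of t] by auto
    have "ann2 c d (tw t, tw t) = q (ch ?m (?h' t) (2 * tw t - 1))"
    \<comment> \<open>At the middle of the window \<open>ann2\<close> takes its first branch; the
      gluing makes the second one agree there.\<close>
    proof (cases "tw t = 1/2")
      case True
      show ?thesis using G[of t] that wm w unfolding True by (simp add: ann2_def wt_tw[of t, unfolded True])
    next
      case False then show ?thesis using s by (simp add: ann2_def wt_tw)
    qed
    then show ?thesis unfolding A tin[OF s(1), of 0, simplified] using s by (simp add: te.ann.wind_def)
  qed
  have 3: "T (q (P (of_int (c + 4 * d) + t))) = q (ch ?m (?h' t) (2 * tw t))" if "t \<in> {0..wm}" "w0 < t" for t
  proof -
    have s: "tw t \<in> {0..1}" "tw t \<le> 1/2" "0 < tw t" using r[of t] that wm tw_wm[of t] tw_le[of t] by auto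
    have t1: "0 \<le> t" "t \<le> 1" using that wm w by auto
    show ?thesis unfolding B[OF t1] tin[OF s(1), of "1/2", simplified] using s by (simp add: te.ann.wind_def ann2_def wt_tw)
  qed
  have 4: "T (q (P (of_int (c + 4 * d) + t))) = q (ch ?m (?h t) (2 * tw t - 1))" if "t \<in> {wm..1}" "t < w1" for t
  proof -
    have s: "tw t \<in> {0..1}" "1/2 \<le> tw t" "tw t < 1" using r[of t] that wm tw_wm[of t] tw_le[of t] by auto
    have t1: "0 \<le> t" "t \<le> 1" using that wm w by auto
    have "ann2 c d (tw t, te.ann.wind (tw t + 1/2)) = q (ch ?m (?h t) (2 * tw t - 1))"
    proof (cases "tw t = 1/2")
      case True
      show ?thesis using G'[OF t1] unfolding True by (simp add: te.ann.wind_def ann2_def wt_tw[of t, unfolded True])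
    next
      case False then show ?thesis using s by (simp add: te.ann.wind_def ann2_def wt_tw algebra_simps)
    qed
    then show ?thesis unfolding B[OF t1] tin[OF s(1), of "1/2", simplified] by simp
  qed
  have hc: "continuous_on UNIV ?h" "continuous_on UNIV ?h'" by (intro continuous_intros)+
  show "pi1_map S T (edge c (c + 1)) = edge c (c + 4 * d + 3) \<otimes>\<^bsub>\<pi>\<^esub> edge (c + 4 * d) (c + 2)"
    unfolding T_def
    by (rule twist2_edge_aux[OF twist2[OF c(1-3)] c(2) c4 1[unfolded T_def] 2[unfolded T_def] _ _ _ _ hc]) auto
  show "pi1_map S T (edge (c + 4 * d) (c + 4 * d + 1)) = edge (c + 4 * d) (c + 3) \<otimes>\<^bsub>\<pi>\<^esub> edge c (c + 4 * d + 2)"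
    unfolding T_def
    by (rule twist2_edge_aux[OF twist2[OF c(1-3)] c4 c(2) 3[unfolded T_def] 4[unfolded T_def] _ _ _ _ hc(2,1)]) auto
qed

end

section \<open>Generation by the edge loops\<close>

lemma square_homotopy:
  fixes F :: "real \<times> real \<Rightarrow> 'a::topological_space"
  assumes F: "continuous_on ({0..1} \<times> {0..1}) F" "F ` ({0..1} \<times> {0..1}) \<subseteq> S"
  shows "homotopic_paths S (F \<circ> linepath (0,0) (1,0)) ((F \<circ> linepath (0,0) (0,1)) +++ ((F \<circ> linepath (0,1) (1,1)) +++ (F \<circ> linepath (1,1) (1,0))))"
proof -
  let ?Q = "{0..1} \<times> {0..1} :: (real \<times> real) set"
  have conv: "convex ?Q" by (intro convex_Times convex_real_interval)
  have seg: "x \<in> ?Q \<Longrightarrow> y \<in> ?Q \<Longrightarrow> closed_segment x y \<subseteq> ?Q" for x y by (rule closed_segment_subset[OF _ _ conv])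
  have pl: "x \<in> ?Q \<Longrightarrow> y \<in> ?Q \<Longrightarrow> pth ?Q (linepath x y) x y" for x y using seg by (simp add: pth_def)
  have a: "pth ?Q (linepath (0,0) (1,0)) (0,0) (1,0)" by (rule pl) auto
  have b: "pth ?Q (linepath (0,0) (0,1) +++ (linepath (0,1) (1,1) +++ linepath (1,1) (1,0))) (0,0) (1,0)"
    by (intro pth_join[of _ _ _ "(0,1)"] pth_join[of _ _ _ "(1,1)"] pl) auto
  have "homotopic_paths ?Q (linepath (0,0) (1,0)) (linepath (0,0) (0,1) +++ (linepath (0,1) (1,1) +++ linepath (1,1) (1,0)))"
  proof (rule homotopic_paths_linear)
    fix t :: real assume "t \<in> {0..1}"
    then show "closed_segment (linepath (0,0) (1,0) t) ((linepath (0,0) (0,1) +++ (linepath (0,1) (1,1) +++ linepath (1,1) (1,0))) t) \<subseteq> ?Q"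
      using a b unfolding pth_def path_image_def by (intro seg) blast+
  qed (use a b in \<open>auto simp: pth_def\<close>)
  from homotopic_paths_continuous_image[OF this F(1)] F(2) show ?thesis by (simp add: path_compose_join image_subset_iff_funcset)
qed

section \<open>Contraction of a neighbourhood of the vertex\<close>

context polygon_surface
begin

lemma P_eq_1: "P x = 1 \<Longrightarrow> x \<in> \<int>"
proof -
  assume "P x = 1"
  then obtain j :: int where "x = 0 + n * of_int j" using P_eq[of x 0] by auto
  then have "x = of_int (4 * int g * j)" by simp
  then show ?thesis by (metis Ints_of_int)
qed

text \<open>In these coordinates a rotation towards a corner is linear in the angle. The centre has
  no angle, and for this reason \<open>star_rect\<close> demands a positive radius.\<close>

definition polar :: "real \<times> real \<Rightarrow> complex" where "polar rx = of_real (fst rx) * P (snd rx)"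

definition rect :: "(real \<times> real) set" where "rect = {0..1} \<times> {0..n}"

lemma polar_norm: "0 \<le> r \<Longrightarrow> norm (polar (r, x)) = r" by (simp add: polar_def norm_mult)

lemma polar_onto: "polar ` rect = D"
proof
  show "polar ` rect \<subseteq> D" using polar_norm by (force simp: rect_def)
  show "D \<subseteq> polar ` rect"
  proof
    fix z assume z: "z \<in> D"
    show "z \<in> polar ` rect"
    proof (cases "z = 0")
      case True then show ?thesis using n_pos by (intro image_eqI[of _ _ "(0, 0)"]) (auto simp: rect_def polar_def)
    next
      case False
      then have "norm (z / of_real (norm z)) = 1" by (simp add: norm_divide)
      from P_surj[OF this] obtain x where x: "0 \<le> x" "x < n" "z / of_real (norm z) = P x" .
      then have "z = polar (norm z, x)" using False by (simp add: polar_def field_simps)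
      then show ?thesis using x z by (intro image_eqI[of _ _ "(norm z, x)"]) (auto simp: rect_def)
    qed
  qed
qed

lemma polar_continuous: "continuous_on A polar"
  unfolding polar_def[abs_def] by (intro continuous_intros)

text \<open>
  Removing from the boundary one point of every edge, compatibly with the gluing, leaves a
  neighbourhood of the vertices; \<open>thr k\<close> is the position of the point on the \<open>k\<close>-th edge.
\<close>

context
  fixes m :: real
  assumes m: "0 < m" "m < 1"
begin

definition thr :: "int \<Rightarrow> real" where "thr k = (if k mod 4 < 2 then m else 1 - m)"

definition star :: "int \<Rightarrow> real set" where "star k = {of_int (k - 1) + thr (k - 1) <..< of_int k + thr k}"

definition near :: "real \<Rightarrow> int" where "near x = (THE k. x \<in> star k)"

lemma thr_range: "0 < thr k" "thr k < 1" using m by (auto simp: thr_def)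

lemma thr_shift: "thr (k + 4 * int g * j) = thr k" by (simp add: thr_def mod4_shift)

lemma star_unique: "x \<in> star k \<Longrightarrow> x \<in> star l \<Longrightarrow> k = l"
proof (rule ccontr)
  assume x: "x \<in> star k" "x \<in> star l" and "k \<noteq> l"
  have *: False if "x \<in> star k" "x \<in> star l" "k < l" for k l
  proof -
    have "of_int k + thr k \<le> of_int (l - 1) + thr (l - 1)"
    proof (cases "k = l - 1")
      case False
      then have "of_int k + 1 \<le> (of_int (l - 1) :: real)" using that(3) by linarith
      then show ?thesis using thr_range[of k] thr_range[of "l - 1"] by linarith
    qed simp
    then show False using that(1,2) unfolding star_def by simp
  qed
  show False using *[of k l] *[of l k] x \<open>k \<noteq> l\<close> by linarith
qed

lemma near_eq: "x \<in> star k \<Longrightarrow> near x = k"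
  unfolding near_def using star_unique by blast

lemma star_shift: "x \<in> star k \<Longrightarrow> x + n * of_int j \<in> star (k + 4 * int g * j)"
proof -
  assume x: "x \<in> star k"
  have e: "k + 4 * int g * j - 1 = (k - 1) + 4 * int g * j" by simp
  show ?thesis using x unfolding star_def e thr_shift by simp
qed

lemma thr_notin: "of_int j + thr j \<notin> star k"
proof
  assume "of_int j + thr j \<in> star k"
  then have j: "of_int (k - 1) + thr (k - 1) < of_int j + thr j" "of_int j + thr j < of_int k + thr k" by (auto simp: star_def)
  consider "j = k" | "j = k - 1" | "j \<ge> k + 1" | "j \<le> k - 2" by linarith
  then show False
  proof cases
    case 3
    then have "(of_int k :: real) + 1 \<le> of_int j" by linarith
    then show False using j thr_range[of k] thr_range[of j] by linarith
  next
    case 4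
    then have "(of_int j :: real) + 1 \<le> of_int (k - 1)" by linarith
    then show False using j thr_range[of "k - 1"] thr_range[of j] by linarith
  qed (use j in auto)
qed

lemma int_in_star: "of_int k \<in> star k"
  using thr_range[of k] thr_range[of "k - 1"] by (simp add: star_def)

lemma in_star:
  assumes "0 \<le> u" "u \<le> 1" "u \<noteq> thr k"
  shows "of_int k + u \<in> star (if u < thr k then k else k + 1)"
  using assms thr_range[of "k - 1"] thr_range[of "k + 1"] by (auto simp: star_def)

definition moved :: "real \<Rightarrow> int \<Rightarrow> real \<Rightarrow> complex" where
  "moved x k t = P (x + t * (of_int k - x))"

text \<open>Sliding towards the corner respects the identifications. The one-sided form is
  transitive, and it also yields that y keeps off the cut points when x does.\<close>

definition related :: "real \<Rightarrow> real \<Rightarrow> bool" where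
  "related x y \<longleftrightarrow> (\<forall>k. x \<in> star k \<longrightarrow> (\<exists>l. y \<in> star l \<and> (\<forall>t\<in>{0..1}. q (moved x k t) = q (moved y l t))))"

lemma related_trans: "related x y \<Longrightarrow> related y z \<Longrightarrow> related x z"
  unfolding related_def by metis

lemma moved_shift: "moved (x + n * of_int j) (k + 4 * int g * j) t = moved x k t"
proof -
  have "x + n * of_int j + t * (of_int (k + 4 * int g * j) - (x + n * of_int j)) = x + t * (of_int k - x) + n * of_int j"
    by (simp add: algebra_simps)
  then show ?thesis unfolding moved_def by (simp only: P_period)
qed

lemma related_shift: "P x = P y \<Longrightarrow> related x y"
proof -
  assume "P x = P y"
  then obtain j where j: "y = x + n * of_int j" using P_eq[of y x] by auto
  show ?thesis unfolding related_def
  proof (intro allI impI)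
    fix k assume "x \<in> star k"
    then show "\<exists>l. y \<in> star l \<and> (\<forall>t\<in>{0..1}. q (moved x k t) = q (moved y l t))"
      using star_shift[of x k j] moved_shift[of x j k] unfolding j by auto
  qed
qed

text \<open>The gluing reverses an edge and exchanges the cut positions m and 1 - m, so that glued
  points lie on corresponding sides of the cuts and slide towards glued corners.\<close>

lemma moved_glue:
  assumes e: "e mod 4 < 2" and u: "0 \<le> u" "u \<le> 1" "u \<noteq> m"
  obtains k l where "of_int e + u \<in> star k" "of_int e + 3 - u \<in> star l" "\<And>t. t \<in> {0..1} \<Longrightarrow> q (moved (of_int e + u) k t) = q (moved (of_int e + 3 - u) l t)"
proof -
  have te: "thr e = m" "thr (e + 2) = 1 - m"
  proof -
    have "\<not> (e + 2) mod 4 < 2" using e by presburger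
    then show "thr e = m" "thr (e + 2) = 1 - m" using e by (simp_all add: thr_def)
  qed
  have e3: "of_int e + 3 - u = of_int (e + 2) + (1 - u)" by simp
  show thesis
  proof (cases "u < m")
    case True
    have 1: "of_int e + u \<in> star e" using in_star[of u e] u te True by simp
    have 2: "of_int e + 3 - u \<in> star (e + 3)" unfolding e3 using in_star[of "1 - u" "e + 2"] u te True by (simp add: add.commute)
    have "q (moved (of_int e + u) e t) = q (moved (of_int e + 3 - u) (e + 3) t)" if t: "t \<in> {0..1}" for t
    proof -
      have "u * (1 - t) \<le> 1 * 1" "0 \<le> u * (1 - t)" using u t mult_mono[of u 1 "1 - t" 1] by auto
      from glue[OF e this(2)] this(1) show ?thesis by (simp add: moved_def algebra_simps)
    qed
    then show thesis by (rule that[OF 1 2])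
  next
    case False
    have 1: "of_int e + u \<in> star (e + 1)" using in_star[of u e] u te False by simp
    have 2: "of_int e + 3 - u \<in> star (e + 2)" unfolding e3 using in_star[of "1 - u" "e + 2"] u te False by auto
    have "q (moved (of_int e + u) (e + 1) t) = q (moved (of_int e + 3 - u) (e + 2) t)" if t: "t \<in> {0..1}" for t
    proof -
      have "t * (1 - u) \<le> 1 * (1 - u)" "0 \<le> t * (1 - u)" using u t mult_right_mono[of t 1 "1 - u"] by auto
      then have "0 \<le> u + t * (1 - u)" "u + t * (1 - u) \<le> 1" using u by auto
      from glue[OF e this] show ?thesis by (simp add: moved_def algebra_simps)
    qed
    then show thesis by (rule that[OF 1 2])
  qed
qed

lemma related_glue:
  assumes e: "e mod 4 < 2" and u: "0 \<le> u" "u \<le> 1"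
  shows "related (of_int e + u) (of_int e + 3 - u)" "related (of_int e + 3 - u) (of_int e + u)"
proof -
  have t: "thr e = m" "thr (e + 2) = 1 - m"
  proof -
    have "\<not> (e + 2) mod 4 < 2" using e by presburger
    then show "thr e = m" "thr (e + 2) = 1 - m" using e by (simp_all add: thr_def)
  qed
  have e3: "of_int e + 3 - u = of_int (e + 2) + (1 - u)" by simp
  have "related (of_int e + u) (of_int e + 3 - u) \<and> related (of_int e + 3 - u) (of_int e + u)"
  proof (cases "u = m")
    case True
    have "of_int e + u \<notin> star k" "of_int e + 3 - u \<notin> star k" for k
      unfolding e3 using thr_notin[of e k] thr_notin[of "e + 2" k] t True by simp_all
    then show ?thesis by (simp add: related_def)
  next
    case False
    from moved_glue[OF e u False] obtain k l where kl: "of_int e + u \<in> star k" "of_int e + 3 - u \<in> star l"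
      "\<And>t. t \<in> {0..1} \<Longrightarrow> q (moved (of_int e + u) k t) = q (moved (of_int e + 3 - u) l t)" by metis
    show ?thesis unfolding related_def
    proof (intro conjI allI impI)
      fix k' assume "of_int e + u \<in> star k'"
      then have "k' = k" by (rule star_unique[OF _ kl(1)])
      then show "\<exists>l. of_int e + 3 - u \<in> star l \<and> (\<forall>t\<in>{0..1}. q (moved (of_int e + u) k' t) = q (moved (of_int e + 3 - u) l t))" using kl by blast
    next
      fix k' assume "of_int e + 3 - u \<in> star k'"
      then have "k' = l" by (rule star_unique[OF _ kl(2)])
      then show "\<exists>l. of_int e + u \<in> star l \<and> (\<forall>t\<in>{0..1}. q (moved (of_int e + 3 - u) k' t) = q (moved (of_int e + u) l t))"
        using kl(1) kl(3)[symmetric] by blast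
    qed
  qed
  then show "related (of_int e + u) (of_int e + 3 - u)" "related (of_int e + 3 - u) (of_int e + u)" by auto
qed

lemma related_boundary:
  assumes "q (P x) = q (P y)" shows "related x y"
  using P_in_D P_in_D assms
proof (cases rule: fiber_cases)
  case same then show ?thesis by (rule related_shift)
next
  case (vertex k l)
  have "related (of_int k) (of_int l)" unfolding related_def
  proof (intro allI impI)
    fix k' assume "of_int k \<in> star k'"
    then have k': "k' = k" by (rule star_unique[OF _ int_in_star])
    have "moved (of_int i) i t = P (of_int i)" for i t by (simp add: moved_def)
    then show "\<exists>l'. of_int l \<in> star l' \<and> (\<forall>t\<in>{0..1}. q (moved (of_int k) k' t) = q (moved (of_int l) l' t))"
      unfolding k' using int_in_star[of l] by (intro exI[of _ l]) (simp add: q_vertex)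
  qed
  then show ?thesis using related_shift[OF vertex(1)] related_shift[OF sym[OF vertex(2)]] related_trans by blast
next
  case (edge k u)
  have "related (of_int k + u) (of_int k + 3 - u)" by (rule related_glue(1)) (use edge in auto)
  then show ?thesis using related_shift[OF edge(4)] related_shift[OF sym[OF edge(5)]] related_trans by blast
next
  case (edge' k u)
  have "related (of_int k + 3 - u) (of_int k + u)" by (rule related_glue(2)) (use edge' in auto)
  then show ?thesis using related_shift[OF edge'(5)] related_shift[OF sym[OF edge'(4)]] related_trans by blast
qed

text \<open>The radius grows to 1 while the angle turns to the corner of its star. All tracks end in
  corners, that is in a single point of the surface.\<close>

definition flow :: "(real \<times> real) \<times> real \<Rightarrow> complex" where
  "flow z = of_real (fst (fst z) + snd z * (1 - fst (fst z))) * moved (snd (fst z)) (near (snd (fst z))) (snd z)"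

definition star_rect :: "(real \<times> real) set" where "star_rect = {rx \<in> rect. 0 < fst rx \<and> (\<exists>k. snd rx \<in> star k)}"

lemma flow_related:
  assumes r: "0 < r" "r \<le> 1" "0 \<le> r'" "r' \<le> 1" and k: "x \<in> star k" and e: "q (polar (r, x)) = q (polar (r', x'))"
  shows "0 < r' \<and> (\<exists>l. x' \<in> star l) \<and> (\<forall>t\<in>{0..1}. q (flow ((r, x), t)) = q (flow ((r', x'), t)))"
proof -
  have D: "polar (r, x) \<in> D" "polar (r', x') \<in> D" using r polar_norm by auto
  have "r = r' \<and> (r < 1 \<longrightarrow> P x = P x')"
  proof (cases "r < 1 \<or> r' < 1")
    case True
    have "polar (r, x) = polar (r', x')"
    proof (cases "r < 1")
      case True show ?thesis by (rule q_interior[OF D _ e]) (use True r polar_norm in auto)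
    next
      case False
      then have "norm (polar (r', x')) < 1" using True r polar_norm by auto
      from q_interior[OF D(2,1) this sym[OF e]] show ?thesis by simp
    qed
    moreover from this have "r = r'" using r polar_norm[of r x] polar_norm[of r' x'] by simp
    ultimately show ?thesis using r by (auto simp: polar_def)
  qed (use r in auto)
  then have rr: "r' = r" and P: "r < 1 \<Longrightarrow> P x = P x'" by auto
  have rel: "related x x'" 
  proof (cases "r < 1")
    case True show ?thesis by (rule related_shift[OF P[OF True]])
  next
    case False
    then have "r = 1" using r by simp
    then show ?thesis using e rr by (intro related_boundary) (simp add: polar_def)
  qed
  then obtain l where l: "x' \<in> star l" "\<And>t. t \<in> {0..1} \<Longrightarrow> q (moved x k t) = q (moved x' l t)"
    using k unfolding related_def by blast
  have "q (flow ((r, x), t)) = q (flow ((r', x'), t))" if t: "t \<in> {0..1}" for t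
  proof (cases "r < 1")
    case False
    then have "r = 1" using r by simp
    then show ?thesis using l(2)[OF t] by (simp add: flow_def rr near_eq[OF k] near_eq[OF l(1)])
  next
    case True
    obtain j where j: "x' = x + n * of_int j" using P[OF True] P_eq[of x' x] by auto
    have "l = k + 4 * int g * j" using star_unique[OF l(1)] star_shift[OF k, of j] unfolding j by blast
    then have "moved x' l t = moved x k t" unfolding j by (simp only: moved_shift)
    then show ?thesis by (simp add: flow_def rr near_eq[OF k] near_eq[OF l(1)])
  qed
  then show ?thesis using l(1) r rr by auto
qed

lemma star_rect_open: "openin (top_of_set rect) star_rect"
proof -
  have "open (({0<..} :: real set) \<times> (\<Union>k. star k))" by (intro open_Times open_UN ballI open_greaterThan) (auto simp: star_def)
  moreover have "star_rect = rect \<inter> ({0<..} \<times> (\<Union>k. star k))" by (auto simp: star_rect_def)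
  ultimately show ?thesis by (metis openin_open_Int)
qed

text \<open>The stars are open and disjoint, and on each of them the function is constant.\<close>

lemma near_continuous: "continuous_on (\<Union>k. star k) (\<lambda>x. of_int (near x) :: real)"
proof (rule continuous_on_open_UN)
  show "continuous_on (star k) (\<lambda>x. of_int (near x) :: real)" for k
    by (subst continuous_on_cong[OF refl, of _ _ "\<lambda>_. of_int k"]) (auto simp: near_eq)
qed (auto simp: star_def)

lemma flow_continuous: "continuous_on (star_rect \<times> {0..1}) flow"
proof -
  have "continuous_on (star_rect \<times> {0..1}) (\<lambda>z. of_int (near (snd (fst z))) :: real)"
    by (rule continuous_on_compose2[OF near_continuous]) (auto intro!: continuous_intros simp: star_rect_def)
  moreover define N where "N = (\<lambda>z :: (real \<times> real) \<times> real. of_int (near (snd (fst z))) :: real)"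
  ultimately have "continuous_on (star_rect \<times> {0..1}) N" by simp
  then have "continuous_on (star_rect \<times> {0..1}) (\<lambda>z. of_real (fst (fst z) + snd z * (1 - fst (fst z))) *
     P (snd (fst z) + snd z * (N z - snd (fst z))))" by (intro continuous_intros)
  then show ?thesis unfolding flow_def[abs_def] moved_def N_def .
qed

lemma flow_D:
  assumes "0 \<le> r" "r \<le> 1" "t \<in> {0..1}" shows "norm (flow ((r, x), t)) \<le> 1"
proof -
  have "0 \<le> r + t * (1 - r)" "r + t * (1 - r) \<le> 1" using assms mult_right_mono[of t 1 "1 - r"] by auto
  then show ?thesis by (simp add: flow_def moved_def norm_mult del: of_real_add of_real_mult)
qed

lemma flow_0: "flow ((r, x), 0) = polar (r, x)" and flow_1: "flow ((r, x), 1) = P (of_int (near x))"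
  by (simp_all add: flow_def moved_def polar_def)

end

end

section \<open>Every loop is a product of edge loops\<close>

context based_polygon
begin

definition Z where "Z = generate \<pi> (range (\<lambda>k. edge k (k + 1)))"

lemma Z_subgroup: "subgroup Z \<pi>" unfolding Z_def by (rule pi.generate_is_subgroup) auto

lemma Z_mult: "x \<in> Z \<Longrightarrow> y \<in> Z \<Longrightarrow> x \<otimes>\<^bsub>\<pi>\<^esub> y \<in> Z" by (rule subgroup.m_closed[OF Z_subgroup])
lemma Z_inv: "x \<in> Z \<Longrightarrow> inv\<^bsub>\<pi>\<^esub> x \<in> Z" by (rule subgroup.m_inv_closed[OF Z_subgroup])
lemma Z_one: "\<one>\<^bsub>\<pi>\<^esub> \<in> Z" by (rule subgroup.one_closed[OF Z_subgroup])

lemma edge_rev: "edge l k = inv\<^bsub>\<pi>\<^esub> edge k l"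
  using edge_mult[of l k l] by (simp add: edge_refl pi.inv_equality)

lemma edge_Z: "edge k l \<in> Z"
proof -
  have up: "edge k (k + int j) \<in> Z" for k j
  proof (induction j)
    case 0 show ?case by (simp add: edge_refl Z_one)
  next
    case (Suc j)
    have "edge (k + int j) (k + int j + 1) \<in> Z" unfolding Z_def by (rule generate.incl) blast
    from Z_mult[OF Suc this] show ?case unfolding edge_mult by (simp add: algebra_simps)
  qed
  show ?thesis
  proof (cases "k \<le> l")
    case True then show ?thesis using up[of k "nat (l - k)"] by simp
  next
    case False then show ?thesis using Z_inv[OF up[of l "nat (k - l)"]] edge_rev[of k l] by simp
  qed
qed

text \<open>For the lift chosen in \<open>tau\<close> the class is trivial. Any other lift of the
  same point is glued to the chosen one, and the loop out along one segment and back along the other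
  crosses a single edge. If the point is the vertex, the segment is itself a diagonal.\<close>

lemma line_Z:
  assumes z: "z \<in> D" shows "Cl v (q z) (q \<circ> linepath 1 z) \<in> Z"
proof (cases "q z = v")
  case True
  have 1: "(1::complex) \<in> D" by simp
  have "\<exists>k::int. z = P (of_int k)"
  using z 1 True
  proof (cases rule: fiber_cases)
    case same then show ?thesis using P_0 by (metis of_int_0)
  next
    case (vertex k l) then show ?thesis by blast
  next
    case (edge k u)
    have "of_int k + 3 - u = of_int (k + 2) + (1 - u)" by simp
    from edge(5)[unfolded this] have "P (of_int (k + 2) + (1 - u)) = 1" by (rule sym)
    from P_eq_1[OF this] show ?thesis using not_int[of "1 - u" "k + 2"] edge by simp
  next
    case (edge' k u)
    from P_eq_1[OF sym[OF edge'(4)]] show ?thesis using not_int[of u k] edge' by simp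
  qed
  then obtain k :: int where k: "z = P (of_int k)" by blast
  have "Cl v (q z) (q \<circ> linepath 1 z) = edge 0 k" unfolding True by (simp add: edge_def k)
  then show ?thesis using edge_Z by simp
next
  case False
  from tau_lift[OF q_in_S[OF z] False] obtain w where w: "w \<in> D" "q w = q z" "tau (q z) = spoke +++ (q \<circ> linepath 1 w)" .
  have line: "pth S (q \<circ> linepath 1 y) v (q y)" if "y \<in> D" for y using pth_q[OF pth_line[of 1 y]] that by simp
  note lz = line[OF z] and lw = line[OF w(1), unfolded w(2)]
  have t: "pth S (tau (q z)) p (q z)" by (rule tau_pth[OF q_in_S[OF z]])
  have "homotopic_paths S (spoke +++ ((q \<circ> linepath 1 w) +++ reversepath (tau (q z)))) ((spoke +++ (q \<circ> linepath 1 w)) +++ reversepath (tau (q z)))"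
    by (rule hp_assoc[OF spoke_pth lw pth_reverse[OF t]])
  also have "homotopic_paths S \<dots> (\<lambda>_. p)" unfolding w(3)[symmetric] by (rule hp_inverse_right[OF t])
  finally have Clw: "Cl v (q z) (q \<circ> linepath 1 w) = \<one>\<^bsub>\<pi>\<^esub>"
    unfolding Cl_def tau_v pi1_one by (rule path_class_cong)
  have "Cl v (q z) (q \<circ> linepath 1 z) = Cl v (q z) (q \<circ> linepath 1 z) \<otimes>\<^bsub>\<pi>\<^esub> inv\<^bsub>\<pi>\<^esub> Cl v (q z) (q \<circ> linepath 1 w)"
    unfolding Clw using Cl_closed[OF lz] by simp
  also have "\<dots> = Lc ((q \<circ> linepath 1 z) +++ reversepath (q \<circ> linepath 1 w))"
    unfolding Cl_reverse[OF lw, symmetric] by (rule Cl_mult[OF lz pth_reverse[OF lw]])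
  finally have eq: "Cl v (q z) (q \<circ> linepath 1 z) = Lc ((q \<circ> linepath 1 z) +++ (q \<circ> linepath w 1))"
    unfolding path_compose_reversepath[symmetric] reversepath_linepath .
  have one: "1 = P (of_int 0)" by simp
  show ?thesis
  using z w(1) w(2)[symmetric]
  proof (cases rule: fiber_cases)
    case same
    then show ?thesis using Clw Z_one by simp
  next
    case (vertex k l)
    then show ?thesis using False q_vertex by simp
  next
    case (edge k u)
    have u: "0 \<le> u" "u \<le> 1" using edge by auto
    have lz': "pth S (q \<circ> linepath z 1) (q z) v" using pth_q[OF pth_line[of z 1]] z by simp
    have l: "pth D (linepath (P (of_int 0)) w) (P (of_int 0)) (P (of_int k + 3 - u))" "pth D (linepath z (P (of_int 0))) (P (of_int k + u)) (P (of_int 0))"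
      unfolding edge(4,5)[symmetric] using z w(1) by (auto intro!: pth_line)
    have "inv\<^bsub>\<pi>\<^esub> (edge 0 (k + 3) \<otimes>\<^bsub>\<pi>\<^esub> edge k 0) \<in> Z" by (intro Z_mult Z_inv edge_Z)
    also have "edge 0 (k + 3) \<otimes>\<^bsub>\<pi>\<^esub> edge k 0 = Lc ((q \<circ> linepath 1 w) +++ (q \<circ> linepath z 1))"
      using crossing(2)[OF edge(1) u l] unfolding one[symmetric] by simp
    also have "\<dots> = Cl v (q z) (q \<circ> linepath 1 w) \<otimes>\<^bsub>\<pi>\<^esub> Cl (q z) v (q \<circ> linepath z 1)" by (rule Cl_mult[OF lw lz', symmetric])
    also have "Cl (q z) v (q \<circ> linepath z 1) = inv\<^bsub>\<pi>\<^esub> Cl v (q z) (q \<circ> linepath 1 z)"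
      using Cl_reverse[OF lz] unfolding path_compose_reversepath[symmetric] reversepath_linepath .
    finally show ?thesis using Cl_closed[OF lz] unfolding Clw by simp
  next
    case (edge' k u)
    have "Lc ((q \<circ> linepath 1 z) +++ (q \<circ> linepath w 1)) = edge 0 (k + 3) \<otimes>\<^bsub>\<pi>\<^esub> edge k 0"
    proof -
      have u: "0 \<le> u" "u \<le> 1" using edge' by auto
      have l: "pth D (linepath (P (of_int 0)) z) (P (of_int 0)) (P (of_int k + 3 - u))" "pth D (linepath w (P (of_int 0))) (P (of_int k + u)) (P (of_int 0))"
        unfolding edge'(4,5)[symmetric] using z w(1) by (auto intro!: pth_line)
      show ?thesis using crossing(2)[OF edge'(1) u l] unfolding one[symmetric] by simp
    qed
    then show ?thesis unfolding eq using Z_mult[OF edge_Z edge_Z] by simp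
  qed
qed

lemma D_path_Z:
  assumes "pth D \<eta> z w" shows "Cl (q z) (q w) (q \<circ> \<eta>) \<in> Z"
proof -
  have zw: "z \<in> D" "w \<in> D" using pth_ends[OF assms] by auto
  have l: "pth D (linepath z 1) z 1" "pth D (linepath 1 w) 1 w" by (intro pth_line zw; simp)+
  have l1: "pth S (q \<circ> linepath 1 z) v (q z)" by (rule pth_q[OF pth_line]) (use zw in auto)
  have "Cl (q z) (q w) (q \<circ> \<eta>) = Cl (q z) (q w) (q \<circ> (linepath z 1 +++ linepath 1 w))"
    by (rule Cl_cong[OF pth_q[OF assms] hp_D[OF assms pth_join[OF l]]])
  also have "\<dots> = Cl (q z) v (q \<circ> linepath z 1) \<otimes>\<^bsub>\<pi>\<^esub> Cl v (q w) (q \<circ> linepath 1 w)"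
    unfolding Cl_mult[OF pth_q[OF l(1)] pth_q[OF l(2)]] by (simp add: path_compose_join)
  also have "Cl (q z) v (q \<circ> linepath z 1) = inv\<^bsub>\<pi>\<^esub> Cl v (q z) (q \<circ> linepath 1 z)"
    using Cl_reverse[OF l1] unfolding path_compose_reversepath[symmetric] reversepath_linepath .
  finally have e: "Cl (q z) (q w) (q \<circ> \<eta>) = inv\<^bsub>\<pi>\<^esub> Cl v (q z) (q \<circ> linepath 1 z) \<otimes>\<^bsub>\<pi>\<^esub> Cl v (q w) (q \<circ> linepath 1 w)" .
  show ?thesis unfolding e by (intro Z_mult Z_inv line_Z zw)
qed

text \<open>
  A contraction upstairs that is compatible with the identifications descends, and deforms a path
  into the tracks of its end points.
\<close>

lemma contraction_Z:
  fixes R :: "'b::t2_space set" and K :: "'b \<times> real \<Rightarrow> complex"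
  assumes R: "compact R" "continuous_on R Q" "Q ` R = S" and V: "openin (top_of_set R) V"
    and sat: "\<And>r r'. r \<in> V \<Longrightarrow> r' \<in> R \<Longrightarrow> Q r = Q r' \<Longrightarrow> r' \<in> V"
    and K: "continuous_on (V \<times> {0..1}) K" "K ` (V \<times> {0..1}) \<subseteq> D"
    and compat: "\<And>r r' t. r \<in> V \<Longrightarrow> r' \<in> V \<Longrightarrow> t \<in> {0..1} \<Longrightarrow> Q r = Q r' \<Longrightarrow> q (K (r, t)) = q (K (r', t))"
    and K0: "\<And>r. r \<in> V \<Longrightarrow> q (K (r, 0)) = Q r" and K1: "\<And>r. r \<in> V \<Longrightarrow> q (K (r, 1)) = y0"
  shows "openin (top_of_set S) (Q ` V)" "pth (Q ` V) \<gamma> x y \<Longrightarrow> Cl x y \<gamma> \<in> Z"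
proof -
  let ?I = "{0..1::real}" and ?U = "Q ` V"
  have VR: "V \<subseteq> R" using openin_imp_subset[OF V] .
  have pre: "{r \<in> R. Q r \<in> ?U} = V" using sat VR by fastforce
  have "continuous_map (top_of_set R) (top_of_set S) Q" using R by (simp add: image_subset_iff_funcset[symmetric])
  then have qm: "quotient_map (top_of_set R) (top_of_set S) Q"
    by (intro continuous_closed_imp_quotient_map continuous_imp_closed_map) (use R Hausdorff in \<open>auto simp: compact_space_subtopology\<close>)
  show U: "openin (top_of_set S) ?U"
  proof -
    have "?U \<subseteq> S" using R VR by auto
    then have "openin (top_of_set R) {r \<in> R. Q r \<in> ?U} = openin (top_of_set S) ?U" using qm by (simp add: quotient_map_def)
    then show ?thesis using V unfolding pre by simp
  qed
  let ?X = "prod_topology (top_of_set R) (top_of_set ?I)" and ?Y = "prod_topology (top_of_set S) (top_of_set ?I)"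
  let ?f = "\<lambda>z. (Q (fst z), snd z :: real)"
  have cf: "continuous_map ?X ?Y ?f"
    unfolding continuous_map_pairwise o_def fst_conv snd_conv
    using R(3) by (auto intro!: continuous_intros continuous_on_compose2[OF R(2)])
  \<comment> \<open>By compactness the product with the interval is again a closed quotient map.
    This is what makes the descended contraction \<open>H\<close> jointly continuous in point and
    time.\<close>
  have qp: "quotient_map ?X ?Y ?f"
  proof (intro continuous_closed_imp_quotient_map continuous_imp_closed_map cf)
    have "compact_space (top_of_set R)" "compact_space (top_of_set ?I)" using R by (auto intro!: compact_space_subtopology)
    then show "compact_space ?X" unfolding compact_space_prod_topology by blast
    have "Hausdorff_space (top_of_set ?I)" by (auto intro!: Hausdorff_space_subtopology)
    then show "Hausdorff_space ?Y" unfolding Hausdorff_space_prod_topology using Hausdorff by blast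
    show "?f ` topspace ?X = topspace ?Y" using R(3) by force
  qed
  have qr: "quotient_map (subtopology ?X (V \<times> ?I)) (subtopology ?Y (?U \<times> ?I)) ?f"
  proof (rule quotient_map_restriction[OF qp])
    show "{z \<in> topspace ?X. ?f z \<in> ?U \<times> ?I} = V \<times> ?I" using pre VR by auto
    show "openin ?Y (?U \<times> ?I) \<or> closedin ?Y (?U \<times> ?I)" unfolding openin_prod_Times_iff using U by auto
  qed
  have sX: "subtopology ?X (V \<times> ?I) = top_of_set (V \<times> ?I)"
  proof -
    have "R \<times> ?I \<inter> V \<times> ?I = V \<times> ?I" using VR by auto
    then show ?thesis by (simp add: subtopology_subtopology)
  qed
  define H where "H = (\<lambda>z. q (K (SOME r. r \<in> V \<and> Q r = fst z, snd z :: real)))"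
  have H: "H (Q r, t) = q (K (r, t))" if "r \<in> V" "t \<in> ?I" for r t
  proof -
    define r' where "r' = (SOME r'. r' \<in> V \<and> Q r' = Q r)"
    have "r' \<in> V \<and> Q r' = Q r" unfolding r'_def by (rule someI[of _ r]) (use that in simp)
    then show ?thesis using compat[of r' r t] that by (simp add: H_def r'_def)
  qed
  have "continuous_map (top_of_set (V \<times> ?I)) (top_of_set S) (q \<circ> K)"
  proof -
    have "continuous_on (V \<times> ?I) (q \<circ> K)" by (rule continuous_on_compose[OF K(1) continuous_on_subset[OF q_continuous K(2)]])
    then show ?thesis using K(2) q_in_S by (auto simp: image_subset_iff)
  qed
  then have "continuous_map (subtopology ?X (V \<times> ?I)) (top_of_set S) (H \<circ> ?f)"
    unfolding sX by (rule continuous_map_eq) (auto simp: H)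
  then have cH: "continuous_map (subtopology ?Y (?U \<times> ?I)) (top_of_set S) H"
    using continuous_compose_quotient_map_eq[OF qr] by blast
  assume g: "pth ?U \<gamma> x y"
  have U_sub: "?U \<subseteq> S" using R VR by auto
  have gc: "continuous_on ?I \<gamma>" "\<gamma> ` ?I \<subseteq> ?U" and ge: "\<gamma> 0 = x" "\<gamma> 1 = y"
    using g by (auto simp: pth_def path_def path_image_def pathstart_def pathfinish_def)
  have gS: "pth S \<gamma> x y" using g U_sub unfolding pth_def by blast
  define F where "F = (\<lambda>z. H (\<gamma> (fst z), snd z))"
  have "continuous_map (top_of_set (?I \<times> ?I)) (subtopology ?Y (?U \<times> ?I)) (\<lambda>z. (\<gamma> (fst z), snd z))"
  proof (rule continuous_map_into_subtopology)
    have "continuous_on (?I \<times> ?I) (\<lambda>z. \<gamma> (fst z))" by (rule continuous_on_compose2[OF gc(1)]) (auto intro!: continuous_intros)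
    then show "continuous_map (top_of_set (?I \<times> ?I)) ?Y (\<lambda>z. (\<gamma> (fst z), snd z))"
      unfolding continuous_map_pairwise o_def fst_conv snd_conv using gc(2) U_sub
      by (fastforce intro!: continuous_intros)
  qed (use gc(2) in auto)
  from continuous_map_compose[OF this cH] have cF: "continuous_map (top_of_set (?I \<times> ?I)) (top_of_set S) F"
    by (simp add: F_def o_def)
  then have F: "continuous_on (?I \<times> ?I) F" "F ` (?I \<times> ?I) \<subseteq> S" by (auto simp: image_subset_iff)
  note sq = square_homotopy[OF F]
  obtain r where r: "r \<in> V" "Q r = x" using gc(2) ge by force
  obtain r' where r': "r' \<in> V" "Q r' = y" using gc(2) ge by force
  have track: "pth D (\<lambda>t. K (r, t)) (K (r, 0)) (K (r, 1))" if "r \<in> V" for r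
  proof -
    have "continuous_on ?I (\<lambda>t. K (r, t))" by (rule continuous_on_compose2[OF K(1)]) (use that in \<open>auto intro!: continuous_intros\<close>)
    then show ?thesis using K(2) that by (fastforce simp: pth_def path_def path_image_def pathstart_def pathfinish_def)
  qed
  have f0: "F (s, 0) = \<gamma> s" and f1: "F (s, 1) = y0" if s: "s \<in> ?I" for s
  proof -
    obtain rs where rs: "rs \<in> V" "\<gamma> s = Q rs" using gc(2) s by blast
    show "F (s, 0) = \<gamma> s" "F (s, 1) = y0" using rs H[OF rs(1)] K0 K1 by (simp_all add: F_def)
  qed
  have y0: "y0 \<in> S" using f1[of 0] F(2) by force
  have p1: "pth S (q \<circ> (\<lambda>t. K (r, t))) x y0" using pth_q[OF track[OF r(1)]] K0 K1 r by simp
  have p3: "pth S (q \<circ> (\<lambda>t. K (r', t))) y y0" using pth_q[OF track[OF r'(1)]] K0 K1 r' by simp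
  have e1: "homotopic_paths S (F \<circ> linepath (0,0) (0,1)) (q \<circ> (\<lambda>t. K (r, t)))"
    by (rule homotopic_paths_sym[OF hp_eq[OF p1]]) (use H[OF r(1)] r(2) ge in \<open>simp add: F_def linepath_def\<close>)
  have e2: "homotopic_paths S (F \<circ> linepath (0,1) (1,1)) (\<lambda>_. y0)"
    by (rule homotopic_paths_sym[OF hp_eq[OF pth_const[OF y0]]]) (use f1 in \<open>simp add: linepath_def\<close>)
  have e3: "homotopic_paths S (F \<circ> linepath (1,1) (1,0)) (reversepath (q \<circ> (\<lambda>t. K (r', t))))"
    by (rule homotopic_paths_sym[OF hp_eq[OF pth_reverse[OF p3]]]) (use H[OF r'(1)] r'(2) ge in \<open>simp add: F_def linepath_def reversepath_def\<close>)
  have P1: "pth S (F \<circ> linepath (0,0) (0,1)) x y0" by (rule pth_homotopic[OF p1 homotopic_paths_sym[OF e1]])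
  have P2: "pth S (F \<circ> linepath (0,1) (1,1)) y0 y0" by (rule pth_homotopic[OF pth_const[OF y0] homotopic_paths_sym[OF e2]])
  have P3: "pth S (F \<circ> linepath (1,1) (1,0)) y0 y" by (rule pth_homotopic[OF pth_reverse[OF p3] homotopic_paths_sym[OF e3]])
  have "homotopic_paths S \<gamma> (F \<circ> linepath (0,0) (1,0))"
    by (rule hp_eq[OF gS]) (simp add: linepath_def f0)
  from Cl_cong[OF gS homotopic_paths_trans[OF this sq]]
  have "Cl x y \<gamma> = Cl x y ((F \<circ> linepath (0,0) (0,1)) +++ ((F \<circ> linepath (0,1) (1,1)) +++ (F \<circ> linepath (1,1) (1,0))))" .
  also have "\<dots> = Cl x y0 (F \<circ> linepath (0,0) (0,1)) \<otimes>\<^bsub>\<pi>\<^esub> (Cl y0 y0 (F \<circ> linepath (0,1) (1,1)) \<otimes>\<^bsub>\<pi>\<^esub> Cl y0 y (F \<circ> linepath (1,1) (1,0)))"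
    unfolding Cl_mult[OF P2 P3] by (rule Cl_mult[OF P1 pth_join[OF P2 P3], symmetric])
  also have "Cl x y0 (F \<circ> linepath (0,0) (0,1)) = Cl x y0 (q \<circ> (\<lambda>t. K (r, t)))" by (rule Cl_cong[OF P1 e1])
  also have "Cl y0 y0 (F \<circ> linepath (0,1) (1,1)) = \<one>\<^bsub>\<pi>\<^esub>" unfolding Cl_cong[OF P2 e2] by (rule Cl_const[OF y0])
  also have "Cl y0 y (F \<circ> linepath (1,1) (1,0)) = inv\<^bsub>\<pi>\<^esub> Cl y y0 (q \<circ> (\<lambda>t. K (r', t)))"
    unfolding Cl_cong[OF P3 e3] by (rule Cl_reverse[OF p3])
  finally have e: "Cl x y \<gamma> = Cl x y0 (q \<circ> (\<lambda>t. K (r, t))) \<otimes>\<^bsub>\<pi>\<^esub> (\<one>\<^bsub>\<pi>\<^esub> \<otimes>\<^bsub>\<pi>\<^esub> inv\<^bsub>\<pi>\<^esub> Cl y y0 (q \<circ> (\<lambda>t. K (r', t))))" .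
  have "Cl x y0 (q \<circ> (\<lambda>t. K (r, t))) \<in> Z" "Cl y y0 (q \<circ> (\<lambda>t. K (r', t))) \<in> Z"
    using D_path_Z[OF track[OF r(1)]] D_path_Z[OF track[OF r'(1)]] unfolding K0[OF r(1)] K1[OF r(1)] K0[OF r'(1)] K1[OF r'(1)] r(2) r'(2) .
  then show "Cl x y \<gamma> \<in> Z" unfolding e by (intro Z_mult Z_inv Z_one)
qed

text \<open>Membership in the subgroup passes to homotopic paths, joins and reverses, so small paths
  suffice; the open cell and the stars of the vertex cover the surface. The end points are
  quantified inside the property, since the induction principle sees only the path.\<close>

lemma path_Z: "pth S \<gamma> x y \<Longrightarrow> Cl x y \<gamma> \<in> Z"
proof -
  assume g: "pth S \<gamma> x y"
  have "\<forall>x y. pth S \<gamma> x y \<longrightarrow> Cl x y \<gamma> \<in> Z"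
  proof (rule path_local_induct[OF _ _ _ _ g, where good = "\<lambda>\<gamma>. \<forall>x y. pth S \<gamma> x y \<longrightarrow> Cl x y \<gamma> \<in> Z"])
    fix \<gamma> \<delta> x y assume "pth S \<gamma> x y" and G: "\<forall>x y. pth S \<gamma> x y \<longrightarrow> Cl x y \<gamma> \<in> Z" and h: "homotopic_paths S \<gamma> \<delta>"
    show "\<forall>x y. pth S \<delta> x y \<longrightarrow> Cl x y \<delta> \<in> Z"
    proof (intro allI impI)
      fix x y assume "pth S \<delta> x y"
      from pth_homotopic[OF this homotopic_paths_sym[OF h]] show "Cl x y \<delta> \<in> Z" using G Cl_cong[OF _ h] by metis
    qed
  next
    fix \<gamma> \<delta> x y z assume 1: "pth S \<gamma> x y" "pth S \<delta> y z" and G: "\<forall>x y. pth S \<gamma> x y \<longrightarrow> Cl x y \<gamma> \<in> Z" "\<forall>x y. pth S \<delta> x y \<longrightarrow> Cl x y \<delta> \<in> Z"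
    have "Cl x z (\<gamma> +++ \<delta>) \<in> Z" unfolding Cl_mult[OF 1, symmetric] using G 1 by (intro Z_mult) auto
    moreover have "x' = x \<and> z' = z" if "pth S (\<gamma> +++ \<delta>) x' z'" for x' z' using that 1 by (auto simp: pth_def)
    ultimately show "\<forall>x y. pth S (\<gamma> +++ \<delta>) x y \<longrightarrow> Cl x y (\<gamma> +++ \<delta>) \<in> Z" by blast
  next
    fix \<gamma> x y assume 1: "pth S \<gamma> x y" and G: "\<forall>x y. pth S \<gamma> x y \<longrightarrow> Cl x y \<gamma> \<in> Z"
    have "Cl y x (reversepath \<gamma>) \<in> Z" unfolding Cl_reverse[OF 1] using G 1 by (intro Z_inv) auto
    moreover have "x' = y \<and> z' = x" if "pth S (reversepath \<gamma>) x' z'" for x' z' using that 1 by (auto simp: pth_def)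
    ultimately show "\<forall>x y. pth S (reversepath \<gamma>) x y \<longrightarrow> Cl x y (reversepath \<gamma>) \<in> Z" by blast
  next
    fix x assume "x \<in> S"
    then obtain z where z: "z \<in> D" "x = q z" using q_image by blast
    have fin: "\<exists>U. openin (top_of_set S) U \<and> x \<in> U \<and> (\<forall>\<gamma> y z. pth U \<gamma> y z \<longrightarrow> (\<forall>x y. pth S \<gamma> x y \<longrightarrow> Cl x y \<gamma> \<in> Z))"
      if "openin (top_of_set S) U" "x \<in> U" "\<And>\<gamma> y z. pth U \<gamma> y z \<Longrightarrow> Cl y z \<gamma> \<in> Z" for U
    proof (intro exI[of _ U] conjI allI impI that(1,2))
      fix \<gamma> y z x' y' assume "pth U \<gamma> y z" "pth S \<gamma> x' y'"
      then show "Cl x' y' \<gamma> \<in> Z" using that(3)[of \<gamma> y z] by (auto simp: pth_def)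
    qed
    show "\<exists>U. openin (top_of_set S) U \<and> x \<in> U \<and> (\<forall>\<gamma> y z. pth U \<gamma> y z \<longrightarrow> (\<forall>x y. pth S \<gamma> x y \<longrightarrow> Cl x y \<gamma> \<in> Z))"
    proof (cases "norm z < 1")
      case True
      \<comment> \<open>On the open cell \<open>q\<close> is injective, and the linear contraction
        to the centre is compatible with the identifications for this trivial reason.\<close>
      define K where "K = (\<lambda>z :: complex \<times> real. of_real (1 - snd z) * fst z)"
      have K: "norm (K (w, t)) \<le> 1" if "norm w < 1" "t \<in> {0..1}" for w t
      proof -
        have "norm (K (w, t)) = (1 - t) * norm w" using that unfolding K_def fst_conv snd_conv norm_mult norm_of_real by simp
        also have "\<dots> \<le> 1 * 1" using that by (intro mult_mono) auto
        finally show ?thesis by simp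
      qed
      have op: "openin (top_of_set D) (ball 0 1)" by (rule open_subset) auto
      have inj: "w = w'" if "w \<in> ball 0 1" "w' \<in> D" "q w = q w'" for w w'
        by (rule q_interior) (use that in auto)
      have K1: "continuous_on (ball 0 1 \<times> {0..1}) K" unfolding K_def by (intro continuous_intros)
      have K2: "K ` (ball 0 1 \<times> {0..1}) \<subseteq> D"
      proof
        fix y assume "y \<in> K ` (ball 0 1 \<times> {0..1})"
        then obtain w t where "norm w < 1" "t \<in> {0..1}" "y = K (w, t)" by auto
        then show "y \<in> D" using K[of w t] unfolding mem_cball_0 by metis
      qed
      have K3: "w' \<in> ball 0 1" if "w \<in> ball 0 1" "w' \<in> D" "q w = q w'" for w w' using inj[OF that] that(1) by simp
      have K4: "q (K (w, t)) = q (K (w', t))" if "w \<in> ball 0 1" "w' \<in> ball 0 1" "t \<in> {0..1}" "q w = q w'" for w w' t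
      proof -
        have "w' \<in> D" using that(2) by simp
        from inj[OF that(1) this that(4)] show ?thesis by simp
      qed
      have K5: "q (K (w, 0)) = q w" "q (K (w, 1)) = q 0" for w by (simp_all add: K_def)
      note C = contraction_Z[OF compact_cball q_continuous q_image op _ K1 K2 _ K5]
      show ?thesis
      proof (rule fin)
        show "openin (top_of_set S) (q ` ball 0 1)" by (rule C(1)) (erule K3, assumption+, erule K4, assumption+)
        show "Cl y z \<gamma> \<in> Z" if "pth (q ` ball 0 1) \<gamma> y z" for \<gamma> y z
          by (rule C(2)[OF _ _ that]) (erule K3, assumption+, erule K4, assumption+)
      qed (use z True in auto)
    next
      case False
      then have "norm z = 1" using z by auto
      from P_surj[OF this] obtain y where y: "0 \<le> y" "y < n" "z = P y" .
      define k where "k = \<lfloor>y\<rfloor>"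
      define u where "u = y - of_int k"
      \<comment> \<open>The cut points must miss the position u, whether the edge is cut at m or at
        1 - m; 1/2 does this unless u = 1/2, and then 1/3 does.\<close>
      define m :: real where "m = (if u = 1/2 then 1/3 else 1/2)"
      have u: "0 \<le> u" "u \<le> 1" "y = of_int k + u" unfolding u_def k_def by linarith+
      have m: "0 < m" "m < 1" by (auto simp: m_def)
      have um: "u \<noteq> thr m k" unfolding thr_def[OF m] by (auto simp: m_def split: if_splits)
      have sub: "(1, y) \<in> star_rect m" using in_star[OF m u(1,2) um] y(1-2) u(3) by (auto simp: star_rect_def[OF m] rect_def)
      have rr: "0 < r \<and> r \<le> 1 \<and> 0 \<le> r \<and> (\<exists>k. x \<in> star m k) \<and> (r, x) \<in> rect" if "(r, x) \<in> star_rect m" for r x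
        using that by (auto simp: star_rect_def[OF m] rect_def)
      have Q: "compact rect" "continuous_on rect (q \<circ> polar)" "(q \<circ> polar) ` rect = S"
      proof -
        show "compact rect" unfolding rect_def by (intro compact_Times compact_Icc)
        show "continuous_on rect (q \<circ> polar)"
          by (rule continuous_on_compose[OF polar_continuous]) (simp add: polar_onto q_continuous)
        show "(q \<circ> polar) ` rect = S" unfolding image_comp[symmetric] polar_onto by (rule q_image)
      qed
      have sat: "b \<in> star_rect m" if "a \<in> star_rect m" "b \<in> rect" "(q \<circ> polar) a = (q \<circ> polar) b" for a b
      proof (cases a, cases b)
        fix r x r' x' assume ab: "a = (r, x)" "b = (r', x')"
        from rr[of r x] that(1) ab obtain k where k: "0 < r" "r \<le> 1" "x \<in> star m k" by auto
        have r': "0 \<le> r'" "r' \<le> 1" using that(2) ab by (auto simp: rect_def)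
        show ?thesis using flow_related[OF m k(1,2) r' k(3), of x'] that(2,3) ab by (auto simp: star_rect_def[OF m])
      qed
      have compat: "q (flow m (a, t)) = q (flow m (b, t))"
        if "a \<in> star_rect m" "b \<in> star_rect m" "t \<in> {0..1}" "(q \<circ> polar) a = (q \<circ> polar) b" for a b t
      proof (cases a, cases b)
        fix r x r' x' assume ab: "a = (r, x)" "b = (r', x')"
        from rr[of r x] that(1) ab obtain k where k: "0 < r" "r \<le> 1" "x \<in> star m k" by auto
        have r': "0 \<le> r'" "r' \<le> 1" using rr[of r' x'] that(2) ab by auto
        show ?thesis using flow_related[OF m k(1,2) r' k(3), of x'] that(3,4) ab by auto
      qed
      have FD: "flow m ` (star_rect m \<times> {0..1}) \<subseteq> D"
        using flow_D[OF m] rr by auto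
      have K0: "q (flow m (a, 0)) = (q \<circ> polar) a" for a by (cases a) (simp add: flow_0[OF m])
      have K1: "q (flow m (a, 1)) = v" for a by (cases a) (simp add: flow_1[OF m] q_vertex)
      note C = contraction_Z[OF Q star_rect_open[OF m] _ flow_continuous[OF m] FD _ K0 K1]
      show ?thesis
      proof (rule fin)
        show "openin (top_of_set S) ((q \<circ> polar) ` star_rect m)" by (rule C(1)) (erule sat, assumption+, erule compat, assumption+)
        have "x = (q \<circ> polar) (1, y)" using z y by (simp add: polar_def)
        then show "x \<in> (q \<circ> polar) ` star_rect m" using sub by blast
        show "Cl y z \<gamma> \<in> Z" if "pth ((q \<circ> polar) ` star_rect m) \<gamma> y z" for \<gamma> y z
          by (rule C(2)[OF _ _ that]) (erule sat, assumption+, erule compat, assumption+)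
      qed
    qed
  qed
  then show ?thesis using g by blast
qed

text \<open>On loops at the marked point \<open>Cl\<close> is conjugation by the class of
  \<open>tau p\<close>, which may be nontrivial; therefore X is obtained from the loop of its
  conjugate.\<close>

lemma generated: "carrier \<pi> = Z"
proof
  show "Z \<subseteq> carrier \<pi>" by (rule subgroup.subset[OF Z_subgroup])
  show "carrier \<pi> \<subseteq> Z"
  proof
    fix X assume X: "X \<in> carrier \<pi>"
    then obtain \<gamma> where g: "pth S \<gamma> p p" "X = path_class S \<gamma>" by (rule pi1_cases)
    have t: "pth S (tau p) p p" by (rule tau_pth[OF p_in_S])
    define c where "c = path_class S (tau p)"
    have c: "c \<in> carrier \<pi>" unfolding c_def by (rule pi1_closed[OF t])
    have Cl: "Cl p p \<alpha> = c \<otimes>\<^bsub>\<pi>\<^esub> path_class S \<alpha> \<otimes>\<^bsub>\<pi>\<^esub> inv\<^bsub>\<pi>\<^esub> c" if "pth S \<alpha> p p" for \<alpha>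
    proof -
      note r = pth_reverse[OF t]
      have "Cl p p \<alpha> = c \<otimes>\<^bsub>\<pi>\<^esub> (path_class S \<alpha> \<otimes>\<^bsub>\<pi>\<^esub> inv\<^bsub>\<pi>\<^esub> c)"
        unfolding c_def pi1_inv[OF t] pi1_mult[OF that r] pi1_mult[OF t pth_join[OF that r]] Cl_def ..
      then show ?thesis using c pi1_closed[OF that] by (simp add: pi.m_assoc)
    qed
    have "inv\<^bsub>\<pi>\<^esub> c \<otimes>\<^bsub>\<pi>\<^esub> X \<otimes>\<^bsub>\<pi>\<^esub> c \<in> carrier \<pi>" using c X by simp
    then obtain \<alpha> where a: "pth S \<alpha> p p" "inv\<^bsub>\<pi>\<^esub> c \<otimes>\<^bsub>\<pi>\<^esub> X \<otimes>\<^bsub>\<pi>\<^esub> c = path_class S \<alpha>" by (rule pi1_cases)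
    have "Cl p p \<alpha> = c \<otimes>\<^bsub>\<pi>\<^esub> (inv\<^bsub>\<pi>\<^esub> c \<otimes>\<^bsub>\<pi>\<^esub> X \<otimes>\<^bsub>\<pi>\<^esub> c) \<otimes>\<^bsub>\<pi>\<^esub> inv\<^bsub>\<pi>\<^esub> c" unfolding Cl[OF a(1)] a(2) ..
    also have "\<dots> = (c \<otimes>\<^bsub>\<pi>\<^esub> inv\<^bsub>\<pi>\<^esub> c) \<otimes>\<^bsub>\<pi>\<^esub> X \<otimes>\<^bsub>\<pi>\<^esub> (c \<otimes>\<^bsub>\<pi>\<^esub> inv\<^bsub>\<pi>\<^esub> c)" using c X by (simp only: pi.m_assoc pi.inv_closed pi.m_closed)
    also have "\<dots> = X" using c X by simp
    finally show "X \<in> Z" using path_Z[OF a(1)] by simp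
  qed
qed

end

section \<open>The base point and the automorphisms\<close>

context polygon_surface
begin

lemma arcs_before:
  assumes Q: "arcs E W Q" and W: "W \<subseteq> {0<..<1}" and e: "e mod 4 < 2" and y: "0 \<le> y" "y < 1" "y \<notin> W"
  shows "P (of_int e + y) \<notin> Q"
proof -
  have "e \<noteq> s + 2 + 4 * int g * j" if "s \<in> E" for s j
  proof
    assume "e = s + 2 + 4 * int g * j"
    then have "e mod 4 = (s + 2) mod 4" by (simp add: mod4_shift)
    moreover have "s mod 4 < 2" using Q that by (auto simp: arcs_def)
    ultimately show False using e by presburger
  qed
  then show ?thesis using arcs_edge[OF Q W y(1,2), of e] y(3) by blast
qed

lemma boundary_lift:
  assumes z: "norm z = 1"
  obtains e x where "e mod 4 < 2" "0 \<le> x" "x < 1" "q z = q (P (of_int e + x))"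
proof -
  obtain y where y: "z = P y" using P_surj[OF z] by blast
  define k where "k = \<lfloor>y\<rfloor>"
  define u where "u = y - of_int k"
  have u: "0 \<le> u" "u < 1" "y = of_int k + u" unfolding u_def k_def by linarith+
  consider "k mod 4 < 2" | "u = 0" | "\<not> k mod 4 < 2" "0 < u" using u by linarith
  then show thesis
  proof cases
    case 1 then show thesis using that[of k u] u y by simp
  next
    case 2
    have "q z = q (P (of_int 0 + 0))" using q_vertex[of k] 2 u y by simp
    then show thesis using that[of 0 0] by simp
  next
    case 3
    have k2: "(k - 2) mod 4 < 2" using 3 by presburger
    have "q (P (of_int (k - 2) + (1 - u))) = q (P (of_int (k - 2) + 3 - (1 - u)))" by (rule glue[OF k2]) (use u in auto)
    moreover have "of_int (k - 2) + 3 - (1 - u) = y" using u by simp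
    ultimately show thesis using that[of "k - 2" "1 - u"] k2 3 u y by simp
  qed
qed

text \<open>The gluing concerns the boundary circle alone, so a homeomorphism of the disc that fixes
  the circle may be put in front of \<open>q\<close>. It serves to move the lift of the marked
  point.\<close>

lemma reparametrize:
  assumes h: "homeomorphism D D h h'" and fx: "\<And>x. norm x = 1 \<Longrightarrow> h x = x"
  shows "polygon_surface g S (q \<circ> h)"
proof
  show "g \<ge> 1" by (rule g)
  have "homeomorphic_map (top_of_set D) (top_of_set D) h"
    unfolding homeomorphic_map_maps homeomorphic_maps_def
    using h by (intro exI[of _ h']) (auto simp: homeomorphism_def image_subset_iff_funcset[symmetric] simp del: mem_cball mem_cball_0)
  from quotient_map_compose[OF this[unfolded homeomorphic_map_def, THEN conjunct1] quot]
  show "quotient_map (top_of_set D) (top_of_set S) (q \<circ> h)" .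
  have hD: "h z \<in> D" if "z \<in> D" for z using h that unfolding homeomorphism_def by blast
  have inj: "h z = h w \<longleftrightarrow> z = w" if "z \<in> D" "w \<in> D" for z w using h that unfolding homeomorphism_def by metis
  have int: "norm (h z) < 1" if "z \<in> D" "norm z < 1" for z
  proof (rule ccontr)
    assume "\<not> norm (h z) < 1"
    then have 1: "norm (h z) = 1" using hD[OF that(1)] by simp
    then have "h (h z) = h z" by (rule fx)
    then have "h z = z" using inj[OF hD[OF that(1)] that(1)] by simp
    then show False using 1 that by simp
  qed
  show "(q \<circ> h) z = (q \<circ> h) w \<longleftrightarrow> (z, w) \<in> (polygon_gluing g \<union> (polygon_gluing g)\<inverse>)\<^sup>*"
    if zw: "z \<in> D" "w \<in> D" for z w
  proof -
    have "q (h z) = q (h w) \<longleftrightarrow> q z = q w"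
    proof (cases "norm z < 1 \<or> norm w < 1")
      case True
      have 1: "q a = q b \<longleftrightarrow> a = b" if "a \<in> D" "b \<in> D" "norm a < 1 \<or> norm b < 1" for a b
        using q_interior[OF that(1,2)] q_interior[OF that(2,1)] that(3) by metis
      have "q (h z) = q (h w) \<longleftrightarrow> h z = h w" by (rule 1) (use hD zw int True in auto)
      then show ?thesis using 1[OF zw True] inj[OF zw] by simp
    next
      case False
      then have "norm z = 1" "norm w = 1" using zw by auto
      then show ?thesis by (simp add: fx)
    qed
    then show ?thesis using fib_iff[OF zw] by simp
  qed
qed

text \<open>The lower end of the window is the midpoint of x and 1, the upper end the midpoint of
  that and 1. The tail runs back along the edge from x to its corner and stays below the
  window.\<close>

lemma based_polygon_boundary:
  assumes e: "e mod 4 < 2" "0 \<le> x" "x < 1"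
  shows "based_polygon g S q ((x + 1) / 2) ((x + 3) / 4) (q (P (of_int e + x))) (\<lambda>t. P (of_int e + x * (1 - t)))"
proof -
  let ?w0 = "(x + 1) / 2" and ?w1 = "(x + 3) / 4"
  interpret polygon_windows g S q ?w0 ?w1 by unfold_locales (use e in auto)
  have notin: "P (of_int e + x * (1 - t)) \<notin> Q" if "arcs E {?w0..?w1} Q" "t \<in> {0..1}" for E Q t
  proof (rule arcs_before[OF that(1) window_sub' e(1)])
    have "x * (1 - t) \<le> x * 1" "0 \<le> x * (1 - t)" using that e mult_left_mono[of "1 - t" 1 x] by auto
    then show "0 \<le> x * (1 - t)" "x * (1 - t) < 1" "x * (1 - t) \<notin> {?w0..?w1}" using e by auto
  qed
  show ?thesis
  proof
    show "path (\<lambda>t. P (of_int e + x * (1 - t)))" unfolding path_def by (intro continuous_intros)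
    show "path_image (\<lambda>t. P (of_int e + x * (1 - t))) \<subseteq> D" by (auto simp: path_image_def)
    show "q (P (of_int e + x * (1 - 1))) = v" by (simp add: q_vertex)
  qed (use notin[OF strip1_arcs] notin[OF strip2_arcs] in simp_all)
qed

text \<open>A lift inside the polygon may lie on a strip. The finitely many strips are closed and
  miss the corner 1, so some inner point is joined to this corner by a segment off all strips; a
  homeomorphism of the disc carries that point to the lift.\<close>

lemma based_polygon_interior:
  assumes z: "norm z < 1"
  obtains q' \<delta> where "based_polygon g S q' (1/3) (2/3) (q z) \<delta>"
proof -
  interpret polygon_windows g S q "1/3" "2/3" by unfold_locales auto
  define B where "B = (\<Union>e\<in>({0..<4 * int g} \<inter> {e. e mod 4 < 2}). strip1 e {1/3..2/3}) \<union>
    (\<Union>c\<in>({0..<4 * int g} \<inter> {c. c mod 4 < 2}). \<Union>d\<in>{1..<int g}. strip2 c d {1/3..2/3})"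
  have refl: "(\<lambda>w. a - w) ` {1/3..2/3} = {a - 2/3..a - 1/3}" for a :: real by (simp add: image_diff_atLeastAtMost)
  have shift: "(\<lambda>w. a + w) ` {1/3..2/3} = {a + 1/3..a + 2/3}" for a :: real by simp
  have "closed B" unfolding B_def
  proof (intro closed_Un closed_UN ballI)
    show "closed (strip1 e {1/3..2/3})" for e unfolding strip1_def refl by (rule strip_closed) (use n_pos in auto)
    fix c d assume "d \<in> {1..<int g}"
    then have "1 \<le> d" "d + 1 \<le> int g" by auto
    then have "1 \<le> (of_int d :: real)" "of_int d + 1 \<le> real g" by (simp, metis of_int_1 of_int_add of_int_le_iff of_int_of_nat_eq)
    then show "closed (strip2 c d {1/3..2/3})" unfolding strip2_def refl shift by (intro closed_Un strip_closed) auto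
  qed auto
  moreover have "1 \<notin> B"
    using arcs_vertex[OF strip1_arcs window_sub', of _ 0] arcs_vertex[OF strip2_arcs window_sub', of _ 0] by (auto simp: B_def)
  ultimately have "open (- B)" "1 \<in> - B" by auto
  then obtain r where r: "r > 0" "ball 1 r \<subseteq> - B" by (meson open_contains_ball)
  define \<epsilon> where "\<epsilon> = min r 1 / 2"
  have \<epsilon>: "0 < \<epsilon>" "\<epsilon> < r" "\<epsilon> < 1" using r by (auto simp: \<epsilon>_def)
  define z1 :: complex where "z1 = of_real (1 - \<epsilon>)"
  have z1: "norm z1 < 1" unfolding z1_def norm_of_real using \<epsilon> by simp
  have "dist 1 z1 < r"
  proof -
    have "1 - z1 = of_real \<epsilon>" by (simp add: z1_def)
    then show ?thesis unfolding dist_norm using \<epsilon> by simp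
  qed
  then have seg: "closed_segment z1 1 \<subseteq> ball 1 r" using r by (intro closed_segment_subset) auto
  obtain h h' where h: "homeomorphism (cball 0 1 \<inter> UNIV) (cball 0 1 \<inter> UNIV) h h'" "h z1 = z"
      "\<And>x. x \<in> sphere 0 1 \<Longrightarrow> x \<in> UNIV \<Longrightarrow> h x = x"
    using homeomorphism_moving_point_2[of UNIV "0::complex" z1 1 z] z z1 by auto
  have ps: "polygon_surface g S (q \<circ> h)" by (rule reparametrize[of h h']) (use h in auto)
  interpret q': polygon_windows g S "q \<circ> h" "1/3" "2/3"
    using ps by (simp add: polygon_windows_def polygon_windows_axioms_def)
  have in_seg: "linepath z1 1 t \<in> closed_segment z1 1" if "t \<in> {0..1}" for t
    using that by (metis imageI linepath_image_01)
  have notB: "linepath z1 1 t \<notin> B" if "t \<in> {0..1}" for t using in_seg[OF that] seg r by blast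
  have "based_polygon g S (q \<circ> h) (1/3) (2/3) (q z) (linepath z1 1)"
  proof
    show "path (linepath z1 1)" by simp
    show "path_image (linepath z1 1) \<subseteq> D" using z1 by (simp add: closed_segment_subset)
    show "(q \<circ> h) (linepath z1 1 0) = q z" using h by (simp add: linepath_def)
    show "(q \<circ> h) (linepath z1 1 1) = (q \<circ> h) 1" by (simp add: linepath_def)
  qed (use notB in \<open>auto simp: B_def\<close>)
  then show thesis by (rule that)
qed

lemma based_polygon_exists:
  assumes "p \<in> S"
  obtains q' w0 w1 \<delta> where "based_polygon g S q' w0 w1 p \<delta>"
proof -
  obtain z where z: "z \<in> D" "p = q z" using assms q_image by blast
  show thesis
  proof (cases "norm z < 1")
    case True
    from based_polygon_interior[OF True] show thesis using that z by metis
  next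
    case False
    then have "norm z = 1" using z by simp
    from boundary_lift[OF this] show thesis using that based_polygon_boundary z by metis
  qed
qed

text \<open>Congruence modulo 4 fixes the kind of edge, and handle indices below g leave no room for
  a nonzero multiple of the period.\<close>

lemma apart:
  assumes i: "i < g" "j < g" and r: "r \<in> {0..<4}" "r' \<in> {0..<4}" and ne: "r \<noteq> r' \<or> i \<noteq> j"
  shows "4 * int j + r \<noteq> 4 * int i + r' + 4 * int g * m"
proof
  assume e: "4 * int j + r = 4 * int i + r' + 4 * int g * m"
  define M where "M = int g * m"
  have e': "4 * int j + r = 4 * int i + r' + 4 * M" using e by (simp add: M_def)
  have "0 \<le> r" "r < 4" "0 \<le> r'" "r' < 4" using r by auto
  then have rr: "r = r'" using e' by presburger
  then have M: "int j = int i + M" using e' by simp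
  have "m = 0"
  proof (rule ccontr)
    assume "m \<noteq> 0"
    then have "int g * 1 \<le> int g * \<bar>m\<bar>" by (intro mult_left_mono) auto
    then have "int g \<le> \<bar>M\<bar>" by (simp add: M_def abs_mult)
    then show False using M i by linarith
  qed
  then show False using M rr ne by (simp add: M_def)
qed

end

section \<open>The standard generators and the twists acting on them\<close>

context based_polygon
begin

lemma edge_period_both: "edge (k + 4 * int g * m) (l + 4 * int g * m) = edge k l"
  using edge_period P_period[of "of_int k" m] by (simp add: edge_def)

definition ea where "ea i = edge (4 * int i) (4 * int i + 1)"
definition eb where "eb i = edge (4 * int i + 1) (4 * int i + 2)"

lemma closed_ab [simp]: "ea i \<in> carrier \<pi>" "eb i \<in> carrier \<pi>" by (simp_all add: ea_def eb_def)

lemma ea_inv: "edge (4 * int i + 2) (4 * int i + 3) = inv\<^bsub>\<pi>\<^esub> ea i"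
  using edge_inv[of "4 * int i"] by (simp add: ea_def)

lemma eb_inv: "edge (4 * int i + 3) (4 * int i + 4) = inv\<^bsub>\<pi>\<^esub> eb i"
  using edge_inv[of "4 * int i + 1"] by (simp add: eb_def add.assoc)

lemma generated_ab: "carrier \<pi> = generate \<pi> (ea ` {..<g} \<union> eb ` {..<g})"
proof
  let ?H = "generate \<pi> (ea ` {..<g} \<union> eb ` {..<g})"
  have sub: "subgroup ?H \<pi>" by (rule pi.generate_is_subgroup) auto
  then show "?H \<subseteq> carrier \<pi>" by (rule subgroup.subset)
  have "edge k (k + 1) \<in> ?H" for k
  proof -
    define r where "r = k mod 4"
    define j where "j = nat ((k div 4) mod int g)"
    define l where "l = (k div 4) div int g"
    have gi: "int g > 0" using g by simp
    have jg: "j < g" using gi by (simp add: j_def nat_less_iff)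
    have "k div 4 = int j + int g * l" using gi by (simp add: j_def l_def)
    moreover have "k = 4 * (k div 4) + r" by (simp add: r_def)
    ultimately have k: "k = (4 * int j + r) + 4 * int g * l" by (simp add: algebra_simps)
    have k1: "k + 1 = (4 * int j + r + 1) + 4 * int g * l" using k by simp
    have e: "edge k (k + 1) = edge (4 * int j + r) (4 * int j + r + 1)" unfolding k1 by (subst k) (rule edge_period_both)
    have ab: "ea j \<in> ?H" "eb j \<in> ?H" using jg by (auto intro!: generate.incl)
    note ab' = ab ab[THEN subgroup.m_inv_closed[OF sub]]
    have "r = 0 \<or> r = 1 \<or> r = 2 \<or> r = 3" unfolding r_def by presburger
    then show ?thesis unfolding e
      by (elim disjE) (use ab' ea_inv[of j] eb_inv[of j] in \<open>simp_all add: ea_def eb_def add.assoc\<close>)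
  qed
  then show "carrier \<pi> \<subseteq> ?H" unfolding generated Z_def by (intro pi.generate_subgroup_incl[OF _ sub]) blast
qed

lemma edge_handle: "edge (4 * int i) (4 * int i + 4) = ea i \<otimes>\<^bsub>\<pi>\<^esub> eb i \<otimes>\<^bsub>\<pi>\<^esub> inv\<^bsub>\<pi>\<^esub> ea i \<otimes>\<^bsub>\<pi>\<^esub> inv\<^bsub>\<pi>\<^esub> eb i"
  unfolding ea_inv[symmetric] eb_inv[symmetric] by (simp add: ea_def eb_def edge_mult)

definition T1 where "T1 e = pi1_map S (annulus.twist (ann1 e))"
definition T2 where "T2 i j = pi1_map S (annulus.twist (ann2 (4 * int i) (int j - int i)))"

lemma T1_fixed:
  assumes i: "i < g" "j < g" and r: "s \<in> {0, 1}" "r \<in> {0, 1}" "s \<noteq> r \<or> i \<noteq> j"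
  shows "T1 (4 * int i + s) (edge (4 * int j + r) (4 * int j + r + 1)) = edge (4 * int j + r) (4 * int j + r + 1)"
proof -
  have e: "4 * int i + s \<in> {0..<4 * int g}" "(4 * int i + s) mod 4 < 2" using i r by auto
  show ?thesis unfolding T1_def
  proof (rule twist_edge.edge_fixed[OF twist1[OF e]])
    fix t k assume "t \<in> {4 * int i + s}"
    then have t: "t = 4 * int i + s" by simp
    have "r \<in> {0..<4}" "s \<in> {0..<4}" "s + 2 \<in> {0..<4}" "r \<noteq> s + 2 \<or> i \<noteq> j" using r by auto
    from apart[OF i this(1,2), of k] apart[OF i this(1,3,4), of k]
    show "4 * int j + r \<noteq> t + 4 * int g * k \<and> 4 * int j + r \<noteq> t + 2 + 4 * int g * k"
      unfolding t using r(3) by (auto simp: add.assoc)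
  qed
qed

lemma T2_fixed:
  assumes ij: "i < j" "j < g" "k < g" and r: "r \<in> {0, 1}" "r = 1 \<or> k \<noteq> i \<and> k \<noteq> j"
  shows "T2 i j (edge (4 * int k + r) (4 * int k + r + 1)) = edge (4 * int k + r) (4 * int k + r + 1)"
proof -
  let ?c = "4 * int i" and ?d = "int j - int i"
  have c: "?c \<in> {0..<4 * int g}" "?c mod 4 < 2" "?d \<in> {1..<int g}" using ij by auto
  show ?thesis unfolding T2_def
  proof (rule twist_edge.edge_fixed[OF twist2[OF c]])
    fix t l assume "t \<in> {?c, ?c + 4 * ?d}"
    then obtain i' where t: "t = 4 * int i' + 0" "i' < g" "i' = i \<or> i' = j" using ij by auto
    have R: "r \<in> {0..<4}" "0 \<in> {0..<4::int}" "2 \<in> {0..<4::int}" "r \<noteq> 0 \<or> i' \<noteq> k" "r \<noteq> 2 \<or> i' \<noteq> k" using r t by auto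
    from apart[OF t(2) ij(3) R(1,2,4), of l] apart[OF t(2) ij(3) R(1,3,5), of l]
    show "4 * int k + r \<noteq> t + 4 * int g * l \<and> 4 * int k + r \<noteq> t + 2 + 4 * int g * l"
      unfolding t(1) by (auto simp: add.assoc)
  qed
qed

text \<open>In the image of an edge the diagonal that joins the two handles is passed once in each
  direction and cancels under f. What remains is the transvection along \<open>eb i\<close> +
  \<open>eb j\<close>.\<close>

lemma T2_moved:
  assumes ij: "i < j" "j < g" and f: "additive_on \<pi> f"
  shows "f (T2 i j (ea i)) = f (ea i) + f (eb i) + f (eb j)" "f (T2 i j (ea j)) = f (ea j) + f (eb i) + f (eb j)"
proof -
  let ?c = "4 * int i" and ?d = "int j - int i"
  have c: "?c \<in> {0..<4 * int g}" "?c mod 4 < 2" "?d \<in> {1..<int g}" using ij by auto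
  have cd: "?c + 4 * ?d = 4 * int j" by simp
  note t = twist2_edge[OF c, folded T2_def, unfolded cd]
  have add: "f (x \<otimes>\<^bsub>\<pi>\<^esub> y) = f x + f y" if "x \<in> carrier \<pi>" "y \<in> carrier \<pi>" for x y by (rule pi.additive_on_mult[OF f that])
  have e: "f (edge k m) = f (edge k l) + f (edge l m)" for k l m using add[of "edge k l" "edge l m"] by (simp add: edge_mult)
  have rev_edge: "f (edge (4 * int j) ?c) = - f (edge ?c (4 * int j))"
    unfolding edge_rev[of "4 * int j" ?c] by (rule pi.additive_on_inv[OF f]) simp
  have inv: "f (edge (4 * int l + 2) (4 * int l + 3)) = - f (ea l)" for l
    unfolding ea_inv by (rule pi.additive_on_inv[OF f]) simp
  have two: "f (edge (4 * int l) (4 * int l + 2)) = f (ea l) + f (eb l)" for l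
    using e[of "4 * int l" "4 * int l + 2" "4 * int l + 1"] by (simp add: ea_def eb_def)
  have three: "f (edge (4 * int l) (4 * int l + 3)) = f (eb l)" for l
    using e[of "4 * int l" "4 * int l + 3" "4 * int l + 2"] two[of l] inv[of l] by simp
  show "f (T2 i j (ea i)) = f (ea i) + f (eb i) + f (eb j)"
    unfolding ea_def[of i] t(1) add[OF edge_closed edge_closed]
    using e[of ?c "4 * int j + 3" "4 * int j"] e[of "4 * int j" "?c + 2" ?c] rev_edge two[of i] three[of j] by (simp add: ea_def)
  show "f (T2 i j (ea j)) = f (ea j) + f (eb i) + f (eb j)"
    unfolding ea_def[of j] t(2) add[OF edge_closed edge_closed]
    using e[of ?c "4 * int j + 2" "4 * int j"] e[of "4 * int j" "?c + 3" ?c] rev_edge two[of j] three[of i] by (simp add: ea_def)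
qed

text \<open>The partial products of the relation are the diagonals from corner 0 to corner 4i; at i
  = g the diagonal returns to corner 0 by the period.\<close>

theorem surface_automorphisms_exist:
  assumes g2: "g \<ge> 2"
  shows "surface_automorphisms \<pi> g ea eb (\<lambda>i. edge 0 (4 * int i)) (pointed_space.geometric S p)
    (\<lambda>i. T1 (4 * int i)) (\<lambda>i. T1 (4 * int i + 1)) (\<lambda>i j. T2 (min i j) (max i j))"
proof -
  interpret ps: pointed_space S p by (simp add: pointed_space_def p_in_S)
  have r0: "(0::int) \<in> {0, 1}" "(1::int) \<in> {0, 1}" by auto
  show ?thesis
  proof
    show "carrier \<pi> = generate \<pi> (ea ` {..<g} \<union> eb ` {..<g})" by (rule generated_ab)
    show "edge 0 (4 * int 0) = \<one>\<^bsub>\<pi>\<^esub>" by (simp add: edge_refl)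
    show "edge 0 (4 * int g) = \<one>\<^bsub>\<pi>\<^esub>" using edge_period[of 0 0 1] by (simp add: edge_refl)
    fix i assume i: "i < g"
    show "edge 0 (4 * int (Suc i)) = edge 0 (4 * int i) \<otimes>\<^bsub>\<pi>\<^esub> (ea i \<otimes>\<^bsub>\<pi>\<^esub> eb i \<otimes>\<^bsub>\<pi>\<^esub> inv\<^bsub>\<pi>\<^esub> ea i \<otimes>\<^bsub>\<pi>\<^esub> inv\<^bsub>\<pi>\<^esub> eb i)"
      unfolding edge_handle[symmetric] edge_mult by (simp add: add.commute)
    have e: "4 * int i \<in> {0..<4 * int g}" "(4 * int i) mod 4 < 2" "4 * int i + 1 \<in> {0..<4 * int g}" "(4 * int i + 1) mod 4 < 2" using i by auto
    show "T1 (4 * int i) \<in> ps.geometric" "T1 (4 * int i + 1) \<in> ps.geometric"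
      unfolding T1_def by (intro ps.geometricI twist_edge.T_homeo_plus[OF twist1] e)+
    show "T1 (4 * int i) (ea i) = ea i \<otimes>\<^bsub>\<pi>\<^esub> eb i"
      using twist1_edge[OF e(1,2)] by (simp add: T1_def ea_def eb_def edge_mult)
    show "T1 (4 * int i + 1) (eb i) = eb i \<otimes>\<^bsub>\<pi>\<^esub> inv\<^bsub>\<pi>\<^esub> ea i"
      unfolding ea_inv[symmetric] using twist1_edge[OF e(3,4)] by (simp add: T1_def eb_def edge_mult add.assoc)
    fix j assume j: "j < g"
    show "T1 (4 * int i) (eb j) = eb j" "T1 (4 * int i + 1) (ea j) = ea j"
      using T1_fixed[OF i j r0(1,2)] T1_fixed[OF i j r0(2,1)] by (simp_all add: ea_def eb_def add.assoc)
    show "T1 (4 * int i) (ea j) = ea j" "T1 (4 * int i + 1) (eb j) = eb j" if "j \<noteq> i"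
      using T1_fixed[OF i j r0(1,1)] T1_fixed[OF i j r0(2,2)] that by (simp_all add: ea_def eb_def add.assoc)
    assume ne: "i \<noteq> j"
    \<comment> \<open>The two strips are built for an ordered pair of handles, whereas the
      transvection is symmetric in them.\<close>
    have mm: "min i j < max i j" "max i j < g" using ne i j by auto
    have c: "4 * int (min i j) \<in> {0..<4 * int g}" "4 * int (min i j) mod 4 < 2" "int (max i j) - int (min i j) \<in> {1..<int g}"
      using mm by auto
    show "T2 (min i j) (max i j) \<in> ps.geometric"
      unfolding T2_def by (intro ps.geometricI twist_edge.T_homeo_plus[OF twist2[OF c]])
    fix k
    show "homologous \<pi> (T2 (min i j) (max i j) (ea k)) (ea k \<otimes>\<^bsub>\<pi>\<^esub> eb i \<otimes>\<^bsub>\<pi>\<^esub> eb j)" if "k \<in> {i, j}"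
      unfolding homologous_def
    proof (intro allI impI)
      fix f assume f: "additive_on \<pi> f"
      have "f (ea k \<otimes>\<^bsub>\<pi>\<^esub> eb i \<otimes>\<^bsub>\<pi>\<^esub> eb j) = f (ea k) + f (eb i) + f (eb j)"
        by (simp add: pi.additive_on_mult[OF f])
      then show "f (T2 (min i j) (max i j) (ea k)) = f (ea k \<otimes>\<^bsub>\<pi>\<^esub> eb i \<otimes>\<^bsub>\<pi>\<^esub> eb j)"
        using T2_moved[OF mm f] that by (cases "i < j") (auto simp: min_def max_def)
    qed
    assume k: "k < g"
    show "homologous \<pi> (T2 (min i j) (max i j) (eb k)) (eb k)"
      using T2_fixed[OF mm k, of 1] by (simp add: homologous_def eb_def add.assoc)
    show "homologous \<pi> (T2 (min i j) (max i j) (ea k)) (ea k)" if "k \<noteq> i" "k \<noteq> j"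
      using T2_fixed[OF mm k, of 0] that by (simp add: homologous_def ea_def min_def max_def)
  qed (use g2 ps.geometric_hom ps.geometric_id ps.geometric_comp ps.geometric_inv in auto)
qed

end

theorem corollary5:
  fixes S :: "'a::topological_space set" and p :: 'a and g :: nat
  assumes "g \<ge> 2"
    and "closed_orientable_surface g S"
    and "p \<in> S"
  shows "\<exists>N. \<forall>k\<ge>N.
    adic_filtration (abelianization (fundamental_group S p)) (johnson_coinvariants S p) k =
    adic_filtration (abelianization (fundamental_group S p)) (johnson_coinvariants S p) N"
proof -
  obtain q where "polygon_surface g S q"
    using assms(2) unfolding closed_orientable_surface_def polygon_surface_def by blast
  from polygon_surface.based_polygon_exists[OF this assms(3)]
  obtain q' w0 w1 \<delta> where "based_polygon g S q' w0 w1 p \<delta>" .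
  from based_polygon.surface_automorphisms_exist[OF this assms(1)]
  have "\<forall>k\<ge>2. adic_filtration (abelianization (fundamental_group S p)) (johnson_coinvariants S p) k =
      adic_filtration (abelianization (fundamental_group S p)) (johnson_coinvariants S p) 2"
    by (rule pointed_space.stable_if_surface_automorphisms[rotated]) (simp add: pointed_space_def assms(3))
  then show ?thesis by blast
qed

end
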